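(* Let $G$ be a finite group and let $M_{(C,D)}$, $M_{(C',D')}$ be idempotents of $\overline R_1(\widetilde G)$ with $C\ne\emptyset\ne C'$, so that $H(C,D),H(C',D')\in\mathrm{Sub}(G)$. Then $$H(C,D)\neq H(C',D')\quad\text{if and only if}\quad\epsilon(C,D)\,\epsilon(C',D')=0.$$
   Context: $K$ is an algebraically closed field of characteristic $0$; groups are finite; $G'=[G,G]$, $G^{ab}=G/G'$. Gliders. A glider of length at most $1$ of $G$ (for $K\subset K[G]$) is a $K[G]$-module $\Omega$ with finite-dimensional $K$-subspaces $M_{-1}\subseteq M_0\subseteq\Omega$ with $K[G]M_{-1}\subseteq M_0$; it has length $0$ if $M_{-1}=0$ and length $1$ otherwise. A morphism to $(N_{-1}\subseteq N_0)$ is a $K$-linear $f:M_0\to N_0$ with $f(M_{-1})\subseteq N_{-1}$ and $f(xm)=xf(m)$ for $x\in K[G]$, $m\in M_{-1}$. Direct sums and tensor products (diagonal $G$-action) are formed levelwise. A glider of length $1$ is irreducible iff $\dim M_{-1}=1$ and $M_0=K[G]M_{-1}$. $\overline{R}_1(\widetilde G)$ is the subring generated by the classes of irreducible gliders of length $1$ in the quotient of the split Grothendieck ring of gliders of length $\le 1$ by the ideal additively generated by gliders of length $0$. In it $[Ku\subset U]\cdot[Kv\subset V]=[K(u\otimes v)\subset K[G](u\otimes v)]$. Parametrization. For every group fix an isomorphism $z\mapsto T_z$ from $G^{ab}$ to the group of one-dimensional $K[G]$-modules. $\mathcal{S}_G$ is the set of subsets $B$ of $\bigsqcup_{U\in\mathrm{Irr}(G),\dim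 U>1}\mathrm{Gr}(U)$, $\mathrm{Gr}(U)=\bigsqcup_{j=1}^{\dim U}\mathrm{Gr}(j,U)$, containing at most one point $W_U$ of each $\mathrm{Gr}(U)$. For $A\subseteq G^{ab}$, $B\in\mathcal S_G$, not both empty, $M_{(A,B)}$ is the class of the irreducible glider $Kv\subset\bigoplus_{z\in A}T_z\oplus\bigoplus_U U^{\oplus m_U}$ with $m_U=\dim W_U$ ($0$ if $B\cap\mathrm{Gr}(U)=\emptyset$), where $v$ has nonzero component in each $T_z$ and its components in the copies of $U$ form a basis of $W_U$. Every irreducible glider of length $1$ is isomorphic to exactly one of these. For $H\le G$: $\mathcal{I}nd_H^G[Ku\subset U]=[K(1\otimes u)\subset K[G]\otimes_{K[H]}U]$ and $\mathcal{R}es^G_H[Ku\subset U]=[Ku\subset K[H]u]$, extended additively to ring maps between $\overline R_1(\widetilde H)$ and $\overline R_1(\widetilde G)$. Chains. For $C\le G^{ab}$ put $\mathcal{L}(C)=\bigcap_{z\in C}\ker(T_z)$. Let $M_{(C,D)}$ be an idempotent with $C\neq\emptyset$ (then $C\le G^{ab}$). Set $H_0=G$, $(C_0,D_0)=(C,D)$; as long as $C_i\ne\{e\}$ let $H_{i+1}=\mathcal{L}(C_i)\lneq H_i$ and $M_{(C_{i+1},D_{i+1})}=\mathcal{R}es^{H_i}_{H_{i+1}}(M_{(C_i,D_i)})$, again an idempotent with $\emptyset\ne C_{i+1}\le H_{i+1}^{ab}$. It stops at the first $m$ with $C_m=\{e\}$; put $H(C,D)=H_m$. $\mathrm{Sub}(G)$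 is the set of all subgroups $H(C,D)$ obtained this way. Idempotents $\epsilon$. For $G'\le H\le G$ let $A_\iota(H)=\{z\in G^{ab}\mid T_z|_H\text{ trivial}\}$, let $\mathcal{M}(H/G')$ be the set of maximal subgroups $L$ of $H$ with $G'\le L$, and $$\epsilon(H,G)=M_{(A_\iota(H),\emptyset)}\prod_{L\in\mathcal{M}(H/G')}\big(M_{(\{T_G\},\emptyset)}-M_{(A_\iota(L),\emptyset)}\big)\in\overline R_1(\widetilde G),$$ $T_G$ the trivial representation. For an idempotent $M_{(C,D)}$ with $C\ne\emptyset$, let $G=H_0\gneq\dots\gneq H_m=H(C,D)$ be the chain of subgroups determined by $H_0=G$, $(C_0,D_0)=(C,D)$, $H_{i+1}=\mathcal{L}(C_i)$ and $M_{(C_{i+1},D_{i+1})}=\mathcal{R}es^{H_i}_{H_{i+1}}(M_{(C_i,D_i)})$, stopping at the first $m$ with $C_m=\{e\}$, and put $$\epsilon(C,D)=\Big(\prod_{i=0}^{m-1}\mathcal{I}nd_{H_i}^G\big(\epsilon(H_{i+1},H_i)\big)\Big)\cdot\mathcal{I}nd_{H_m}^G\big(\epsilon(H_m,H_m)\big).$$ *)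

theory Defs
  imports
    "HOL-Algebra.QuotRing"
    "HOL-Algebra.Generated_Groups"
    "HOL-Algebra.Generated_Rings"
    "HOL-Library.Function_Algebras"
    "HOL-Library.Nat_Bijection"
    "HOL-Library.Poly_Mapping"
    "HOL-Computational_Algebra.Polynomial"
begin

section \<open>Function spaces over a field\<close>

text \<open>
  The field is the type \<open>'k\<close>. All vector spaces are subspaces of function spaces
  \<open>'a \<Rightarrow> 'k\<close>, with pointwise addition.
\<close>

definition smul :: "'k::field \<Rightarrow> ('a \<Rightarrow> 'k) \<Rightarrow> 'a \<Rightarrow> 'k"
  where "smul c v = (\<lambda>i. c * v i)"

interpretation fn: vector_space "smul :: 'k::field \<Rightarrow> ('a \<Rightarrow> 'k) \<Rightarrow> 'a \<Rightarrow> 'k"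
  by unfold_locales (auto simp: smul_def fun_eq_iff algebra_simps)

definition linear_on :: "('a \<Rightarrow> 'k::field) set \<Rightarrow> (('a \<Rightarrow> 'k) \<Rightarrow> 'b \<Rightarrow> 'k) \<Rightarrow> bool"
  where "linear_on V f \<longleftrightarrow>
    (\<forall>v\<in>V. \<forall>w\<in>V. f (v + w) = f v + f w) \<and> (\<forall>c. \<forall>v\<in>V. f (smul c v) = smul c (f v))"

definition finite_dim :: "('a \<Rightarrow> 'k::field) set \<Rightarrow> bool"
  where "finite_dim V \<longleftrightarrow> (\<exists>b. finite b \<and> V = fn.span b)"

text \<open>
  The tensor product of two function spaces \<open>V\<close>, \<open>W\<close> is realised inside the functions of
  two variables: the canonical map from \<open>V \<otimes> W\<close> to those is injective, so its image, the
  span of the functions \<open>(i, j) \<mapsto> v i * w j\<close>, is a model of \<open>V \<otimes> W\<close>.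
\<close>

definition tens :: "('a \<Rightarrow> 'k::field) \<Rightarrow> ('b \<Rightarrow> 'k) \<Rightarrow> 'a \<times> 'b \<Rightarrow> 'k"
  where "tens v w = (\<lambda>(i, j). v i * w j)"

definition tens_space :: "('a \<Rightarrow> 'k::field) set \<Rightarrow> ('b \<Rightarrow> 'k) set \<Rightarrow> ('a \<times> 'b \<Rightarrow> 'k) set"
  where "tens_space V W = fn.span {tens v w |v w. v \<in> V \<and> w \<in> W}"

text \<open>Functions of two natural variables as functions of one.\<close>

definition enc :: "(nat \<times> nat \<Rightarrow> 'k) \<Rightarrow> nat \<Rightarrow> 'k"
  where "enc f = (\<lambda>n. f (prod_decode n))"

definition dec :: "(nat \<Rightarrow> 'k) \<Rightarrow> nat \<times> nat \<Rightarrow> 'k"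
  where "dec w = (\<lambda>p. w (prod_encode p))"


section \<open>Modules over the group algebra\<close>

text \<open>
  A \<open>K[G]\<close>-module is a vector space with a linear action of \<open>G\<close>. Its space is a subspace of
  \<open>nat \<Rightarrow> 'k\<close>, of finite or infinite dimension; every finite-dimensional module has an
  isomorphic copy of this kind.
\<close>

record ('g, 'k) rep =
  space :: "(nat \<Rightarrow> 'k) set"
  act :: "'g \<Rightarrow> (nat \<Rightarrow> 'k) \<Rightarrow> nat \<Rightarrow> 'k"

definition is_module :: "('g, 'x) monoid_scheme \<Rightarrow> ('g, 'k::field, 'y) rep_scheme \<Rightarrow> bool"
  where "is_module G V \<longleftrightarrow>
    fn.subspace (space V) \<and>
    (\<forall>g\<in>carrier G. act V g ` space V \<subseteq> space V \<and> linear_on (space V) (act V g)) \<and>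
    (\<forall>v\<in>space V. act V \<one>\<^bsub>G\<^esub> v = v) \<and>
    (\<forall>g\<in>carrier G. \<forall>h\<in>carrier G. \<forall>v\<in>space V. act V (g \<otimes>\<^bsub>G\<^esub> h) v = act V g (act V h v))"

text \<open>
  The group algebra \<open>K[G]\<close> of a finite group consists of the functions vanishing off
  \<open>carrier G\<close>; thus \<open>K[H] \<subseteq> K[G]\<close> for a subgroup \<open>H\<close>.
\<close>

definition group_alg :: "('g, 'x) monoid_scheme \<Rightarrow> ('g \<Rightarrow> 'k::field) set"
  where "group_alg G = {x. \<forall>g. g \<notin> carrier G \<longrightarrow> x g = 0}"

definition delta :: "'g \<Rightarrow> 'g \<Rightarrow> 'k::field"
  where "delta g = (\<lambda>a. if a = g then 1 else 0)"

definition conv :: "('g, 'x) monoid_scheme \<Rightarrow> ('g \<Rightarrow> 'k::field) \<Rightarrow> ('g \<Rightarrow> 'k) \<Rightarrow> 'g \<Rightarrow> 'k"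
  where "conv G x y = (\<lambda>g. if g \<in> carrier G
    then \<Sum>a\<in>carrier G. x a * y (inv\<^bsub>G\<^esub> a \<otimes>\<^bsub>G\<^esub> g) else 0)"

definition alg_act :: "('g, 'x) monoid_scheme \<Rightarrow> ('g, 'k::field, 'y) rep_scheme
    \<Rightarrow> ('g \<Rightarrow> 'k) \<Rightarrow> (nat \<Rightarrow> 'k) \<Rightarrow> nat \<Rightarrow> 'k"
  where "alg_act G V x v = (\<Sum>g\<in>carrier G. smul (x g) (act V g v))"

definition alg_span :: "('g, 'x) monoid_scheme \<Rightarrow> ('g, 'k::field, 'y) rep_scheme
    \<Rightarrow> (nat \<Rightarrow> 'k) set \<Rightarrow> (nat \<Rightarrow> 'k) set"
  where "alg_span G V S = fn.span {alg_act G V x v |x v. x \<in> group_alg G \<and> v \<in> S}"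

definition rep_iso :: "('g, 'x) monoid_scheme \<Rightarrow> ('g, 'k::field, 'y) rep_scheme
    \<Rightarrow> ('g, 'k, 'z) rep_scheme \<Rightarrow> bool"
  where "rep_iso G V W \<longleftrightarrow> (\<exists>f. linear_on (space V) f \<and> bij_betw f (space V) (space W) \<and>
    (\<forall>g\<in>carrier G. \<forall>v\<in>space V. f (act V g v) = act W g (f v)))"

definition simple_module :: "('g, 'x) monoid_scheme \<Rightarrow> ('g, 'k::field, 'y) rep_scheme \<Rightarrow> bool"
  where "simple_module G V \<longleftrightarrow> is_module G V \<and> space V \<noteq> {0} \<and>
    (\<forall>W. fn.subspace W \<and> W \<subseteq> space V \<and> (\<forall>g\<in>carrier G. act V g ` W \<subseteq> W)
       \<longrightarrow> W = {0} \<or> W = space V)"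

text \<open>
  The diagonal action on \<open>V \<otimes> W\<close>: apply the action on \<open>V\<close> to \<open>i \<mapsto> f (i, j)\<close> for each \<open>j\<close>,
  then the action on \<open>W\<close> to the resulting function of \<open>j\<close> for each \<open>i\<close>; on elementary tensors
  see the lemma \<open>act_rep_tensor\<close> below.
\<close>

definition tens_act :: "('g, 'k::field, 'y) rep_scheme \<Rightarrow> ('g, 'k, 'z) rep_scheme
    \<Rightarrow> 'g \<Rightarrow> (nat \<times> nat \<Rightarrow> 'k) \<Rightarrow> nat \<times> nat \<Rightarrow> 'k"
  where "tens_act V W g f = (\<lambda>(i, j). act W g (\<lambda>j'. act V g (\<lambda>i'. f (i', j')) i) j)"

definition rep_tensor :: "('g, 'k::field, 'y) rep_scheme \<Rightarrow> ('g, 'k, 'z) rep_scheme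
    \<Rightarrow> ('g, 'k) rep"
  where "rep_tensor V W =
    \<lparr>space = enc ` tens_space (space V) (space W), act = \<lambda>g w. enc (tens_act V W g (dec w))\<rparr>"

lemma act_rep_tensor:
  assumes "is_module G V" "is_module G W" "g \<in> carrier G" "v \<in> space V" "w \<in> space W"
  shows "act (rep_tensor V W) g (enc (tens v w)) = enc (tens (act V g v) (act W g w))"
proof -
  have *: "act V g (smul c v) = smul c (act V g v)" "act W g (smul c w) = smul c (act W g w)" for c
    using assms by (auto simp: is_module_def linear_on_def)
  have "act V g (\<lambda>i'. v i' * w j') i = w j' * act V g v i" for i j'
    using fun_cong[OF *(1)[of "w j'"], of i] by (simp add: smul_def mult.commute)
  moreover have "act W g (\<lambda>j'. w j' * act V g v i) j = act V g v i * act W g w j" for i j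
    using fun_cong[OF *(2)[of "act V g v i"], of j] by (simp add: smul_def mult.commute)
  ultimately show ?thesis
    by (auto simp: rep_tensor_def tens_act_def enc_def dec_def tens_def split: prod.split)
qed

text \<open>
  The direct sum of a list of modules; component \<open>k\<close> of \<open>w\<close> is \<open>i \<mapsto> w (prod_encode (k, i))\<close>.
\<close>

definition comp :: "(nat \<Rightarrow> 'k) \<Rightarrow> nat \<Rightarrow> nat \<Rightarrow> 'k"
  where "comp w k = (\<lambda>i. dec w (k, i))"

definition tuple :: "(nat \<Rightarrow> 'k::zero) list \<Rightarrow> nat \<Rightarrow> 'k"
  where "tuple vs = enc (\<lambda>(k, i). if k < length vs then (vs ! k) i else 0)"

definition dsum_space :: "(nat \<Rightarrow> 'k::zero) set list \<Rightarrow> (nat \<Rightarrow> 'k) set"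
  where "dsum_space Vs = {tuple vs |vs. list_all2 (\<in>) vs Vs}"

definition dsum :: "('g, 'k::zero) rep list \<Rightarrow> ('g, 'k) rep"
  where "dsum Vs = \<lparr>space = dsum_space (map space Vs),
    act = \<lambda>g w. tuple (map (\<lambda>k. act (Vs ! k) g (comp w k)) [0..<length Vs])\<rparr>"


section \<open>Gliders of length at most one\<close>

text \<open>The subspaces \<open>lev0\<close> and \<open>lev1\<close> are \<open>M\<^sub>0\<close> and \<open>M\<^sub>-\<^sub>1\<close>; the module is \<open>\<Omega>\<close>.\<close>

record ('g, 'k) glider = "('g, 'k) rep" +
  lev0 :: "(nat \<Rightarrow> 'k) set"
  lev1 :: "(nat \<Rightarrow> 'k) set"

definition is_glider :: "('g, 'x) monoid_scheme \<Rightarrow> ('g, 'k::field) glider \<Rightarrow> bool"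
  where "is_glider G M \<longleftrightarrow> is_module G M \<and>
    fn.subspace (lev0 M) \<and> fn.subspace (lev1 M) \<and> finite_dim (lev0 M) \<and> finite_dim (lev1 M) \<and>
    lev1 M \<subseteq> lev0 M \<and> lev0 M \<subseteq> space M \<and> alg_span G M (lev1 M) \<subseteq> lev0 M"

definition length_zero :: "('g, 'x) monoid_scheme \<Rightarrow> ('g, 'k::field) glider \<Rightarrow> bool"
  where "length_zero G M \<longleftrightarrow> is_glider G M \<and> lev1 M = {0}"

definition irreducible_glider :: "('g, 'x) monoid_scheme \<Rightarrow> ('g, 'k::field) glider \<Rightarrow> bool"
  where "irreducible_glider G M \<longleftrightarrow>
    is_glider G M \<and> fn.dim (lev1 M) = 1 \<and> lev0 M = alg_span G M (lev1 M)"

definition glider_morphism :: "('g, 'x) monoid_scheme \<Rightarrow> ('g, 'k::field) glider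
    \<Rightarrow> ('g, 'k) glider \<Rightarrow> ((nat \<Rightarrow> 'k) \<Rightarrow> nat \<Rightarrow> 'k) \<Rightarrow> bool"
  where "glider_morphism G M N f \<longleftrightarrow>
    linear_on (lev0 M) f \<and> f ` lev0 M \<subseteq> lev0 N \<and> f ` lev1 M \<subseteq> lev1 N \<and>
    (\<forall>x\<in>group_alg G. \<forall>m\<in>lev1 M. f (alg_act G M x m) = alg_act G N x (f m))"

definition glider_iso :: "('g, 'x) monoid_scheme \<Rightarrow> ('g, 'k::field) glider
    \<Rightarrow> ('g, 'k) glider \<Rightarrow> bool"
  where "glider_iso G M N \<longleftrightarrow> (\<exists>f h. glider_morphism G M N f \<and> glider_morphism G N M h \<and>
    (\<forall>m\<in>lev0 M. h (f m) = m) \<and> (\<forall>n\<in>lev0 N. f (h n) = n))"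

definition glider_sum :: "('g, 'k::field) glider \<Rightarrow> ('g, 'k) glider \<Rightarrow> ('g, 'k) glider"
  where "glider_sum M N = rep.extend (dsum [rep.truncate M, rep.truncate N])
    \<lparr>lev0 = dsum_space [lev0 M, lev0 N], lev1 = dsum_space [lev1 M, lev1 N]\<rparr>"

definition glider_tensor :: "('g, 'k::field) glider \<Rightarrow> ('g, 'k) glider \<Rightarrow> ('g, 'k) glider"
  where "glider_tensor M N = rep.extend (rep_tensor M N)
    \<lparr>lev0 = enc ` tens_space (lev0 M) (lev0 N), lev1 = enc ` tens_space (lev1 M) (lev1 N)\<rparr>"

definition unit_glider :: "('g, 'k::field) glider"
  where "unit_glider = (let V = {v. \<forall>i>0. v i = 0}
    in \<lparr>space = V, act = \<lambda>g v. v, lev0 = V, lev1 = V\<rparr>)"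


section \<open>The glider representation ring\<close>

text \<open>
  The free abelian group on all gliders, with the bilinear extension of the tensor product.
  This multiplication is associative only up to isomorphism of gliders; the quotients below
  are formed with \<^const>\<open>FactRing\<close>, which is defined for an arbitrary record.
\<close>

definition free_gliders :: "('g, 'x) monoid_scheme \<Rightarrow> (('g, 'k::field) glider \<Rightarrow>\<^sub>0 int) ring"
  where "free_gliders G =
    \<lparr>carrier = {p. \<forall>M\<in>Poly_Mapping.keys p. is_glider G M},
     monoid.mult = \<lambda>p q. frag_extend (\<lambda>M. frag_extend (\<lambda>N. frag_of (glider_tensor M N)) q) p,
     one = frag_of unit_glider, ring.zero = 0, add = (+)\<rparr>"

definition split_relations :: "('g, 'x) monoid_scheme \<Rightarrow> (('g, 'k::field) glider \<Rightarrow>\<^sub>0 int) set"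
  where "split_relations G = generate (add_monoid (free_gliders G))
    ({frag_of M - frag_of N |M N. is_glider G M \<and> is_glider G N \<and> glider_iso G M N} \<union>
     {frag_of (glider_sum M N) - frag_of M - frag_of N |M N. is_glider G M \<and> is_glider G N})"

definition split_Grothendieck :: "('g, 'x) monoid_scheme \<Rightarrow> (('g, 'k::field) glider \<Rightarrow>\<^sub>0 int) set ring"
  where "split_Grothendieck G = free_gliders G Quot split_relations G"

definition split_class :: "('g, 'x) monoid_scheme \<Rightarrow> ('g, 'k::field) glider
    \<Rightarrow> (('g, 'k) glider \<Rightarrow>\<^sub>0 int) set"
  where "split_class G M = split_relations G +>\<^bsub>free_gliders G\<^esub> frag_of M"

definition length_zero_ideal :: "('g, 'x) monoid_scheme \<Rightarrow> (('g, 'k::field) glider \<Rightarrow>\<^sub>0 int) set set"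
  where "length_zero_ideal G =
    generate (add_monoid (split_Grothendieck G)) {split_class G M |M. length_zero G M}"

type_synonym ('g, 'k) glider_class = "(('g, 'k) glider \<Rightarrow>\<^sub>0 int) set set"

definition reduced_ring :: "('g, 'x) monoid_scheme \<Rightarrow> ('g, 'k::field) glider_class ring"
  where "reduced_ring G = split_Grothendieck G Quot length_zero_ideal G"

definition cls :: "('g, 'x) monoid_scheme \<Rightarrow> ('g, 'k::field) glider \<Rightarrow> ('g, 'k) glider_class"
  where "cls G M = length_zero_ideal G +>\<^bsub>split_Grothendieck G\<^esub> split_class G M"

definition R1 :: "('g, 'x) monoid_scheme \<Rightarrow> ('g, 'k::field) glider_class ring"
  where "R1 G = reduced_ring G
    \<lparr>carrier := generate_ring (reduced_ring G) {cls G M |M. irreducible_glider G M}\<rparr>"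


section \<open>Induction and restriction\<close>

text \<open>
  A subgroup \<open>H\<close> enters as a set; as a group it is \<open>sub G H\<close>.
\<close>

abbreviation sub :: "('g, 'x) monoid_scheme \<Rightarrow> 'g set \<Rightarrow> ('g, 'x) monoid_scheme"
  where "sub G H \<equiv> G\<lparr>carrier := H\<rparr>"

text \<open>
  \<open>K[G] \<otimes>\<^bsub>K[H]\<^esub> U\<close> is the quotient of \<open>K[G] \<otimes>\<^bsub>K\<^esub> U\<close> by the span of the elements
  \<open>x y \<otimes> u - x \<otimes> y u\<close>.  \<open>is_induced G H X Y\<close> says that, for \<open>X = (Ku \<subseteq> U)\<close>, the glider \<open>Y\<close>
  is (a copy of) \<open>K (1 \<otimes> u) \<subseteq> K[G] \<otimes>\<^bsub>K[H]\<^esub> U\<close>, the map \<open>p\<close> being the quotient map.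
\<close>

definition balance_relations :: "('g, 'x) monoid_scheme \<Rightarrow> 'g set \<Rightarrow> ('g, 'k::field) glider
    \<Rightarrow> ('g \<times> nat \<Rightarrow> 'k) set"
  where "balance_relations G H X =
    fn.span {tens (conv G x y) u - tens x (alg_act (sub G H) X y u) |x y u.
      x \<in> group_alg G \<and> y \<in> group_alg (sub G H) \<and> u \<in> lev0 X}"

definition is_induced :: "('g, 'x) monoid_scheme \<Rightarrow> 'g set \<Rightarrow> ('g, 'k::field) glider
    \<Rightarrow> ('g, 'k) glider \<Rightarrow> bool"
  where "is_induced G H X Y \<longleftrightarrow> is_glider G Y \<and>
    (\<exists>p. linear_on (tens_space (group_alg G) (lev0 X)) p \<and>
      p ` tens_space (group_alg G) (lev0 X) = space Y \<and>
      {w \<in> tens_space (group_alg G) (lev0 X). p w = 0} = balance_relations G H X \<and>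
      (\<forall>g\<in>carrier G. \<forall>x\<in>group_alg G. \<forall>u\<in>lev0 X.
         act Y g (p (tens x u)) = p (tens (conv G (delta g) x) u)) \<and>
      lev0 Y = space Y \<and>
      lev1 Y = (\<lambda>u. p (tens (delta \<one>\<^bsub>G\<^esub>) u)) ` lev1 X)"

text \<open>
  The additive extensions to the rings are determined by their values on the classes of
  irreducible gliders.
\<close>

definition Ind :: "('g, 'x) monoid_scheme \<Rightarrow> 'g set
    \<Rightarrow> ('g, 'k::field) glider_class \<Rightarrow> ('g, 'k) glider_class"
  where "Ind G H = (SOME \<phi>. \<phi> \<in> hom (add_monoid (R1 (sub G H))) (add_monoid (R1 G)) \<and>
    (\<forall>X Y. irreducible_glider (sub G H) X \<and> is_induced G H X Y
       \<longrightarrow> \<phi> (cls (sub G H) X) = cls G Y))"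

definition restricted :: "('g, 'x) monoid_scheme \<Rightarrow> 'g set \<Rightarrow> ('g, 'k::field) glider
    \<Rightarrow> ('g, 'k) glider"
  where "restricted G H X = X\<lparr>lev0 := alg_span (sub G H) X (lev1 X)\<rparr>"

definition Res :: "('g, 'x) monoid_scheme \<Rightarrow> 'g set
    \<Rightarrow> ('g, 'k::field) glider_class \<Rightarrow> ('g, 'k) glider_class"
  where "Res G H = (SOME \<phi>. \<phi> \<in> hom (add_monoid (R1 G)) (add_monoid (R1 (sub G H))) \<and>
    (\<forall>X. irreducible_glider G X \<longrightarrow> \<phi> (cls G X) = cls (sub G H) (restricted G H X)))"


section \<open>Parametrization of the irreducible gliders\<close>

definition ab :: "('g, 'x) monoid_scheme \<Rightarrow> 'g set monoid"
  where "ab G = G Mod derived G (carrier G)"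

text \<open>
  \<open>one_dim_param G T\<close>: \<open>z \<mapsto> T z\<close> is an isomorphism from the abelianization of \<open>G\<close> to the group
  of isomorphism classes of one-dimensional modules under the tensor product.
  \<open>irr_param G I\<close>: \<open>I\<close> is a set of representatives of the isomorphism classes of simple modules.
\<close>

definition one_dim_param :: "('g, 'x) monoid_scheme \<Rightarrow> ('g set \<Rightarrow> ('g, 'k::field) rep) \<Rightarrow> bool"
  where "one_dim_param G T \<longleftrightarrow>
    (\<forall>z\<in>carrier (ab G). is_module G (T z) \<and> fn.dim (space (T z)) = 1) \<and>
    (\<forall>z\<in>carrier (ab G). \<forall>w\<in>carrier (ab G).
       rep_iso G (T (z \<otimes>\<^bsub>ab G\<^esub> w)) (rep_tensor (T z) (T w))) \<and>
    (\<forall>V :: ('g, 'k) rep. is_module G V \<and> fn.dim (space V) = 1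
       \<longrightarrow> (\<exists>!z. z \<in> carrier (ab G) \<and> rep_iso G V (T z)))"

definition irr_param :: "('g, 'x) monoid_scheme \<Rightarrow> ('g, 'k::field) rep set \<Rightarrow> bool"
  where "irr_param G I \<longleftrightarrow> (\<forall>U\<in>I. simple_module G U) \<and>
    (\<forall>V :: ('g, 'k) rep. simple_module G V \<longrightarrow> (\<exists>!U. U \<in> I \<and> rep_iso G V U))"

text \<open>Such choices are fixed for \<open>G\<close> and for each of its subgroups \<open>H\<close>.\<close>

definition params :: "('g, 'x) monoid_scheme \<Rightarrow> ('g set \<Rightarrow> 'g set \<Rightarrow> ('g, 'k::field) rep)
    \<Rightarrow> ('g set \<Rightarrow> ('g, 'k) rep set) \<Rightarrow> bool"
  where "params G T I \<longleftrightarrow>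
    (\<forall>H. subgroup H G \<longrightarrow> one_dim_param (sub G H) (T H) \<and> irr_param (sub G H) (I H))"

text \<open>
  The disjoint union of the Grassmannians of the simple modules of dimension greater than one,
  a point being a pair of a module and a nonzero subspace.
\<close>

definition grass :: "('g, 'k::field) rep \<Rightarrow> (nat \<Rightarrow> 'k) set set"
  where "grass U = {W. fn.subspace W \<and> W \<subseteq> space U \<and> 1 \<le> fn.dim W \<and> fn.dim W \<le> fn.dim (space U)}"

definition SS :: "('g, 'k::field) rep set \<Rightarrow> (('g, 'k) rep \<times> (nat \<Rightarrow> 'k) set) set set"
  where "SS I = {B. B \<subseteq> (SIGMA U : {U \<in> I. fn.dim (space U) > 1}. grass U) \<and>
    (\<forall>U W W'. (U, W) \<in> B \<and> (U, W') \<in> B \<longrightarrow> W = W')}"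

definition admissible :: "('g, 'x) monoid_scheme \<Rightarrow> ('g set \<Rightarrow> ('g, 'k::field) rep set)
    \<Rightarrow> 'g set set \<Rightarrow> (('g, 'k) rep \<times> (nat \<Rightarrow> 'k) set) set \<Rightarrow> bool"
  where "admissible G I A B \<longleftrightarrow>
    A \<subseteq> carrier (ab G) \<and> B \<in> SS (I (carrier G)) \<and> \<not> (A = {} \<and> B = {})"

text \<open>
  The glider \<open>K v\<close> inside the direct sum of the modules in a list of pairs (module, component
  of \<open>v\<close>).
\<close>

definition cyclic_glider :: "(('g, 'k::field) rep \<times> (nat \<Rightarrow> 'k)) list \<Rightarrow> ('g, 'k) glider"
  where "cyclic_glider cs = rep.extend (dsum (map fst cs))
    \<lparr>lev0 = space (dsum (map fst cs)), lev1 = fn.span {tuple (map snd cs)}\<rparr>"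

text \<open>
  \<open>standard_glider T A B X\<close>: the glider \<open>X\<close> is of the form described by \<open>(A, B)\<close>. The modules
  \<open>T z\<close>, with nonzero components \<open>c z\<close>, come first; they are followed, for each \<open>(U, W) \<in> B\<close>, by
  \<open>dim W\<close> copies of \<open>U\<close>, whose components are the members of the basis \<open>b (U, W)\<close> of \<open>W\<close>.
\<close>

definition standard_glider :: "('g set \<Rightarrow> ('g, 'k::field) rep)
    \<Rightarrow> 'g set set \<Rightarrow> (('g, 'k) rep \<times> (nat \<Rightarrow> 'k) set) set \<Rightarrow> ('g, 'k) glider \<Rightarrow> bool"
  where "standard_glider T A B X \<longleftrightarrow> (\<exists>zs c ps b.
    distinct zs \<and> set zs = A \<and> distinct ps \<and> set ps = B \<and>
    (\<forall>z\<in>A. c z \<in> space (T z) \<and> c z \<noteq> 0) \<and>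
    (\<forall>p\<in>B. distinct (b p) \<and> fn.independent (set (b p)) \<and> fn.span (set (b p)) = snd p) \<and>
    X = cyclic_glider (map (\<lambda>z. (T z, c z)) zs @ concat (map (\<lambda>p. map (Pair (fst p)) (b p)) ps)))"

definition Mcls :: "('g, 'x) monoid_scheme \<Rightarrow> ('g set \<Rightarrow> 'g set \<Rightarrow> ('g, 'k::field) rep)
    \<Rightarrow> 'g set set \<Rightarrow> (('g, 'k) rep \<times> (nat \<Rightarrow> 'k) set) set \<Rightarrow> ('g, 'k) glider_class"
  where "Mcls G T A B = cls G (SOME X. standard_glider (T (carrier G)) A B X)"


section \<open>Chains and the elements \<open>\<epsilon>\<close>\<close>

definition LL :: "('g, 'x) monoid_scheme \<Rightarrow> ('g set \<Rightarrow> 'g set \<Rightarrow> ('g, 'k::field) rep)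
    \<Rightarrow> 'g set set \<Rightarrow> 'g set"
  where "LL G T C = {g \<in> carrier G. \<forall>z\<in>C. \<forall>v\<in>space (T (carrier G) z). act (T (carrier G) z) g v = v}"

type_synonym ('g, 'k) link = "'g set \<times> 'g set set \<times> (('g, 'k) rep \<times> (nat \<Rightarrow> 'k) set) set"

text \<open>
  \<open>next_link\<close> sends \<open>(H\<^sub>i, C\<^sub>i, D\<^sub>i)\<close> to \<open>(H\<^sub>i\<^sub>+\<^sub>1, C\<^sub>i\<^sub>+\<^sub>1, D\<^sub>i\<^sub>+\<^sub>1)\<close>; the last two are determined by the
  class of the glider. The links after the first one with \<open>C\<^sub>i = {e}\<close> are irrelevant.
\<close>

definition next_link :: "('g, 'x) monoid_scheme \<Rightarrow> ('g set \<Rightarrow> 'g set \<Rightarrow> ('g, 'k::field) rep)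
    \<Rightarrow> ('g set \<Rightarrow> ('g, 'k) rep set) \<Rightarrow> ('g, 'k) link \<Rightarrow> ('g, 'k) link"
  where "next_link G T I = (\<lambda>(H, C, D). let K = LL (sub G H) T C in
    (K, SOME (A, B). admissible (sub G K) I A B \<and>
                     Mcls (sub G K) T A B = Res (sub G H) K (Mcls (sub G H) T C D)))"

definition link :: "('g, 'x) monoid_scheme \<Rightarrow> ('g set \<Rightarrow> 'g set \<Rightarrow> ('g, 'k::field) rep)
    \<Rightarrow> ('g set \<Rightarrow> ('g, 'k) rep set) \<Rightarrow> 'g set set \<Rightarrow> (('g, 'k) rep \<times> (nat \<Rightarrow> 'k) set) set
    \<Rightarrow> nat \<Rightarrow> ('g, 'k) link"
  where "link G T I C D i = (next_link G T I ^^ i) (carrier G, C, D)"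

definition chain_grp :: "('g, 'x) monoid_scheme \<Rightarrow> ('g set \<Rightarrow> 'g set \<Rightarrow> ('g, 'k::field) rep)
    \<Rightarrow> ('g set \<Rightarrow> ('g, 'k) rep set) \<Rightarrow> 'g set set \<Rightarrow> (('g, 'k) rep \<times> (nat \<Rightarrow> 'k) set) set
    \<Rightarrow> nat \<Rightarrow> 'g set"
  where "chain_grp G T I C D i = fst (link G T I C D i)"

definition chain_len :: "('g, 'x) monoid_scheme \<Rightarrow> ('g set \<Rightarrow> 'g set \<Rightarrow> ('g, 'k::field) rep)
    \<Rightarrow> ('g set \<Rightarrow> ('g, 'k) rep set) \<Rightarrow> 'g set set \<Rightarrow> (('g, 'k) rep \<times> (nat \<Rightarrow> 'k) set) set \<Rightarrow> nat"
  where "chain_len G T I C D = (LEAST m.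
    fst (snd (link G T I C D m)) = {\<one>\<^bsub>ab (sub G (chain_grp G T I C D m))\<^esub>})"

definition HCD :: "('g, 'x) monoid_scheme \<Rightarrow> ('g set \<Rightarrow> 'g set \<Rightarrow> ('g, 'k::field) rep)
    \<Rightarrow> ('g set \<Rightarrow> ('g, 'k) rep set) \<Rightarrow> 'g set set \<Rightarrow> (('g, 'k) rep \<times> (nat \<Rightarrow> 'k) set) set \<Rightarrow> 'g set"
  where "HCD G T I C D = chain_grp G T I C D (chain_len G T I C D)"

definition idem_param :: "('g, 'x) monoid_scheme \<Rightarrow> ('g set \<Rightarrow> 'g set \<Rightarrow> ('g, 'k::field) rep)
    \<Rightarrow> ('g set \<Rightarrow> ('g, 'k) rep set) \<Rightarrow> 'g set set \<Rightarrow> (('g, 'k) rep \<times> (nat \<Rightarrow> 'k) set) set \<Rightarrow> bool"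
  where "idem_param G T I C D \<longleftrightarrow> admissible G I C D \<and> C \<noteq> {} \<and>
    Mcls G T C D \<otimes>\<^bsub>R1 G\<^esub> Mcls G T C D = Mcls G T C D"

definition Sub :: "('g, 'x) monoid_scheme \<Rightarrow> ('g set \<Rightarrow> 'g set \<Rightarrow> ('g, 'k::field) rep)
    \<Rightarrow> ('g set \<Rightarrow> ('g, 'k) rep set) \<Rightarrow> 'g set set"
  where "Sub G T I = {HCD G T I C D |C D. idem_param G T I C D}"

lemma HCD_in_Sub: "idem_param G T I C D \<Longrightarrow> HCD G T I C D \<in> Sub G T I"
  by (auto simp: Sub_def)

definition Aiota :: "('g, 'x) monoid_scheme \<Rightarrow> ('g set \<Rightarrow> 'g set \<Rightarrow> ('g, 'k::field) rep)
    \<Rightarrow> 'g set \<Rightarrow> 'g set set"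
  where "Aiota G T H = {z \<in> carrier (ab G).
    \<forall>h\<in>H. \<forall>v\<in>space (T (carrier G) z). act (T (carrier G) z) h v = v}"

definition maximal_subgroups :: "('g, 'x) monoid_scheme \<Rightarrow> 'g set \<Rightarrow> 'g set set"
  where "maximal_subgroups G H = {L. subgroup L (sub G H) \<and> L \<noteq> H \<and>
    derived G (carrier G) \<subseteq> L \<and>
    (\<forall>L'. subgroup L' (sub G H) \<and> L \<subseteq> L' \<longrightarrow> L' = L \<or> L' = H)}"

text \<open>The trivial representation is \<open>T z\<close> for \<open>z\<close> the unit of the abelianization.\<close>

definition eps_rel :: "('g, 'x) monoid_scheme \<Rightarrow> ('g set \<Rightarrow> 'g set \<Rightarrow> ('g, 'k::field) rep)
    \<Rightarrow> 'g set \<Rightarrow> ('g, 'k) glider_class"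
  where "eps_rel G T H = Mcls G T (Aiota G T H) {} \<otimes>\<^bsub>R1 G\<^esub>
    (\<Otimes>\<^bsub>R1 G\<^esub>L\<in>maximal_subgroups G H.
       Mcls G T {\<one>\<^bsub>ab G\<^esub>} {} \<ominus>\<^bsub>R1 G\<^esub> Mcls G T (Aiota G T L) {})"

definition eps :: "('g, 'x) monoid_scheme \<Rightarrow> ('g set \<Rightarrow> 'g set \<Rightarrow> ('g, 'k::field) rep)
    \<Rightarrow> ('g set \<Rightarrow> ('g, 'k) rep set) \<Rightarrow> 'g set set \<Rightarrow> (('g, 'k) rep \<times> (nat \<Rightarrow> 'k) set) set
    \<Rightarrow> ('g, 'k) glider_class"
  where "eps G T I C D = (let Hs = chain_grp G T I C D; m = chain_len G T I C D in
    (\<Otimes>\<^bsub>R1 G\<^esub>i\<in>{..<m}. Ind G (Hs i) (eps_rel (sub G (Hs i)) T (Hs (Suc i)))) \<otimes>\<^bsub>R1 G\<^esub>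
    Ind G (Hs m) (eps_rel (sub G (Hs m)) T (Hs m)))"

end

theory Submission
  imports Defs
begin

text \<open>
  Up to summands of length zero, a glider with one-dimensional \<open>M\<^sub>-\<^sub>1 = K u\<close> is determined by the
  annihilator of \<open>u\<close> in \<open>K[G]\<close>, and the functions counting \<open>dim {m \<in> M\<^sub>-\<^sub>1. J m = 0}\<close>, for \<open>J\<close>
  a subset of \<open>K[G]\<close>, separate the elements of the ring. The annihilator of an idempotent is closed under
  multiplication by the coordinate functions \<open>g \<mapsto> (g u) i\<close>, which forces it to be the annihilator of the
  unit coset in \<open>K[G/S]\<close> for a subgroup \<open>S\<close>. The span of these classes \<open>E\<^sub>S\<close> is a Burnside-like
  ring with \<open>E\<^sub>S E\<^sub>L = E\<^bsub>S \<inter> L\<^esub>\<close>; the counting functions for the ideals of the subgroups \<open>P\<close>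
  (\<open>marks\<close> below) are ring homomorphisms on it which together are faithful, and induction from
  \<open>H\<close> multiplies them by the indicator of \<open>P \<subseteq> H\<close>.

  For an idempotent attached to \<open>S\<close>, each step of the chain passes from \<open>H\<^sub>i\<close> to its least subgroup
  containing \<open>S\<close> and the derived subgroup. The marks of \<open>\<epsilon>\<close> are \<open>0\<close> or \<open>1\<close>, the last subgroup of the
  chain has mark \<open>1\<close>, and a subgroup \<open>P\<close> of mark \<open>1\<close> determines the chain: at the first place where two
  chains differ, \<open>P\<close> would lie in a maximal subgroup excluded by one of the two elements.
\<close>


section \<open>Linear algebra in function spaces\<close>

text \<open>The product on the free group is associative, commutative and unital only up to
  isomorphism of gliders. The quotients are therefore formed with distributivity alone, and the ring
  laws are obtained only on the span of cyclic gliders, where both sides of each law have the same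
  counting functions. Restriction, induction, standard gliders and the links of the chain are given
  by Hilbert choice, so each of them needs an existence proof and a proof that the annihilator,
  hence the class, does not depend on the choice. Characteristic 0 enters through division by the
  orders of \<open>S\<close>, \<open>H\<close> and \<open>G\<close>. Algebraic closedness enters
  because a simple module on which all commutators act trivially has to be one-dimensional; this
  identifies the glider with parameters (A_iota(N), {}) with the class of the coset \<open>N\<close>
  in \<open>K[G/N]\<close> when \<open>N\<close> contains the derived subgroup. The mark at
  \<open>P\<close> of a factor of \<epsilon> is then 1 exactly when \<open>P\<close> and the derived
  subgroup of one link generate the next link, so that \<open>P\<close> recovers each link from the
  previous one.\<close>

interpretation fnp: vector_space_pair "smul :: 'k::field \<Rightarrow> ('a \<Rightarrow> 'k) \<Rightarrow> 'a \<Rightarrow> 'k"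
  "smul :: 'k \<Rightarrow> ('b \<Rightarrow> 'k) \<Rightarrow> 'b \<Rightarrow> 'k"
  by unfold_locales

lemma smul_apply: "smul c v i = c * v i"
  by (simp add: smul_def)

lemma sum_fun_apply: "(\<Sum>a\<in>A. f a) i = (\<Sum>a\<in>A. f a i)"
  by (induction A rule: infinite_finite_induct) (auto simp: plus_fun_apply zero_fun_apply)

text \<open>Higher-order unification leaves eta-expanded functions behind, which the rules below would
  unfold pointwise.\<close>

declare plus_fun_apply [simp del] minus_apply [simp del] zero_fun_apply [simp del]
  uminus_apply [simp del]

lemmas fun_simps = plus_fun_apply minus_apply zero_fun_apply smul_apply

lemma linear_onI:
  assumes "\<And>v w. v \<in> V \<Longrightarrow> w \<in> V \<Longrightarrow> f (v + w) = f v + f w"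
    and "\<And>c v. v \<in> V \<Longrightarrow> f (smul c v) = smul c (f v)"
  shows "linear_on V f"
  using assms by (simp add: linear_on_def)

lemma linear_on_add: "linear_on V f \<Longrightarrow> v \<in> V \<Longrightarrow> w \<in> V \<Longrightarrow> f (v + w) = f v + f w"
  by (simp add: linear_on_def)

lemma linear_on_smul: "linear_on V f \<Longrightarrow> v \<in> V \<Longrightarrow> f (smul c v) = smul c (f v)"
  by (simp add: linear_on_def)

lemma linear_on_subset: "linear_on V f \<Longrightarrow> W \<subseteq> V \<Longrightarrow> linear_on W f"
  unfolding linear_on_def by blast

lemma linear_on_compose:
  "linear_on V f \<Longrightarrow> linear_on W g \<Longrightarrow> f ` V \<subseteq> W \<Longrightarrow> linear_on V (\<lambda>v. g (f v))"
  by (simp add: linear_on_def image_subset_iff)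

lemma linear_on_id [simp]: "linear_on V (\<lambda>v. v)"
  by (simp add: linear_on_def)

lemma linear_imp_linear_on: "Vector_Spaces.linear smul smul f \<Longrightarrow> linear_on V f"
  by (intro linear_onI) (erule fnp.linear_add fnp.linear_scale)+

lemma linear_on_diff:
  assumes "linear_on V f" "fn.subspace V" "v \<in> V" "w \<in> V"
  shows "f (v - w) = f v - f w"
proof -
  have "f (v - w) + f w = f (v - w + w)"
    using assms by (intro linear_on_add[OF assms(1), symmetric] fn.subspace_diff)
  then show ?thesis by (simp add: algebra_simps)
qed

lemma linear_on_zero:
  assumes "linear_on V f" "fn.subspace V"
  shows "f 0 = 0"
  using linear_on_diff[OF assms fn.subspace_0[OF assms(2)] fn.subspace_0[OF assms(2)]] by simp

lemma linear_on_sum: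
  assumes "linear_on V f" "fn.subspace V" "\<And>i. i \<in> A \<Longrightarrow> v i \<in> V"
  shows "f (\<Sum>i\<in>A. v i) = (\<Sum>i\<in>A. f (v i))"
  using assms(3)
proof (induction A rule: infinite_finite_induct)
  case (insert x F)
  have "f (v x + (\<Sum>i\<in>F. v i)) = f (v x) + f (\<Sum>i\<in>F. v i)"
    using insert.prems by (intro linear_on_add[OF assms(1)] fn.subspace_sum assms(2)) auto
  then show ?case using insert by simp
qed (auto simp: linear_on_zero[OF assms(1,2)])

lemma subspace_linear_on_vimage:
  assumes "linear_on V f" "fn.subspace V" "fn.subspace W"
  shows "fn.subspace {v \<in> V. f v \<in> W}"
proof (rule fn.subspaceI)
  show "0 \<in> {v \<in> V. f v \<in> W}"
    using linear_on_zero[OF assms(1,2)] fn.subspace_0[OF assms(2)] fn.subspace_0[OF assms(3)] by simp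
  show "x + y \<in> {v \<in> V. f v \<in> W}" if "x \<in> {v \<in> V. f v \<in> W}" "y \<in> {v \<in> V. f v \<in> W}" for x y
    using that linear_on_add[OF assms(1)] fn.subspace_add[OF assms(2)] fn.subspace_add[OF assms(3)]
    by simp
  show "smul c x \<in> {v \<in> V. f v \<in> W}" if "x \<in> {v \<in> V. f v \<in> W}" for c x
    using that linear_on_smul[OF assms(1)] fn.subspace_scale[OF assms(2)] fn.subspace_scale[OF assms(3)]
    by simp
qed

lemma subspace_linear_on_image:
  assumes "linear_on V f" "fn.subspace V"
  shows "fn.subspace (f ` V)"
proof (rule fn.subspaceI)
  show "0 \<in> f ` V"
    using linear_on_zero[OF assms] fn.subspace_0[OF assms(2)] by (intro image_eqI[of _ _ 0]) auto
next
  fix x y assume "x \<in> f ` V" "y \<in> f ` V"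
  then obtain v w where "v \<in> V" "w \<in> V" "x = f v" "y = f w" by auto
  then show "x + y \<in> f ` V"
    using linear_on_add[OF assms(1), of v w] fn.subspace_add[OF assms(2), of v w]
    by (intro image_eqI[of _ _ "v + w"]) auto
next
  fix c x assume "x \<in> f ` V"
  then obtain v where "v \<in> V" "x = f v" by auto
  then show "smul c x \<in> f ` V"
    using linear_on_smul[OF assms(1), of v c] fn.subspace_scale[OF assms(2), of v c]
    by (intro image_eqI[of _ _ "smul c v"]) auto
qed

lemma linear_on_span_subset:
  assumes "linear_on (fn.span S) f" "fn.subspace W" "f ` S \<subseteq> W"
  shows "f ` fn.span S \<subseteq> W"
proof -
  have "fn.span S \<subseteq> {v \<in> fn.span S. f v \<in> W}"
    using assms
    by (intro fn.span_minimal subspace_linear_on_vimage) (auto intro: fn.span_base)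
  then show ?thesis by auto
qed

lemma linear_on_span_image:
  assumes "linear_on (fn.span S) f"
  shows "f ` fn.span S = fn.span (f ` S)"
proof
  show "f ` fn.span S \<subseteq> fn.span (f ` S)"
    by (intro linear_on_span_subset assms) (auto intro: fn.span_base)
  show "fn.span (f ` S) \<subseteq> f ` fn.span S"
    by (intro fn.span_minimal subspace_linear_on_image assms) (auto intro: fn.span_base)
qed

lemma linear_on_span_eq:
  assumes "linear_on (fn.span S) f" "linear_on (fn.span S) g" "\<And>v. v \<in> S \<Longrightarrow> f v = g v"
    "v \<in> fn.span S"
  shows "f v = g v"
proof -
  have "linear_on (fn.span S) (\<lambda>v. f v - g v)"
    using assms(1,2) by (auto simp: linear_on_def algebra_simps fn.scale_right_diff_distrib)
  from linear_on_span_subset[OF this fn.subspace_single_0]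
  show ?thesis using assms(3,4) by (auto simp: image_subset_iff)
qed

text \<open>\<open>linear_on\<close> says nothing off \<open>V\<close>, whereas the basis theorems
  concern maps that are linear everywhere; extending \<open>f\<close> from a basis of
  \<open>V\<close> makes them applicable.\<close>

lemma linear_on_extend:
  assumes "linear_on V f" "fn.subspace V"
  obtains g where "Vector_Spaces.linear smul smul g" "\<And>v. v \<in> V \<Longrightarrow> g v = f v"
proof -
  obtain B where B: "B \<subseteq> V" "fn.independent B" "V \<subseteq> fn.span B"
    using fn.basis_exists[of V] by metis
  then have VB: "V = fn.span B"
    using assms(2) by (intro equalityI fn.span_minimal) auto
  obtain g where g: "Vector_Spaces.linear smul smul g" "\<forall>x\<in>B. g x = f x"
    using fnp.linear_independent_extend[OF B(2), of f] by blast
  show thesis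
  proof (rule that[OF g(1)])
    fix v assume "v \<in> V"
    then show "g v = f v"
      using linear_on_span_eq[OF linear_imp_linear_on[OF g(1)], of B f] g(2) assms(1) VB by blast
  qed
qed

section \<open>Finite-dimensional subspaces and their dimensions\<close>

lemma finite_dim_span [simp]: "finite B \<Longrightarrow> finite_dim (fn.span B)"
  by (auto simp: finite_dim_def)

lemma finite_dim_subspace:
  assumes "finite_dim V" "fn.subspace W" "W \<subseteq> V"
  shows "finite_dim W"
proof -
  obtain b where b: "finite b" "V = fn.span b"
    using assms(1) by (auto simp: finite_dim_def)
  obtain B where B: "B \<subseteq> W" "fn.independent B" "W \<subseteq> fn.span B"
    using fn.basis_exists[of W] by metis
  have "finite B"
    using fn.independent_span_bound[OF b(1) B(2)] B assms(3) b(2) by auto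
  moreover have "W = fn.span B"
    using B assms(2) by (intro equalityI fn.span_minimal) auto
  ultimately show ?thesis by (auto simp: finite_dim_def)
qed

lemma finite_dim_basis:
  assumes "finite_dim V"
  obtains B where "finite B" "fn.independent B" "V = fn.span B" "card B = fn.dim V"
proof -
  obtain b where b: "finite b" "V = fn.span b"
    using assms by (auto simp: finite_dim_def)
  obtain B where B: "B \<subseteq> V" "fn.independent B" "V \<subseteq> fn.span B" "card B = fn.dim V"
    using fn.basis_exists[of V] by metis
  moreover have "finite B"
    using fn.independent_span_bound[OF b(1) B(2)] B b(2) by auto
  moreover have "V = fn.span B"
    using B b(2) by (intro equalityI fn.span_minimal) auto
  ultimately show thesis using that by blast
qed

lemma finite_dim_imp_subspace: "finite_dim V \<Longrightarrow> fn.subspace V"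
  by (auto simp: finite_dim_def)

text \<open>\<open>fn.dim\<close> is the cardinality of a basis, and an infinite set has cardinality
  0; a positive value thus excludes an infinite basis. This is how conditions such as
  \<open>fn.dim (space U) > 1\<close> yield finite dimension.\<close>

lemma finite_dim_of_dim_pos:
  assumes "fn.subspace V" "fn.dim V > 0"
  shows "finite_dim V"
proof -
  obtain B where B: "B \<subseteq> V" "fn.independent B" "V \<subseteq> fn.span B" "card B = fn.dim V"
    using fn.basis_exists[of V] by metis
  then have "finite B" using assms(2) by (metis card.infinite less_numeral_extra(3))
  moreover have "V = fn.span B"
    using B assms(1) by (intro equalityI fn.span_minimal) auto
  ultimately show ?thesis by (auto simp: finite_dim_def)
qed

lemma finite_dim_image:
  assumes "linear_on V f" "finite_dim V"
  shows "finite_dim (f ` V)"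
proof -
  obtain b where "finite b" "V = fn.span b"
    using assms(2) by (auto simp: finite_dim_def)
  then show ?thesis
    using linear_on_span_image assms(1) by fastforce
qed

lemma finite_dim_zero [simp]: "finite_dim {0}"
  using finite_dim_span[of "{}"] by simp

lemma dim_zero [simp]: "fn.dim {0} = 0"
  using fn.dim_span_eq_card_independent[of "{}"] by (simp add: fn.independent_empty)

lemma dim_line: "u \<noteq> 0 \<Longrightarrow> fn.dim (fn.span {u}) = 1"
  using fn.dim_span_eq_card_independent[of "{u}"] by simp

lemma dim_one_line:
  assumes "fn.subspace V" "fn.dim V = 1"
  obtains u where "u \<noteq> 0" "V = fn.span {u}"
proof -
  obtain B where B: "fn.independent B" "V = fn.span B" "card B = 1"
    using finite_dim_basis[OF finite_dim_of_dim_pos[OF assms(1)]] assms(2) by (metis zero_less_one)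
  then obtain u where "B = {u}" by (auto simp: card_1_singleton_iff)
  then show thesis using B that by auto
qed

lemma finite_dim_eq_0:
  assumes "finite_dim V" "fn.dim V = 0"
  shows "V = {0}"
  using finite_dim_basis[OF assms(1)] assms(2) by (metis card_0_eq fn.span_empty)

lemma dim_psubset:
  assumes "finite_dim V" "fn.subspace W" "W \<subset> V"
  shows "fn.dim W < fn.dim V"
proof -
  obtain B where B: "finite B" "fn.independent B" "W = fn.span B" "card B = fn.dim W"
    using finite_dim_basis finite_dim_subspace assms by (metis psubset_imp_subset)
  obtain b where b: "finite b" "V = fn.span b" "card b = fn.dim V"
    using finite_dim_basis[OF assms(1)] by metis
  obtain v where v: "v \<in> V" "v \<notin> W" using assms(3) by auto
  then have "fn.independent (insert v B)" using B by (simp add: fn.independent_insertI)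
  moreover have "insert v B \<subseteq> fn.span b"
    using v B(3) b(2) assms(3) fn.span_superset[of B] by blast
  ultimately have "card (insert v B) \<le> card b"
    using fn.independent_span_bound[OF b(1)] by blast
  moreover have "v \<notin> B" using v B by (auto intro: fn.span_base)
  ultimately show ?thesis using B b by simp
qed

lemma dim_subset:
  assumes "finite_dim V" "fn.subspace W" "W \<subseteq> V"
  shows "fn.dim W \<le> fn.dim V"
  using dim_psubset[OF assms(1,2)] assms(3) by (metis less_imp_le order_refl psubsetI)

lemma dim_linear_on_image:
  assumes "linear_on V f" "finite_dim V" "inj_on f V"
  shows "fn.dim (f ` V) = fn.dim V"
proof -
  obtain B where B: "finite B" "fn.independent B" "V = fn.span B" "card B = fn.dim V"
    using finite_dim_basis[OF assms(2)] by metis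
  obtain g where g: "Vector_Spaces.linear smul smul g" "\<And>v. v \<in> V \<Longrightarrow> g v = f v"
    using linear_on_extend[OF assms(1) finite_dim_imp_subspace[OF assms(2)]] by metis
  have injg: "inj_on g (fn.span B)"
    using assms(3) g(2) B(3) by (simp add: inj_on_def)
  then have "fn.independent (g ` B)"
    using fnp.linear_independent_injective_image[OF g(1) B(2)] by blast
  moreover have "card (g ` B) = card B"
    by (intro card_image inj_on_subset[OF injg]) (auto intro: fn.span_base)
  moreover have "f ` V = fn.span (g ` B)"
    using g B(3) fnp.linear_span_image[OF g(1)] by (metis image_cong)
  ultimately show ?thesis
    using B(4) fn.dim_span_eq_card_independent by metis
qed

lemma dim_direct_sum:
  assumes "finite_dim V" "finite_dim W" "V \<inter> W = {0}"
  shows "fn.dim {v + w |v w. v \<in> V \<and> w \<in> W} = fn.dim V + fn.dim W"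
proof -
  obtain a where a: "finite a" "fn.independent a" "V = fn.span a" "card a = fn.dim V"
    using finite_dim_basis[OF assms(1)] by metis
  obtain b where b: "finite b" "fn.independent b" "W = fn.span b" "card b = fn.dim W"
    using finite_dim_basis[OF assms(2)] by metis
  \<comment> \<open>The vectors of \<open>b\<close> are adjoined to \<open>a\<close> one at a time.
    If \<open>y\<close> depended on \<open>a\<close> and on earlier vectors \<open>c\<close>,
    removing the part in the span of \<open>c\<close> would leave a vector of
    \<open>V \<inter> W\<close>, hence 0, and \<open>y\<close> would depend on the rest of
    \<open>b\<close>.\<close>
  have "b' \<subseteq> b \<Longrightarrow> fn.independent (a \<union> b')" if "finite b'" for b'
    using that
  proof (induction b')
    case (insert y c)
    have "y \<notin> fn.span (a \<union> c)"
    proof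
      assume "y \<in> fn.span (a \<union> c)"
      then obtain p q where pq: "p \<in> fn.span a" "q \<in> fn.span c" "y = p + q"
        by (auto simp: fn.span_Un)
      have "q \<in> fn.span b" using pq(2) insert.prems fn.span_mono[of c b] by auto
      moreover have "y \<in> fn.span b" using insert.prems by (auto intro: fn.span_base)
      ultimately have "p \<in> fn.span b" using pq(3) fn.span_diff[of y b q] by simp
      then have "p = 0" using pq(1) a(3) b(3) assms(3) by auto
      then have "y \<in> fn.span c" using pq by simp
      moreover have "fn.independent (insert y c)"
        using b(2) insert.prems fn.independent_mono by blast
      ultimately show False
        using insert.hyps fn.independent_insert[of y c] by auto
    qed
    then show ?case using insert by (simp add: fn.independent_insertI)
  qed (use a in simp)
  then have "fn.independent (a \<union> b)" using b(1) by blast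
  moreover have "a \<inter> b = {}"
  proof (rule ccontr)
    assume "a \<inter> b \<noteq> {}"
    then obtain y where y: "y \<in> a" "y \<in> b" by auto
    then have "y = 0" using assms(3) a(3) b(3) fn.span_base by blast
    then show False using y a(2) fn.dependent_zero by blast
  qed
  moreover have "{v + w |v w. v \<in> V \<and> w \<in> W} = fn.span (a \<union> b)"
    using a(3) b(3) by (simp add: fn.span_Un)
  ultimately show ?thesis
    using a b card_Un_disjoint fn.dim_span_eq_card_independent by metis
qed

text \<open>A left inverse of the identity on \<open>W\<close> with values in \<open>W\<close>. It
  supplies the complement of \<open>alg_span\<close> in \<open>lev0\<close> and, after averaging,
  the equivariant projection of \<open>maschke\<close>.\<close>

lemma projection_exists:
  fixes W :: "('a \<Rightarrow> 'k::field) set"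
  assumes "fn.subspace W"
  obtains p where "Vector_Spaces.linear smul smul p" "range p \<subseteq> W" "\<And>w. w \<in> W \<Longrightarrow> p w = w"
proof -
  have "Vector_Spaces.linear smul smul (id :: ('a \<Rightarrow> 'k) \<Rightarrow> _)"
    by (simp add: fn.linear_id)
  from fnp.linear_exists_left_inverse_on[OF this assms] that show thesis by auto
qed

section \<open>Tensor products of function spaces\<close>

lemma enc_dec [simp]: "enc (dec w) = w" "dec (enc f) = f"
  by (auto simp: enc_def dec_def)

lemma enc_linear [simp]: "enc (f + g) = enc f + enc g" "enc (smul c f) = smul c (enc f)" "enc 0 = 0"
  by (auto simp: enc_def fun_eq_iff fun_simps)

lemma dec_linear [simp]: "dec (f + g) = dec f + dec g" "dec (smul c f) = smul c (dec f)" "dec 0 = 0"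
  by (auto simp: dec_def fun_eq_iff fun_simps)

lemma enc_eq_iff [simp]: "enc f = enc g \<longleftrightarrow> f = g"
  by (metis enc_dec(2))

lemma linear_enc: "linear_on V enc" and linear_dec: "linear_on W dec"
  by (auto simp: linear_on_def)

lemma enc_span: "enc ` fn.span S = fn.span (enc ` S)"
  by (intro linear_on_span_image linear_enc)

lemma subspace_tens_space [simp]: "fn.subspace (tens_space V W)"
  by (simp add: tens_space_def)

lemma tens_in_tens_space: "v \<in> V \<Longrightarrow> w \<in> W \<Longrightarrow> tens v w \<in> tens_space V W"
  by (auto simp: tens_space_def intro: fn.span_base)

lemma tens_space_mono: "V \<subseteq> V' \<Longrightarrow> W \<subseteq> W' \<Longrightarrow> tens_space V W \<subseteq> tens_space V' W'"
  unfolding tens_space_def by (intro fn.span_mono) auto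

lemma tens_add_left: "tens (v + v') w = tens v w + tens v' w"
  and tens_add_right: "tens v (w + w') = tens v w + tens v w'"
  and tens_smul_left: "tens (smul c v) w = smul c (tens v w)"
  and tens_smul_right: "tens v (smul c w) = smul c (tens v w)"
  and tens_zero [simp]: "tens 0 w = 0" "tens v 0 = 0"
  by (auto simp: tens_def fun_eq_iff fun_simps algebra_simps)

lemma tens_space_span:
  "tens_space (fn.span S) (fn.span R) = fn.span {tens v w |v w. v \<in> S \<and> w \<in> R}"
    (is "?L = fn.span ?R")
proof
  have 1: "tens v w \<in> fn.span ?R" if "v \<in> S" "w \<in> fn.span R" for v w
  proof -
    have "linear_on (fn.span R) (tens v)"
      by (simp add: linear_on_def tens_add_right tens_smul_right)
    then have "tens v ` fn.span R \<subseteq> fn.span ?R"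
      using that(1) by (intro linear_on_span_subset) (auto intro: fn.span_base)
    then show ?thesis using that by auto
  qed
  have "tens v w \<in> fn.span ?R" if "v \<in> fn.span S" "w \<in> fn.span R" for v w
  proof -
    have "linear_on (fn.span S) (\<lambda>v. tens v w)"
      by (simp add: linear_on_def tens_add_left tens_smul_left)
    then have "(\<lambda>v. tens v w) ` fn.span S \<subseteq> fn.span ?R"
      using that(2) 1 by (intro linear_on_span_subset) auto
    then show ?thesis using that by auto
  qed
  then show "?L \<subseteq> fn.span ?R"
    unfolding tens_space_def by (intro fn.span_minimal) auto
  show "fn.span ?R \<subseteq> ?L"
    unfolding tens_space_def by (intro fn.span_mono) (auto intro: fn.span_base)
qed

lemma finite_dim_tens_space: "finite_dim V \<Longrightarrow> finite_dim W \<Longrightarrow> finite_dim (tens_space V W)"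
proof -
  assume "finite_dim V" "finite_dim W"
  then obtain b c where "finite b" "V = fn.span b" "finite c" "W = fn.span c"
    by (auto simp: finite_dim_def)
  then have "finite {tens v w |v w. v \<in> b \<and> w \<in> c}"
    "tens_space V W = fn.span {tens v w |v w. v \<in> b \<and> w \<in> c}"
    by (simp_all add: tens_space_span finite_image_set2)
  then show ?thesis unfolding finite_dim_def by blast
qed

text \<open>The model of \<open>f \<otimes> h\<close> on functions of two variables:
  \<open>f\<close> is applied in the first variable, then \<open>h\<close> in the second. With
  \<open>f = act V g\<close> and \<open>h = act W g\<close> it is
  \<open>tens_act V W g\<close>.\<close>

definition tmap :: "(('a \<Rightarrow> 'k) \<Rightarrow> 'c \<Rightarrow> 'k) \<Rightarrow> (('b \<Rightarrow> 'k) \<Rightarrow> 'd \<Rightarrow> 'k) \<Rightarrow> ('a \<times> 'b \<Rightarrow> 'k) \<Rightarrow> 'c \<times> 'd \<Rightarrow> 'k"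
  where "tmap f h F = (\<lambda>(i, j). h (\<lambda>j'. f (\<lambda>i'. F (i', j')) i) j)"

lemma tmap_tens:
  assumes "linear_on V f" "linear_on W h" "v \<in> V" "w \<in> W"
  shows "tmap f h (tens v w) = tens (f v) (h w)"
proof -
  have "f (\<lambda>i'. v i' * w j') i = w j' * f v i" for i j'
    using fun_cong[OF linear_on_smul[OF assms(1,3), of "w j'"], of i]
    by (simp add: smul_def mult.commute)
  moreover have "h (\<lambda>j'. w j' * f v i) j = f v i * h w j" for i j
    using fun_cong[OF linear_on_smul[OF assms(2,4), of "f v i"], of j]
    by (simp add: smul_def mult.commute)
  ultimately show ?thesis by (auto simp: tmap_def tens_def)
qed

text \<open>\<open>tmap f h\<close> applies \<open>f\<close> to slices, and \<open>f\<close> is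
  linear only on \<open>V\<close>, so every slice of a tensor has to lie in \<open>V\<close>. For
  \<open>tens v w\<close> a slice is a multiple of \<open>v\<close>.\<close>

lemma tens_space_slice:
  fixes V :: "('a \<Rightarrow> 'k::field) set" and W :: "('b \<Rightarrow> 'k) set"
  assumes "F \<in> tens_space V W" "fn.subspace V"
  shows "(\<lambda>i. F (i, j)) \<in> V"
proof -
  have "linear_on (tens_space V W) (\<lambda>F i. F (i, j))"
    by (auto simp: linear_on_def fun_eq_iff fun_simps)
  then have "(\<lambda>F i. F (i, j)) ` tens_space V W \<subseteq> V"
    unfolding tens_space_def using assms(2)
  proof (intro linear_on_span_subset)
    have "(\<lambda>i. tens v w (i, j)) = smul (w j) v" for v and w :: "'b \<Rightarrow> 'k"
      by (auto simp: tens_def smul_def mult.commute)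
    then have "(\<lambda>i. tens v w (i, j)) \<in> V" if "v \<in> V" for v and w :: "'b \<Rightarrow> 'k"
      using fn.subspace_scale[OF assms(2) that] by metis
    then show "(\<lambda>F i. F (i, j)) ` {tens v w |v w. v \<in> V \<and> w \<in> W} \<subseteq> V" by blast
  qed
  then show ?thesis using assms(1) by auto
qed

lemma tens_space_slice_linear_on:
  assumes "linear_on V f" "fn.subspace V"
  shows "linear_on (tens_space V W) (\<lambda>F j. f (\<lambda>i. F (i, j)) a)"
proof (rule linear_onI)
  fix F F' assume F: "F \<in> tens_space V W" "F' \<in> tens_space V W"
  have "f (\<lambda>i. (F + F') (i, j)) = f (\<lambda>i. F (i, j)) + f (\<lambda>i. F' (i, j))" for j
    using linear_on_add[OF assms(1) F[THEN tens_space_slice, OF assms(2)]]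
    by (simp add: plus_fun_def)
  then show "(\<lambda>j. f (\<lambda>i. (F + F') (i, j)) a)
      = (\<lambda>j. f (\<lambda>i. F (i, j)) a) + (\<lambda>j. f (\<lambda>i. F' (i, j)) a)"
    by (simp add: fun_eq_iff fun_simps)
next
  fix c F assume F: "F \<in> tens_space V W"
  have "f (\<lambda>i. (smul c F) (i, j)) = smul c (f (\<lambda>i. F (i, j)))" for j
    using linear_on_smul[OF assms(1) F[THEN tens_space_slice, OF assms(2)]]
    by (simp add: smul_def)
  then show "(\<lambda>j. f (\<lambda>i. (smul c F) (i, j)) a) = smul c (\<lambda>j. f (\<lambda>i. F (i, j)) a)"
    by (simp add: fun_eq_iff smul_apply)
qed

text \<open>Once \<open>f\<close> has been applied to the slices of \<open>tens v w\<close>, fixing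
  the first coordinate leaves a multiple of \<open>w\<close>. The result thus stays in
  \<open>W\<close>, where \<open>h\<close> is linear.\<close>

lemma tens_space_slice_image:
  fixes f :: "('a \<Rightarrow> 'k::field) \<Rightarrow> 'c \<Rightarrow> 'k" and W :: "('b \<Rightarrow> 'k) set"
  assumes "linear_on V f" "fn.subspace V" "fn.subspace W" "F \<in> tens_space V W"
  shows "(\<lambda>j. f (\<lambda>i. F (i, j)) a) \<in> W"
proof -
  have "(\<lambda>F j. f (\<lambda>i. F (i, j)) a) ` tens_space V W \<subseteq> W"
    unfolding tens_space_def
  proof (intro linear_on_span_subset)
    show "linear_on (fn.span {tens v w |v w. v \<in> V \<and> w \<in> W}) (\<lambda>F j. f (\<lambda>i. F (i, j)) a)"
      using tens_space_slice_linear_on[OF assms(1,2)] by (auto simp: tens_space_def)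
    have "(\<lambda>j. f (\<lambda>i. tens v w (i, j)) a) = smul (f v a) w" if "v \<in> V" for v and w :: "'b \<Rightarrow> 'k"
    proof
      fix j
      have "(\<lambda>i. tens v w (i, j)) = smul (w j) v"
        by (auto simp: tens_def smul_def mult.commute)
      then show "f (\<lambda>i. tens v w (i, j)) a = smul (f v a) w j"
        using linear_on_smul[OF assms(1) that] by (simp add: smul_def)
    qed
    then have "(\<lambda>j. f (\<lambda>i. tens v w (i, j)) a) \<in> W" if "v \<in> V" "w \<in> W" for v w
      using fn.subspace_scale[OF assms(3) that(2)] that(1) by metis
    then show "(\<lambda>F j. f (\<lambda>i. F (i, j)) a) ` {tens v w |v w. v \<in> V \<and> w \<in> W} \<subseteq> W" by blast
  qed (rule assms)
  then show ?thesis using assms(4) by auto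
qed

lemma tmap_linear_on:
  assumes "linear_on V f" "fn.subspace V" "linear_on W h" "fn.subspace W"
  shows "linear_on (tens_space V W) (tmap f h)"
proof (rule linear_onI)
  fix F F' assume F: "F \<in> tens_space V W" "F' \<in> tens_space V W"
  have "h (\<lambda>j'. f (\<lambda>i'. (F + F') (i', j')) i)
      = h (\<lambda>j'. f (\<lambda>i'. F (i', j')) i) + h (\<lambda>j'. f (\<lambda>i'. F' (i', j')) i)" for i
    unfolding linear_on_add[OF tens_space_slice_linear_on[OF assms(1,2)] F]
    by (intro linear_on_add[OF assms(3)] tens_space_slice_image[OF assms(1,2,4)] F)
  then show "tmap f h (F + F') = tmap f h F + tmap f h F'"
    by (auto simp: tmap_def fun_eq_iff fun_simps)
next
  fix c F assume F: "F \<in> tens_space V W"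
  have "h (\<lambda>j'. f (\<lambda>i'. smul c F (i', j')) i) = smul c (h (\<lambda>j'. f (\<lambda>i'. F (i', j')) i))" for i
    unfolding linear_on_smul[OF tens_space_slice_linear_on[OF assms(1,2)] F]
    by (intro linear_on_smul[OF assms(3)] tens_space_slice_image[OF assms(1,2,4)] F)
  then show "tmap f h (smul c F) = smul c (tmap f h F)"
    by (auto simp: tmap_def fun_eq_iff fun_simps)
qed

lemma tmap_image:
  assumes "linear_on V f" "fn.subspace V" "linear_on W h" "fn.subspace W"
    "A \<subseteq> V" "B \<subseteq> W" "f ` A \<subseteq> V'" "h ` B \<subseteq> W'"
  shows "tmap f h ` tens_space A B \<subseteq> tens_space V' W'"
proof -
  have "linear_on (tens_space A B) (tmap f h)"
    using tmap_linear_on[OF assms(1-4)] tens_space_mono[OF assms(5,6)] linear_on_subset by blast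
  then show ?thesis
    unfolding tens_space_def[of A B] using assms
    by (intro linear_on_span_subset)
      (auto simp: subset_eq tmap_tens[OF assms(1,3)] intro!: tens_in_tens_space)
qed

lemma tens_space_eq_on:
  assumes "linear_on (tens_space V W) f" "linear_on (tens_space V W) g"
    "\<And>v w. v \<in> V \<Longrightarrow> w \<in> W \<Longrightarrow> f (tens v w) = g (tens v w)" "F \<in> tens_space V W"
  shows "f F = g F"
  using assms unfolding tens_space_def by (elim linear_on_span_eq) auto

lemma linear_on_tens_subset:
  assumes "linear_on (tens_space V W) f" "fn.subspace X"
    "\<And>v w. v \<in> V \<Longrightarrow> w \<in> W \<Longrightarrow> f (tens v w) \<in> X"
  shows "f ` tens_space V W \<subseteq> X"
  using assms unfolding tens_space_def by (elim linear_on_span_subset) auto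


section \<open>Modules and gliders\<close>

lemma is_moduleD:
  assumes "is_module G V"
  shows "fn.subspace (space V)"
    and "g \<in> carrier G \<Longrightarrow> v \<in> space V \<Longrightarrow> act V g v \<in> space V"
    and "g \<in> carrier G \<Longrightarrow> linear_on (space V) (act V g)"
    and "v \<in> space V \<Longrightarrow> act V \<one>\<^bsub>G\<^esub> v = v"
    and "g \<in> carrier G \<Longrightarrow> h \<in> carrier G \<Longrightarrow> v \<in> space V \<Longrightarrow>
      act V (g \<otimes>\<^bsub>G\<^esub> h) v = act V g (act V h v)"
  using assms by (auto simp: is_module_def)

lemma alg_act_in_subspace:
  assumes "fn.subspace L" "\<And>g. g \<in> carrier G \<Longrightarrow> act M g m \<in> L"
  shows "alg_act G M x m \<in> L"
  unfolding alg_act_def by (intro fn.subspace_sum fn.subspace_scale assms)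

lemma alg_act_closed: "is_module G M \<Longrightarrow> m \<in> space M \<Longrightarrow> alg_act G M x m \<in> space M"
  by (intro alg_act_in_subspace is_moduleD) auto

lemma linear_on_sum_fun:
  assumes "\<And>g. g \<in> A \<Longrightarrow> linear_on V (f g)"
  shows "linear_on V (\<lambda>v. \<Sum>g\<in>A. smul (c g) (f g v))"
proof (rule linear_onI)
  show "(\<Sum>g\<in>A. smul (c g) (f g (v + w))) = (\<Sum>g\<in>A. smul (c g) (f g v)) + (\<Sum>g\<in>A. smul (c g) (f g w))"
    if "v \<in> V" "w \<in> V" for v w
    unfolding sum.distrib[symmetric] fn.scale_right_distrib[symmetric]
    using linear_on_add[OF assms that] by (intro sum.cong) auto
  show "(\<Sum>g\<in>A. smul (c g) (f g (smul a v))) = smul a (\<Sum>g\<in>A. smul (c g) (f g v))"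
    if "v \<in> V" for a v
    unfolding fn.scale_sum_right
    using linear_on_smul[OF assms that] by (intro sum.cong) (auto simp: mult.commute)
qed

lemma alg_act_linear: "is_module G M \<Longrightarrow> linear_on (space M) (alg_act G M x)"
  unfolding alg_act_def by (intro linear_on_sum_fun is_moduleD)

lemma alg_act_linear_left:
  "alg_act G M (x + y) m = alg_act G M x m + alg_act G M y m"
  "alg_act G M (smul c x) m = smul c (alg_act G M x m)"
  "alg_act G M 0 m = 0"
  by (simp_all add: alg_act_def fun_simps fn.scale_left_distrib sum.distrib fn.scale_sum_right)

lemma delta_in_group_alg: "g \<in> carrier G \<Longrightarrow> delta g \<in> group_alg G"
  by (auto simp: delta_def group_alg_def)

lemma subspace_group_alg: "fn.subspace (group_alg G)"
  by (auto simp: group_alg_def fn.subspace_def fun_simps)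

lemma alg_act_delta:
  assumes "finite (carrier G)" "g \<in> carrier G"
  shows "alg_act G V (delta g) v = act V g v"
proof -
  have "alg_act G V (delta g) v = (\<Sum>h\<in>carrier G. if h = g then act V h v else 0)"
    unfolding alg_act_def by (intro sum.cong) (auto simp: delta_def)
  then show ?thesis using assms by simp
qed

text \<open>\<open>delta g\<close> acts as \<open>g\<close>, and \<open>alg_act\<close> is a linear
  combination of actions of group elements; conditions on the group algebra thereby reduce to
  conditions on the group.\<close>

lemma alg_span_subset_iff:
  assumes "finite (carrier G)" "fn.subspace L"
  shows "alg_span G M S \<subseteq> L \<longleftrightarrow> (\<forall>g\<in>carrier G. \<forall>m\<in>S. act M g m \<in> L)"
proof
  assume *: "alg_span G M S \<subseteq> L"
  have "act M g m \<in> alg_span G M S" if "g \<in> carrier G" "m \<in> S" for g m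
    unfolding alg_span_def alg_act_delta[OF assms(1) that(1), symmetric]
    using that by (intro fn.span_base) (auto intro: delta_in_group_alg)
  then show "\<forall>g\<in>carrier G. \<forall>m\<in>S. act M g m \<in> L" using * by blast
next
  assume "\<forall>g\<in>carrier G. \<forall>m\<in>S. act M g m \<in> L"
  then show "alg_span G M S \<subseteq> L"
    unfolding alg_span_def
    by (intro fn.span_minimal assms) (auto intro!: alg_act_in_subspace assms)
qed

lemma is_glider_iff:
  assumes "finite (carrier G)"
  shows "is_glider G M \<longleftrightarrow> is_module G M \<and> finite_dim (lev0 M) \<and> fn.subspace (lev1 M) \<and>
    lev1 M \<subseteq> lev0 M \<and> lev0 M \<subseteq> space M \<and> (\<forall>g\<in>carrier G. \<forall>m\<in>lev1 M. act M g m \<in> lev0 M)"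
proof -
  have "finite_dim (lev0 M) \<Longrightarrow> alg_span G M (lev1 M) \<subseteq> lev0 M \<longleftrightarrow>
      (\<forall>g\<in>carrier G. \<forall>m\<in>lev1 M. act M g m \<in> lev0 M)"
    using alg_span_subset_iff[OF assms, of "lev0 M" M "lev1 M"] finite_dim_imp_subspace by blast
  then show ?thesis
    unfolding is_glider_def by (auto intro: finite_dim_subspace finite_dim_imp_subspace)
qed

lemma is_gliderD:
  assumes "is_glider G M"
  shows "is_module G M" "fn.subspace (lev0 M)" "fn.subspace (lev1 M)" "finite_dim (lev0 M)"
    "finite_dim (lev1 M)" "lev1 M \<subseteq> lev0 M" "lev0 M \<subseteq> space M" "lev1 M \<subseteq> space M"
    "finite (carrier G) \<Longrightarrow> g \<in> carrier G \<Longrightarrow> m \<in> lev1 M \<Longrightarrow> act M g m \<in> lev0 M"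
  using assms is_glider_iff[of G M] by (auto simp: is_glider_def)

lemma alg_act_hom:
  assumes "linear_on L f" "fn.subspace L" "\<And>g. g \<in> carrier G \<Longrightarrow> act M g m \<in> L"
    "\<And>g. g \<in> carrier G \<Longrightarrow> f (act M g m) = act N g (f m)"
  shows "f (alg_act G M x m) = alg_act G N x (f m)"
proof -
  have "f (alg_act G M x m) = (\<Sum>g\<in>carrier G. f (smul (x g) (act M g m)))"
    unfolding alg_act_def
    by (intro linear_on_sum[OF assms(1,2)] fn.subspace_scale[OF assms(2)] assms(3))
  also have "\<dots> = alg_act G N x (f m)"
    unfolding alg_act_def
    using linear_on_smul[OF assms(1) assms(3)] assms(4) by (intro sum.cong) auto
  finally show ?thesis .
qed

text \<open>Equivariance is asked only of \<open>f\<close>, and only for group elements. It extends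
  to the group algebra by linearity, and \<open>h\<close> inherits it by undoing \<open>f\<close> in
  \<open>act N g n = f (act M g (h n))\<close>.\<close>

lemma glider_isoI:
  assumes fin: "finite (carrier G)" and M: "is_glider G M" and N: "is_glider G N"
    and f: "linear_on (lev0 M) f" "f ` lev0 M \<subseteq> lev0 N" "f ` lev1 M \<subseteq> lev1 N"
    and h: "linear_on (lev0 N) h" "h ` lev0 N \<subseteq> lev0 M" "h ` lev1 N \<subseteq> lev1 M"
    and hf: "\<And>m. m \<in> lev0 M \<Longrightarrow> h (f m) = m" and fh: "\<And>n. n \<in> lev0 N \<Longrightarrow> f (h n) = n"
    and eq: "\<And>g m. g \<in> carrier G \<Longrightarrow> m \<in> lev1 M \<Longrightarrow> f (act M g m) = act N g (f m)"
  shows "glider_iso G M N"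
proof -
  have "f (alg_act G M x m) = alg_act G N x (f m)" if "m \<in> lev1 M" for x m
    using that is_gliderD(9)[OF M fin] eq
    by (intro alg_act_hom[OF f(1)] is_gliderD(2)[OF M]) auto
  moreover have "h (alg_act G N x n) = alg_act G M x (h n)" if n: "n \<in> lev1 N" for x n
  proof (intro alg_act_hom[OF h(1)] is_gliderD(2)[OF N])
    fix g assume g: "g \<in> carrier G"
    then show "act N g n \<in> lev0 N" using n is_gliderD(9)[OF N fin] by auto
    have hn: "h n \<in> lev1 M" using h n by auto
    have "act N g n = act N g (f (h n))" using fh n is_gliderD(6)[OF N] by auto
    also have "\<dots> = f (act M g (h n))" using eq[OF g hn] by simp
    finally show "h (act N g n) = act M g (h n)"
      using hf is_gliderD(9)[OF M fin g hn] by simp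
  qed
  ultimately have "glider_morphism G M N f" "glider_morphism G N M h"
    unfolding glider_morphism_def using f h by simp_all
  then show ?thesis
    unfolding glider_iso_def using hf fh by (intro exI[of _ f] exI[of _ h]) simp
qed

lemma glider_iso_refl: "finite (carrier G) \<Longrightarrow> is_glider G M \<Longrightarrow> glider_iso G M M"
  by (rule glider_isoI[where f = "\<lambda>v. v" and h = "\<lambda>v. v"]) auto

section \<open>Tensor products of gliders\<close>

lemma glider_tensor_simps [simp]:
  "space (glider_tensor M N) = enc ` tens_space (space M) (space N)"
  "lev0 (glider_tensor M N) = enc ` tens_space (lev0 M) (lev0 N)"
  "lev1 (glider_tensor M N) = enc ` tens_space (lev1 M) (lev1 N)"
  "act (glider_tensor M N) g w = enc (tmap (act M g) (act N g) (dec w))"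
  by (simp_all add: glider_tensor_def rep_tensor_def rep.defs tens_act_def tmap_def)

lemma subspace_enc: "fn.subspace V \<Longrightarrow> fn.subspace (enc ` V)"
  by (rule subspace_linear_on_image[OF linear_enc])

lemma linear_on_enc_conj:
  assumes "linear_on V f"
  shows "linear_on (enc ` V) (\<lambda>w. enc (f (dec w)))"
  using assms by (auto simp: linear_on_def)

lemma is_glider_tensor:
  assumes fin: "finite (carrier G)" and "group G" and M: "is_glider G M" and N: "is_glider G N"
  shows "is_glider G (glider_tensor M N)"
proof -
  interpret group G by fact
  let ?T = "tens_space (space M) (space N)"
  note MM = is_moduleD[OF is_gliderD(1)[OF M]] and NN = is_moduleD[OF is_gliderD(1)[OF N]]
  have lin: "linear_on ?T (tmap (act M g) (act N g))" if "g \<in> carrier G" for g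
    using that by (intro tmap_linear_on MM NN)
  have im: "tmap (act M g) (act N g) ` tens_space A B \<subseteq> tens_space V W"
    if "g \<in> carrier G" "A \<subseteq> space M" "B \<subseteq> space N" "act M g ` A \<subseteq> V" "act N g ` B \<subseteq> W" for g A B V W
    using that by (intro tmap_image[OF MM(3) MM(1) NN(3) NN(1)])
  have one: "tmap (act M \<one>\<^bsub>G\<^esub>) (act N \<one>\<^bsub>G\<^esub>) F = F" if "F \<in> ?T" for F
    by (rule tens_space_eq_on[OF lin linear_on_id _ that])
       (auto simp: tmap_tens[OF MM(3) NN(3)] MM(4) NN(4))
  have mult: "tmap (act M (g \<otimes>\<^bsub>G\<^esub> h)) (act N (g \<otimes>\<^bsub>G\<^esub> h)) F
      = tmap (act M g) (act N g) (tmap (act M h) (act N h) F)"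
    if gh: "g \<in> carrier G" "h \<in> carrier G" and F: "F \<in> ?T" for g h F
  proof (rule tens_space_eq_on[OF lin linear_on_compose[OF lin lin] _ F])
    show "tmap (act M h) (act N h) ` ?T \<subseteq> ?T"
      using gh MM(2) NN(2) by (intro im) auto
    show "tmap (act M (g \<otimes>\<^bsub>G\<^esub> h)) (act N (g \<otimes>\<^bsub>G\<^esub> h)) (tens v w)
      = tmap (act M g) (act N g) (tmap (act M h) (act N h) (tens v w))"
      if "v \<in> space M" "w \<in> space N" for v w
      using gh that by (simp add: tmap_tens[OF MM(3) NN(3)] MM NN)
  qed (use gh in auto)
  have mod: "is_module G (glider_tensor M N)"
    unfolding is_module_def
  proof (intro conjI ballI)
    fix g assume g: "g \<in> carrier G"
    show "act (glider_tensor M N) g ` space (glider_tensor M N) \<subseteq> space (glider_tensor M N)"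
      using im[OF g order_refl order_refl, of "space M" "space N"] g MM(2) NN(2)
      by (auto simp: image_subset_iff)
    show "linear_on (space (glider_tensor M N)) (act (glider_tensor M N) g)"
      using linear_on_enc_conj[OF lin[OF g]] by (simp add: linear_on_def)
  qed (auto simp: subspace_enc one mult)
  show ?thesis
    unfolding is_glider_iff[OF fin]
  proof (intro conjI mod ballI)
    show "finite_dim (lev0 (glider_tensor M N))"
      unfolding glider_tensor_simps
      by (intro finite_dim_image[OF linear_enc] finite_dim_tens_space is_gliderD(4)[OF M] is_gliderD(4)[OF N])
    show "lev1 (glider_tensor M N) \<subseteq> lev0 (glider_tensor M N)"
      "lev0 (glider_tensor M N) \<subseteq> space (glider_tensor M N)"
      unfolding glider_tensor_simps
      by (intro image_mono tens_space_mono is_gliderD(6)[OF M] is_gliderD(6)[OF N]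
          is_gliderD(7)[OF M] is_gliderD(7)[OF N])+
    fix g m assume g: "g \<in> carrier G" and "m \<in> lev1 (glider_tensor M N)"
    then show "act (glider_tensor M N) g m \<in> lev0 (glider_tensor M N)"
      using im[OF g is_gliderD(8)[OF M] is_gliderD(8)[OF N], of "lev0 M" "lev0 N"]
        is_gliderD(9)[OF M fin g] is_gliderD(9)[OF N fin g]
      by (auto simp: image_subset_iff)
  qed (simp add: subspace_enc)
qed

text \<open>A morphism is linear on \<open>lev0\<close> but commutes with the action only on
  \<open>lev1\<close>. Accordingly \<open>tmap f p\<close> is linear on the tensor product of the
  larger spaces, while equivariance is compared on elementary tensors from
  \<open>lev1\<close>.\<close>

lemma glider_iso_tensor:
  assumes fin: "finite (carrier G)" and grp: "group G"
    and gl: "is_glider G M" "is_glider G M'" "is_glider G N" "is_glider G N'"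
    and iso: "glider_iso G M M'" "glider_iso G N N'"
  shows "glider_iso G (glider_tensor M N) (glider_tensor M' N')"
proof -
  have act_f: "f (act A g m) = act B g (f m)"
    if "glider_morphism G A B f" "g \<in> carrier G" "m \<in> lev1 A" for A B f g m
    using that delta_in_group_alg[OF that(2)] alg_act_delta[OF fin that(2)]
    unfolding glider_morphism_def by metis
  obtain f h where f: "glider_morphism G M M' f" and h: "glider_morphism G M' M h"
    and hf: "\<forall>m\<in>lev0 M. h (f m) = m" and fh: "\<forall>m\<in>lev0 M'. f (h m) = m"
    using iso(1) unfolding glider_iso_def by auto
  obtain p q where p: "glider_morphism G N N' p" and q: "glider_morphism G N' N q"
    and qp: "\<forall>m\<in>lev0 N. q (p m) = m" and pq: "\<forall>m\<in>lev0 N'. p (q m) = m"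
    using iso(2) unfolding glider_iso_def by auto
  note fm = f[unfolded glider_morphism_def] and hm = h[unfolded glider_morphism_def]
    and pm = p[unfolded glider_morphism_def] and qm = q[unfolded glider_morphism_def]
  note sub = gl[THEN is_gliderD(2)] and le = gl[THEN is_gliderD(6)]
  have linf: "linear_on (lev0 M) f" "linear_on (lev0 M') h" "linear_on (lev0 N) p" "linear_on (lev0 N') q"
    and img: "f ` lev0 M \<subseteq> lev0 M'" "h ` lev0 M' \<subseteq> lev0 M" "p ` lev0 N \<subseteq> lev0 N'" "q ` lev0 N' \<subseteq> lev0 N"
    and img1: "f ` lev1 M \<subseteq> lev1 M'" "h ` lev1 M' \<subseteq> lev1 M" "p ` lev1 N \<subseteq> lev1 N'" "q ` lev1 N' \<subseteq> lev1 N"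
    using fm hm pm qm by simp_all
  have lf: "linear_on (tens_space (lev0 M) (lev0 N)) (tmap f p)"
    and lh: "linear_on (tens_space (lev0 M') (lev0 N')) (tmap h q)"
    by (intro tmap_linear_on linf sub)+
  have im: "tmap f p ` tens_space (lev0 M) (lev0 N) \<subseteq> tens_space (lev0 M') (lev0 N')"
    "tmap f p ` tens_space (lev1 M) (lev1 N) \<subseteq> tens_space (lev1 M') (lev1 N')"
    "tmap h q ` tens_space (lev0 M') (lev0 N') \<subseteq> tens_space (lev0 M) (lev0 N)"
    "tmap h q ` tens_space (lev1 M') (lev1 N') \<subseteq> tens_space (lev1 M) (lev1 N)"
    by (intro tmap_image[OF linf(1) sub(1) linf(3) sub(3)] tmap_image[OF linf(2) sub(2) linf(4) sub(4)]
        order_refl img img1 le)+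
  have inv1: "tmap h q (tmap f p F) = F" if "F \<in> tens_space (lev0 M) (lev0 N)" for F
    using hf qp img
    by (intro tens_space_eq_on[OF linear_on_compose[OF lf lh im(1)] linear_on_id _ that])
       (simp add: tmap_tens[OF linf(1,3)] tmap_tens[OF linf(2,4)] image_subset_iff)
  have inv2: "tmap f p (tmap h q F) = F" if "F \<in> tens_space (lev0 M') (lev0 N')" for F
    using fh pq img
    by (intro tens_space_eq_on[OF linear_on_compose[OF lh lf im(3)] linear_on_id _ that])
       (simp add: tmap_tens[OF linf(1,3)] tmap_tens[OF linf(2,4)] image_subset_iff)
  have eqv: "tmap f p (tmap (act M g) (act N g) F) = tmap (act M' g) (act N' g) (tmap f p F)"
    if g: "g \<in> carrier G" and F: "F \<in> tens_space (lev1 M) (lev1 N)" for g F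
  proof (rule tens_space_eq_on[OF _ _ _ F])
    have a: "linear_on (tens_space (lev1 A) (lev1 B)) (tmap (act A g) (act B g))"
      "tmap (act A g) (act B g) ` tens_space (lev1 A) (lev1 B) \<subseteq> tens_space (lev0 A) (lev0 B)"
      if A: "is_glider G A" and B: "is_glider G B" for A B
    proof -
      note AA = is_moduleD[OF is_gliderD(1)[OF A]] and BB = is_moduleD[OF is_gliderD(1)[OF B]]
      show "linear_on (tens_space (lev1 A) (lev1 B)) (tmap (act A g) (act B g))"
        using linear_on_subset[OF tmap_linear_on[OF AA(3)[OF g] AA(1) BB(3)[OF g] BB(1)]]
          tens_space_mono[OF is_gliderD(8)[OF A] is_gliderD(8)[OF B]] by blast
      show "tmap (act A g) (act B g) ` tens_space (lev1 A) (lev1 B) \<subseteq> tens_space (lev0 A) (lev0 B)"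
        using is_gliderD(9)[OF A fin g] is_gliderD(9)[OF B fin g]
        by (intro tmap_image[OF AA(3)[OF g] AA(1) BB(3)[OF g] BB(1)] is_gliderD(8)[OF A]
            is_gliderD(8)[OF B]) auto
    qed
    show "linear_on (tens_space (lev1 M) (lev1 N)) (\<lambda>F. tmap f p (tmap (act M g) (act N g) F))"
      by (rule linear_on_compose[OF a(1) lf a(2)]) (rule gl)+
    show "linear_on (tens_space (lev1 M) (lev1 N)) (\<lambda>F. tmap (act M' g) (act N' g) (tmap f p F))"
      by (rule linear_on_compose[OF linear_on_subset[OF lf tens_space_mono[OF le(1,3)]] a(1) im(2)])
         (rule gl)+
    fix v w assume v: "v \<in> lev1 M" and w: "w \<in> lev1 N"
    have "tmap (act M g) (act N g) (tens v w) = tens (act M g v) (act N g w)"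
      using is_gliderD(8)[OF gl(1)] is_gliderD(8)[OF gl(3)] v w
      by (intro tmap_tens[OF is_moduleD(3)[OF is_gliderD(1)[OF gl(1)] g]
            is_moduleD(3)[OF is_gliderD(1)[OF gl(3)] g]]) auto
    moreover have "tmap f p (tens (act M g v) (act N g w)) = tens (f (act M g v)) (p (act N g w))"
      using is_gliderD(9)[OF gl(1) fin g v] is_gliderD(9)[OF gl(3) fin g w]
      by (rule tmap_tens[OF linf(1,3)])
    moreover have "tmap f p (tens v w) = tens (f v) (p w)"
      using v w le by (intro tmap_tens[OF linf(1,3)]) auto
    moreover have "tmap (act M' g) (act N' g) (tens (f v) (p w)) = tens (act M' g (f v)) (act N' g (p w))"
      using is_gliderD(8)[OF gl(2)] is_gliderD(8)[OF gl(4)] img1 v w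
      by (intro tmap_tens[OF is_moduleD(3)[OF is_gliderD(1)[OF gl(2)] g]
            is_moduleD(3)[OF is_gliderD(1)[OF gl(4)] g]]) auto
    ultimately show "tmap f p (tmap (act M g) (act N g) (tens v w))
      = tmap (act M' g) (act N' g) (tmap f p (tens v w))"
      by (simp add: act_f[OF f g v] act_f[OF p g w])
  qed
  show ?thesis
  proof (rule glider_isoI[OF fin, where f = "\<lambda>w. enc (tmap f p (dec w))"
        and h = "\<lambda>w. enc (tmap h q (dec w))"])
    show "is_glider G (glider_tensor M N)" "is_glider G (glider_tensor M' N')"
      by (intro is_glider_tensor fin grp gl)+
  qed (use im in \<open>auto simp: linear_on_enc_conj lf lh inv1 inv2 eqv image_subset_iff\<close>)
qed

text \<open>Makes the product of the free group commutative modulo the split relations, which turns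
  absorption on one side into absorption on both.\<close>

lemma glider_iso_tensor_swap:
  fixes M N :: "('g, 'b::field) glider"
  assumes fin: "finite (carrier G)" and grp: "group G" and M: "is_glider G M" and N: "is_glider G N"
  shows "glider_iso G (glider_tensor M N) (glider_tensor N M)"
proof -
  let ?s = "\<lambda>w. enc (\<lambda>(i, j). dec w (j, i))"
  have lin: "linear_on V ?s" for V :: "(nat \<Rightarrow> 'b) set"
    by (rule linear_onI) (auto simp: enc_def dec_def fun_eq_iff fun_simps split: prod.split)
  have tens: "?s (enc (tens v w)) = enc (tens w v)" for v w :: "nat \<Rightarrow> 'b"
    by (auto simp: tens_def mult.commute)
  have im: "?s ` enc ` tens_space V W \<subseteq> enc ` tens_space W V" for V W :: "(nat \<Rightarrow> 'b) set"
  proof -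
    have "(\<lambda>F. ?s (enc F)) ` tens_space V W \<subseteq> enc ` tens_space W V"
      by (rule linear_on_tens_subset[OF linear_on_compose[OF linear_enc lin order_refl]])
         (auto simp: tens[simplified] subspace_enc intro: tens_in_tens_space)
    then show ?thesis by (simp add: image_image)
  qed
  \<comment> \<open>\<open>tmap\<close> treats its two variables in a fixed order, so it does not
    commute with the exchange of coordinates by definition; the two sides are compared on elementary
    tensors.\<close>
  have tw: "?s (enc (tmap f p F)) = enc (tmap p f (\<lambda>(i, j). F (j, i)))"
    if "linear_on V f" "fn.subspace V" "linear_on W p" "fn.subspace W" "F \<in> tens_space V W"
    for f p :: "(nat \<Rightarrow> 'b) \<Rightarrow> nat \<Rightarrow> 'b" and F V W
  proof (rule tens_space_eq_on[OF _ _ _ that(5)])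
    show "linear_on (tens_space V W) (\<lambda>F. ?s (enc (tmap f p F)))"
      by (rule linear_on_compose[OF tmap_linear_on[OF that(1-4)] linear_on_compose[OF linear_enc lin]])
        (rule order_refl subset_UNIV)+
    have "linear_on (tens_space V W) (\<lambda>F. dec (?s (enc F)))"
      by (rule linear_on_compose[OF linear_on_compose[OF linear_enc lin order_refl] linear_dec subset_UNIV])
    moreover have "(\<lambda>F. dec (?s (enc F))) ` tens_space V W \<subseteq> tens_space W V"
    proof clarify
      fix F assume "F \<in> tens_space V W"
      then have "?s (enc F) \<in> enc ` tens_space W V" using im[of V W] by blast
      then show "dec (?s (enc F)) \<in> tens_space W V" by auto
    qed
    ultimately have "linear_on (tens_space V W) (\<lambda>F. tmap p f (dec (?s (enc F))))"
      by (rule linear_on_compose[OF _ tmap_linear_on[OF that(3,4,1,2)]])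
    then show "linear_on (tens_space V W) (\<lambda>F. enc (tmap p f (\<lambda>(i, j). F (j, i))))"
      using linear_on_compose[OF _ linear_enc subset_UNIV] by simp
    fix v w assume v: "v \<in> V" "w \<in> W"
    have "(\<lambda>(i, j). tens v w (j, i)) = tens w v" by (auto simp: tens_def mult.commute)
    then show "?s (enc (tmap f p (tens v w))) = enc (tmap p f (\<lambda>(i, j). tens v w (j, i)))"
      using v by (simp only: tmap_tens[OF that(1,3)] tmap_tens[OF that(3,1)] tens)
  qed
  show ?thesis
  proof (rule glider_isoI[OF fin, where f = ?s and h = ?s])
    fix g m assume g: "g \<in> carrier G" and m: "m \<in> lev1 (glider_tensor M N)"
    obtain F where F: "m = enc F" "F \<in> tens_space (lev1 M) (lev1 N)" using m by auto
    then have "F \<in> tens_space (space M) (space N)"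
      using tens_space_mono[OF is_gliderD(8)[OF M] is_gliderD(8)[OF N]] by auto
    with tw[of "space M" "act M g" "space N" "act N g" F] show "?s (act (glider_tensor M N) g m) = act (glider_tensor N M) g (?s m)"
      using F is_moduleD[OF is_gliderD(1)[OF M]] is_moduleD[OF is_gliderD(1)[OF N]] g by simp
  qed (use im in \<open>auto simp: lin is_glider_tensor[OF fin grp] M N\<close>)
qed


section \<open>Direct sums of gliders\<close>

lemma comp_apply: "comp w k i = w (prod_encode (k, i))"
  by (simp add: comp_def dec_def)

lemma comp_linear [simp]:
  fixes v w :: "nat \<Rightarrow> 'k::field"
  shows "comp (v + w) k = comp v k + comp w k" "comp (v - w) k = comp v k - comp w k"
  "comp (smul c v) k = smul c (comp v k)" "comp 0 k = 0"
  by (auto simp: comp_apply fun_eq_iff fun_simps)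

lemma comp_sum [simp]: "comp (\<Sum>a\<in>A. f a :: nat \<Rightarrow> 'k::field) k = (\<Sum>a\<in>A. comp (f a) k)"
  by (induction A rule: infinite_finite_induct) auto

lemma comp_eqI:
  assumes "\<And>k. comp v k = comp w k"
  shows "v = w"
proof
  fix n
  show "v n = w n"
    using fun_cong[OF assms, of "fst (prod_decode n)" "snd (prod_decode n)"] by (simp add: comp_apply)
qed

lemma comp_tuple: "comp (tuple vs) k = (if k < length vs then vs ! k else 0)"
  by (auto simp: tuple_def comp_apply enc_def fun_eq_iff fun_simps)

text \<open>Inclusion of the \<open>k\<close>-th summand into a direct sum, the counterpart of the
  projection \<open>comp\<close>.\<close>

definition coord :: "nat \<Rightarrow> (nat \<Rightarrow> 'k::zero) \<Rightarrow> nat \<Rightarrow> 'k"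
  where "coord k v = enc (\<lambda>(l, i). if l = k then v i else 0)"

lemma comp_coord [simp]: "comp (coord k v) l = (if l = k then v else 0)"
  by (auto simp: coord_def comp_apply enc_def fun_eq_iff fun_simps)

lemma coord_linear: "linear_on V (coord k)"
  by (rule linear_onI; rule comp_eqI) auto

lemma inj_coord: "inj_on (coord k) V"
proof (rule inj_onI)
  fix v w :: "nat \<Rightarrow> 'a" assume "coord k v = coord k w"
  then have "comp (coord k v) k = comp (coord k w) k" by simp
  then show "v = w" by simp
qed

lemma dsum_space_iff:
  "w \<in> dsum_space Vs \<longleftrightarrow>
    (\<forall>k<length Vs. comp w k \<in> Vs ! k) \<and> (\<forall>k\<ge>length Vs. comp w k = 0)"
proof
  assume "w \<in> dsum_space Vs"
  then show "(\<forall>k<length Vs. comp w k \<in> Vs ! k) \<and> (\<forall>k\<ge>length Vs. comp w k = 0)"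
    by (auto simp: dsum_space_def comp_tuple list_all2_conv_all_nth)
next
  assume *: "(\<forall>k<length Vs. comp w k \<in> Vs ! k) \<and> (\<forall>k\<ge>length Vs. comp w k = 0)"
  have "w = tuple (map (comp w) [0..<length Vs])"
    by (rule comp_eqI) (use * in \<open>auto simp: comp_tuple\<close>)
  moreover have "list_all2 (\<in>) (map (comp w) [0..<length Vs]) Vs"
    using * by (auto simp: list_all2_conv_all_nth)
  ultimately show "w \<in> dsum_space Vs" by (auto simp: dsum_space_def)
qed

lemma dsum_space_eq_sum:
  fixes w :: "nat \<Rightarrow> 'k::field"
  assumes "w \<in> dsum_space Vs"
  shows "w = (\<Sum>k<length Vs. coord k (comp w k))"
  by (rule comp_eqI) (use assms in \<open>auto simp: dsum_space_iff sum.delta\<close>)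

lemma subspace_dsum_space: "(\<And>V. V \<in> set Vs \<Longrightarrow> fn.subspace V) \<Longrightarrow> fn.subspace (dsum_space Vs)"
  by (auto intro!: fn.subspaceI simp: dsum_space_iff fn.subspace_0 fn.subspace_add fn.subspace_scale)

lemma dsum_space_subset:
  assumes "fn.subspace L" "\<And>k v. k < length Vs \<Longrightarrow> v \<in> Vs ! k \<Longrightarrow> coord k v \<in> L"
  shows "dsum_space Vs \<subseteq> L"
proof
  fix w assume w: "w \<in> dsum_space Vs"
  show "w \<in> L"
    by (subst dsum_space_eq_sum[OF w], intro fn.subspace_sum assms)
       (use w in \<open>auto simp: dsum_space_iff\<close>)
qed

lemma finite_dim_dsum_space:
  assumes "\<And>V. V \<in> set Vs \<Longrightarrow> finite_dim V"
  shows "finite_dim (dsum_space Vs)"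
proof -
  have "\<exists>b. finite b \<and> Vs ! k = fn.span b" if "k < length Vs" for k
    using assms[OF nth_mem[OF that]] by (simp add: finite_dim_def)
  then obtain b where b: "\<And>k. k < length Vs \<Longrightarrow> finite (b k) \<and> Vs ! k = fn.span (b k)"
    by metis
  let ?B = "\<Union>k<length Vs. coord k ` b k"
  have "dsum_space Vs \<subseteq> fn.span ?B"
  proof (rule dsum_space_subset)
    fix k v assume k: "k < length Vs" and "v \<in> Vs ! k"
    then have "coord k v \<in> coord k ` fn.span (b k)" using b by auto
    also have "\<dots> = fn.span (coord k ` b k)" by (rule linear_on_span_image[OF coord_linear])
    also have "\<dots> \<subseteq> fn.span ?B" using k by (intro fn.span_mono) auto
    finally show "coord k v \<in> fn.span ?B" .
  qed simp
  moreover have "fn.subspace (dsum_space Vs)"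
    by (rule subspace_dsum_space) (rule finite_dim_imp_subspace[OF assms])
  moreover have "finite ?B"
    using b by (intro finite_UN_I finite_imageI) blast+
  ultimately show ?thesis
    using finite_dim_subspace[OF finite_dim_span] by blast
qed

lemma dsum_simps [simp]:
  "space (dsum Vs) = dsum_space (map space Vs)"
  "comp (act (dsum Vs) g w) k = (if k < length Vs then act (Vs ! k) g (comp w k) else 0)"
  by (auto simp: dsum_def comp_tuple)

lemma comp_alg_act_dsum:
  "comp (alg_act G (dsum Vs) x w) k = (if k < length Vs then alg_act G (Vs ! k) x (comp w k) else 0)"
  by (simp add: alg_act_def)

lemma is_module_dsum:
  assumes "\<And>V. V \<in> set Vs \<Longrightarrow> is_module G V"
  shows "is_module G (dsum Vs)"
proof -
  note V = assms[OF nth_mem]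
  show ?thesis
    unfolding is_module_def
  proof (intro conjI ballI)
    show "fn.subspace (space (dsum Vs))"
      using assms by (auto intro!: subspace_dsum_space is_moduleD(1))
    fix g assume g: "g \<in> carrier G"
    show "act (dsum Vs) g ` space (dsum Vs) \<subseteq> space (dsum Vs)"
      using is_moduleD(2)[OF V g] by (auto simp: dsum_space_iff)
    show "linear_on (space (dsum Vs)) (act (dsum Vs) g)"
      by (rule linear_onI; rule comp_eqI)
         (auto simp: dsum_space_iff linear_on_add[OF is_moduleD(3)[OF V g]]
            linear_on_smul[OF is_moduleD(3)[OF V g]])
    fix h v assume h: "h \<in> carrier G" and v: "v \<in> space (dsum Vs)"
    show "act (dsum Vs) (g \<otimes>\<^bsub>G\<^esub> h) v = act (dsum Vs) g (act (dsum Vs) h v)"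
      by (rule comp_eqI) (use v is_moduleD(5)[OF V g h] in \<open>auto simp: dsum_space_iff\<close>)
  next
    fix v assume v: "v \<in> space (dsum Vs)"
    show "act (dsum Vs) \<one>\<^bsub>G\<^esub> v = v"
      by (rule comp_eqI) (use v is_moduleD(4)[OF V] in \<open>auto simp: dsum_space_iff\<close>)
  qed
qed

lemma truncate_simps [simp]:
  "space (rep.truncate M) = space M" "act (rep.truncate M) = act M"
  by (simp_all add: rep.truncate_def)

lemma is_module_truncate [simp]: "is_module G (rep.truncate M) \<longleftrightarrow> is_module G M"
  by (simp add: is_module_def)

lemma is_module_cong:
  "space M = space N \<Longrightarrow> act M = act N \<Longrightarrow> is_module G M \<longleftrightarrow> is_module G N"
  by (simp add: is_module_def)

lemma alg_act_cong: "act M = act N \<Longrightarrow> alg_act G M = alg_act G N"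
  by (intro ext) (simp add: alg_act_def)

lemma less_2_cases': "(\<forall>k<Suc (Suc 0). P k) \<longleftrightarrow> P 0 \<and> P (Suc 0)"
  by (auto simp: less_Suc_eq)

lemma glider_sum_simps [simp]:
  "space (glider_sum M N) = dsum_space [space M, space N]"
  "lev0 (glider_sum M N) = dsum_space [lev0 M, lev0 N]"
  "lev1 (glider_sum M N) = dsum_space [lev1 M, lev1 N]"
  "act (glider_sum M N) = act (dsum [rep.truncate M, rep.truncate N])"
  by (simp_all add: glider_sum_def rep.defs dsum_def)

lemma is_glider_sum:
  assumes fin: "finite (carrier G)" and M: "is_glider G M" and N: "is_glider G N"
  shows "is_glider G (glider_sum M N)"
  unfolding is_glider_iff[OF fin]
proof (intro conjI ballI)
  have "is_module G (dsum [rep.truncate M, rep.truncate N])"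
    using is_gliderD(1)[OF M] is_gliderD(1)[OF N] by (intro is_module_dsum) auto
  then show "is_module G (glider_sum M N)"
    by (subst is_module_cong[of _ "dsum [rep.truncate M, rep.truncate N]"]) auto
  show "finite_dim (lev0 (glider_sum M N))"
    using is_gliderD(4)[OF M] is_gliderD(4)[OF N] by (auto intro!: finite_dim_dsum_space)
  show "fn.subspace (lev1 (glider_sum M N))"
    using is_gliderD(3)[OF M] is_gliderD(3)[OF N] by (auto intro!: subspace_dsum_space)
  show "lev1 (glider_sum M N) \<subseteq> lev0 (glider_sum M N)"
    "lev0 (glider_sum M N) \<subseteq> space (glider_sum M N)"
    using is_gliderD(6,7)[OF M] is_gliderD(6,7)[OF N] by (auto simp: dsum_space_iff less_2_cases')
  fix g m assume "g \<in> carrier G" "m \<in> lev1 (glider_sum M N)"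
  then show "act (glider_sum M N) g m \<in> lev0 (glider_sum M N)"
    using is_gliderD(9)[OF M fin] is_gliderD(9)[OF N fin] by (auto simp: dsum_space_iff less_2_cases')
qed

text \<open>The coordinate permutation underlying the distributivity of tensor products over sums.\<close>

definition distr :: "(nat \<Rightarrow> 'k) \<Rightarrow> nat \<Rightarrow> 'k"
  where "distr w = enc (\<lambda>(k, n). case prod_decode n of (i, j) \<Rightarrow> dec w (prod_encode (k, i), j))"

definition undistr :: "(nat \<Rightarrow> 'k) \<Rightarrow> nat \<Rightarrow> 'k"
  where "undistr w = enc (\<lambda>(n, j). case prod_decode n of (k, i) \<Rightarrow> dec w (k, prod_encode (i, j)))"

lemma distr_inverse [simp]: "undistr (distr w) = w" "distr (undistr w) = w"
  by (auto simp: distr_def undistr_def enc_def dec_def fun_eq_iff split: prod.split)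

lemma linear_distr: "linear_on V distr" and linear_undistr: "linear_on V undistr"
  by (auto simp: linear_on_def distr_def undistr_def enc_def dec_def fun_eq_iff fun_simps
      split: prod.split)

lemma comp_distr_tens: "comp (distr (enc (tens u c))) k = enc (tens (comp u k) c)"
  by (auto simp: comp_apply distr_def enc_def dec_def tens_def fun_eq_iff split: prod.split)

lemma undistr_coord: "undistr (coord k (enc (tens a c))) = enc (tens (coord k a) c)"
proof -
  have "distr (enc (tens (coord k a) c)) = coord k (enc (tens a c))"
    by (rule comp_eqI) (simp add: comp_distr_tens)
  then show ?thesis by (metis distr_inverse(1))
qed

lemma distr_image:
  assumes "\<And>V. V \<in> set As \<Longrightarrow> fn.subspace V"
  shows "distr ` enc ` tens_space (dsum_space As) C \<subseteq> dsum_space (map (\<lambda>A. enc ` tens_space A C) As)"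
proof -
  have "(\<lambda>F. distr (enc F)) ` tens_space (dsum_space As) C
      \<subseteq> dsum_space (map (\<lambda>A. enc ` tens_space A C) As)"
    by (rule linear_on_tens_subset[OF linear_on_compose[OF linear_enc linear_distr order_refl]])
      (auto intro!: subspace_dsum_space subspace_enc
        simp: dsum_space_iff comp_distr_tens tens_in_tens_space)
  then show ?thesis by (simp add: image_image)
qed

lemma undistr_image:
  assumes "\<And>V. V \<in> set As \<Longrightarrow> fn.subspace V"
  shows "undistr ` dsum_space (map (\<lambda>A. enc ` tens_space A C) As) \<subseteq> enc ` tens_space (dsum_space As) C"
proof -
  let ?L = "{w \<in> UNIV. undistr w \<in> enc ` tens_space (dsum_space As) C}"
  have sub: "fn.subspace ?L"
    by (rule subspace_linear_on_vimage[OF linear_undistr]) (simp_all add: subspace_enc)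
  have "dsum_space (map (\<lambda>A. enc ` tens_space A C) As) \<subseteq> ?L"
  proof (rule dsum_space_subset[OF sub])
    fix k v assume k: "k < length (map (\<lambda>A. enc ` tens_space A C) As)"
      and "v \<in> map (\<lambda>A. enc ` tens_space A C) As ! k"
    then obtain F where F: "v = enc F" "F \<in> tens_space (As ! k) C" by auto
    have "(\<lambda>F. undistr (coord k (enc F))) ` tens_space (As ! k) C
        \<subseteq> enc ` tens_space (dsum_space As) C"
    proof (rule linear_on_tens_subset)
      show "linear_on (tens_space (As ! k) C) (\<lambda>F. undistr (coord k (enc F)))"
        by (rule linear_on_compose[OF linear_on_compose[OF linear_enc coord_linear order_refl]
            linear_undistr order_refl])
      fix a c assume "a \<in> As ! k" "c \<in> C"
      moreover have "coord k a \<in> dsum_space As"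
        using \<open>a \<in> As ! k\<close> assms k by (auto simp: dsum_space_iff fn.subspace_0)
      ultimately show "undistr (coord k (enc (tens a c))) \<in> enc ` tens_space (dsum_space As) C"
        unfolding undistr_coord by (intro imageI tens_in_tens_space)
    qed (simp add: subspace_enc)
    then show "coord k v \<in> ?L" using F by auto
  qed
  then show ?thesis by auto
qed

text \<open>Writes the product of a direct-sum relation with \<open>P\<close> as an isomorphism
  relation plus a direct-sum relation. Since \<open>distr\<close> only permutes coordinates,
  equivariance can be compared component by component on elementary tensors.\<close>

lemma glider_iso_distr:
  assumes fin: "finite (carrier G)" and grp: "group G"
    and gl: "is_glider G M" "is_glider G N" "is_glider G P"
  shows "glider_iso G (glider_tensor (glider_sum M N) P)
    (glider_sum (glider_tensor M P) (glider_tensor N P))"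
proof -
  note sub0 = gl[THEN is_gliderD(2)] and sub1 = gl[THEN is_gliderD(3)]
    and le = gl[THEN is_gliderD(6)]
  let ?S = "glider_sum M N" and ?R = "glider_sum (glider_tensor M P) (glider_tensor N P)"
  have gS: "is_glider G ?S" by (intro is_glider_sum fin gl)
  have gT: "is_glider G (glider_tensor ?S P)" by (intro is_glider_tensor fin grp gS gl)
  have gR: "is_glider G ?R" by (intro is_glider_sum is_glider_tensor fin grp gl)
  have eqv: "distr (enc (tmap (act ?S g) (act P g) F)) = act ?R g (distr (enc F))"
    if g: "g \<in> carrier G" and F: "F \<in> tens_space (lev1 ?S) (lev1 P)" for g F
  proof (rule tens_space_eq_on[OF _ _ _ F])
    note SS = is_moduleD[OF is_gliderD(1)[OF gS]] and PP = is_moduleD[OF is_gliderD(1)[OF gl(3)]]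
    have "linear_on (tens_space (space ?S) (space P)) (tmap (act ?S g) (act P g))"
      by (intro tmap_linear_on SS PP g)
    then have "linear_on (tens_space (lev1 ?S) (lev1 P)) (tmap (act ?S g) (act P g))"
      by (rule linear_on_subset[OF _ tens_space_mono[OF is_gliderD(8)[OF gS] is_gliderD(8)[OF gl(3)]]])
    then show "linear_on (tens_space (lev1 ?S) (lev1 P)) (\<lambda>F. distr (enc (tmap (act ?S g) (act P g) F)))"
      by (rule linear_on_compose[OF linear_on_compose[OF _ linear_enc subset_UNIV] linear_distr subset_UNIV])
    have "linear_on (tens_space (lev1 ?S) (lev1 P)) (\<lambda>F. distr (enc F))"
      by (rule linear_on_compose[OF linear_enc linear_distr order_refl])
    moreover have "(\<lambda>F. distr (enc F)) ` tens_space (lev1 ?S) (lev1 P) \<subseteq> space ?R"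
    proof -
      have "distr ` enc ` tens_space (lev1 ?S) (lev1 P) \<subseteq> lev1 ?R"
        using distr_image[of "[lev1 M, lev1 N]" "lev1 P"] sub1 by auto
      then show ?thesis using is_gliderD(8)[OF gR] by (auto simp del: glider_sum_simps)
    qed
    ultimately show "linear_on (tens_space (lev1 ?S) (lev1 P)) (\<lambda>F. act ?R g (distr (enc F)))"
      by (rule linear_on_compose[OF _ is_moduleD(3)[OF is_gliderD(1)[OF gR] g]])
    fix u c assume u: "u \<in> lev1 ?S" and c: "c \<in> lev1 P"
    then have uc: "u \<in> space ?S" "c \<in> space P"
      using is_gliderD(8)[OF gS] is_gliderD(8)[OF gl(3)] by auto
    have "tmap (act ?S g) (act P g) (tens u c) = tens (act ?S g u) (act P g c)"
      by (rule tmap_tens[OF SS(3)[OF g] PP(3)[OF g] uc])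
    moreover have "distr (enc (tens (act ?S g u) (act P g c))) = act ?R g (distr (enc (tens u c)))"
    proof (rule comp_eqI)
      fix k
      have u0: "comp u 0 \<in> space M" "comp u (Suc 0) \<in> space N" "k \<ge> 2 \<Longrightarrow> comp u k = 0"
        using uc(1) by (auto simp: dsum_space_iff less_2_cases')
      have t: "tmap (act A g) (act P g) (tens v c) = tens (act A g v) (act P g c)"
        if "is_glider G A" "v \<in> space A" for A v
        by (rule tmap_tens[OF is_moduleD(3)[OF is_gliderD(1)[OF that(1)] g] PP(3)[OF g] that(2) uc(2)])
      consider "k = 0" | "k = Suc 0" | "k \<ge> 2" by linarith
      then show "comp (distr (enc (tens (act ?S g u) (act P g c)))) k
          = comp (act ?R g (distr (enc (tens u c)))) k"
        by cases (use u0 t[OF gl(1)] t[OF gl(2)] in \<open>simp_all add: comp_distr_tens\<close>)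
    qed
    ultimately show "distr (enc (tmap (act ?S g) (act P g) (tens u c))) = act ?R g (distr (enc (tens u c)))"
      by simp
  qed
  show ?thesis
  proof (rule glider_isoI[OF fin gT gR, where f = distr and h = undistr])
    show "distr ` lev0 (glider_tensor ?S P) \<subseteq> lev0 ?R"
      using distr_image[of "[lev0 M, lev0 N]" "lev0 P"] sub0 by auto
    show "distr ` lev1 (glider_tensor ?S P) \<subseteq> lev1 ?R"
      using distr_image[of "[lev1 M, lev1 N]" "lev1 P"] sub1 by auto
    show "undistr ` lev0 ?R \<subseteq> lev0 (glider_tensor ?S P)"
      using undistr_image[of "[lev0 M, lev0 N]" "lev0 P"] sub0 by auto
    show "undistr ` lev1 ?R \<subseteq> lev1 (glider_tensor ?S P)"
      using undistr_image[of "[lev1 M, lev1 N]" "lev1 P"] sub1 by auto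
    fix g m assume g: "g \<in> carrier G" and m: "m \<in> lev1 (glider_tensor ?S P)"
    then obtain F where F: "m = enc F" "F \<in> tens_space (lev1 ?S) (lev1 P)" by auto
    then show "distr (act (glider_tensor ?S P) g m) = act ?R g (distr m)"
      using eqv[OF g F(2)] by (simp del: glider_sum_simps)
  qed (auto simp: linear_distr linear_undistr)
qed

section \<open>Additive invariants\<close>

text \<open>For an irreducible glider \<open>Ku \<subseteq> U\<close>, \<open>chi G J\<close> tells whether \<open>J\<close> annihilates \<open>u\<close>. These
  invariants vanish on gliders of length zero, and they separate the classes of irreducible gliders.\<close>

definition killed :: "('g, 'x) monoid_scheme \<Rightarrow> ('g \<Rightarrow> 'k::field) set \<Rightarrow> ('g, 'k) glider \<Rightarrow> (nat \<Rightarrow> 'k) set"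
  where "killed G J M = {m \<in> lev1 M. \<forall>x\<in>J. alg_act G M x m = 0}"

definition chi :: "('g, 'x) monoid_scheme \<Rightarrow> ('g \<Rightarrow> 'k::field) set \<Rightarrow> ('g, 'k) glider \<Rightarrow> int"
  where "chi G J M = int (fn.dim (killed G J M))"

lemma subspace_killed:
  assumes "is_glider G M"
  shows "fn.subspace (killed G J M)"
proof -
  note lin = alg_act_linear[OF is_gliderD(1)[OF assms]]
  have "fn.subspace {m \<in> lev1 M. alg_act G M x m \<in> {0}}" for x
    using is_gliderD(3,8)[OF assms] by (intro subspace_linear_on_vimage linear_on_subset[OF lin]) auto
  then have "fn.subspace (lev1 M \<inter> (\<Inter>x\<in>J. {m \<in> lev1 M. alg_act G M x m \<in> {0}}))"
    by (intro fn.subspace_inter fn.subspace_Inter is_gliderD(3)[OF assms]) auto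
  moreover have "killed G J M = lev1 M \<inter> (\<Inter>x\<in>J. {m \<in> lev1 M. alg_act G M x m \<in> {0}})"
    by (auto simp: killed_def)
  ultimately show ?thesis by simp
qed

lemma finite_dim_killed: "is_glider G M \<Longrightarrow> finite_dim (killed G J M)"
  by (rule finite_dim_subspace[OF is_gliderD(5) subspace_killed]) (auto simp: killed_def)

text \<open>\<open>f\<close> and \<open>h\<close> commute with every element of \<open>J\<close> on
  \<open>lev1\<close>, so they exchange the killed subspaces, and an injective linear map preserves
  dimension.\<close>

lemma chi_iso:
  assumes J: "J \<subseteq> group_alg G" and M: "is_glider G M" and N: "is_glider G N"
    and iso: "glider_iso G M N"
  shows "chi G J M = chi G J N"
proof -
  obtain f h where fm: "glider_morphism G M N f" and hm: "glider_morphism G N M h"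
    and inv: "\<forall>m\<in>lev0 M. h (f m) = m" "\<forall>n\<in>lev0 N. f (h n) = n"
    using iso unfolding glider_iso_def by auto
  have f: "linear_on (lev0 M) f" "f ` lev1 M \<subseteq> lev1 N"
      "\<forall>x\<in>group_alg G. \<forall>m\<in>lev1 M. f (alg_act G M x m) = alg_act G N x (f m)"
    and h: "linear_on (lev0 N) h" "h ` lev1 N \<subseteq> lev1 M"
      "\<forall>x\<in>group_alg G. \<forall>m\<in>lev1 N. h (alg_act G N x m) = alg_act G M x (h m)"
    using fm hm unfolding glider_morphism_def by simp_all
  have f0: "f 0 = 0" using linear_on_zero[OF f(1) is_gliderD(2)[OF M]] .
  then have h0: "h 0 = 0"
    using inv(1) fn.subspace_0[OF is_gliderD(2)[OF M]] by metis
  have 1: "f ` killed G J M \<subseteq> killed G J N"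
  proof clarify
    fix m assume m: "m \<in> killed G J M"
    have "alg_act G N x (f m) = 0" if "x \<in> J" for x
    proof -
      have "f (alg_act G M x m) = alg_act G N x (f m)"
        using that m J f(3) unfolding killed_def by blast
      then show ?thesis using that m f0 by (simp add: killed_def)
    qed
    then show "f m \<in> killed G J N"
      using m f(2) unfolding killed_def by blast
  qed
  have 2: "n \<in> f ` killed G J M" if n: "n \<in> killed G J N" for n
  proof
    have nl: "n \<in> lev1 N" using n by (simp add: killed_def)
    have hn: "h n \<in> lev1 M" using nl h(2) by auto
    then have fn: "f (h n) \<in> lev1 N" using f(2) by auto
    have "alg_act G M x (h n) = 0" if "x \<in> J" for x
    proof -
      have "h (alg_act G N x n) = alg_act G M x (h n)"
        using that nl J h(3) by blast
      then show ?thesis using that n h0 by (simp add: killed_def)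
    qed
    then show hk: "h n \<in> killed G J M"
      using hn unfolding killed_def by blast
    show "n = f (h n)"
      using inv(2) nl is_gliderD(6)[OF N] by auto
  qed
  from 1 2 have "killed G J N = f ` killed G J M" by auto
  moreover have sub: "killed G J M \<subseteq> lev0 M"
    using is_gliderD(6)[OF M] by (auto simp: killed_def)
  moreover have "inj_on f (killed G J M)"
    using inv(1) sub by (intro inj_on_inverseI[of _ h]) auto
  ultimately show ?thesis
    using dim_linear_on_image[OF linear_on_subset[OF f(1) sub] finite_dim_killed[OF M]]
    by (simp add: chi_def)
qed

lemma alg_act_sum_glider:
  fixes M N :: "('g, 'k::field) glider"
  shows "comp (alg_act G (glider_sum M N) x w) 0 = alg_act G M x (comp w 0)"
  "comp (alg_act G (glider_sum M N) x w) (Suc 0) = alg_act G N x (comp w (Suc 0))"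
  "k \<ge> 2 \<Longrightarrow> comp (alg_act G (glider_sum M N) x w) k = 0"
proof -
  have "alg_act G (glider_sum M N) = alg_act G (dsum [rep.truncate M, rep.truncate N])"
    by (rule alg_act_cong) simp
  moreover have "alg_act G (rep.truncate K) = alg_act G K" for K :: "('g, 'k) glider"
    by (rule alg_act_cong) simp
  ultimately show "comp (alg_act G (glider_sum M N) x w) 0 = alg_act G M x (comp w 0)"
    "comp (alg_act G (glider_sum M N) x w) (Suc 0) = alg_act G N x (comp w (Suc 0))"
    "k \<ge> 2 \<Longrightarrow> comp (alg_act G (glider_sum M N) x w) k = 0"
    by (simp_all add: comp_alg_act_dsum)
qed

lemma killed_sum:
  "killed G J (glider_sum M N) = {v + w |v w. v \<in> coord 0 ` killed G J M \<and> w \<in> coord 1 ` killed G J N}"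
proof (intro equalityI subsetI)
  fix m assume m: "m \<in> killed G J (glider_sum M N)"
  have z: "\<forall>k\<ge>2. comp m k = 0" using m by (auto simp: killed_def dsum_space_iff)
  have "m = coord 0 (comp m 0) + coord 1 (comp m 1)"
  proof (rule comp_eqI)
    fix k
    consider "k = 0" | "k = Suc 0" | "k \<ge> 2" by linarith
    then show "comp m k = comp (coord 0 (comp m 0) + coord 1 (comp m 1)) k"
      using z by cases auto
  qed
  moreover have "comp m 0 \<in> killed G J M" "comp m 1 \<in> killed G J N"
    using m by (auto simp: killed_def dsum_space_iff less_2_cases' alg_act_sum_glider(1,2)[of G M N, symmetric])
  ultimately show "m \<in> {v + w |v w. v \<in> coord 0 ` killed G J M \<and> w \<in> coord 1 ` killed G J N}"
    by blast
next
  fix m assume "m \<in> {v + w |v w. v \<in> coord 0 ` killed G J M \<and> w \<in> coord 1 ` killed G J N}"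
  then obtain a b where a: "a \<in> killed G J M" and b: "b \<in> killed G J N"
    and m: "m = coord 0 a + coord 1 b" by auto
  have "alg_act G (glider_sum M N) x m = 0" if x: "x \<in> J" for x
  proof (rule comp_eqI)
    fix k
    consider "k = 0" | "k = Suc 0" | "k \<ge> 2" by linarith
    then show "comp (alg_act G (glider_sum M N) x m) k = comp 0 k"
      by cases (use a b x in \<open>auto simp: alg_act_sum_glider m killed_def\<close>)
  qed
  moreover have "m \<in> lev1 (glider_sum M N)"
    using a b by (auto simp: m dsum_space_iff less_2_cases' killed_def)
  ultimately show "m \<in> killed G J (glider_sum M N)"
    by (simp add: killed_def)
qed

lemma chi_sum:
  fixes M N :: "('g, 'k::field) glider"
  assumes M: "is_glider G M" and N: "is_glider G N"
  shows "chi G J (glider_sum M N) = chi G J M + chi G J N"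
proof -
  have d: "fn.dim (coord k ` killed G J K) = fn.dim (killed G J K)"
    "finite_dim (coord k ` killed G J K)" if "is_glider G K" for k K
    using dim_linear_on_image[OF coord_linear finite_dim_killed[OF that] inj_coord]
      finite_dim_image[OF coord_linear finite_dim_killed[OF that]] by auto
  have "coord 0 ` killed G J M \<inter> coord 1 ` killed G J N = {0}"
  proof (intro equalityI subsetI)
    fix v assume "v \<in> coord 0 ` killed G J M \<inter> coord 1 ` killed G J N"
    then obtain a b where ab: "v = coord 0 a" "v = coord 1 b" by blast
    have "comp v k = comp 0 k" for k
      using arg_cong[OF ab(1), of "\<lambda>w. comp w k"] arg_cong[OF ab(2), of "\<lambda>w. comp w k"]
      by (cases "k = 0") simp_all
    then show "v \<in> {0}" using comp_eqI by blast
  next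
    have "coord k 0 = (0 :: nat \<Rightarrow> 'k)" for k by (rule comp_eqI) simp
    then show "v \<in> coord 0 ` killed G J M \<inter> coord 1 ` killed G J N" if "v \<in> {0}" for v
      using that fn.subspace_0[OF subspace_killed[OF M]] fn.subspace_0[OF subspace_killed[OF N]]
      by (auto intro!: image_eqI)
  qed
  then show ?thesis
    unfolding chi_def killed_sum using dim_direct_sum[OF d(2)[OF M] d(2)[OF N], of 0 1] d(1)[OF M] d(1)[OF N] by simp
qed

lemma chi_length_zero: "length_zero G M \<Longrightarrow> chi G J M = 0"
proof -
  assume "length_zero G M"
  then have "is_glider G M" "lev1 M = {0}" by (auto simp: length_zero_def)
  then have "killed G J M = {0}"
    using fn.subspace_0[OF subspace_killed, of G M J] by (auto simp: killed_def)
  then show ?thesis by (simp add: chi_def)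
qed

section \<open>Cyclic gliders\<close>

text \<open>Here \<open>M\<^sub>0\<close> may be larger than the module generated by the line \<open>M\<^sub>-\<^sub>1\<close>; the difference is
  a summand of length zero.\<close>

definition cyclic :: "('g, 'x) monoid_scheme \<Rightarrow> ('g, 'k::field) glider \<Rightarrow> bool"
  where "cyclic G M \<longleftrightarrow> is_glider G M \<and> fn.dim (lev1 M) = 1"

definition ann :: "('g, 'x) monoid_scheme \<Rightarrow> ('g, 'k::field) glider \<Rightarrow> ('g \<Rightarrow> 'k) set"
  where "ann G M = {x \<in> group_alg G. \<forall>m\<in>lev1 M. alg_act G M x m = 0}"

lemma cyclic_generator:
  assumes "cyclic G M"
  obtains u where "u \<noteq> 0" "lev1 M = fn.span {u}"
  using assms dim_one_line is_gliderD(3) unfolding cyclic_def by metis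

text \<open>\<open>lev1\<close> is a line, whose only subspaces are 0 and itself; the dimension
  becomes a truth value.\<close>

lemma chi_cyclic:
  assumes M: "cyclic G M" and J: "J \<subseteq> group_alg G"
  shows "chi G J M = (if J \<subseteq> ann G M then 1 else 0)"
proof (cases "J \<subseteq> ann G M")
  case True
  then have "killed G J M = lev1 M" by (auto simp: killed_def ann_def)
  then show ?thesis using True M by (simp add: chi_def cyclic_def)
next
  case False
  have gM: "is_glider G M" using M by (simp add: cyclic_def)
  have "killed G J M \<noteq> lev1 M"
    using False J by (auto simp: killed_def ann_def)
  then have "killed G J M \<subset> lev1 M" by (auto simp: killed_def)
  then have "fn.dim (killed G J M) < 1"
    using dim_psubset[OF is_gliderD(5)[OF gM] subspace_killed[OF gM]] M by (simp add: cyclic_def)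
  then show ?thesis using False by (simp add: chi_def)
qed

lemma ann_line:
  assumes "is_glider G M" "lev1 M = fn.span {u}"
  shows "ann G M = {x \<in> group_alg G. alg_act G M x u = 0}"
proof -
  have "u \<in> space M" using assms is_gliderD(8)[OF assms(1)] fn.span_base[of u "{u}"] by auto
  then have "alg_act G M x (smul c u) = smul c (alg_act G M x u)" for x c
    by (rule linear_on_smul[OF alg_act_linear[OF is_gliderD(1)[OF assms(1)]]])
  then have "(\<forall>m\<in>fn.span {u}. alg_act G M x m = 0) \<longleftrightarrow> alg_act G M x u = 0" for x
    using fn.span_base[of u "{u}"] by (intro iffI) (blast, auto simp: fn.span_singleton)
  then show ?thesis
    unfolding ann_def assms(2) by simp
qed

lemma alg_span_line:
  assumes "is_module G M" "u \<in> space M"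
  shows "alg_span G M (fn.span {u}) = (\<lambda>x. alg_act G M x u) ` group_alg G"
proof -
  have lin: "linear_on (group_alg G) (\<lambda>x. alg_act G M x u)"
    by (rule linear_onI) (simp_all add: alg_act_linear_left)
  have smul: "alg_act G M x (smul c u) = alg_act G M (smul c x) u" for x c
    using linear_on_smul[OF alg_act_linear[OF assms(1)] assms(2)] by (simp add: alg_act_linear_left)
  have "{alg_act G M x v |x v. x \<in> group_alg G \<and> v \<in> fn.span {u}}
      = (\<lambda>x. alg_act G M x u) ` group_alg G" (is "?L = ?R")
  proof
    show "?L \<subseteq> ?R"
      using fn.subspace_scale[OF subspace_group_alg[of G]] by (auto simp: fn.span_singleton smul intro!: imageI)
    show "?R \<subseteq> ?L" using fn.span_base[of u "{u}"] by blast
  qed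
  then show ?thesis
    unfolding alg_span_def using subspace_linear_on_image[OF lin subspace_group_alg]
    by (simp add: fn.span_eq_iff)
qed

lemma subspace_alg_span: "fn.subspace (alg_span G M S)"
  by (simp add: alg_span_def)

lemma alg_span_lev1:
  assumes fin: "finite (carrier G)" and grp: "group G" and M: "is_glider G M"
  shows "lev1 M \<subseteq> alg_span G M (lev1 M)" "alg_span G M (lev1 M) \<subseteq> lev0 M"
    and "\<And>g m. g \<in> carrier G \<Longrightarrow> m \<in> lev1 M \<Longrightarrow> act M g m \<in> alg_span G M (lev1 M)"
proof -
  show act: "act M g m \<in> alg_span G M (lev1 M)" if "g \<in> carrier G" "m \<in> lev1 M" for g m
    using alg_span_subset_iff[OF fin subspace_alg_span[of G M "lev1 M"], of M "lev1 M"] that by blast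
  show "lev1 M \<subseteq> alg_span G M (lev1 M)"
  proof
    fix m assume m: "m \<in> lev1 M"
    have "act M \<one>\<^bsub>G\<^esub> m = m"
      using is_moduleD(4)[OF is_gliderD(1)[OF M]] is_gliderD(8)[OF M] m by auto
    then show "m \<in> alg_span G M (lev1 M)"
      using act[OF group.is_monoid[OF grp, THEN monoid.one_closed] m] by simp
  qed
  show "alg_span G M (lev1 M) \<subseteq> lev0 M" using M by (simp add: is_glider_def)
qed

lemma is_glider_shrink:
  assumes fin: "finite (carrier G)" and grp: "group G" and M: "is_glider G M"
  shows "is_glider G (M\<lparr>lev0 := alg_span G M (lev1 M)\<rparr>)"
proof -
  note a = alg_span_lev1[OF assms]
  have "is_module G (M\<lparr>lev0 := alg_span G M (lev1 M)\<rparr>)"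
    using is_gliderD(1)[OF M] by (simp add: is_module_def)
  moreover have "finite_dim (alg_span G M (lev1 M))"
    by (rule finite_dim_subspace[OF is_gliderD(4)[OF M] subspace_alg_span a(2)])
  ultimately show ?thesis
    unfolding is_glider_iff[OF fin] using a is_gliderD(3,7)[OF M] by simp
qed

lemma irreducible_shrink:
  assumes fin: "finite (carrier G)" and grp: "group G" and M: "cyclic G M"
  shows "irreducible_glider G (M\<lparr>lev0 := alg_span G M (lev1 M)\<rparr>)"
proof -
  have "alg_span G (M\<lparr>lev0 := alg_span G M (lev1 M)\<rparr>) = alg_span G M"
    by (simp add: alg_span_def alg_act_def fun_eq_iff)
  then show ?thesis
    using is_glider_shrink[OF fin grp, of M] M by (simp add: irreducible_glider_def cyclic_def)
qed

lemma ann_shrink [simp]: "ann G (M\<lparr>lev0 := V\<rparr>) = ann G M"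
  by (simp add: ann_def alg_act_def)

lemma irreducible_imp_cyclic: "irreducible_glider G M \<Longrightarrow> cyclic G M"
  by (simp add: irreducible_glider_def cyclic_def)

text \<open>The complement of \<open>alg_span\<close> in \<open>lev0 M\<close> is the kernel
  \<open>W\<close> of a linear projection and need not be stable under the group. As
  \<open>lev1\<close> of the new summand is 0, morphisms impose no equivariance on it, and it can be
  given the trivial action.\<close>

lemma glider_iso_shrink_sum:
  assumes fin: "finite (carrier G)" and grp: "group G" and M: "is_glider G M"
  obtains Z where "length_zero G Z"
    "glider_iso G (glider_sum (M\<lparr>lev0 := alg_span G M (lev1 M)\<rparr>) Z) M"
proof -
  let ?L = "alg_span G M (lev1 M)" and ?M = "M\<lparr>lev0 := alg_span G M (lev1 M)\<rparr>"
  note a = alg_span_lev1[OF assms]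
  obtain p where p: "Vector_Spaces.linear smul smul p" "range p \<subseteq> ?L" "\<And>w. w \<in> ?L \<Longrightarrow> p w = w"
    using projection_exists[OF subspace_alg_span] by blast
  note lp = linear_imp_linear_on[OF p(1)]
  define W where "W = {v \<in> lev0 M. p v \<in> {0}}"
  have W: "fn.subspace W"
    unfolding W_def by (intro subspace_linear_on_vimage lp is_gliderD(2)[OF M] fn.subspace_single_0)
  let ?Z = "\<lparr>space = W, act = (\<lambda>g v. v), lev0 = W, lev1 = {0}\<rparr> :: ('a, 'c) glider"
  have Z: "is_glider G ?Z"
    unfolding is_glider_iff[OF fin]
    using W finite_dim_subspace[OF is_gliderD(4)[OF M] W] fn.subspace_0[OF W]
    by (auto simp: W_def is_module_def)
  then have lz: "length_zero G ?Z" by (simp add: length_zero_def)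
  have gM: "is_glider G ?M" by (rule is_glider_shrink[OF assms])
  let ?f = "\<lambda>w. comp w 0 + comp w (Suc 0)"
  let ?h = "\<lambda>v. coord 0 (p v) + coord (Suc 0) (v - p v)"
  have pv: "p v \<in> ?L" for v using p(2) by auto
  have pW: "v - p v \<in> W" if "v \<in> lev0 M" for v
  proof -
    have "p (v - p v) = p v - p (p v)" by (rule linear_on_diff[OF lp[of UNIV]]) auto
    then show ?thesis
      using that a(2) pv[of v] p(3)[OF pv] fn.subspace_diff[OF is_gliderD(2)[OF M]]
      by (auto simp: W_def)
  qed
  have "glider_iso G (glider_sum ?M ?Z) M"
  proof (rule glider_isoI[OF fin is_glider_sum[OF fin gM Z] M, where f = ?f and h = ?h])
    show "linear_on (lev0 (glider_sum ?M ?Z)) ?f"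
      by (rule linear_onI) (simp_all add: fn.scale_right_distrib)
    show "linear_on (lev0 M) ?h"
      by (rule linear_onI; rule comp_eqI)
        (auto simp: linear_on_add[OF lp[of UNIV]] linear_on_smul[OF lp[of UNIV]]
          fn.scale_right_diff_distrib)
    show "?f ` lev0 (glider_sum ?M ?Z) \<subseteq> lev0 M"
      using a(2) fn.subspace_add[OF is_gliderD(2)[OF M]]
      by (auto simp: dsum_space_iff less_2_cases' W_def)
    show "?f ` lev1 (glider_sum ?M ?Z) \<subseteq> lev1 M"
      by (auto simp: dsum_space_iff less_2_cases')
    show "?h ` lev0 M \<subseteq> lev0 (glider_sum ?M ?Z)"
      using pv pW by (auto simp: dsum_space_iff less_2_cases')
    show "?h ` lev1 M \<subseteq> lev1 (glider_sum ?M ?Z)"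
      using a(1) p(3) by (auto simp: dsum_space_iff less_2_cases' subset_eq)
    show "?f (?h n) = n" for n by simp
    show "?h (?f m) = m" if m: "m \<in> lev0 (glider_sum ?M ?Z)" for m
    proof (rule comp_eqI)
      have m': "comp m 0 \<in> ?L" "comp m (Suc 0) \<in> W" "\<And>k. k \<ge> 2 \<Longrightarrow> comp m k = 0"
        using m by (auto simp: dsum_space_iff less_2_cases')
      have pm: "p (?f m) = comp m 0"
        using m' linear_on_add[OF lp[of UNIV], of "comp m 0" "comp m (Suc 0)"] p(3)
        by (simp add: W_def)
      fix k
      consider "k = 0" | "k = Suc 0" | "k \<ge> 2" by linarith
      then show "comp (?h (?f m)) k = comp m k" by cases (simp_all add: pm m')
    qed
    fix g m assume "m \<in> lev1 (glider_sum ?M ?Z)"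
    then show "?f (act (glider_sum ?M ?Z) g m) = act M g (?f m)"
      by (auto simp: dsum_space_iff less_2_cases')
  qed
  then show thesis using lz that by blast
qed

text \<open>The assignment \<open>x u \<mapsto> x v\<close> is well defined and injective because
  \<open>x - y\<close> kills \<open>u\<close> exactly when it kills \<open>v\<close>, and
  irreducibility makes \<open>lev0\<close> consist of such vectors. The function \<open>r\<close>
  chooses a group algebra element representing a given vector.\<close>

lemma glider_iso_irreducible:
  assumes fin: "finite (carrier G)" and grp: "group G"
    and X: "irreducible_glider G X" and Y: "irreducible_glider G Y" and eq: "ann G X = ann G Y"
  shows "glider_iso G X Y"
proof -
  have gX: "is_glider G X" and gY: "is_glider G Y"
    using X Y by (auto simp: irreducible_glider_def)
  obtain u where u: "u \<noteq> 0" "lev1 X = fn.span {u}"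
    using cyclic_generator irreducible_imp_cyclic X by metis
  obtain v where v: "v \<noteq> 0" "lev1 Y = fn.span {v}"
    using cyclic_generator irreducible_imp_cyclic Y by metis
  have uX: "u \<in> lev1 X" "v \<in> lev1 Y" using u v fn.span_base by auto
  have us: "u \<in> space X" "v \<in> space Y"
    using uX is_gliderD(8)[OF gX] is_gliderD(8)[OF gY] by auto
  have l0: "lev0 X = (\<lambda>x. alg_act G X x u) ` group_alg G" "lev0 Y = (\<lambda>x. alg_act G Y x v) ` group_alg G"
    using X Y alg_span_line[OF is_gliderD(1)[OF gX] us(1)] alg_span_line[OF is_gliderD(1)[OF gY] us(2)]
    by (auto simp: irreducible_glider_def u v)
  have key: "alg_act G X x u = alg_act G X y u \<longleftrightarrow> alg_act G Y x v = alg_act G Y y v"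
    if "x \<in> group_alg G" "y \<in> group_alg G" for x y
  proof -
    have "alg_act G M (x - y) w = alg_act G M x w - alg_act G M y w" for M :: "('a, 'c) glider" and w
      using alg_act_linear_left(1)[of G M "x - y" y w] by simp
    moreover have "x - y \<in> ann G X \<longleftrightarrow> x - y \<in> ann G Y" using eq by simp
    ultimately show ?thesis
      using fn.subspace_diff[OF subspace_group_alg that]
      by (simp add: ann_line[OF gX u(2)] ann_line[OF gY v(2)])
  qed
  define r where "r M (w :: nat \<Rightarrow> 'c) m = (SOME x. x \<in> group_alg G \<and> alg_act G M x w = m)"
    for M :: "('a, 'c) glider" and w m
  have r: "r M w (alg_act G M x w) \<in> group_alg G" "alg_act G M (r M w (alg_act G M x w)) w = alg_act G M x w"
    if "x \<in> group_alg G" for M w x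
    using someI_ex[of "\<lambda>y. y \<in> group_alg G \<and> alg_act G M y w = alg_act G M x w"] that
    unfolding r_def by auto
  let ?f = "\<lambda>m. alg_act G Y (r X u m) v" and ?h = "\<lambda>m. alg_act G X (r Y v m) u"
  have f: "?f (alg_act G X x u) = alg_act G Y x v" and h: "?h (alg_act G Y x v) = alg_act G X x u"
    if "x \<in> group_alg G" for x
    using key[OF r(1)[OF that] that] r(2)[OF that] by auto
  have ga: "x + y \<in> group_alg G" "smul c x \<in> group_alg G"
    if "x \<in> group_alg G" "y \<in> group_alg G" for x y :: "'a \<Rightarrow> 'c" and c
    using that fn.subspace_add[OF subspace_group_alg] fn.subspace_scale[OF subspace_group_alg] by auto
  have lin: "linear_on (lev0 X) ?f" "linear_on (lev0 Y) ?h"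
    unfolding l0
    by (rule linear_onI; clarify; simp only: alg_act_linear_left(1,2)[symmetric] f h ga; fail)+
  have smul: "alg_act G M x (smul c w) = alg_act G M (smul c x) w"
    if "is_glider G M" "w \<in> space M" for M x c w
    using linear_on_smul[OF alg_act_linear[OF is_gliderD(1)[OF that(1)]] that(2)]
    by (simp add: alg_act_linear_left)
  have one: "\<one>\<^bsub>G\<^esub> \<in> carrier G" by (rule group.is_monoid[OF grp, THEN monoid.one_closed])
  have gen: "smul c w = alg_act G M (smul c (delta \<one>\<^bsub>G\<^esub>)) w" if "is_glider G M" "w \<in> space M" for M c w
    using is_moduleD(4)[OF is_gliderD(1)[OF that(1)] that(2)]
    by (simp add: alg_act_linear_left alg_act_delta[OF fin one])
  have d: "smul c (delta \<one>\<^bsub>G\<^esub>) \<in> (group_alg G :: ('a \<Rightarrow> 'c) set)" for c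
    by (intro fn.subspace_scale[OF subspace_group_alg] delta_in_group_alg one)
  have fu: "?f (smul c u) = smul c v" "?h (smul c v) = smul c u" for c
    using f[OF d[of c]] h[OF d[of c]] gen[OF gX us(1), of c] gen[OF gY us(2), of c] by auto
  show ?thesis
  proof (rule glider_isoI[OF fin gX gY, where f = ?f and h = ?h])
    fix g m assume g: "g \<in> carrier G" and "m \<in> lev1 X"
    then obtain c where c: "m = smul c u" by (auto simp: u fn.span_singleton)
    have "act X g m = alg_act G X (smul c (delta g)) u" "act Y g (smul c v) = alg_act G Y (smul c (delta g)) v"
      using smul[OF gX us(1), of "delta g" c] smul[OF gY us(2), of "delta g" c]
      by (simp_all add: c alg_act_delta[OF fin g])
    then show "?f (act X g m) = act Y g (?f m)"
      using f[OF fn.subspace_scale[OF subspace_group_alg delta_in_group_alg[OF g]], of c]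
      by (simp add: c fu)
  qed (use lin f h fu in \<open>auto simp: l0 u v fn.span_singleton\<close>)
qed


section \<open>Quotients of rings that need not be associative\<close>

text \<open>The axioms available at every stage from the free group to the reduced ring: an additive
  group with a biadditive product. Associativity and the unit law are established only for
  \<open>R1\<close>.\<close>

locale bilinear_ring = abelian_group R for R (structure) +
  assumes mult_closed: "\<lbrakk>x \<in> carrier R; y \<in> carrier R\<rbrakk> \<Longrightarrow> x \<otimes> y \<in> carrier R"
    and mult_add_left: "\<lbrakk>x \<in> carrier R; y \<in> carrier R; z \<in> carrier R\<rbrakk> \<Longrightarrow>
      (x \<oplus> y) \<otimes> z = x \<otimes> z \<oplus> y \<otimes> z"
    and mult_add_right: "\<lbrakk>x \<in> carrier R; y \<in> carrier R; z \<in> carrier R\<rbrakk> \<Longrightarrow>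
      z \<otimes> (x \<oplus> y) = z \<otimes> x \<oplus> z \<otimes> y"
begin

lemma zero_mult: "x \<in> carrier R \<Longrightarrow> \<zero> \<otimes> x = \<zero>"
  using mult_add_left[of \<zero> \<zero> x] mult_closed[of \<zero> x] by (simp add: add.l_cancel_one')

lemma mult_zero: "x \<in> carrier R \<Longrightarrow> x \<otimes> \<zero> = \<zero>"
  using mult_add_right[of \<zero> \<zero> x] mult_closed[of x \<zero>] by (simp add: add.l_cancel_one')

lemma minus_mult: "\<lbrakk>x \<in> carrier R; y \<in> carrier R\<rbrakk> \<Longrightarrow> (\<ominus> x) \<otimes> y = \<ominus> (x \<otimes> y)"
  using mult_add_left[of "\<ominus> x" x y] zero_mult[of y] mult_closed
  by (intro minus_equality[symmetric]) (simp_all add: l_neg)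

lemma mult_minus: "\<lbrakk>x \<in> carrier R; y \<in> carrier R\<rbrakk> \<Longrightarrow> x \<otimes> (\<ominus> y) = \<ominus> (x \<otimes> y)"
  using mult_add_right[of "\<ominus> y" y x] mult_zero[of x] mult_closed
  by (intro minus_equality[symmetric]) (simp_all add: l_neg)

lemma abelian_subgroup_generate:
  "S \<subseteq> carrier R \<Longrightarrow> abelian_subgroup (generate (add_monoid R) S) R"
  by (intro abelian_subgroupI3 additive_subgroupI add.generate_is_subgroup abelian_group_axioms) simp

text \<open>Distributivity carries absorption over to sums and negatives, so it has to be tested on
  generators only.\<close>

lemma generate_absorbing:
  assumes S: "S \<subseteq> carrier R" and i: "i \<in> generate (add_monoid R) S" and x: "x \<in> carrier R"
    and l: "\<And>s x. s \<in> S \<Longrightarrow> x \<in> carrier R \<Longrightarrow> s \<otimes> x \<in> generate (add_monoid R) S"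
    and r: "\<And>s x. s \<in> S \<Longrightarrow> x \<in> carrier R \<Longrightarrow> x \<otimes> s \<in> generate (add_monoid R) S"
  shows "i \<otimes> x \<in> generate (add_monoid R) S" "x \<otimes> i \<in> generate (add_monoid R) S"
proof -
  let ?I = "generate (add_monoid R) S"
  interpret abelian_subgroup ?I R by (rule abelian_subgroup_generate[OF S])
  from i have "i \<otimes> x \<in> ?I \<and> x \<otimes> i \<in> ?I"
  proof induction
    case one
    then show ?case using x zero_mult mult_zero zero_closed by simp
  next
    case (incl h)
    then show ?case using l r x by simp
  next
    case (inv h)
    then have "h \<in> carrier R" "h \<otimes> x \<in> ?I" "x \<otimes> h \<in> ?I" using l r x S by auto
    then show ?case
      using x minus_mult mult_minus a_inv_closed by (simp flip: a_inv_def)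
  next
    case (eng a b)
    then have "a \<in> carrier R" "b \<in> carrier R" using a_Hcarr by auto
    then show ?case using eng x mult_add_left mult_add_right a_closed by simp
  qed
  then show "i \<otimes> x \<in> ?I" "x \<otimes> i \<in> ?I" by auto
qed

end

locale absorbing_subgroup = bilinear_ring R + abelian_subgroup I R for I and R (structure) +
  assumes absorb_left: "\<lbrakk>i \<in> I; x \<in> carrier R\<rbrakk> \<Longrightarrow> i \<otimes> x \<in> I"
    and absorb_right: "\<lbrakk>i \<in> I; x \<in> carrier R\<rbrakk> \<Longrightarrow> x \<otimes> i \<in> I"
begin

text \<open>The product of two cosets in \<open>FactRing\<close> is the union of the cosets of all
  products of representatives; absorption on both sides makes these one and the same coset.\<close>

lemma rcoset_mult_eq:
  assumes "x \<in> carrier R" "y \<in> carrier R"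
  shows "[mod I:] (I +> x) \<Otimes> (I +> y) = I +> (x \<otimes> y)"
proof -
  have "I +> (a \<otimes> b) = I +> (x \<otimes> y)" if ab: "a \<in> I +> x" "b \<in> I +> y" for a b
  proof -
    obtain i j where i: "i \<in> I" "a = i \<oplus> x" and j: "j \<in> I" "b = j \<oplus> y"
      using ab by (auto simp: a_r_coset_def r_coset_def)
    note c = assms a_Hcarr[OF i(1)] a_Hcarr[OF j(1)]
    have "a \<otimes> b = (i \<otimes> (j \<oplus> y) \<oplus> x \<otimes> j) \<oplus> x \<otimes> y"
      using c by (simp add: i j mult_add_left mult_add_right mult_closed a_ac)
    moreover have "i \<otimes> (j \<oplus> y) \<oplus> x \<otimes> j \<in> I"
      using i j c by (simp add: absorb_left absorb_right)
    ultimately have "a \<otimes> b \<in> I +> (x \<otimes> y)"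
      by (auto simp: a_r_coset_def r_coset_def)
    then show ?thesis
      using a_repr_independence'[of "a \<otimes> b" "x \<otimes> y"] c mult_closed by simp
  qed
  moreover have "x \<in> I +> x" "y \<in> I +> y" using assms a_rcos_self by auto
  ultimately show ?thesis
    unfolding rcoset_mult_def by blast
qed

lemma carrier_Quot: "carrier (R Quot I) = (\<lambda>x. I +> x) ` carrier R"
  by (auto simp: FactRing_def A_RCOSETS_def RCOSETS_def a_r_coset_def)

lemma Quot_simps:
  "x \<in> carrier R \<Longrightarrow> y \<in> carrier R \<Longrightarrow> (I +> x) \<otimes>\<^bsub>R Quot I\<^esub> (I +> y) = I +> (x \<otimes> y)"
  "x \<in> carrier R \<Longrightarrow> y \<in> carrier R \<Longrightarrow> (I +> x) \<oplus>\<^bsub>R Quot I\<^esub> (I +> y) = I +> (x \<oplus> y)"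
  "\<zero>\<^bsub>R Quot I\<^esub> = I" "\<one>\<^bsub>R Quot I\<^esub> = I +> \<one>"
  by (simp_all add: FactRing_def rcoset_mult_eq a_rcos_sum)

lemma coset_zero: "I +> \<zero> = I"
  using a_coset_add_zero a_subset by blast

lemma bilinear_ring_Quot: "bilinear_ring (R Quot I)"
proof (intro bilinear_ring.intro bilinear_ring_axioms.intro)
  show "abelian_group (R Quot I)"
    by (rule comm_group_abelian_groupI)
      (simp add: FactRing_def a_factorgroup_is_comm_group[unfolded A_FactGroup_def'])
qed (auto simp: carrier_Quot Quot_simps mult_closed mult_add_left mult_add_right)

lemma Quot_minus:
  assumes "x \<in> carrier R"
  shows "\<ominus>\<^bsub>R Quot I\<^esub> (I +> x) = I +> (\<ominus> x)"
proof -
  interpret Q: bilinear_ring "R Quot I" by (rule bilinear_ring_Quot)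
  have "(I +> (\<ominus> x)) \<oplus>\<^bsub>R Quot I\<^esub> (I +> x) = \<zero>\<^bsub>R Quot I\<^esub>"
    using assms by (simp add: Quot_simps l_neg coset_zero)
  then show ?thesis
    using assms by (intro Q.minus_equality) (auto simp: carrier_Quot)
qed

end

section \<open>The glider representation ring\<close>

locale finite_group = group G for G (structure) +
  assumes finite_carrier: "finite (carrier G)"
begin

lemma is_group: "group G" ..

text \<open>Keeps both supports inside \<open>S\<close> in the case of a difference, where facts
  about combinations of gliders of a restricted kind are applied.\<close>

lemma frag_induct_supp [consumes 1, case_names zero one diff]:
  assumes "Poly_Mapping.keys c \<subseteq> S" and "P 0" and "\<And>x. x \<in> S \<Longrightarrow> P (frag_of x)"
    and diff: "\<And>a b. \<lbrakk>Poly_Mapping.keys a \<subseteq> S; Poly_Mapping.keys b \<subseteq> S; P a; P b\<rbrakk> \<Longrightarrow> P (a - b)"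
  shows "P c"
proof -
  have "Poly_Mapping.keys c \<subseteq> S \<and> P c"
    using assms(1)
  proof (induction c rule: frag_induction)
    case (diff a b)
    then show ?case using assms(4) keys_diff[of a b] by blast
  qed (use assms in auto)
  then show ?thesis by simp
qed

lemmas glider_tensor_closed = is_glider_tensor[OF finite_carrier is_group]
  and glider_sum_closed = is_glider_sum[OF finite_carrier]

lemma free_simps:
  "carrier (free_gliders G) = {p. \<forall>M\<in>Poly_Mapping.keys p. is_glider G M}"
  "p \<oplus>\<^bsub>free_gliders G\<^esub> q = p + q" "\<zero>\<^bsub>free_gliders G\<^esub> = 0"
  "p \<otimes>\<^bsub>free_gliders G\<^esub> q = frag_extend (\<lambda>M. frag_extend (\<lambda>N. frag_of (glider_tensor M N)) q) p"
  "\<one>\<^bsub>free_gliders G\<^esub> = frag_of unit_glider"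
  by (auto simp: free_gliders_def)

lemma frag_extend_fun_add:
  "frag_extend (\<lambda>M. f M + h M) p = frag_extend f p + frag_extend h p"
  by (simp add: frag_extend_def frag_cmul_distrib2 sum.distrib)

lemma bilinear_ring_free: "bilinear_ring (free_gliders G :: (('a, 'k::field) glider \<Rightarrow>\<^sub>0 int) ring)"
proof (intro bilinear_ring.intro bilinear_ring_axioms.intro abelian_groupI)
  fix p q :: "('a, 'k) glider \<Rightarrow>\<^sub>0 int"
  assume p: "p \<in> carrier (free_gliders G)" and q: "q \<in> carrier (free_gliders G)"
  show "p \<oplus>\<^bsub>free_gliders G\<^esub> q \<in> carrier (free_gliders G)"
    using p q Poly_Mapping.keys_add[of p q] by (auto simp: free_simps)
  have "Poly_Mapping.keys (frag_extend (\<lambda>N. frag_of (glider_tensor M N)) q) \<subseteq> Collect (is_glider G)"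
    if "is_glider G M" for M
    using keys_frag_extend[of "\<lambda>N. frag_of (glider_tensor M N)" q] q that
    by (fastforce simp: free_simps intro: glider_tensor_closed)
  then show "p \<otimes>\<^bsub>free_gliders G\<^esub> q \<in> carrier (free_gliders G)"
    using keys_frag_extend[of "\<lambda>M. frag_extend (\<lambda>N. frag_of (glider_tensor M N)) q" p] p
    by (fastforce simp: free_simps)
next
  fix p :: "('a, 'k) glider \<Rightarrow>\<^sub>0 int" assume p: "p \<in> carrier (free_gliders G)"
  then have "- p \<in> carrier (free_gliders G)" by (simp add: free_simps)
  then show "\<exists>q\<in>carrier (free_gliders G). q \<oplus>\<^bsub>free_gliders G\<^esub> p = \<zero>\<^bsub>free_gliders G\<^esub>"
    by (intro bexI[of _ "- p"]) (auto simp: free_simps)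
qed (auto simp: free_simps frag_extend_add frag_extend_fun_add algebra_simps)

lemma free_minus:
  "(p :: ('a, 'k::field) glider \<Rightarrow>\<^sub>0 int) \<in> carrier (free_gliders G) \<Longrightarrow> \<ominus>\<^bsub>free_gliders G\<^esub> p = - p"
proof -
  interpret F: bilinear_ring "free_gliders G :: (('a, 'k) glider \<Rightarrow>\<^sub>0 int) ring"
    by (rule bilinear_ring_free)
  assume "p \<in> carrier (free_gliders G)"
  then show ?thesis by (intro F.minus_equality) (auto simp: free_simps)
qed

lemma frag_of_in_free: "is_glider G M \<Longrightarrow> frag_of M \<in> carrier (free_gliders G)"
  by (simp add: free_simps)

definition rel_gens :: "(('a, 'k::field) glider \<Rightarrow>\<^sub>0 int) set"
  where "rel_gens =
    {frag_of M - frag_of N |M N. is_glider G M \<and> is_glider G N \<and> glider_iso G M N} \<union>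
    {frag_of (glider_sum M N) - frag_of M - frag_of N |M N. is_glider G M \<and> is_glider G N}"

lemma split_relations_eq: "split_relations G = generate (add_monoid (free_gliders G)) rel_gens"
  by (simp add: split_relations_def rel_gens_def)

lemma free_diff_closed:
  "p \<in> carrier (free_gliders G) \<Longrightarrow> q \<in> carrier (free_gliders G) \<Longrightarrow> p - q \<in> carrier (free_gliders G)"
  using keys_diff[of p q] by (auto simp: free_simps)

lemma rel_gens_closed: "rel_gens \<subseteq> carrier (free_gliders G)"
  by (auto simp: rel_gens_def intro!: free_diff_closed frag_of_in_free glider_sum_closed)

text \<open>A relation times a single glider is a combination of relations by
  \<open>glider_iso_tensor\<close> and \<open>glider_iso_distr\<close>. The other side follows from
  commutativity modulo the relations, and arbitrary factors by biadditivity.\<close>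

lemma absorbing_split_relations:
  "absorbing_subgroup (split_relations G) (free_gliders G :: (('a, 'k::field) glider \<Rightarrow>\<^sub>0 int) ring)"
proof -
  let ?F = "free_gliders G :: (('a, 'k) glider \<Rightarrow>\<^sub>0 int) ring"
  let ?I = "split_relations G :: (('a, 'k) glider \<Rightarrow>\<^sub>0 int) set"
  interpret F: bilinear_ring ?F by (rule bilinear_ring_free)
  interpret I: abelian_subgroup ?I ?F
    unfolding split_relations_eq by (rule F.abelian_subgroup_generate[OF rel_gens_closed])
  have add: "a + b \<in> ?I" if "a \<in> ?I" "b \<in> ?I" for a b
    using I.a_closed[OF that] by (simp add: free_simps)
  have uminus: "- a \<in> ?I" if "a \<in> ?I" for a
    using I.a_inv_closed[OF that] free_minus[OF I.a_Hcarr[OF that]] by simp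
  have zero: "0 \<in> ?I" using I.zero_closed by (simp add: free_simps)
  have iso: "frag_of M - frag_of N \<in> ?I" if "is_glider G M" "is_glider G N" "glider_iso G M N" for M N
    unfolding split_relations_eq by (rule generate.incl) (use that in \<open>auto simp: rel_gens_def\<close>)
  have sum: "frag_of (glider_sum M N) - frag_of M - frag_of N \<in> ?I" if "is_glider G M" "is_glider G N" for M N
    unfolding split_relations_eq by (rule generate.incl) (use that in \<open>auto simp: rel_gens_def\<close>)
  have swap: "frag_of (glider_tensor M N) - frag_of (glider_tensor N M) \<in> ?I"
    if "is_glider G M" "is_glider G N" for M N
    using that by (intro iso glider_tensor_closed glider_iso_tensor_swap finite_carrier is_group)
  have diff: "a - b \<in> ?I" if "a \<in> ?I" "b \<in> ?I" for a b
    using add[OF that(1) uminus[OF that(2)]] by simp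
  have left: "s \<otimes>\<^bsub>?F\<^esub> frag_of P \<in> ?I" if s: "s \<in> rel_gens" and P: "is_glider G P" for s P
    using s unfolding rel_gens_def
  proof (elim UnE CollectE exE conjE)
    fix M N assume s: "s = frag_of M - frag_of N" and MN: "is_glider G M" "is_glider G N" "glider_iso G M N"
    have "glider_iso G (glider_tensor M P) (glider_tensor N P)"
      by (intro glider_iso_tensor finite_carrier is_group MN P glider_iso_refl)
    then show ?thesis
      using MN P by (simp add: s free_simps frag_extend_diff iso glider_tensor_closed)
  next
    fix M N assume s: "s = frag_of (glider_sum M N) - frag_of M - frag_of N"
      and MN: "is_glider G M" "is_glider G N"
    let ?A = "glider_tensor (glider_sum M N) P" and ?B = "glider_tensor M P" and ?C = "glider_tensor N P"
    have "frag_of ?A - frag_of ?B - frag_of ?C =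
        (frag_of ?A - frag_of (glider_sum ?B ?C)) + (frag_of (glider_sum ?B ?C) - frag_of ?B - frag_of ?C)"
      by simp
    also have "\<dots> \<in> ?I"
      by (intro add iso sum glider_iso_distr finite_carrier is_group MN P glider_tensor_closed glider_sum_closed)
    finally show ?thesis by (simp add: s free_simps frag_extend_diff)
  qed
  have comm: "frag_of P \<otimes>\<^bsub>?F\<^esub> s - s \<otimes>\<^bsub>?F\<^esub> frag_of P \<in> ?I" if s: "s \<in> carrier ?F" and P: "is_glider G P" for s P
  proof -
    have "Poly_Mapping.keys s \<subseteq> Collect (is_glider G)" using s by (auto simp: free_simps)
    then show ?thesis
    proof (induction s rule: frag_induction)
      case (diff a b)
      have "frag_of P \<otimes>\<^bsub>?F\<^esub> (a - b) - (a - b) \<otimes>\<^bsub>?F\<^esub> frag_of P =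
        (frag_of P \<otimes>\<^bsub>?F\<^esub> a - a \<otimes>\<^bsub>?F\<^esub> frag_of P) - (frag_of P \<otimes>\<^bsub>?F\<^esub> b - b \<otimes>\<^bsub>?F\<^esub> frag_of P)"
        by (simp add: free_simps frag_extend_diff)
      then show ?case using \<open>\<And>a b. a \<in> ?I \<Longrightarrow> b \<in> ?I \<Longrightarrow> a - b \<in> ?I\<close>[OF diff.IH] by simp
    qed (use P swap zero in \<open>auto simp: free_simps\<close>)
  qed
  have right: "frag_of P \<otimes>\<^bsub>?F\<^esub> s \<in> ?I" if s: "s \<in> rel_gens" and P: "is_glider G P" for s P
    using add[OF comm[OF subsetD[OF rel_gens_closed s] P] left[OF s P]] by simp
  have both: "s \<otimes>\<^bsub>?F\<^esub> x \<in> ?I \<and> x \<otimes>\<^bsub>?F\<^esub> s \<in> ?I" if s: "s \<in> rel_gens" and x: "x \<in> carrier ?F" for s x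
  proof -
    have "Poly_Mapping.keys x \<subseteq> Collect (is_glider G)" using x by (auto simp: free_simps)
    then show ?thesis
    proof (induction x rule: frag_induction)
      case zero
      then show ?case using \<open>0 \<in> ?I\<close> by (simp add: free_simps frag_extend_eq_0)
    next
      case (one P)
      then show ?case using left right s by auto
    next
      case (diff a b)
      have "s \<otimes>\<^bsub>?F\<^esub> (a - b) = s \<otimes>\<^bsub>?F\<^esub> a - s \<otimes>\<^bsub>?F\<^esub> b" "(a - b) \<otimes>\<^bsub>?F\<^esub> s = a \<otimes>\<^bsub>?F\<^esub> s - b \<otimes>\<^bsub>?F\<^esub> s"
        using frag_extend_fun_add[of "\<lambda>M. frag_extend (\<lambda>N. frag_of (glider_tensor M N)) (a - b)"
            "\<lambda>M. frag_extend (\<lambda>N. frag_of (glider_tensor M N)) b" s]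
        by (simp_all add: free_simps frag_extend_diff)
      then show ?case using \<open>\<And>a b. a \<in> ?I \<Longrightarrow> b \<in> ?I \<Longrightarrow> a - b \<in> ?I\<close> diff by simp
    qed
  qed
  have "i \<otimes>\<^bsub>?F\<^esub> x \<in> ?I \<and> x \<otimes>\<^bsub>?F\<^esub> i \<in> ?I" if "i \<in> ?I" "x \<in> carrier ?F" for i x
    using F.generate_absorbing[OF rel_gens_closed _ that(2), of i] both that(1)
    unfolding split_relations_eq by blast
  then show ?thesis by unfold_locales auto
qed

lemma bilinear_ring_split: "bilinear_ring (split_Grothendieck G)"
  unfolding split_Grothendieck_def by (rule absorbing_subgroup.bilinear_ring_Quot[OF absorbing_split_relations])

definition spl :: "(('a, 'k::field) glider \<Rightarrow>\<^sub>0 int) \<Rightarrow> (('a, 'k) glider \<Rightarrow>\<^sub>0 int) set"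
  where "spl p = split_relations G +>\<^bsub>free_gliders G\<^esub> p"

lemma carrier_split: "carrier (split_Grothendieck G) = spl ` carrier (free_gliders G)"
  unfolding split_Grothendieck_def spl_def
  by (rule absorbing_subgroup.carrier_Quot[OF absorbing_split_relations])

lemma spl_simps:
  fixes p q :: "('a, 'k::field) glider \<Rightarrow>\<^sub>0 int"
  shows "p \<in> carrier (free_gliders G) \<Longrightarrow> q \<in> carrier (free_gliders G) \<Longrightarrow>
    spl p \<otimes>\<^bsub>split_Grothendieck G\<^esub> spl q = spl (p \<otimes>\<^bsub>free_gliders G\<^esub> q)"
  "p \<in> carrier (free_gliders G) \<Longrightarrow> q \<in> carrier (free_gliders G) \<Longrightarrow>
    spl p \<oplus>\<^bsub>split_Grothendieck G\<^esub> spl q = spl (p + q)"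
  "\<zero>\<^bsub>split_Grothendieck G\<^esub> = spl (0 :: ('a, 'k) glider \<Rightarrow>\<^sub>0 int)"
  "\<one>\<^bsub>split_Grothendieck G\<^esub> = spl (frag_of (unit_glider :: ('a, 'k) glider))"
  "p \<in> carrier (free_gliders G) \<Longrightarrow> \<ominus>\<^bsub>split_Grothendieck G\<^esub> spl p = spl (- p)"
proof -
  interpret I: absorbing_subgroup "split_relations G" "free_gliders G :: (('a, 'k) glider \<Rightarrow>\<^sub>0 int) ring"
    by (rule absorbing_split_relations)
  show "p \<in> carrier (free_gliders G) \<Longrightarrow> q \<in> carrier (free_gliders G) \<Longrightarrow>
    spl p \<otimes>\<^bsub>split_Grothendieck G\<^esub> spl q = spl (p \<otimes>\<^bsub>free_gliders G\<^esub> q)"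
    "p \<in> carrier (free_gliders G) \<Longrightarrow> q \<in> carrier (free_gliders G) \<Longrightarrow>
    spl p \<oplus>\<^bsub>split_Grothendieck G\<^esub> spl q = spl (p + q)"
    "\<zero>\<^bsub>split_Grothendieck G\<^esub> = spl (0 :: ('a, 'k) glider \<Rightarrow>\<^sub>0 int)"
    "\<one>\<^bsub>split_Grothendieck G\<^esub> = spl (frag_of (unit_glider :: ('a, 'k) glider))"
    "p \<in> carrier (free_gliders G) \<Longrightarrow> \<ominus>\<^bsub>split_Grothendieck G\<^esub> spl p = spl (- p)"
    using I.Quot_simps I.Quot_minus[of p] I.coset_zero free_minus[of p]
    by (simp_all add: split_Grothendieck_def spl_def free_simps(2,3,5))
qed

lemma length_zero_ideal_eq:
  "length_zero_ideal G = generate (add_monoid (split_Grothendieck G)) {spl (frag_of M) |M. length_zero G M}"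
  by (simp add: length_zero_ideal_def spl_def split_class_def)

lemma length_zero_tensor:
  fixes M P :: "('a, 'k::field) glider"
  assumes "length_zero G M" "is_glider G P"
  shows "length_zero G (glider_tensor M P)" "length_zero G (glider_tensor P M)"
proof -
  have M: "is_glider G M" "lev1 M = {0}" using assms(1) by (auto simp: length_zero_def)
  have "fn.subspace (tens_space {0 :: nat \<Rightarrow> 'k} (lev1 P))"
    "fn.subspace (tens_space (lev1 P) {0 :: nat \<Rightarrow> 'k})" by simp_all
  then have "0 \<in> tens_space {0 :: nat \<Rightarrow> 'k} (lev1 P)" "0 \<in> tens_space (lev1 P) {0 :: nat \<Rightarrow> 'k}"
    by (simp_all add: fn.subspace_0)
  moreover have "tens_space {0 :: nat \<Rightarrow> 'k} (lev1 P) \<subseteq> {0}" "tens_space (lev1 P) {0 :: nat \<Rightarrow> 'k} \<subseteq> {0}"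
    unfolding tens_space_def by (rule fn.span_minimal; auto)+
  ultimately have "tens_space {0 :: nat \<Rightarrow> 'k} (lev1 P) = {0}" "tens_space (lev1 P) {0 :: nat \<Rightarrow> 'k} = {0}" by blast+
  then show "length_zero G (glider_tensor M P)" "length_zero G (glider_tensor P M)"
    using M assms(2) glider_tensor_closed[OF M(1) assms(2)] glider_tensor_closed[OF assms(2) M(1)]
    by (simp_all add: length_zero_def)
qed

lemma absorbing_length_zero:
  "absorbing_subgroup (length_zero_ideal G)
    (split_Grothendieck G :: (('a, 'k::field) glider \<Rightarrow>\<^sub>0 int) set ring)"
proof -
  let ?S = "split_Grothendieck G :: (('a, 'k) glider \<Rightarrow>\<^sub>0 int) set ring"
  let ?Z = "{spl (frag_of M) |M. length_zero G M} :: (('a, 'k) glider \<Rightarrow>\<^sub>0 int) set set"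
  let ?I = "length_zero_ideal G :: (('a, 'k) glider \<Rightarrow>\<^sub>0 int) set set"
  interpret S: bilinear_ring ?S by (rule bilinear_ring_split)
  have Z: "?Z \<subseteq> carrier ?S"
    by (auto simp: carrier_split length_zero_def intro!: imageI frag_of_in_free)
  interpret I: abelian_subgroup ?I ?S
    unfolding length_zero_ideal_eq by (rule S.abelian_subgroup_generate[OF Z])
  have both: "spl (frag_of M) \<otimes>\<^bsub>?S\<^esub> spl x \<in> ?I \<and> spl x \<otimes>\<^bsub>?S\<^esub> spl (frag_of M) \<in> ?I"
    if M: "length_zero G M" and x: "x \<in> carrier (free_gliders G)" for M :: "('a, 'k) glider" and x
  proof -
    have gM: "frag_of M \<in> carrier (free_gliders G)"
      using M by (simp add: length_zero_def frag_of_in_free)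
    have "Poly_Mapping.keys x \<subseteq> Collect (is_glider G)" using x by (auto simp: free_simps)
    then show ?thesis
    proof (induction x rule: frag_induct_supp)
      case zero
      show ?case
        using S.zero_mult S.mult_zero Z I.zero_closed M by (auto simp: spl_simps(3)[symmetric])
    next
      case (one P)
      then have P: "is_glider G P" by simp
      have "spl (frag_of (glider_tensor M P)) \<in> ?I" "spl (frag_of (glider_tensor P M)) \<in> ?I"
        unfolding length_zero_ideal_eq
        using length_zero_tensor[OF M P] by (auto intro!: generate.incl)
      then show ?case
        using spl_simps(1)[OF gM frag_of_in_free[OF P]] spl_simps(1)[OF frag_of_in_free[OF P] gM]
        by (simp add: free_simps)
    next
      case (diff a b)
      then have ab: "a \<in> carrier (free_gliders G)" "b \<in> carrier (free_gliders G)"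
        by (auto simp: free_simps)
      have "spl (a - b) = spl a \<ominus>\<^bsub>?S\<^esub> spl b"
        using ab free_diff_closed[of 0 b] spl_simps(2)[OF ab(1), of "- b"]
        by (simp add: a_minus_def spl_simps free_simps)
      moreover have "spl a \<in> carrier ?S" "spl b \<in> carrier ?S" "spl (frag_of M) \<in> carrier ?S"
        using ab gM by (auto simp: carrier_split)
      ultimately show ?case
        using diff.IH
        by (simp add: a_minus_def S.mult_add_left S.mult_add_right S.minus_mult S.mult_minus)
    qed
  qed
  have "i \<otimes>\<^bsub>?S\<^esub> x \<in> ?I \<and> x \<otimes>\<^bsub>?S\<^esub> i \<in> ?I" if "i \<in> ?I" "x \<in> carrier ?S" for i x
    using S.generate_absorbing[OF Z _ that(2), of i] both that(1)
    unfolding length_zero_ideal_eq by (auto simp: carrier_split)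
  then show ?thesis by unfold_locales auto
qed

end


section \<open>Integer-valued additive maps, and the separation of classes\<close>

lemma lookup_sum_frag:
  "Poly_Mapping.lookup (\<Sum>x\<in>A. c x) i = (\<Sum>x\<in>A. Poly_Mapping.lookup (c x) i)"
  by (induction A rule: infinite_finite_induct) (auto simp: lookup_add)

text \<open>The additive extension of \<open>f\<close> to formal combinations. The integers appear
  as the free abelian group on the one-element type, which allows the use of
  \<open>frag_extend\<close>.\<close>

definition ext :: "('c \<Rightarrow> int) \<Rightarrow> ('c \<Rightarrow>\<^sub>0 int) \<Rightarrow> int"
  where "ext f p = Poly_Mapping.lookup (frag_extend (\<lambda>x. frag_cmul (f x) (frag_of ())) p) ()"

lemma ext_simps [simp]:
  "ext f (frag_of x) = f x" "ext f 0 = 0" "ext f (p + q) = ext f p + ext f q"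
  "ext f (p - q) = ext f p - ext f q" "ext f (- p) = - ext f p"
  by (simp_all add: ext_def frag_extend_add frag_extend_diff frag_extend_minus lookup_add lookup_minus)

lemma ext_cong: "(\<And>x. x \<in> Poly_Mapping.keys p \<Longrightarrow> f x = h x) \<Longrightarrow> ext f p = ext h p"
  unfolding ext_def by (metis (no_types, lifting) frag_extend_eq)

lemma ext_eq_sum: "ext f p = (\<Sum>x\<in>Poly_Mapping.keys p. Poly_Mapping.lookup p x * f x)"
  by (simp add: ext_def frag_extend_def lookup_sum_frag)

lemma ext_frag_extend: "ext f (frag_extend (\<lambda>x. frag_of (h x)) p) = ext (\<lambda>x. f (h x)) p"
proof -
  have "Poly_Mapping.keys p \<subseteq> UNIV" by simp
  then show ?thesis
    by (induction p rule: frag_induction) (auto simp: frag_extend_diff)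
qed

context finite_group
begin

definition red :: "(('a, 'k::field) glider \<Rightarrow>\<^sub>0 int) \<Rightarrow> ('a, 'k) glider_class"
  where "red p = length_zero_ideal G +>\<^bsub>split_Grothendieck G\<^esub> spl p"

lemma cls_eq: "cls G M = red (frag_of M)"
  by (simp add: cls_def red_def spl_def split_class_def)

lemma bilinear_ring_reduced: "bilinear_ring (reduced_ring G)"
  unfolding reduced_ring_def by (rule absorbing_subgroup.bilinear_ring_Quot[OF absorbing_length_zero])

lemma carrier_reduced: "carrier (reduced_ring G) = red ` carrier (free_gliders G)"
  using absorbing_subgroup.carrier_Quot[OF absorbing_length_zero]
  by (auto simp: reduced_ring_def carrier_split red_def)

lemma red_simps:
  fixes p q :: "('a, 'k::field) glider \<Rightarrow>\<^sub>0 int"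
  shows "p \<in> carrier (free_gliders G) \<Longrightarrow> q \<in> carrier (free_gliders G) \<Longrightarrow>
    red p \<otimes>\<^bsub>reduced_ring G\<^esub> red q = red (p \<otimes>\<^bsub>free_gliders G\<^esub> q)"
  "p \<in> carrier (free_gliders G) \<Longrightarrow> q \<in> carrier (free_gliders G) \<Longrightarrow>
    red p \<oplus>\<^bsub>reduced_ring G\<^esub> red q = red (p + q)"
  "\<zero>\<^bsub>reduced_ring G\<^esub> = red (0 :: ('a, 'k) glider \<Rightarrow>\<^sub>0 int)"
  "\<one>\<^bsub>reduced_ring G\<^esub> = red (frag_of (unit_glider :: ('a, 'k) glider))"
  "p \<in> carrier (free_gliders G) \<Longrightarrow> \<ominus>\<^bsub>reduced_ring G\<^esub> red p = red (- p)"
proof -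
  interpret I: absorbing_subgroup "length_zero_ideal G"
    "split_Grothendieck G :: (('a, 'k) glider \<Rightarrow>\<^sub>0 int) set ring"
    by (rule absorbing_length_zero)
  have c: "p \<in> carrier (free_gliders G) \<Longrightarrow> spl p \<in> carrier (split_Grothendieck G)"
    for p :: "('a, 'k) glider \<Rightarrow>\<^sub>0 int"
    by (simp add: carrier_split)
  show "red p \<otimes>\<^bsub>reduced_ring G\<^esub> red q = red (p \<otimes>\<^bsub>free_gliders G\<^esub> q)"
    "red p \<oplus>\<^bsub>reduced_ring G\<^esub> red q = red (p + q)"
    if "p \<in> carrier (free_gliders G)" "q \<in> carrier (free_gliders G)"
    unfolding reduced_ring_def red_def I.Quot_simps(1,2)[OF c[OF that(1)] c[OF that(2)]]
    by (simp_all only: spl_simps(1,2)[OF that])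
  show "\<zero>\<^bsub>reduced_ring G\<^esub> = red (0 :: ('a, 'k) glider \<Rightarrow>\<^sub>0 int)"
    unfolding reduced_ring_def red_def I.Quot_simps(3) spl_simps(3)[symmetric] I.coset_zero ..
  show "\<one>\<^bsub>reduced_ring G\<^esub> = red (frag_of (unit_glider :: ('a, 'k) glider))"
    unfolding reduced_ring_def red_def I.Quot_simps(4) spl_simps(4) ..
  show "\<ominus>\<^bsub>reduced_ring G\<^esub> red p = red (- p)" if "p \<in> carrier (free_gliders G)"
    unfolding reduced_ring_def red_def I.Quot_minus[OF c[OF that]] spl_simps(5)[OF that] ..
qed

text \<open>An element of the reduced ring is a coset of cosets, so the invariant is followed
  through two quotients. By \<open>iso\<close> and \<open>sum\<close> it vanishes on the split
  relations and is constant on each \<open>spl r\<close>; by \<open>lz\<close> it vanishes on all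
  combinations inside members of the length zero ideal.\<close>

lemma additive_invariant_red:
  fixes p p' :: "('a, 'k::field) glider \<Rightarrow>\<^sub>0 int"
  assumes iso: "\<And>M N. is_glider G M \<Longrightarrow> is_glider G N \<Longrightarrow> glider_iso G M N \<Longrightarrow> f M = f N"
    and sum: "\<And>M N. is_glider G M \<Longrightarrow> is_glider G N \<Longrightarrow> f (glider_sum M N) = f M + f N"
    and lz: "\<And>M. length_zero G M \<Longrightarrow> f M = 0"
    and p: "p \<in> carrier (free_gliders G)" and p': "p' \<in> carrier (free_gliders G)"
    and eq: "red p = red p'"
  shows "ext f p = ext f p'"
proof -
  interpret I: absorbing_subgroup "split_relations G" "free_gliders G :: (('a, 'k) glider \<Rightarrow>\<^sub>0 int) ring"
    by (rule absorbing_split_relations)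
  interpret Z: absorbing_subgroup "length_zero_ideal G"
    "split_Grothendieck G :: (('a, 'k) glider \<Rightarrow>\<^sub>0 int) set ring"
    by (rule absorbing_length_zero)
  have gen0: "ext f r = 0" if "r \<in> rel_gens" for r
    using that iso sum by (auto simp: rel_gens_def)
  have 1: "ext f r = 0" if "r \<in> split_relations G" for r
    using that unfolding split_relations_eq
  proof induction
    case (inv h)
    then have "h \<in> carrier (free_gliders G)" using rel_gens_closed by auto
    then have "inv\<^bsub>add_monoid (free_gliders G)\<^esub> h = - h"
      using free_minus[of h] by (simp only: a_inv_def)
    then show ?case using gen0[OF inv] by simp
  qed (auto simp: gen0 free_simps)
  have spl: "ext f r = ext f s" if "r \<in> spl s" for r s
    using that 1 by (auto simp: spl_def a_r_coset_def r_coset_def free_simps)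
  have fr: "frag_of M \<in> carrier (free_gliders G)" if "length_zero G M" for M
    using that by (simp add: length_zero_def frag_of_in_free)
  have add: "A \<oplus>\<^bsub>split_Grothendieck G\<^esub> B = {a + b |a b. a \<in> A \<and> b \<in> B}"
    for A B :: "(('a, 'k) glider \<Rightarrow>\<^sub>0 int) set"
    by (auto simp: split_Grothendieck_def FactRing_def set_add_def set_mult_def free_simps)
  have 2: "\<forall>r\<in>A. ext f r = 0" if "A \<in> length_zero_ideal G" for A
    using that unfolding length_zero_ideal_eq
  proof induction
    case one
    then show ?case using spl[of _ 0] by (simp add: spl_simps)
  next
    case (incl h)
    then show ?case using spl lz by fastforce
  next
    case (inv h)
    then obtain M where M: "h = spl (frag_of M)" "length_zero G M" by auto
    have "inv\<^bsub>add_monoid (split_Grothendieck G)\<^esub> h = spl (- frag_of M)"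
      using spl_simps(5)[OF fr[OF M(2)]] M(1) by (simp only: a_inv_def)
    then show ?case using spl[of _ "- frag_of M"] lz[OF M(2)] by simp
  next
    case (eng A B)
    then show ?case by (auto simp: add)
  qed
  \<comment> \<open>\<open>red p\<close> has \<open>spl p\<close> as a member, which in turn
    contains \<open>p\<close>. Equality of the classes therefore writes \<open>p\<close> as
    \<open>a + b\<close> with \<open>a\<close> inside a member of the ideal and \<open>b\<close> in
    \<open>spl p'\<close>.\<close>
  have "spl p \<in> carrier (split_Grothendieck G)" using p by (simp add: carrier_split)
  then have "spl p \<in> red p" using Z.a_rcos_self[of "spl p"] by (simp add: red_def)
  then have "spl p \<in> red p'" using eq by simp
  then obtain A where A: "A \<in> length_zero_ideal G" "spl p = A \<oplus>\<^bsub>split_Grothendieck G\<^esub> spl p'"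
    by (auto simp: red_def a_r_coset_def r_coset_def)
  moreover have "p \<in> spl p" using I.a_rcos_self[OF p] by (simp add: spl_def)
  ultimately obtain a b where "a \<in> A" "b \<in> spl p'" "p = a + b" by (auto simp: add)
  then show ?thesis using 2[OF A(1)] spl by simp
qed

lemma red_iso:
  assumes "is_glider G M" "is_glider G N" "glider_iso G M (N :: ('a, 'k::field) glider)"
  shows "red (frag_of M) = red (frag_of N)"
proof -
  interpret I: absorbing_subgroup "split_relations G" "free_gliders G :: (('a, 'k) glider \<Rightarrow>\<^sub>0 int) ring"
    by (rule absorbing_split_relations)
  have "frag_of M - frag_of N \<in> split_relations G"
    unfolding split_relations_eq by (rule generate.incl) (use assms in \<open>auto simp: rel_gens_def\<close>)
  then have "frag_of M \<in> spl (frag_of N)"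
    by (auto simp: spl_def a_r_coset_def r_coset_def free_simps intro!: bexI[of _ "frag_of M - frag_of N"])
  then have "spl (frag_of M) = spl (frag_of N)"
    using I.a_repr_independence'[OF _ frag_of_in_free[OF assms(2)]] by (simp add: spl_def)
  then show ?thesis by (simp add: red_def)
qed

lemma red_sum:
  assumes M: "is_glider G M" and N: "is_glider G (N :: ('a, 'k::field) glider)"
  shows "red (frag_of (glider_sum M N)) = red (frag_of M + frag_of N)"
proof -
  interpret I: absorbing_subgroup "split_relations G" "free_gliders G :: (('a, 'k) glider \<Rightarrow>\<^sub>0 int) ring"
    by (rule absorbing_split_relations)
  have "frag_of (glider_sum M N) - frag_of M - frag_of N \<in> split_relations G"
    unfolding split_relations_eq by (rule generate.incl) (use assms in \<open>auto simp: rel_gens_def\<close>)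
  then have "frag_of (glider_sum M N) \<in> spl (frag_of M + frag_of N)"
    by (auto simp: spl_def a_r_coset_def r_coset_def free_simps
        intro!: bexI[of _ "frag_of (glider_sum M N) - frag_of M - frag_of N"])
  moreover have "frag_of M + frag_of N \<in> carrier (free_gliders G)"
    using I.add.m_closed[OF frag_of_in_free[OF M] frag_of_in_free[OF N]] by (simp add: free_simps(2))
  ultimately have "spl (frag_of (glider_sum M N)) = spl (frag_of M + frag_of N)"
    using I.a_repr_independence' by (simp add: spl_def)
  then show ?thesis by (simp add: red_def)
qed

lemma red_length_zero:
  assumes "length_zero G (M :: ('a, 'k::field) glider)"
  shows "red (frag_of M) = red 0"
proof -
  interpret Z: absorbing_subgroup "length_zero_ideal G"
    "split_Grothendieck G :: (('a, 'k) glider \<Rightarrow>\<^sub>0 int) set ring"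
    by (rule absorbing_length_zero)
  have "spl (frag_of M) \<in> length_zero_ideal G"
    unfolding length_zero_ideal_eq by (rule generate.incl) (use assms in auto)
  then have "red (frag_of M) = length_zero_ideal G"
    using Z.a_rcos_const by (simp add: red_def)
  also have "\<dots> = red 0" using Z.coset_zero by (simp add: red_def spl_simps)
  finally show ?thesis .
qed

text \<open>What \<open>lev0\<close> contains beyond the module generated by \<open>lev1\<close>
  splits off as a glider of length zero.\<close>

lemma cls_shrink:
  assumes "cyclic G (M :: ('a, 'k::field) glider)"
  shows "cls G (M\<lparr>lev0 := alg_span G M (lev1 M)\<rparr>) = cls G M"
proof -
  let ?M = "M\<lparr>lev0 := alg_span G M (lev1 M)\<rparr>"
  have M: "is_glider G M" using assms by (simp add: cyclic_def)
  have M': "is_glider G ?M" by (rule is_glider_shrink[OF finite_carrier is_group M])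
  obtain Z where Z: "length_zero G Z" "glider_iso G (glider_sum ?M Z) M"
    using glider_iso_shrink_sum[OF finite_carrier is_group M] by blast
  have gZ: "is_glider G Z" using Z by (simp add: length_zero_def)
  interpret R: bilinear_ring "reduced_ring G :: ('a, 'k) glider_class ring" by (rule bilinear_ring_reduced)
  have "red (frag_of M) = red (frag_of ?M + frag_of Z)"
    using red_iso[OF glider_sum_closed[OF M' gZ] M Z(2)] red_sum[OF M' gZ] by simp
  also have "\<dots> = red (frag_of ?M) \<oplus>\<^bsub>reduced_ring G\<^esub> red (frag_of Z)"
    using red_simps(2)[OF frag_of_in_free[OF M'] frag_of_in_free[OF gZ]] by simp
  also have "red (frag_of Z) = \<zero>\<^bsub>reduced_ring G\<^esub>"
    using red_length_zero[OF Z(1)] by (simp add: red_simps)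
  also have "red (frag_of ?M) \<oplus>\<^bsub>reduced_ring G\<^esub> \<zero>\<^bsub>reduced_ring G\<^esub> = red (frag_of ?M)"
    by (intro R.r_zero) (auto simp: carrier_reduced intro!: imageI frag_of_in_free M')
  finally show ?thesis by (simp add: cls_eq)
qed

lemma ext_chi_red:
  fixes p p' :: "('a, 'k::field) glider \<Rightarrow>\<^sub>0 int"
  assumes "J \<subseteq> group_alg G" "p \<in> carrier (free_gliders G)" "p' \<in> carrier (free_gliders G)"
    "red p = red p'"
  shows "ext (chi G J) p = ext (chi G J) p'"
  using assms chi_iso[OF assms(1)] chi_sum chi_length_zero
  by (intro additive_invariant_red) auto

text \<open>Equal classes have equal invariants, and evaluating these at the two annihilators gives
  both inclusions. Conversely, equal annihilators make the irreducible parts isomorphic.\<close>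

lemma cls_eq_iff:
  assumes X: "cyclic G X" and Y: "cyclic G (Y :: ('a, 'k::field) glider)"
  shows "cls G X = cls G Y \<longleftrightarrow> ann G X = ann G Y"
proof
  assume "cls G X = cls G Y"
  then have "chi G J X = chi G J Y" if "J \<subseteq> group_alg G" for J
    using ext_chi_red[OF that frag_of_in_free frag_of_in_free, of X Y] X Y
    by (simp add: cls_eq cyclic_def)
  moreover have "ann G X \<subseteq> group_alg G" "ann G Y \<subseteq> group_alg G" by (auto simp: ann_def)
  ultimately have "chi G (ann G X) X = chi G (ann G X) Y" "chi G (ann G Y) X = chi G (ann G Y) Y"
    by blast+
  then show "ann G X = ann G Y"
    using \<open>ann G X \<subseteq> group_alg G\<close> \<open>ann G Y \<subseteq> group_alg G\<close>
    by (simp add: chi_cyclic X Y split: if_splits)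
next
  assume eq: "ann G X = ann G Y"
  let ?X = "X\<lparr>lev0 := alg_span G X (lev1 X)\<rparr>" and ?Y = "Y\<lparr>lev0 := alg_span G Y (lev1 Y)\<rparr>"
  have irr: "irreducible_glider G ?X" "irreducible_glider G ?Y"
    using irreducible_shrink[OF finite_carrier is_group] X Y by auto
  have "glider_iso G ?X ?Y"
    using irr eq by (intro glider_iso_irreducible finite_carrier is_group) simp_all
  then have "cls G ?X = cls G ?Y"
    using irr unfolding cls_eq by (intro red_iso) (auto simp: irreducible_glider_def)
  then show "cls G X = cls G Y" using cls_shrink X Y by metis
qed

text \<open>Cyclic instead of irreducible gliders, because cyclic ones are closed under tensor
  products: in a product of irreducible gliders \<open>lev0\<close> can be larger than the module
  generated by \<open>u \<otimes> v\<close>.\<close>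

definition cyclic_frags :: "(('a, 'k::field) glider \<Rightarrow>\<^sub>0 int) set"
  where "cyclic_frags = {p. Poly_Mapping.keys p \<subseteq> Collect (cyclic G)}"

lemma cyclic_frags_free: "p \<in> cyclic_frags \<Longrightarrow> p \<in> carrier (free_gliders G)"
  by (auto simp: cyclic_frags_def free_simps cyclic_def)

lemma cyclic_frags_closed:
  "frag_of M \<in> cyclic_frags \<longleftrightarrow> cyclic G M" "0 \<in> cyclic_frags"
  "p \<in> cyclic_frags \<Longrightarrow> q \<in> cyclic_frags \<Longrightarrow> p + q \<in> cyclic_frags"
  "p \<in> cyclic_frags \<Longrightarrow> q \<in> cyclic_frags \<Longrightarrow> p - q \<in> cyclic_frags"
  "p \<in> cyclic_frags \<Longrightarrow> - p \<in> cyclic_frags"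
  using keys_diff[of p q] Poly_Mapping.keys_add[of p q] by (auto simp: cyclic_frags_def)

text \<open>Choosing one glider for every annihilator removes the redundancy, and then a maximal
  annihilator occurring in \<open>p\<close> has a nonzero invariant.\<close>

lemma red_eq_zero:
  fixes p :: "('a, 'k::field) glider \<Rightarrow>\<^sub>0 int"
  assumes p: "p \<in> cyclic_frags"
    and chi: "\<And>M. M \<in> Poly_Mapping.keys p \<Longrightarrow> ext (chi G (ann G M)) p = 0"
  shows "red p = red 0"
proof -
  define c where "c M = (SOME X. cyclic G X \<and> ann G X = ann G M)" for M :: "('a, 'k) glider"
  have c: "cyclic G (c M)" "ann G (c M) = ann G M" if "cyclic G M" for M
    using someI_ex[of "\<lambda>X. cyclic G X \<and> ann G X = ann G M"] that by (auto simp: c_def)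
  have cc: "c M = c N" if "ann G M = ann G N" for M N using that by (simp add: c_def)
  let ?p = "frag_extend (\<lambda>M. frag_of (c M)) p"
  have kp: "Poly_Mapping.keys p \<subseteq> Collect (cyclic G)" using p by (simp add: cyclic_frags_def)
  then have "?p \<in> carrier (free_gliders G) \<and> red ?p = red p"
  proof (induction p rule: frag_induct_supp)
    case zero
    then show ?case by (simp add: free_simps)
  next
    case (one M)
    then have M: "cyclic G M" by simp
    then have "cls G (c M) = cls G M" using cls_eq_iff c by blast
    then show ?case using c(1)[OF M] by (simp add: cls_eq cyclic_def frag_of_in_free)
  next
    case (diff a b)
    then have "a \<in> carrier (free_gliders G)" "b \<in> carrier (free_gliders G)"
      by (auto simp: free_simps cyclic_def)
    moreover have "red (x - y) = red x \<oplus>\<^bsub>reduced_ring G\<^esub> (\<ominus>\<^bsub>reduced_ring G\<^esub> red y)"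
      if "x \<in> carrier (free_gliders G)" "y \<in> carrier (free_gliders G)" for x y :: "('a, 'k) glider \<Rightarrow>\<^sub>0 int"
      using that free_diff_closed[of 0 y] red_simps(2)[of x "- y"] red_simps(5)[of y]
      by (simp add: free_simps)
    ultimately show ?case
      using diff.IH free_diff_closed[of "frag_extend (\<lambda>M. frag_of (c M)) a" "frag_extend (\<lambda>M. frag_of (c M)) b"]
      by (simp add: frag_extend_diff)
  qed
  moreover have "?p = 0"
  proof (rule ccontr)
    assume "?p \<noteq> 0"
    let ?K = "Poly_Mapping.keys ?p"
    have K: "?K \<subseteq> c ` Poly_Mapping.keys p"
      using keys_frag_extend[of "\<lambda>M. frag_of (c M)" p] by auto
    have "finite (ann G ` ?K)" "ann G ` ?K \<noteq> {}" using \<open>?p \<noteq> 0\<close> by auto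
    then obtain A where A: "A \<in> ann G ` ?K" "\<And>B. B \<in> ann G ` ?K \<Longrightarrow> A \<subseteq> B \<Longrightarrow> A = B"
      by (meson finite_has_maximal)
    then obtain X where X: "X \<in> ?K" "A = ann G X" by auto
    then obtain M where M: "M \<in> Poly_Mapping.keys p" "X = c M" using K by auto
    have cM: "cyclic G M" using M kp by auto
    have AM: "A = ann G M" using c(2)[OF cM] M X by simp
    have "A \<subseteq> group_alg G" by (auto simp: X ann_def)
    have cyc: "cyclic G Y" if "Y \<in> ?K" for Y using that K kp c by auto
    have inj: "Y = X" if Y: "Y \<in> ?K" "A \<subseteq> ann G Y" for Y
    proof -
      obtain N where N: "N \<in> Poly_Mapping.keys p" "Y = c N" using Y K by auto
      then have "ann G N = ann G Y" using c(2)[of N] kp by auto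
      moreover have "A = ann G Y" using A(2) Y by blast
      ultimately show ?thesis using cc[of N M] AM N M by simp
    qed
    \<comment> \<open>The invariant sees only annihilators, so \<open>p\<close> and the normalized
      \<open>?p\<close> have the same value. In \<open>?p\<close> only \<open>X\<close> has an
      annihilator containing the maximal \<open>A\<close>, and the value is the coefficient of
      \<open>X\<close>.\<close>
    have "ext (chi G A) p = ext (\<lambda>N. chi G A (c N)) p"
    proof (rule ext_cong)
      fix N assume "N \<in> Poly_Mapping.keys p"
      then have "cyclic G N" using kp by auto
      then show "chi G A N = chi G A (c N)"
        using c[of N] \<open>A \<subseteq> group_alg G\<close> by (simp add: chi_cyclic)
    qed
    also have "\<dots> = ext (chi G A) ?p" by (simp add: ext_frag_extend)
    also have "\<dots> = (\<Sum>Y\<in>?K. if Y = X then Poly_Mapping.lookup ?p Y else 0)"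
      unfolding ext_eq_sum
      using cyc inj \<open>A \<subseteq> group_alg G\<close> X by (intro sum.cong) (auto simp: chi_cyclic)
    also have "\<dots> = Poly_Mapping.lookup ?p X" using X by simp
    finally have "ext (chi G A) p \<noteq> 0" using X by (simp add: in_keys_iff)
    then show False using chi[OF M(1)] AM by simp
  qed
  ultimately show ?thesis by simp
qed

lemma red_eqI:
  fixes p q :: "('a, 'k::field) glider \<Rightarrow>\<^sub>0 int"
  assumes p: "p \<in> cyclic_frags" and q: "q \<in> cyclic_frags"
    and chi: "\<And>J. J \<subseteq> group_alg G \<Longrightarrow> ext (chi G J) p = ext (chi G J) q"
  shows "red p = red q"
proof -
  have "red (p - q) = red 0"
    using chi by (intro red_eq_zero cyclic_frags_closed p q) (auto simp: ann_def)
  interpret R: bilinear_ring "reduced_ring G :: ('a, 'k) glider_class ring" by (rule bilinear_ring_reduced)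
  have c: "red p \<in> carrier (reduced_ring G)" "red q \<in> carrier (reduced_ring G)"
    using p q cyclic_frags_free by (auto simp: carrier_reduced)
  have "red p = red ((p - q) + q)" by simp
  also have "\<dots> = red (p - q) \<oplus>\<^bsub>reduced_ring G\<^esub> red q"
    using red_simps(2)[OF cyclic_frags_free[OF cyclic_frags_closed(4)[OF p q]] cyclic_frags_free[OF q]]
    by simp
  also have "\<dots> = red q"
    using c by (simp add: \<open>red (p - q) = red 0\<close> red_simps(3)[symmetric])
  finally show ?thesis .
qed

section \<open>Annihilators in coordinates\<close>

definition generates :: "('a, 'k::field) glider \<Rightarrow> (nat \<Rightarrow> 'k) \<Rightarrow> bool"
  where "generates M u \<longleftrightarrow> is_glider G M \<and> u \<noteq> 0 \<and> lev1 M = fn.span {u}"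

lemma generates_cyclic: "generates M u \<Longrightarrow> cyclic G M"
  using dim_line[of u] by (auto simp: generates_def cyclic_def)

lemma cyclic_generates:
  assumes "cyclic G M" obtains u where "generates M u"
  using cyclic_generator[OF assms] assms by (metis cyclic_def generates_def)

lemma generates_in: "generates M u \<Longrightarrow> u \<in> lev1 M" "generates M u \<Longrightarrow> u \<in> space M"
  using is_gliderD(8)[of G M] fn.span_base[of u "{u}"] by (auto simp: generates_def)

text \<open>The annihilator as the orthogonal complement of the coordinate functions
  \<open>g \<mapsto> (g u) i\<close> on the group. The ring laws and the analysis of idempotents
  both work with these functions.\<close>

lemma ann_iff:
  assumes "generates M u"
  shows "x \<in> ann G M \<longleftrightarrow> x \<in> group_alg G \<and> (\<forall>i. (\<Sum>g\<in>carrier G. x g * act M g u i) = 0)"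
proof -
  have "alg_act G M x u = 0 \<longleftrightarrow> (\<forall>i. (\<Sum>g\<in>carrier G. x g * act M g u i) = 0)"
    by (simp add: alg_act_def fun_eq_iff sum_fun_apply smul_apply zero_fun_apply)
  then show ?thesis
    using ann_line[of G M u] assms by (simp add: generates_def)
qed

lemma act_tensor_tens:
  assumes "is_glider G M" "is_glider G N" "g \<in> carrier G" "u \<in> space M" "v \<in> space N"
  shows "act (glider_tensor M N) g (enc (tens u v)) = enc (tens (act M g u) (act N g v))"
  using tmap_tens[OF is_moduleD(3)[OF is_gliderD(1)[OF assms(1)] assms(3)]
      is_moduleD(3)[OF is_gliderD(1)[OF assms(2)] assms(3)] assms(4,5)]
  by simp

lemma generates_tensor:
  assumes M: "generates M u" and N: "generates N v"
  shows "generates (glider_tensor M N) (enc (tens u v))"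
proof -
  obtain i j where "u i \<noteq> 0" "v j \<noteq> 0"
    using M N by (auto simp: generates_def fun_eq_iff zero_fun_apply)
  then have "tens u v (i, j) \<noteq> 0" by (simp add: tens_def)
  then have "tens u v \<noteq> 0" by (auto simp: zero_fun_apply)
  then have "enc (tens u v) \<noteq> 0" by (metis enc_eq_iff enc_linear(3))
  moreover have "lev1 (glider_tensor M N) = fn.span {enc (tens u v)}"
  proof -
    have "tens_space (lev1 M) (lev1 N) = fn.span {tens u v}"
      using M N tens_space_span[of "{u}" "{v}"] by (simp add: generates_def)
    then show ?thesis by (simp add: enc_span)
  qed
  ultimately show ?thesis
    using M N glider_tensor_closed[of M N] by (simp add: generates_def)
qed

lemma act_generator_tensor:
  assumes "generates M u" "generates N v" "g \<in> carrier G"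
  shows "act (glider_tensor M N) g (enc (tens u v)) n =
    act M g u (fst (prod_decode n)) * act N g v (snd (prod_decode n))"
  using act_tensor_tens[OF _ _ assms(3) generates_in(2)[OF assms(1)] generates_in(2)[OF assms(2)]] assms
  by (simp add: generates_def enc_def tens_def case_prod_beta)

lemma cyclic_tensor: "cyclic G M \<Longrightarrow> cyclic G N \<Longrightarrow> cyclic G (glider_tensor M N)"
  by (metis cyclic_generates generates_cyclic generates_tensor)

lemma all_prod_decode: "(\<forall>n. P (fst (prod_decode n)) (snd (prod_decode n))) \<longleftrightarrow> (\<forall>i j. P i j)"
  by (metis fst_conv prod_encode_inverse snd_conv)

text \<open>The coordinate functions of \<open>u \<otimes> v\<close> are the products of those of
  \<open>u\<close> and \<open>v\<close>; commutativity, associativity and the unit law for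
  annihilators are thereby inherited from multiplication in the field.\<close>

lemma ann_tensor_iff:
  assumes M: "generates M u" and N: "generates N v"
  shows "x \<in> ann G (glider_tensor M N) \<longleftrightarrow> x \<in> group_alg G \<and>
    (\<forall>i j. (\<Sum>g\<in>carrier G. x g * (act M g u i * act N g v j)) = 0)"
  unfolding ann_iff[OF generates_tensor[OF M N]]
  using all_prod_decode[of "\<lambda>i j. (\<Sum>g\<in>carrier G. x g * (act M g u i * act N g v j)) = 0"]
  by (simp add: act_generator_tensor[OF M N] del: glider_tensor_simps cong: sum.cong)

lemma generates_unit: "generates unit_glider (\<lambda>i. if i = 0 then 1 else 0 :: 'k::field)"
proof -
  let ?V = "{v :: nat \<Rightarrow> 'k. \<forall>i>0. v i = 0}" and ?e = "\<lambda>i::nat. if i = 0 then 1 else 0 :: 'k"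
  have V: "?V = fn.span {?e}"
  proof (intro equalityI subsetI)
    fix v assume "v \<in> ?V"
    then have "v = smul (v 0) ?e" by (intro ext) (simp add: smul_apply)
    then show "v \<in> fn.span {?e}" unfolding fn.span_singleton by (rule range_eqI)
  next
    fix v assume "v \<in> fn.span {?e}"
    then obtain c where "v = smul c ?e" unfolding fn.span_singleton by (elim rangeE)
    then show "v \<in> ?V" by (simp add: smul_apply)
  qed
  have "?e \<noteq> 0"
  proof
    assume "?e = 0"
    from fun_cong[OF this, of 0] show False by (simp add: zero_fun_apply)
  qed
  moreover have "is_glider G (unit_glider :: ('a, 'k) glider)"
    unfolding is_glider_iff[OF finite_carrier]
    using V by (auto simp: unit_glider_def Let_def is_module_def)
  ultimately show ?thesis using V by (simp add: generates_def unit_glider_def Let_def)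
qed

lemma act_unit [simp]: "act unit_glider g v = v"
  by (simp add: unit_glider_def Let_def)

lemma ann_unit_iff:
  "x \<in> ann G unit_glider \<longleftrightarrow> x \<in> group_alg G \<and> (\<Sum>g\<in>carrier G. x g) = 0"
  unfolding ann_iff[OF generates_unit] by (auto simp: sum_distrib_right[symmetric] split: if_splits)

section \<open>The ring generated by the irreducible gliders\<close>

lemma cyclic_frags_mult:
  assumes "p \<in> cyclic_frags" "q \<in> cyclic_frags"
  shows "p \<otimes>\<^bsub>free_gliders G\<^esub> q \<in> cyclic_frags"
proof -
  have "Poly_Mapping.keys (frag_extend (\<lambda>N. frag_of (glider_tensor M N)) q) \<subseteq> Collect (cyclic G)"
    if "cyclic G M" for M
    using keys_frag_extend[of "\<lambda>N. frag_of (glider_tensor M N)" q] assms(2) that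
    by (fastforce simp: cyclic_frags_def intro: cyclic_tensor)
  then show ?thesis
    using keys_frag_extend[of "\<lambda>M. frag_extend (\<lambda>N. frag_of (glider_tensor M N)) q" p] assms(1)
    by (fastforce simp: cyclic_frags_def free_simps)
qed

lemma R1_simps:
  "monoid.mult (R1 G) = monoid.mult (reduced_ring G)" "add (R1 G) = add (reduced_ring G)"
  "\<zero>\<^bsub>R1 G\<^esub> = \<zero>\<^bsub>reduced_ring G\<^esub>" "\<one>\<^bsub>R1 G\<^esub> = \<one>\<^bsub>reduced_ring G\<^esub>"
  by (simp_all add: R1_def)

text \<open>Products of cyclic gliders are cyclic, so the span of their classes is already a
  subring; by \<open>cls_shrink\<close> each of these classes is that of an irreducible
  glider.\<close>

lemma carrier_R1: "carrier (R1 G) = (red :: (('a, 'k::field) glider \<Rightarrow>\<^sub>0 int) \<Rightarrow> _) ` cyclic_frags"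
proof (intro equalityI subsetI)
  fix x assume "x \<in> carrier (R1 G :: ('a, 'k) glider_class ring)"
  then have "x \<in> generate_ring (reduced_ring G) {cls G M |M. irreducible_glider G M}"
    by (simp add: R1_def)
  then show "x \<in> red ` cyclic_frags"
  proof induction
    case one
    then show ?case
      using generates_cyclic[OF generates_unit]
      by (auto simp: red_simps cyclic_frags_closed intro!: imageI)
  next
    case (incl h)
    then show ?case by (auto simp: cls_eq cyclic_frags_closed irreducible_imp_cyclic intro!: imageI)
  next
    case (a_inv h)
    then show ?case by (auto simp: red_simps cyclic_frags_free cyclic_frags_closed intro!: imageI)
  next
    case (eng_add h1 h2)
    then show ?case by (auto simp: red_simps cyclic_frags_free cyclic_frags_closed intro!: imageI)
  next
    case (eng_mult h1 h2)
    then show ?case by (auto simp: red_simps cyclic_frags_free cyclic_frags_mult intro!: imageI)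
  qed
next
  fix x assume "x \<in> (red :: (('a, 'k) glider \<Rightarrow>\<^sub>0 int) \<Rightarrow> _) ` cyclic_frags"
  then obtain p :: "('a, 'k) glider \<Rightarrow>\<^sub>0 int" where x: "x = red p" and p: "p \<in> cyclic_frags" by auto
  interpret R: bilinear_ring "reduced_ring G :: ('a, 'k) glider_class ring" by (rule bilinear_ring_reduced)
  let ?A = "generate_ring (reduced_ring G) {cls G M |M. irreducible_glider G (M :: ('a, 'k) glider)}"
  have irr: "cls G M \<in> ?A" if "cyclic G M" for M :: "('a, 'k) glider"
    using cls_shrink[OF that] irreducible_shrink[OF finite_carrier is_group that]
    by (intro generate_ring.incl) (metis (mono_tags, lifting) mem_Collect_eq)
  have "Poly_Mapping.keys p \<subseteq> Collect (cyclic G)" using p by (simp add: cyclic_frags_def)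
  then have "red p \<in> ?A"
  proof (induction p rule: frag_induct_supp)
    case zero
    \<comment> \<open>Zero is reached in the generated subring as the unit minus itself.\<close>
    let ?u = "red (frag_of (unit_glider :: ('a, 'k) glider))"
    have u: "cyclic G (unit_glider :: ('a, 'k) glider)" by (rule generates_cyclic[OF generates_unit])
    have "?u \<in> ?A" using irr[OF u] by (simp add: cls_eq)
    then have "?u \<oplus>\<^bsub>reduced_ring G\<^esub> (\<ominus>\<^bsub>reduced_ring G\<^esub> ?u) \<in> ?A"
      by (intro generate_ring.eng_add generate_ring.a_inv)
    moreover have "?u \<in> carrier (reduced_ring G)"
      using u by (auto simp: carrier_reduced cyclic_def intro!: imageI frag_of_in_free)
    ultimately show ?case by (simp add: R.r_neg red_simps)
  next
    case (one M)
    then show ?case using irr[of M] by (simp add: cls_eq)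
  next
    case (diff a b)
    then have "a \<in> cyclic_frags" "b \<in> cyclic_frags" by (auto simp: cyclic_frags_def)
    then have "red (a - b) = red a \<oplus>\<^bsub>reduced_ring G\<^esub> (\<ominus>\<^bsub>reduced_ring G\<^esub> red b)"
      using red_simps(2)[of a "- b"] red_simps(5)[of b] cyclic_frags_free[of a] cyclic_frags_free[of b]
        cyclic_frags_free[OF cyclic_frags_closed(5)[of b]] by simp
    then show ?case using diff.IH by (simp add: generate_ring.eng_add generate_ring.a_inv)
  qed
  then show "x \<in> carrier (R1 G :: ('a, 'k) glider_class ring)" by (simp add: x R1_def)
qed

end


section \<open>The laws of a commutative ring, read off from annihilators\<close>

context finite_group
begin

abbreviation tensor_prod :: "(('a, 'k::field) glider \<Rightarrow>\<^sub>0 int) \<Rightarrow> (('a, 'k) glider \<Rightarrow>\<^sub>0 int) \<Rightarrow>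
    (('a, 'k) glider \<Rightarrow>\<^sub>0 int)" (infixl "\<odot>" 70)
  where "p \<odot> q \<equiv> p \<otimes>\<^bsub>free_gliders G\<^esub> q"

lemma frag_extend_fun_diff:
  "frag_extend (\<lambda>M. f M - h M) p = frag_extend f p - frag_extend h p"
  using frag_extend_fun_add[of "\<lambda>M. f M - h M" h p] by simp

lemma tensor_prod_simps:
  "(a - b) \<odot> q = a \<odot> q - b \<odot> q" "q \<odot> (a - b) = q \<odot> a - q \<odot> b"
  "0 \<odot> q = 0" "q \<odot> 0 = 0" "frag_of M \<odot> frag_of N = frag_of (glider_tensor M N)"
  by (simp_all add: free_simps frag_extend_diff frag_extend_fun_diff frag_extend_eq_0)

lemma R1_red:
  assumes "p \<in> cyclic_frags" "q \<in> cyclic_frags"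
  shows "red p \<otimes>\<^bsub>R1 G\<^esub> red q = red (p \<odot> q)" "red p \<oplus>\<^bsub>R1 G\<^esub> red q = red (p + q)"
  using red_simps(1,2)[OF assms[THEN cyclic_frags_free]] by (simp_all add: R1_simps)

lemma cls_mult:
  assumes "cyclic G X" "cyclic G Y"
  shows "cls G X \<otimes>\<^bsub>R1 G\<^esub> cls G Y = cls G (glider_tensor X Y)"
  using assms by (simp add: cls_eq R1_red cyclic_frags_closed tensor_prod_simps)

lemma chi_tensor_eqI:
  assumes "cyclic G X" "cyclic G Y" "ann G X = ann G Y" "J \<subseteq> group_alg G"
  shows "chi G J X = chi G J Y"
  using assms by (simp add: chi_cyclic)

lemma ann_tensor_comm:
  assumes "cyclic G X" "cyclic G Y"
  shows "ann G (glider_tensor X Y) = ann G (glider_tensor Y X)"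
proof -
  obtain u where u: "generates X u" using assms(1) by (rule cyclic_generates)
  obtain v where v: "generates Y v" using assms(2) by (rule cyclic_generates)
  show ?thesis
    unfolding set_eq_iff ann_tensor_iff[OF u v] ann_tensor_iff[OF v u] by (auto simp: mult.commute)
qed

lemma ann_tensor_assoc:
  assumes "cyclic G X" "cyclic G Y" "cyclic G Z"
  shows "ann G (glider_tensor (glider_tensor X Y) Z) = ann G (glider_tensor X (glider_tensor Y Z))"
proof -
  obtain u where g1: "generates X u" using assms(1) by (rule cyclic_generates)
  obtain v where g2: "generates Y v" using assms(2) by (rule cyclic_generates)
  obtain w where g3: "generates Z w" using assms(3) by (rule cyclic_generates)
  let ?P = "\<lambda>x i j k. (\<Sum>g\<in>carrier G. x g * (act X g u i * (act Y g v j * act Z g w k))) = 0"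
  have 1: "x \<in> ann G (glider_tensor (glider_tensor X Y) Z) \<longleftrightarrow> x \<in> group_alg G \<and> (\<forall>i j k. ?P x i j k)" for x
    unfolding ann_tensor_iff[OF generates_tensor[OF g1 g2] g3]
    using all_prod_decode[of "\<lambda>i j. \<forall>k. ?P x i j k"]
    by (simp add: act_generator_tensor[OF g1 g2] mult.assoc del: glider_tensor_simps cong: sum.cong)
  have 2: "x \<in> ann G (glider_tensor X (glider_tensor Y Z)) \<longleftrightarrow> x \<in> group_alg G \<and> (\<forall>i j k. ?P x i j k)" for x
    unfolding ann_tensor_iff[OF g1 generates_tensor[OF g2 g3]]
    using all_prod_decode[of "\<lambda>j k. \<forall>i. ?P x i j k"]
    by (auto simp: act_generator_tensor[OF g2 g3] mult.assoc simp del: glider_tensor_simps cong: sum.cong)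
  show ?thesis using 1 2 by blast
qed

lemma ann_tensor_unit:
  assumes "cyclic G X"
  shows "ann G (glider_tensor unit_glider X) = ann G X"
proof -
  obtain u where u: "generates X u" using assms by (rule cyclic_generates)
  show ?thesis
    unfolding set_eq_iff ann_tensor_iff[OF generates_unit u] ann_iff[OF u]
    by (auto split: if_splits)
qed

lemma ext_comm:
  assumes "p \<in> cyclic_frags" "q \<in> cyclic_frags" "J \<subseteq> group_alg G"
  shows "ext (chi G J) (p \<odot> q) = ext (chi G J) (q \<odot> p)"
proof -
  have "Poly_Mapping.keys p \<subseteq> Collect (cyclic G)" "Poly_Mapping.keys q \<subseteq> Collect (cyclic G)"
    using assms by (auto simp: cyclic_frags_def)
  then show ?thesis
  proof (induction p rule: frag_induct_supp)
    case (one X)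
    from one(2) show ?case
    proof (induction q rule: frag_induct_supp)
      case (one Y)
      then show ?case
        using \<open>X \<in> Collect (cyclic G)\<close> assms(3)
        unfolding tensor_prod_simps ext_simps mem_Collect_eq
        by (intro chi_tensor_eqI cyclic_tensor ann_tensor_comm)
    qed (simp_all add: tensor_prod_simps)
  qed (simp_all add: tensor_prod_simps)
qed

lemma ext_assoc:
  assumes "p \<in> cyclic_frags" "q \<in> cyclic_frags" "r \<in> cyclic_frags" "J \<subseteq> group_alg G"
  shows "ext (chi G J) (p \<odot> q \<odot> r) = ext (chi G J) (p \<odot> (q \<odot> r))"
proof -
  have "Poly_Mapping.keys p \<subseteq> Collect (cyclic G)" "Poly_Mapping.keys q \<subseteq> Collect (cyclic G)"
    "Poly_Mapping.keys r \<subseteq> Collect (cyclic G)"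
    using assms by (auto simp: cyclic_frags_def)
  then show ?thesis
  proof (induction p rule: frag_induct_supp)
    case (one X)
    from one(2,3) show ?case
    proof (induction q rule: frag_induct_supp)
      case (one Y)
      from one(2) show ?case
      proof (induction r rule: frag_induct_supp)
        case (one Z)
        then show ?case
          using \<open>X \<in> Collect (cyclic G)\<close> \<open>Y \<in> Collect (cyclic G)\<close> assms(4)
          unfolding tensor_prod_simps ext_simps mem_Collect_eq
          by (intro chi_tensor_eqI cyclic_tensor ann_tensor_assoc)
      qed (simp_all add: tensor_prod_simps)
    qed (simp_all add: tensor_prod_simps)
  qed (simp_all add: tensor_prod_simps)
qed

lemma ext_unit:
  assumes "p \<in> cyclic_frags" "J \<subseteq> group_alg G"
  shows "ext (chi G J) (frag_of unit_glider \<odot> p) = ext (chi G J) p"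
proof -
  have "Poly_Mapping.keys p \<subseteq> Collect (cyclic G)"
    using assms by (auto simp: cyclic_frags_def)
  then show ?thesis
  proof (induction p rule: frag_induct_supp)
    case (one X)
    then show ?case
      using assms(2)
      unfolding tensor_prod_simps ext_simps mem_Collect_eq
      by (intro chi_tensor_eqI cyclic_tensor ann_tensor_unit generates_cyclic[OF generates_unit])
  qed (simp_all add: tensor_prod_simps)
qed

text \<open>The multiplicative laws need not hold for representing combinations, but both sides have
  the same invariants, and \<open>red_eqI\<close> converts this into equality of classes. The
  additive laws are those of the reduced ring.\<close>

lemma cring_R1: "cring (R1 G :: ('a, 'k::field) glider_class ring)"
proof -
  let ?R = "R1 G :: ('a, 'k) glider_class ring"
  interpret S: bilinear_ring "reduced_ring G :: ('a, 'k) glider_class ring" by (rule bilinear_ring_reduced)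
  have sub: "x \<in> carrier (reduced_ring G)" if "x \<in> carrier ?R" for x
    using that by (auto simp: carrier_R1 carrier_reduced cyclic_frags_free)
  have u: "frag_of unit_glider \<in> (cyclic_frags :: (('a, 'k) glider \<Rightarrow>\<^sub>0 int) set)"
    using generates_cyclic[OF generates_unit] by (simp add: cyclic_frags_closed)
  have one: "\<one>\<^bsub>?R\<^esub> = red (frag_of unit_glider)" by (simp add: R1_simps red_simps)
  have add_closed: "x \<oplus>\<^bsub>?R\<^esub> y \<in> carrier ?R" if "x \<in> carrier ?R" "y \<in> carrier ?R" for x y
    using that by (auto simp: carrier_R1 R1_red cyclic_frags_closed intro!: imageI)
  have mult_closed: "x \<otimes>\<^bsub>?R\<^esub> y \<in> carrier ?R" if "x \<in> carrier ?R" "y \<in> carrier ?R" for x y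
    using that by (auto simp: carrier_R1 R1_red cyclic_frags_mult intro!: imageI)
  have comm: "x \<otimes>\<^bsub>?R\<^esub> y = y \<otimes>\<^bsub>?R\<^esub> x" if xy: "x \<in> carrier ?R" "y \<in> carrier ?R" for x y
  proof -
    obtain p q where pq: "x = red p" "y = red q" "p \<in> cyclic_frags" "q \<in> cyclic_frags"
      using xy by (auto simp: carrier_R1)
    show ?thesis
      unfolding pq(1,2) R1_red(1)[OF pq(3,4)] R1_red(1)[OF pq(4,3)]
      by (intro red_eqI cyclic_frags_mult ext_comm pq)
  qed
  have assoc: "(x \<otimes>\<^bsub>?R\<^esub> y) \<otimes>\<^bsub>?R\<^esub> z = x \<otimes>\<^bsub>?R\<^esub> (y \<otimes>\<^bsub>?R\<^esub> z)"
    if xyz: "x \<in> carrier ?R" "y \<in> carrier ?R" "z \<in> carrier ?R" for x y z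
  proof -
    obtain p q r where pqr: "x = red p" "y = red q" "z = red r"
      "p \<in> cyclic_frags" "q \<in> cyclic_frags" "r \<in> cyclic_frags"
      using xyz by (auto simp: carrier_R1)
    show ?thesis
      unfolding pqr(1-3) R1_red(1)[OF pqr(4,5)] R1_red(1)[OF pqr(5,6)]
        R1_red(1)[OF pqr(4) cyclic_frags_mult[OF pqr(5,6)]]
        R1_red(1)[OF cyclic_frags_mult[OF pqr(4,5)] pqr(6)]
      by (intro red_eqI cyclic_frags_mult ext_assoc pqr)
  qed
  have one_closed: "\<one>\<^bsub>?R\<^esub> \<in> carrier ?R" using u by (simp add: one carrier_R1)
  have l_one: "\<one>\<^bsub>?R\<^esub> \<otimes>\<^bsub>?R\<^esub> x = x" if x: "x \<in> carrier ?R" for x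
  proof -
    obtain p where p: "x = red p" "p \<in> cyclic_frags" using x by (auto simp: carrier_R1)
    show ?thesis
      unfolding p(1) one R1_red(1)[OF u p(2)]
      by (intro red_eqI cyclic_frags_mult ext_unit u p)
  qed
  show ?thesis
  proof (rule cringI)
    show "abelian_group ?R"
    proof (rule abelian_groupI)
      show "\<zero>\<^bsub>?R\<^esub> \<in> carrier ?R"
        by (auto simp: R1_simps red_simps carrier_R1 cyclic_frags_closed)
      fix x assume x: "x \<in> carrier ?R"
      then obtain p where "x = red p" "p \<in> cyclic_frags" by (auto simp: carrier_R1)
      then have "red (- p) \<in> carrier ?R" "red (- p) \<oplus>\<^bsub>?R\<^esub> x = \<zero>\<^bsub>?R\<^esub>"
        using cyclic_frags_closed(5)[of p] R1_red(2)[of "- p" p]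
        by (auto simp: carrier_R1 R1_simps red_simps)
      then show "\<exists>y\<in>carrier ?R. y \<oplus>\<^bsub>?R\<^esub> x = \<zero>\<^bsub>?R\<^esub>" by blast
      show "\<zero>\<^bsub>?R\<^esub> \<oplus>\<^bsub>?R\<^esub> x = x" using sub[OF x] by (simp add: R1_simps)
      fix y assume y: "y \<in> carrier ?R"
      show "x \<oplus>\<^bsub>?R\<^esub> y = y \<oplus>\<^bsub>?R\<^esub> x" using sub[OF x] sub[OF y] by (simp add: R1_simps S.a_comm)
      fix z assume z: "z \<in> carrier ?R"
      show "x \<oplus>\<^bsub>?R\<^esub> y \<oplus>\<^bsub>?R\<^esub> z = x \<oplus>\<^bsub>?R\<^esub> (y \<oplus>\<^bsub>?R\<^esub> z)"
        using sub[OF x] sub[OF y] sub[OF z] by (simp add: R1_simps S.a_assoc)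
    qed (rule add_closed)
    show "comm_monoid ?R"
      by (intro comm_monoidI mult_closed one_closed assoc l_one comm)
    fix x y z assume "x \<in> carrier ?R" "y \<in> carrier ?R" "z \<in> carrier ?R"
    then show "(x \<oplus>\<^bsub>?R\<^esub> y) \<otimes>\<^bsub>?R\<^esub> z = x \<otimes>\<^bsub>?R\<^esub> z \<oplus>\<^bsub>?R\<^esub> y \<otimes>\<^bsub>?R\<^esub> z"
      using sub by (simp add: R1_simps S.mult_add_left)
  qed
qed

lemma red_in_R1: "p \<in> cyclic_frags \<Longrightarrow> red p \<in> carrier (R1 G)"
  by (simp add: carrier_R1)

lemma red_diff:
  assumes "p \<in> cyclic_frags" "q \<in> (cyclic_frags :: (('a, 'k::field) glider \<Rightarrow>\<^sub>0 int) set)"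
  shows "red (p - q) = red p \<ominus>\<^bsub>R1 G\<^esub> red q"
proof -
  interpret R: cring "R1 G :: ('a, 'k) glider_class ring" by (rule cring_R1)
  have e: "red p = red (p - q) \<oplus>\<^bsub>R1 G\<^esub> red q"
    using R1_red(2)[OF cyclic_frags_closed(4)[OF assms] assms(2)] by simp
  have c: "red (p - q) \<in> carrier (R1 G)" "red q \<in> carrier (R1 G)"
    using assms by (auto simp: red_in_R1 cyclic_frags_closed)
  show ?thesis
    unfolding e a_minus_def using c by (simp add: R.a_assoc R.r_neg)
qed

end

section \<open>Permutation gliders\<close>

text \<open>\<open>coset_ann G S\<close> is the annihilator of the coset \<open>S\<close> in the permutation module on \<open>G/S\<close>.\<close>

definition coset_ann :: "('g, 'x) monoid_scheme \<Rightarrow> 'g set \<Rightarrow> ('g \<Rightarrow> 'k::field) set"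
  where "coset_ann G S = {x \<in> group_alg G. \<forall>a\<in>carrier G. (\<Sum>s\<in>S. x (a \<otimes>\<^bsub>G\<^esub> s)) = 0}"

context finite_group
begin

lemma finite_subgroup: "subgroup S G \<Longrightarrow> finite S"
  using finite_subset[OF subgroup.subset finite_carrier] .

lemma sum_right_mult: "s \<in> carrier G \<Longrightarrow> (\<Sum>g\<in>carrier G. f (g \<otimes> s)) = (\<Sum>g\<in>carrier G. f g)"
  by (rule sum.reindex_bij_witness[where i = "\<lambda>g. g \<otimes> inv s" and j = "\<lambda>g. g \<otimes> s"])
     (auto simp: m_assoc)

lemma sum_left_mult: "s \<in> carrier G \<Longrightarrow> (\<Sum>g\<in>carrier G. f (s \<otimes> g)) = (\<Sum>g\<in>carrier G. f g)"
  by (rule sum.reindex_bij_witness[where i = "\<lambda>g. inv s \<otimes> g" and j = "\<lambda>g. s \<otimes> g"])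
     (auto simp: m_assoc[symmetric])

lemma subgroup_coset_mem_iff:
  assumes "subgroup S G" "s \<in> S" "b \<in> carrier G"
  shows "b \<otimes> s \<in> S \<longleftrightarrow> b \<in> S"
proof -
  interpret S: subgroup S G by (rule assms(1))
  have "b = (b \<otimes> s) \<otimes> inv s" using assms by (simp add: m_assoc)
  then show ?thesis using assms(2) S.m_closed S.m_inv_closed by metis
qed

text \<open>Averaging over \<open>S\<close>: translating the sum by each \<open>s\<close> and adding
  up gives \<open>card S\<close> times the sum on one side, and on the other the values of
  \<open>f\<close> weighted by the sums of \<open>x\<close> over cosets, which are 0. In
  characteristic 0 the factor \<open>card S\<close> cancels.\<close>

lemma coset_ann_sum:
  fixes x f :: "'a \<Rightarrow> 'k::field_char_0"
  assumes S: "subgroup S G" and x: "x \<in> coset_ann G S"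
    and f: "\<And>g s. g \<in> carrier G \<Longrightarrow> s \<in> S \<Longrightarrow> f (g \<otimes> s) = f g"
  shows "(\<Sum>g\<in>carrier G. x g * f g) = 0"
proof -
  interpret S: subgroup S G by (rule S)
  have "of_nat (card S) * (\<Sum>g\<in>carrier G. x g * f g) = (\<Sum>s\<in>S. \<Sum>g\<in>carrier G. x g * f g)"
    by simp
  also have "\<dots> = (\<Sum>s\<in>S. \<Sum>g\<in>carrier G. x (g \<otimes> s) * f (g \<otimes> s))"
    by (intro sum.cong sum_right_mult[symmetric] refl) auto
  also have "\<dots> = (\<Sum>g\<in>carrier G. \<Sum>s\<in>S. x (g \<otimes> s) * f (g \<otimes> s))" by (rule sum.swap)
  also have "\<dots> = (\<Sum>g\<in>carrier G. (\<Sum>s\<in>S. x (g \<otimes> s)) * f g)"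
    by (simp add: f sum_distrib_right)
  also have "\<dots> = 0" using x by (simp add: coset_ann_def)
  finally show ?thesis
    using finite_subgroup[OF S] subgroup.one_closed[OF S] by (metis card_0_eq empty_iff mult_eq_0_iff of_nat_eq_0_iff)
qed

text \<open>\<open>inv a \<otimes> g \<in> S\<close> describes the coset \<open>a S\<close>; a sum
  over it becomes the pairing of \<open>x\<close> with an indicator function on the whole
  group.\<close>

lemma sum_coset_indicator:
  fixes x :: "'a \<Rightarrow> 'k::field"
  assumes S: "subgroup S G" and a: "a \<in> carrier G"
  shows "(\<Sum>s\<in>S. x (a \<otimes> s)) = (\<Sum>g\<in>carrier G. x g * (if inv a \<otimes> g \<in> S then 1 else 0))"
proof -
  interpret S: subgroup S G by (rule S)
  have "(\<Sum>g\<in>carrier G. x g * (if inv a \<otimes> g \<in> S then 1 else 0))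
      = (\<Sum>g\<in>carrier G. x (a \<otimes> g) * (if inv a \<otimes> (a \<otimes> g) \<in> S then 1 else 0))"
    by (rule sum_left_mult[OF a, symmetric])
  also have "\<dots> = (\<Sum>g\<in>carrier G. if g \<in> S then x (a \<otimes> g) else 0)"
    using a by (intro sum.cong) (auto simp: m_assoc[symmetric])
  also have "\<dots> = (\<Sum>g\<in>carrier G \<inter> S. x (a \<otimes> g))"
    by (rule sum.inter_restrict[symmetric, OF finite_carrier])
  also have "carrier G \<inter> S = S" using S.subset by auto
  finally show ?thesis by simp
qed

text \<open>\<open>g \<otimes> s\<close> and \<open>g\<close> move the coset \<open>S\<close> to the
  same coset.\<close>

lemma delta_diff_in_coset_ann:
  assumes S: "subgroup S G" and g: "g \<in> carrier G" and s: "s \<in> S"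
  shows "delta (g \<otimes> s) - delta g \<in> (coset_ann G S :: ('a \<Rightarrow> 'k::field) set)"
proof -
  have sG: "s \<in> carrier G" by (rule subgroup.mem_carrier[OF S s])
  have sum: "(\<Sum>t\<in>S. delta h (a \<otimes> t)) = (if inv a \<otimes> h \<in> S then 1 else 0 :: 'k)"
    if "a \<in> carrier G" "h \<in> carrier G" for a h
  proof -
    have "(\<Sum>t\<in>S. delta h (a \<otimes> t)) = (\<Sum>g\<in>carrier G. delta h g * (if inv a \<otimes> g \<in> S then 1 else 0 :: 'k))"
      by (rule sum_coset_indicator[OF S that(1)])
    also have "\<dots> = (\<Sum>g\<in>carrier G. if g = h then (if inv a \<otimes> g \<in> S then 1 else 0) else 0)"
      by (intro sum.cong) (auto simp: delta_def)
    finally show ?thesis using that finite_carrier by simp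
  qed
  have "inv a \<otimes> (g \<otimes> s) \<in> S \<longleftrightarrow> inv a \<otimes> g \<in> S" if "a \<in> carrier G" for a
    using subgroup_coset_mem_iff[OF S s, of "inv a \<otimes> g"] that g sG by (simp add: m_assoc)
  moreover have "delta (g \<otimes> s) - delta g \<in> (group_alg G :: ('a \<Rightarrow> 'k) set)"
    using g sG by (intro fn.subspace_diff[OF subspace_group_alg] delta_in_group_alg) auto
  ultimately show ?thesis
    using g sG by (auto simp: coset_ann_def minus_apply sum_subtractf sum)
qed

text \<open>For the forward direction \<open>delta p - delta \<one>\<close> is the test element.
  Conversely, the indicator of a coset of \<open>L\<close> is invariant under right multiplication
  by \<open>P\<close>, so \<open>coset_ann_sum\<close> applies to it.\<close>

lemma coset_ann_subset_iff:
  assumes P: "subgroup P G" and L: "subgroup L G"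
  shows "(coset_ann G P :: ('a \<Rightarrow> 'k::field_char_0) set) \<subseteq> coset_ann G L \<longleftrightarrow> P \<subseteq> L"
proof
  assume sub: "(coset_ann G P :: ('a \<Rightarrow> 'k) set) \<subseteq> coset_ann G L"
  show "P \<subseteq> L"
  proof
    fix p assume p: "p \<in> P"
    then have pG: "p \<in> carrier G" by (rule subgroup.mem_carrier[OF P])
    have LG: "\<And>s. s \<in> L \<Longrightarrow> s \<in> carrier G" by (rule subgroup.mem_carrier[OF L])
    have "delta p - delta \<one> \<in> (coset_ann G L :: ('a \<Rightarrow> 'k) set)"
      using delta_diff_in_coset_ann[OF P one_closed p, where ?'k = 'k] sub pG by auto
    then have "(\<Sum>s\<in>L. (delta p - delta \<one> :: 'a \<Rightarrow> 'k) (\<one> \<otimes> s)) = 0"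
      unfolding coset_ann_def using one_closed by blast
    moreover have "(\<Sum>s\<in>L. (delta p - delta \<one> :: 'a \<Rightarrow> 'k) (\<one> \<otimes> s))
        = (\<Sum>s\<in>L. delta p s :: 'k) - (\<Sum>s\<in>L. delta \<one> s)"
      using LG by (simp add: minus_apply sum_subtractf[symmetric] cong: sum.cong)
    moreover have "(\<Sum>s\<in>L. delta h s) = (if h \<in> L then 1 else 0 :: 'k)" for h
      using finite_subgroup[OF L] by (simp add: delta_def)
    ultimately show "p \<in> L"
      using subgroup.one_closed[OF L] by (auto split: if_splits)
  qed
next
  assume PL: "P \<subseteq> L"
  show "(coset_ann G P :: ('a \<Rightarrow> 'k) set) \<subseteq> coset_ann G L"
  proof
    fix x :: "'a \<Rightarrow> 'k" assume x: "x \<in> coset_ann G P"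
    have "(\<Sum>s\<in>L. x (a \<otimes> s)) = 0" if a: "a \<in> carrier G" for a
      unfolding sum_coset_indicator[OF L a]
    proof (rule coset_ann_sum[OF P x])
      fix g s assume g: "g \<in> carrier G" and "s \<in> P"
      then have s: "s \<in> L" using PL by auto
      then have "s \<in> carrier G" by (rule subgroup.mem_carrier[OF L])
      then show "(if inv a \<otimes> (g \<otimes> s) \<in> L then 1 else 0 :: 'k) = (if inv a \<otimes> g \<in> L then 1 else 0)"
        using subgroup_coset_mem_iff[OF L s, of "inv a \<otimes> g"] a g by (simp add: m_assoc)
    qed
    then show "x \<in> coset_ann G L" using x by (auto simp: coset_ann_def)
  qed
qed

lemma coset_ann_subset: "coset_ann G S \<subseteq> group_alg G"
  by (auto simp: coset_ann_def)

lemma act_generator_invariant: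
  assumes X: "generates X u" and S: "subgroup S G" and ann: "coset_ann G S \<subseteq> ann G X"
    and g: "g \<in> carrier G" and s: "s \<in> S"
  shows "act X (g \<otimes> s) u = act X g u"
proof -
  have gs: "g \<otimes> s \<in> carrier G" using g subgroup.mem_carrier[OF S s] by simp
  have "delta (g \<otimes> s) - delta g \<in> ann G X"
    using delta_diff_in_coset_ann[OF S g s] ann by auto
  then have "alg_act G X (delta (g \<otimes> s) - delta g) u = 0"
    using generates_in[OF X] by (simp add: ann_def)
  moreover have "alg_act G X (delta (g \<otimes> s) - delta g) u + alg_act G X (delta g) u = alg_act G X (delta (g \<otimes> s)) u"
    by (simp flip: alg_act_linear_left(1))
  ultimately show ?thesis
    by (simp add: alg_act_delta[OF finite_carrier g] alg_act_delta[OF finite_carrier gs])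
qed

text \<open>The class is that of the line through the coset \<open>S\<close> in
  \<open>K[G/S]\<close>. Only the annihilator is recorded, since it determines the class of a cyclic
  glider.\<close>

definition perm_glider :: "('a, 'k::field) glider \<Rightarrow> 'a set \<Rightarrow> bool"
  where "perm_glider X S \<longleftrightarrow> cyclic G X \<and> subgroup S G \<and> ann G X = coset_ann G S"

text \<open>One inclusion holds because products of coordinates are right invariant under
  \<open>S \<inter> L\<close>. For the other, \<open>x\<close> times a coordinate of
  \<open>v\<close> lies in the annihilator of \<open>X\<close>; summing over \<open>a S\<close>
  shows that the restriction \<open>y\<close> of \<open>x\<close> to \<open>a S\<close> annihilates
  \<open>v\<close>, and summing \<open>y\<close> over \<open>a L\<close> leaves the coset
  \<open>a (S \<inter> L)\<close>.\<close>

lemma perm_glider_tensor: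
  fixes X Y :: "('a, 'k::field_char_0) glider"
  assumes X: "perm_glider X S" and Y: "perm_glider Y L"
  shows "perm_glider (glider_tensor X Y) (S \<inter> L)"
proof -
  have S: "subgroup S G" "ann G X = coset_ann G S" "cyclic G X"
    and L: "subgroup L G" "ann G Y = coset_ann G L" "cyclic G Y"
    using X Y by (auto simp: perm_glider_def)
  obtain u where u: "generates X u" using S(3) by (rule cyclic_generates)
  obtain v where v: "generates Y v" using L(3) by (rule cyclic_generates)
  have SL: "subgroup (S \<inter> L) G" by (rule subgroups_Inter_pair[OF S(1) L(1)])
  have inv: "act X (g \<otimes> s) u = act X g u" if "g \<in> carrier G" "s \<in> S" for g s
    using act_generator_invariant[OF u S(1)] S(2) that by simp
  have inv': "act Y (g \<otimes> s) v = act Y g v" if "g \<in> carrier G" "s \<in> L" for g s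
    using act_generator_invariant[OF v L(1)] L(2) that by simp
  have "x \<in> ann G (glider_tensor X Y) \<longleftrightarrow> x \<in> coset_ann G (S \<inter> L)" for x
  proof
    assume x: "x \<in> coset_ann G (S \<inter> L)"
    then have "(\<Sum>g\<in>carrier G. x g * (act X g u i * act Y g v j)) = 0" for i j
      by (rule coset_ann_sum[OF SL]) (simp add: inv inv')
    then show "x \<in> ann G (glider_tensor X Y)"
      using x by (auto simp: ann_tensor_iff[OF u v] coset_ann_def)
  next
    assume x: "x \<in> ann G (glider_tensor X Y)"
    then have xG: "x \<in> group_alg G" by (simp add: ann_def)
    have "(\<Sum>s\<in>S \<inter> L. x (a \<otimes> s)) = 0" if a: "a \<in> carrier G" for a
    proof -
      define y where "y g = x g * (if g \<in> carrier G \<and> inv a \<otimes> g \<in> S then 1 else 0)" for g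
      have "(\<Sum>g\<in>carrier G. y g * act Y g v j) = 0" for j
      proof -
        have "(\<lambda>g. x g * act Y g v j) \<in> ann G X"
          using x xG by (simp add: ann_tensor_iff[OF u v] ann_iff[OF u] group_alg_def mult_ac)
        then have "(\<Sum>s\<in>S. x (a \<otimes> s) * act Y (a \<otimes> s) v j) = 0"
          using a by (simp add: S(2) coset_ann_def)
        then have "(\<Sum>g\<in>carrier G. x g * act Y g v j * (if inv a \<otimes> g \<in> S then 1 else 0)) = 0"
          using sum_coset_indicator[OF S(1) a, of "\<lambda>g. x g * act Y g v j"] by simp
        moreover have "(\<Sum>g\<in>carrier G. y g * act Y g v j)
            = (\<Sum>g\<in>carrier G. x g * act Y g v j * (if inv a \<otimes> g \<in> S then 1 else 0))"
          by (intro sum.cong) (auto simp: y_def)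
        ultimately show ?thesis by simp
      qed
      moreover have "y \<in> group_alg G" by (simp add: y_def group_alg_def)
      ultimately have "y \<in> coset_ann G L" by (simp add: L(2)[symmetric] ann_iff[OF v])
      then have "(\<Sum>s\<in>L. y (a \<otimes> s)) = 0" using a by (simp add: coset_ann_def)
      moreover have "(\<Sum>s\<in>L. y (a \<otimes> s)) = (\<Sum>s\<in>L. if s \<in> S then x (a \<otimes> s) else 0)"
        using a subgroup.mem_carrier[OF L(1)] by (intro sum.cong) (auto simp: y_def m_assoc[symmetric])
      moreover have "\<dots> = (\<Sum>s\<in>L \<inter> S. x (a \<otimes> s))"
        by (rule sum.inter_restrict[symmetric, OF finite_subgroup[OF L(1)]])
      ultimately show ?thesis by (simp add: Int_commute)
    qed
    then show "x \<in> coset_ann G (S \<inter> L)" using xG by (simp add: coset_ann_def)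
  qed
  then show ?thesis
    using S L SL cyclic_tensor[of X Y] by (auto simp: perm_glider_def)
qed

text \<open>If the class of \<open>X\<close> is idempotent, then \<open>ann G X\<close> is closed under multiplication by the
  coordinate functions of \<open>u\<close>, hence under multiplication by the indicator functions of the cosets
  of the stabilizer of \<open>u\<close>, which are polynomials in them.\<close>

lemma idempotent_perm_glider:
  fixes X :: "('a, 'k::field_char_0) glider"
  assumes X: "cyclic G X" and idem: "ann G (glider_tensor X X) = ann G X"
  obtains S where "perm_glider X S"
proof -
  obtain u where u: "generates X u" using X by (rule cyclic_generates)
  have gX: "is_glider G X" using u by (simp add: generates_def)
  have mod: "is_module G X" by (rule is_gliderD(1)[OF gX])
  note us = generates_in(2)[OF u]
  define S where "S = {g \<in> carrier G. act X g u = u}"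
  have one: "act X \<one> u = u" by (rule is_moduleD(4)[OF mod us])
  have mult: "act X (g \<otimes> h) u = act X g (act X h u)" if "g \<in> carrier G" "h \<in> carrier G" for g h
    by (rule is_moduleD(5)[OF mod that us])
  have S: "subgroup S G"
  proof (rule subgroupI)
    show "S \<subseteq> carrier G" "S \<noteq> {}" using one by (auto simp: S_def)
    show "inv a \<in> S" if "a \<in> S" for a
      using that mult[of "inv a" a] one by (simp add: S_def)
    show "a \<otimes> b \<in> S" if "a \<in> S" "b \<in> S" for a b
      using that mult[of a b] by (simp add: S_def)
  qed
  let ?f = "\<lambda>i g. act X g u i"
  have closed: "(\<lambda>g. x g * ?f j g) \<in> ann G X" if x: "x \<in> ann G X" for x j
  proof -
    have "x \<in> ann G (glider_tensor X X)" using x idem by simp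
    then show ?thesis
      by (simp add: ann_tensor_iff[OF u u] ann_iff[OF u] group_alg_def mult.assoc)
  qed
  have lin: "(\<lambda>g. x g * (c * p g + d * q g)) \<in> ann G X"
    if "(\<lambda>g. x g * p g) \<in> ann G X" "(\<lambda>g. x g * q g) \<in> ann G X" for x p q and c d :: 'k
  proof -
    have "(\<Sum>g\<in>carrier G. x g * (c * p g + d * q g) * ?f i g)
        = c * (\<Sum>g\<in>carrier G. x g * p g * ?f i g) + d * (\<Sum>g\<in>carrier G. x g * q g * ?f i g)" for i
      by (simp add: sum_distrib_left sum.distrib algebra_simps)
    moreover have "x g * (c * p g + d * q g) = 0" if "g \<notin> carrier G" for g
    proof -
      have "x g * (c * p g + d * q g) = c * (x g * p g) + d * (x g * q g)" by (simp add: algebra_simps)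
      then show ?thesis
        using that \<open>(\<lambda>g. x g * p g) \<in> ann G X\<close> \<open>(\<lambda>g. x g * q g) \<in> ann G X\<close>
        by (auto simp: ann_def group_alg_def)
    qed
    ultimately show ?thesis using that unfolding ann_iff[OF u] group_alg_def by simp
  qed
  have inv: "act X (g \<otimes> s) u = act X g u" if "g \<in> carrier G" "s \<in> S" for g s
    using that mult[of g s] by (simp add: S_def)
  have "coset_ann G S \<subseteq> ann G X"
  proof
    fix x :: "'a \<Rightarrow> 'k" assume x: "x \<in> coset_ann G S"
    have "(\<Sum>g\<in>carrier G. x g * ?f i g) = 0" for i
      by (rule coset_ann_sum[OF S x]) (simp add: inv)
    then show "x \<in> ann G X" using x by (simp add: ann_iff[OF u] coset_ann_def)
  qed
  moreover have "ann G X \<subseteq> coset_ann G S"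
  proof
    fix x assume x: "x \<in> ann G X"
    have "(\<Sum>s\<in>S. x (a \<otimes> s)) = 0" if a: "a \<in> carrier G" for a
    proof -
      have undo: "act X (inv a) (act X a u) = u"
        using mult[of "inv a" a] one a by simp
      have "act X a u \<noteq> 0"
      proof
        assume "act X a u = 0"
        then have "u = act X (inv a) 0" using undo by simp
        also have "\<dots> = 0"
          using a by (intro linear_on_zero[OF is_moduleD(3)[OF mod]] is_moduleD(1)[OF mod]) auto
        finally show False using u by (simp add: generates_def)
      qed
      then obtain i0 where i0: "?f i0 a \<noteq> 0" by (auto simp: fun_eq_iff zero_fun_apply)
      have sep: "\<exists>p. p a \<noteq> 0 \<and> p b = 0 \<and> (\<forall>g\<in>carrier G. \<forall>s\<in>S. p (g \<otimes> s) = p g) \<and>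
          (\<forall>y\<in>ann G X. (\<lambda>g. y g * p g) \<in> ann G X)"
        if b: "b \<in> carrier G" "inv a \<otimes> b \<notin> S" for b
      proof -
        have "act X b u \<noteq> act X a u"
        proof
          assume "act X b u = act X a u"
          then have "act X (inv a \<otimes> b) u = u"
            using mult[of "inv a" b] undo a b by simp
          then show False using a b by (simp add: S_def)
        qed
        then obtain i where i: "?f i b \<noteq> ?f i a" by (auto simp: fun_eq_iff)
        have two: "(\<lambda>g. y g * (c * (?f j g * ?f k g) + d * ?f l g)) \<in> ann G X"
          if "y \<in> ann G X" for y j k l and c d :: 'k
          using closed[OF closed[OF that], of j k] closed[OF that, of l]
          by (intro lin) (simp_all add: mult.assoc)
        have one': "(\<lambda>g. y g * (c * ?f k g + d * ?f l g)) \<in> ann G X"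
          if "y \<in> ann G X" for y k l and c d :: 'k
          by (rule lin[OF closed[OF that] closed[OF that]])
        \<comment> \<open>The coordinate \<open>i\<close> distinguishes \<open>a\<close> from
          \<open>b\<close>. If it vanishes at \<open>a\<close>, it is combined with the coordinate
          \<open>i0\<close>, which does not; otherwise \<open>f (f - f b)\<close>, with
          \<open>f\<close> the coordinate \<open>i\<close>, vanishes at \<open>b\<close> and not at
          \<open>a\<close>.\<close>
        show ?thesis
        proof (cases "?f i a = 0")
          case True
          let ?p = "\<lambda>g. ?f i b * ?f i0 g + (- ?f i0 b) * ?f i g"
          have "?p a \<noteq> 0" "?p b = 0" using True i i0 by auto
          moreover have "\<forall>g\<in>carrier G. \<forall>s\<in>S. ?p (g \<otimes> s) = ?p g" by (simp add: inv)
          moreover have "\<forall>y\<in>ann G X. (\<lambda>g. y g * ?p g) \<in> ann G X" by (intro ballI one')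
          ultimately show ?thesis by (intro exI[of _ ?p] conjI)
        next
          case False
          let ?p = "\<lambda>g. 1 * (?f i g * ?f i g) + (- ?f i b) * ?f i g"
          have "?p a = ?f i a * (?f i a - ?f i b)" by (simp add: algebra_simps)
          then have "?p a \<noteq> 0" "?p b = 0" using False i by auto
          moreover have "\<forall>g\<in>carrier G. \<forall>s\<in>S. ?p (g \<otimes> s) = ?p g" by (simp add: inv)
          moreover have "\<forall>y\<in>ann G X. (\<lambda>g. y g * ?p g) \<in> ann G X" by (intro ballI two)
          ultimately show ?thesis by (intro exI[of _ ?p] conjI)
        qed
      qed
      \<comment> \<open>The product of the separating functions over all points outside
        \<open>a S\<close> is supported on this coset, where it is a nonzero constant.\<close>
      have prod: "\<exists>p. p a \<noteq> 0 \<and> (\<forall>b\<in>B. p b = 0) \<and> (\<forall>g\<in>carrier G. \<forall>s\<in>S. p (g \<otimes> s) = p g) \<and>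
          (\<forall>y\<in>ann G X. (\<lambda>g. y g * p g) \<in> ann G X)"
        if "finite B" "B \<subseteq> {b \<in> carrier G. inv a \<otimes> b \<notin> S}" for B
        using that
      proof (induction B)
        case empty
        show ?case by (rule exI[of _ "\<lambda>_. 1"]) simp
      next
        case (insert b B)
        then obtain p where p: "p a \<noteq> 0" "\<forall>b\<in>B. p b = 0" "\<forall>g\<in>carrier G. \<forall>s\<in>S. p (g \<otimes> s) = p g"
          "\<forall>y\<in>ann G X. (\<lambda>g. y g * p g) \<in> ann G X" by auto
        obtain q where q: "q a \<noteq> 0" "q b = 0" "\<forall>g\<in>carrier G. \<forall>s\<in>S. q (g \<otimes> s) = q g"
          "\<forall>y\<in>ann G X. (\<lambda>g. y g * q g) \<in> ann G X" using sep[of b] insert.prems by auto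
        have "(\<lambda>g. y g * (p g * q g)) \<in> ann G X" if "y \<in> ann G X" for y
          using bspec[OF q(4) bspec[OF p(4) that]] by (simp add: mult.assoc)
        then show ?case
          using p q by (intro exI[of _ "\<lambda>g. p g * q g"]) auto
      qed
      obtain p where p: "p a \<noteq> 0" "\<forall>b\<in>{b \<in> carrier G. inv a \<otimes> b \<notin> S}. p b = 0"
        "\<forall>g\<in>carrier G. \<forall>s\<in>S. p (g \<otimes> s) = p g" "\<forall>y\<in>ann G X. (\<lambda>g. y g * p g) \<in> ann G X"
        using prod[of "{b \<in> carrier G. inv a \<otimes> b \<notin> S}"] finite_carrier by auto
      \<comment> \<open>On \<open>a S\<close> both \<open>p\<close> and the coordinate
        \<open>i0\<close> are constant, and off it \<open>p\<close> vanishes. Up to a nonzero factor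
        the coset sum of \<open>x\<close> is therefore the pairing of \<open>x\<close> times
        \<open>p\<close>, an element of the annihilator, with a coordinate function.\<close>
      have "(\<Sum>s\<in>S. x (a \<otimes> s)) * (p a * ?f i0 a)
          = (\<Sum>s\<in>S. x (a \<otimes> s) * p (a \<otimes> s) * ?f i0 (a \<otimes> s))"
        using a p(3) by (simp add: inv sum_distrib_right mult.assoc)
      also have "\<dots> = (\<Sum>g\<in>carrier G. (x g * p g * ?f i0 g) * (if inv a \<otimes> g \<in> S then 1 else 0))"
        using sum_coset_indicator[OF S a, of "\<lambda>g. x g * p g * ?f i0 g"] by simp
      also have "\<dots> = (\<Sum>g\<in>carrier G. (x g * p g) * ?f i0 g)"
        using p(2) by (intro sum.cong) auto
      also have "\<dots> = 0"
        using bspec[OF p(4) x] by (simp add: ann_iff[OF u])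
      finally show ?thesis using p(1) i0 by simp
    qed
    then show "x \<in> coset_ann G S" using x by (auto simp: coset_ann_def ann_def)
  qed
  ultimately have "perm_glider X S" using X S by (auto simp: perm_glider_def)
  then show thesis using that by blast
qed

text \<open>\<open>marks r f\<close>: \<open>r\<close> is a combination of classes of permutation gliders, and \<open>f\<close> is its table of marks.\<close>

definition marks :: "('a, 'k::field_char_0) glider_class \<Rightarrow> ('a set \<Rightarrow> int) \<Rightarrow> bool"
  where "marks r f \<longleftrightarrow> (\<exists>p. Poly_Mapping.keys p \<subseteq> {X. \<exists>S. perm_glider X S} \<and> red p = r \<and>
    (\<forall>P. subgroup P G \<longrightarrow> ext (chi G (coset_ann G P)) p = f P))"

lemma perm_frags_cyclic: "Poly_Mapping.keys p \<subseteq> {X. \<exists>S. perm_glider X S} \<Longrightarrow> p \<in> cyclic_frags"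
  by (auto simp: cyclic_frags_def perm_glider_def)

text \<open>This is \<open>coset_ann_subset_iff\<close> in terms of invariants. The marks are
  indexed by subgroups rather than conjugacy classes because the glider remembers the point
  \<open>S\<close> of \<open>G/S\<close>.\<close>

lemma chi_perm_glider:
  fixes X :: "('a, 'k::field_char_0) glider"
  assumes "perm_glider X S" "subgroup P G"
  shows "chi G (coset_ann G P) X = (if P \<subseteq> S then 1 else 0)"
proof -
  have "(coset_ann G P :: ('a \<Rightarrow> 'k) set) \<subseteq> coset_ann G S \<longleftrightarrow> P \<subseteq> S"
    using assms by (intro coset_ann_subset_iff) (auto simp: perm_glider_def)
  then show ?thesis
    using assms by (simp add: perm_glider_def chi_cyclic coset_ann_subset)
qed

lemma marks_perm_glider: "perm_glider X S \<Longrightarrow> marks (cls G X) (\<lambda>P. if P \<subseteq> S then 1 else 0)"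
  unfolding marks_def by (rule exI[of _ "frag_of X"]) (auto simp: cls_eq chi_perm_glider)

lemma marks_in_R1: "marks r f \<Longrightarrow> r \<in> carrier (R1 G)"
  unfolding marks_def using perm_frags_cyclic red_in_R1 by blast

lemma marks_cong: "marks r f \<Longrightarrow> (\<And>P. subgroup P G \<Longrightarrow> f P = h P) \<Longrightarrow> marks r h"
  unfolding marks_def by metis

lemma marks_minus:
  fixes r s :: "('a, 'k::field_char_0) glider_class"
  assumes "marks r f" "marks s h"
  shows "marks (r \<ominus>\<^bsub>R1 G\<^esub> s) (\<lambda>P. f P - h P)"
proof -
  let ?B = "{X :: ('a, 'k) glider. \<exists>S. perm_glider X S}"
  obtain p where p: "Poly_Mapping.keys p \<subseteq> ?B" "red p = r"
      "\<forall>P. subgroup P G \<longrightarrow> ext (chi G (coset_ann G P)) p = f P"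
    using assms(1) unfolding marks_def by blast
  obtain q where q: "Poly_Mapping.keys q \<subseteq> ?B" "red q = s"
      "\<forall>P. subgroup P G \<longrightarrow> ext (chi G (coset_ann G P)) q = h P"
    using assms(2) unfolding marks_def by blast
  have "Poly_Mapping.keys (p - q) \<subseteq> ?B"
    using p(1) q(1) keys_diff[of p q] by blast
  moreover have "red (p - q) = r \<ominus>\<^bsub>R1 G\<^esub> s"
    using red_diff[OF perm_frags_cyclic[OF p(1)] perm_frags_cyclic[OF q(1)]] p(2) q(2) by simp
  ultimately show ?thesis
    unfolding marks_def using p(3) q(3) by (intro exI[of _ "p - q"]) simp
qed

text \<open>On generators the claim is that \<open>P\<close> lies in \<open>S \<inter> L\<close>
  exactly when it lies in \<open>S\<close> and in \<open>L\<close>; both sides are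
  biadditive.\<close>

lemma marks_mult:
  fixes r s :: "('a, 'k::field_char_0) glider_class"
  assumes "marks r f" "marks s h"
  shows "marks (r \<otimes>\<^bsub>R1 G\<^esub> s) (\<lambda>P. f P * h P)"
proof -
  let ?B = "{X :: ('a, 'k) glider. \<exists>S. perm_glider X S}"
  obtain p where p: "Poly_Mapping.keys p \<subseteq> ?B" "red p = r"
      "\<forall>P. subgroup P G \<longrightarrow> ext (chi G (coset_ann G P)) p = f P"
    using assms(1) unfolding marks_def by blast
  obtain q where q: "Poly_Mapping.keys q \<subseteq> ?B" "red q = s"
      "\<forall>P. subgroup P G \<longrightarrow> ext (chi G (coset_ann G P)) q = h P"
    using assms(2) unfolding marks_def by blast
  have "Poly_Mapping.keys (p \<odot> q) \<subseteq> ?B \<and> (\<forall>P. subgroup P G \<longrightarrow>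
    ext (chi G (coset_ann G P)) (p \<odot> q) = ext (chi G (coset_ann G P)) p * ext (chi G (coset_ann G P)) q)"
    using p(1)
  proof (induction p rule: frag_induct_supp)
    case (one X)
    from q(1) show ?case
    proof (induction q rule: frag_induct_supp)
      case (one Y)
      then obtain S L where "perm_glider X S" "perm_glider Y L" using \<open>X \<in> ?B\<close> by auto
      then show ?case
        using perm_glider_tensor[of X S Y L]
        by (auto simp: tensor_prod_simps chi_perm_glider)
    next
      case (diff a b)
      then show ?case
        using keys_diff[of "frag_of X \<odot> a" "frag_of X \<odot> b"]
        by (auto simp: tensor_prod_simps algebra_simps)
    qed (simp_all add: tensor_prod_simps)
  next
    case (diff a b)
    then show ?case
      using keys_diff[of "a \<odot> q" "b \<odot> q"]
      by (auto simp: tensor_prod_simps algebra_simps)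
  qed (simp_all add: tensor_prod_simps)
  moreover have "red (p \<odot> q) = r \<otimes>\<^bsub>R1 G\<^esub> s"
    using R1_red(1)[OF perm_frags_cyclic[OF p(1)] perm_frags_cyclic[OF q(1)]] p(2) q(2) by simp
  ultimately show ?thesis
    unfolding marks_def using p(3) q(3) by (intro exI[of _ "p \<odot> q"]) simp
qed

text \<open>Every annihilator occurring in the representing combination is a
  \<open>coset_ann\<close>, and \<open>red_eq_zero\<close> asks for the invariants only at the
  annihilators that occur, where they are values of \<open>f\<close>.\<close>

lemma marks_zero_iff:
  fixes r :: "('a, 'k::field_char_0) glider_class"
  assumes "marks r f"
  shows "r = \<zero>\<^bsub>R1 G\<^esub> \<longleftrightarrow> (\<forall>P. subgroup P G \<longrightarrow> f P = 0)"
proof -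
  obtain p where p: "Poly_Mapping.keys p \<subseteq> {X :: ('a, 'k) glider. \<exists>S. perm_glider X S}" "red p = r"
      "\<forall>P. subgroup P G \<longrightarrow> ext (chi G (coset_ann G P)) p = f P"
    using assms unfolding marks_def by blast
  have pc: "p \<in> cyclic_frags" by (rule perm_frags_cyclic[OF p(1)])
  have zero: "\<zero>\<^bsub>R1 G\<^esub> = red (0 :: ('a, 'k) glider \<Rightarrow>\<^sub>0 int)" by (simp add: R1_simps red_simps)
  show ?thesis
  proof
    assume "r = \<zero>\<^bsub>R1 G\<^esub>"
    then have "red p = red 0" using zero p(2) by simp
    then have "ext (chi G (coset_ann G P)) p = ext (chi G (coset_ann G P)) 0" for P
      using ext_chi_red[OF coset_ann_subset[of P] cyclic_frags_free[OF pc] cyclic_frags_free, of 0]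
      by (simp add: cyclic_frags_closed)
    then show "\<forall>P. subgroup P G \<longrightarrow> f P = 0" using p(3) by simp
  next
    assume f: "\<forall>P. subgroup P G \<longrightarrow> f P = 0"
    have "red p = red 0"
    proof (rule red_eq_zero[OF pc])
      fix M assume "M \<in> Poly_Mapping.keys p"
      then obtain S where S: "perm_glider M S" using p(1) by auto
      then show "ext (chi G (ann G M)) p = 0" using f p(3) by (simp add: perm_glider_def)
    qed
    then show "r = \<zero>\<^bsub>R1 G\<^esub>" using zero p(2) by simp
  qed
qed

end


section \<open>Restriction\<close>

text \<open>The hypothesis on \<open>chi\<close> is an adjunction; by \<open>red_eqI\<close> it makes \<open>F\<close> well defined on classes.\<close>

lemma class_hom_exists:
  fixes A B :: "('g, 'x) monoid_scheme" and F :: "('g, 'k::field) glider \<Rightarrow> ('g, 'k) glider"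
  assumes A: "finite_group A" and B: "finite_group B"
    and F: "\<And>X. cyclic A X \<Longrightarrow> cyclic B (F X)"
    and adj: "\<And>J. J \<subseteq> group_alg B \<Longrightarrow> adj J \<subseteq> group_alg A"
    and chi: "\<And>J X. J \<subseteq> group_alg B \<Longrightarrow> cyclic A X \<Longrightarrow> chi B J (F X) = chi A (adj J) X"
  obtains \<phi> where "\<phi> \<in> hom (add_monoid (R1 A)) (add_monoid (R1 B))"
    and "\<And>X. cyclic A X \<Longrightarrow> \<phi> (cls A X) = cls B (F X)"
proof -
  interpret A: finite_group A by (rule A)
  interpret B: finite_group B by (rule B)
  let ?F = "frag_extend (\<lambda>X. frag_of (F X))"
  have F_cyc: "?F p \<in> B.cyclic_frags" if "p \<in> A.cyclic_frags" for p
    using that keys_frag_extend[of "\<lambda>X. frag_of (F X)" p] F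
    by (fastforce simp: A.cyclic_frags_def B.cyclic_frags_def)
  have wd: "B.red (?F p) = B.red (?F q)"
    if p: "p \<in> A.cyclic_frags" and q: "q \<in> A.cyclic_frags" and eq: "A.red p = A.red q" for p q
  proof (rule B.red_eqI[OF F_cyc[OF p] F_cyc[OF q]])
    fix J :: "('g \<Rightarrow> 'k) set" assume J: "J \<subseteq> group_alg B"
    have ext: "ext (chi B J) (?F r) = ext (chi A (adj J)) r" if "r \<in> A.cyclic_frags" for r
      unfolding ext_frag_extend using that chi[OF J]
      by (intro ext_cong) (auto simp: A.cyclic_frags_def)
    show "ext (chi B J) (?F p) = ext (chi B J) (?F q)"
      unfolding ext[OF p] ext[OF q]
      by (rule A.ext_chi_red[OF adj[OF J] A.cyclic_frags_free[OF p] A.cyclic_frags_free[OF q] eq])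
  qed
  define \<phi> where "\<phi> r = B.red (?F (SOME p. p \<in> A.cyclic_frags \<and> A.red p = r))" for r
  have \<phi>: "\<phi> (A.red p) = B.red (?F p)" if p: "p \<in> A.cyclic_frags" for p
  proof -
    have "(SOME q. q \<in> A.cyclic_frags \<and> A.red q = A.red p) \<in> A.cyclic_frags \<and>
        A.red (SOME q. q \<in> A.cyclic_frags \<and> A.red q = A.red p) = A.red p"
      by (rule someI[of _ p]) (use p in simp)
    then show ?thesis unfolding \<phi>_def by (intro wd p) auto
  qed
  show thesis
  proof (rule that[of \<phi>])
    show "\<phi> \<in> hom (add_monoid (R1 A)) (add_monoid (R1 B))"
    proof (rule homI)
      fix x assume "x \<in> carrier (add_monoid (R1 A :: ('g, 'k) glider_class ring))"
      then obtain p where p: "x = A.red p" "p \<in> A.cyclic_frags" by (auto simp: A.carrier_R1)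
      then show "\<phi> x \<in> carrier (add_monoid (R1 B))"
        using B.red_in_R1[OF F_cyc[OF p(2)]] \<phi> by simp
      fix y assume "y \<in> carrier (add_monoid (R1 A :: ('g, 'k) glider_class ring))"
      then obtain q where q: "y = A.red q" "q \<in> A.cyclic_frags" by (auto simp: A.carrier_R1)
      show "\<phi> (x \<otimes>\<^bsub>add_monoid (R1 A)\<^esub> y) = \<phi> x \<otimes>\<^bsub>add_monoid (R1 B)\<^esub> \<phi> y"
        using A.R1_red(2)[OF p(2) q(2)] B.R1_red(2)[OF F_cyc[OF p(2)] F_cyc[OF q(2)]]
          \<phi>[OF p(2)] \<phi>[OF q(2)] \<phi>[OF A.cyclic_frags_closed(3)[OF p(2) q(2)]]
        by (simp add: p(1) q(1) frag_extend_add)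
    qed
    show "\<phi> (cls A X) = cls B (F X)" if "cyclic A X" for X
      using \<phi>[of "frag_of X"] that by (simp add: A.cls_eq B.cls_eq A.cyclic_frags_closed)
  qed
qed

context finite_group
begin

lemma finite_group_sub:
  assumes "subgroup H G"
  shows "finite_group (sub G H)"
  using subgroup_imp_group[OF assms] finite_subgroup[OF assms]
  by (simp add: finite_group_def finite_group_axioms_def)

lemma finite_dim_group_alg: "finite_dim (group_alg G :: ('a \<Rightarrow> 'k::field) set)"
proof -
  have "x \<in> fn.span (delta ` carrier G)" if "x \<in> group_alg G" for x :: "'a \<Rightarrow> 'k"
  proof -
    have "x = (\<Sum>g\<in>carrier G. smul (x g) (delta g))"
    proof
      fix a
      have "(\<Sum>g\<in>carrier G. smul (x g) (delta g)) a = (\<Sum>g\<in>carrier G. if g = a then x g else 0)"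
        unfolding sum_fun_apply by (intro sum.cong) (auto simp: smul_apply delta_def)
      then show "x a = (\<Sum>g\<in>carrier G. smul (x g) (delta g)) a"
        using that finite_carrier by (simp add: group_alg_def)
    qed
    moreover have "(\<Sum>g\<in>carrier G. smul (x g) (delta g)) \<in> fn.span (delta ` carrier G)"
      by (intro fn.span_sum fn.span_scale fn.span_base imageI)
    ultimately show ?thesis by simp
  qed
  then show ?thesis
    using finite_dim_subspace[OF finite_dim_span[of "delta ` carrier G"] subspace_group_alg[of G]]
      finite_carrier by blast
qed

lemma alg_act_sub:
  assumes H: "subgroup H G" and x: "x \<in> group_alg (sub G H)"
  shows "alg_act (sub G H) M x m = alg_act G M x m"
  unfolding alg_act_def
  by (rule sum.mono_neutral_left)
    (use x finite_carrier subgroup.subset[OF H] in \<open>auto simp: group_alg_def\<close>)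

lemma group_alg_sub: "subgroup H G \<Longrightarrow> group_alg (sub G H) \<subseteq> group_alg G"
  using subgroup.subset[of H G] by (auto simp: group_alg_def)

lemma is_glider_sub:
  assumes H: "subgroup H G" and M: "is_glider G M"
  shows "is_glider (sub G H) M"
proof -
  have fin: "finite (carrier (sub G H))" using finite_subgroup[OF H] by simp
  show ?thesis
    using M subgroup.mem_carrier[OF H]
    unfolding is_glider_iff[OF fin] is_glider_iff[OF finite_carrier] is_module_def by auto
qed

lemma cyclic_sub: "subgroup H G \<Longrightarrow> cyclic G X \<Longrightarrow> cyclic (sub G H) X"
  by (simp add: cyclic_def is_glider_sub)

lemma ann_sub: "subgroup H G \<Longrightarrow> ann (sub G H) X = ann G X \<inter> group_alg (sub G H)"
  using group_alg_sub[of H] by (auto simp: ann_def alg_act_sub)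

text \<open>The glider \<open>X\<close> viewed over \<open>H\<close> is again cyclic, and for
  \<open>J\<close> inside \<open>K[H]\<close> the killed vectors are the same, so
  \<open>class_hom_exists\<close> applies with the identity. Any map allowed by the choice in
  \<open>Res\<close> agrees with it, since cyclic classes have irreducible representatives.\<close>

lemma Res_cls:
  fixes X :: "('a, 'k::field) glider"
  assumes H: "subgroup H G" and X: "cyclic G X"
  shows "Res G H (cls G X) = cls (sub G H) X"
proof -
  interpret K: finite_group "sub G H" by (rule finite_group_sub[OF H])
  define P where "P \<phi> \<longleftrightarrow> \<phi> \<in> hom (add_monoid (R1 G)) (add_monoid (R1 (sub G H))) \<and>
    (\<forall>X :: ('a, 'k) glider. irreducible_glider G X \<longrightarrow> \<phi> (cls G X) = cls (sub G H) (restricted G H X))" for \<phi>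
  have sub: "cyclic (sub G H) X" if "cyclic G X" for X :: "('a, 'k) glider"
    by (rule cyclic_sub[OF H that])
  have "chi (sub G H) J X = chi G J X" if "J \<subseteq> group_alg (sub G H)" "cyclic G X"
    for J and X :: "('a, 'k) glider"
  proof -
    have "J \<subseteq> group_alg G" using that(1) group_alg_sub[OF H] by blast
    then show ?thesis
      using that(1) by (simp add: chi_cyclic[OF that(2)] chi_cyclic[OF sub[OF that(2)]] ann_sub[OF H])
  qed
  then obtain \<phi> where \<phi>: "\<phi> \<in> hom (add_monoid (R1 G)) (add_monoid (R1 (sub G H)))"
    "\<And>X :: ('a, 'k) glider. cyclic G X \<Longrightarrow> \<phi> (cls G X) = cls (sub G H) X"
    using class_hom_exists[of G "sub G H" "\<lambda>X :: ('a, 'k) glider. X" "\<lambda>J. J"]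
      finite_group_axioms K.finite_group_axioms sub group_alg_sub[OF H]
    by (metis (no_types, lifting) subset_trans)
  have restr: "cls (sub G H) (restricted G H X) = cls (sub G H) X" if "cyclic G X"
    for X :: "('a, 'k) glider"
    unfolding restricted_def by (rule K.cls_shrink[OF sub[OF that]])
  have "P \<phi>"
    unfolding P_def
  proof (intro conjI allI impI \<phi>(1))
    fix X :: "('a, 'k) glider" assume "irreducible_glider G X"
    then have c: "cyclic G X" by (rule irreducible_imp_cyclic)
    show "\<phi> (cls G X) = cls (sub G H) (restricted G H X)" unfolding \<phi>(2)[OF c] restr[OF c] ..
  qed
  then have "P (SOME \<phi>. P \<phi>)" by (rule someI[of P])
  then have "P (Res G H)" unfolding Res_def P_def .
  then have "Res G H (cls G Y) = cls (sub G H) Y" if "irreducible_glider G Y" for Y :: "('a, 'k) glider"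
    using restr[OF irreducible_imp_cyclic[OF that]] that by (simp add: P_def)
  moreover note irr = irreducible_shrink[OF finite_carrier is_group X]
  ultimately have "Res G H (cls G X) = cls (sub G H) (X\<lparr>lev0 := alg_span G X (lev1 X)\<rparr>)"
    using cls_shrink[OF X] by metis
  also have "\<dots> = cls (sub G H) X"
    using K.cls_eq_iff[OF sub[OF irreducible_imp_cyclic[OF irr]] sub[OF X]] by simp
  finally show ?thesis .
qed

text \<open>For \<open>a\<close> outside \<open>H\<close> the coset \<open>a S\<close> misses
  \<open>H\<close>, off which \<open>x\<close> vanishes; only the cosets inside \<open>H\<close>
  give conditions.\<close>

lemma coset_ann_sub:
  assumes H: "subgroup H G" and S: "subgroup S G" "S \<subseteq> H"
  shows "coset_ann (sub G H) S = (coset_ann G S :: ('a \<Rightarrow> 'k::field) set) \<inter> group_alg (sub G H)"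
proof -
  interpret H: subgroup H G by (rule H)
  have "(\<Sum>s\<in>S. x (a \<otimes> s)) = 0"
    if x: "x \<in> group_alg (sub G H)" and z: "\<forall>a\<in>H. (\<Sum>s\<in>S. x (a \<otimes> s)) = 0" and a: "a \<in> carrier G"
    for x :: "'a \<Rightarrow> 'k" and a
  proof (cases "a \<in> H")
    case False
    have "a \<otimes> s \<notin> H" if "s \<in> S" for s
      using subgroup_coset_mem_iff[OF H, of s a] that S(2) a False by auto
    then show ?thesis using x by (simp add: group_alg_def)
  qed (use z in simp)
  then show ?thesis
    using group_alg_sub[OF H] by (auto simp: coset_ann_def)
qed

lemma perm_glider_sub:
  fixes X :: "('a, 'k::field) glider"
  assumes H: "subgroup H G" and X: "perm_glider X S" and S: "S \<subseteq> H"
  shows "finite_group.perm_glider (sub G H) X S"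
proof -
  interpret K: finite_group "sub G H" by (rule finite_group_sub[OF H])
  have "subgroup S G" using X by (simp add: perm_glider_def)
  then show ?thesis
    using X S cyclic_sub[OF H, of X] subgroup_incl[OF _ H S]
    by (simp add: K.perm_glider_def perm_glider_def ann_sub[OF H] coset_ann_sub[OF H])
qed

end

section \<open>Induction\<close>

locale induction_data = finite_group G for G (structure) +
  fixes H :: "'a set" and X :: "('a, 'k::field_char_0) glider" and u :: "nat \<Rightarrow> 'k"
  assumes H: "subgroup H G" and X: "irreducible_glider (sub G H) X"
    and u: "u \<noteq> 0" "lev1 X = fn.span {u}"
begin

sublocale H: subgroup H G by (rule H)

sublocale K: finite_group "sub G H" by (rule finite_group_sub[OF H])

abbreviation "V \<equiv> lev0 X"

lemma gX: "is_glider (sub G H) X"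
  using X by (simp add: irreducible_glider_def)

lemma mod: "is_module (sub G H) X"
  by (rule is_gliderD(1)[OF gX])

lemma subV: "fn.subspace V" "V \<subseteq> space X" "finite_dim V"
  using is_gliderD[OF gX] by auto

lemma uV: "u \<in> V" "u \<in> lev1 X"
  using u fn.span_base[of u "{u}"] is_gliderD(6)[OF gX] by auto

lemma V_eq: "V = alg_span (sub G H) X (lev1 X)"
  using X by (simp add: irreducible_glider_def)

lemma act_simps:
  assumes "v \<in> space X"
  shows "act X \<one> v = v" and "h \<in> H \<Longrightarrow> k \<in> H \<Longrightarrow> act X (h \<otimes> k) v = act X h (act X k v)"
    and "h \<in> H \<Longrightarrow> act X h (smul c v) = smul c (act X h v)"
  using is_moduleD(4)[OF mod assms] is_moduleD(5)[OF mod _ _ assms]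
    linear_on_smul[OF is_moduleD(3)[OF mod, of h] assms] by auto

text \<open>\<open>lev0\<close> of a glider need not be stable under the action. Here irreducibility
  makes it the module generated by \<open>lev1\<close>, so \<open>V\<close> is a representation of
  \<open>H\<close>.\<close>

lemma act_V: "h \<in> H \<Longrightarrow> v \<in> V \<Longrightarrow> act X h v \<in> V"
proof -
  assume h: "h \<in> H" and v: "v \<in> V"
  have "fn.subspace {v \<in> space X. act X h v \<in> V}"
    using h by (intro subspace_linear_on_vimage subV is_moduleD[OF mod]) auto
  moreover have "act X g m \<in> space X \<and> act X h (act X g m) \<in> V" if g: "g \<in> H" and m: "m \<in> lev1 X" for g m
  proof -
    have mX: "m \<in> space X" using m is_gliderD(8)[OF gX] by auto
    have "act X h (act X g m) = act X (h \<otimes> g) m" using act_simps(2)[OF mX h g] by simp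
    then show ?thesis
      using is_gliderD(9)[OF gX K.finite_carrier, of "h \<otimes> g" m] h g m is_moduleD(2)[OF mod, of g m] mX by simp
  qed
  ultimately have "alg_span (sub G H) X (lev1 X) \<subseteq> {v \<in> space X. act X h v \<in> V}"
    using alg_span_subset_iff[OF K.finite_carrier, of "{v \<in> space X. act X h v \<in> V}" X "lev1 X"] by simp
  then have "V \<subseteq> {v \<in> space X. act X h v \<in> V}" using V_eq by simp
  then show "act X h v \<in> V" using v by blast
qed

lemma act_lin: "h \<in> H \<Longrightarrow> linear_on V (act X h)"
  using linear_on_subset[OF is_moduleD(3)[OF mod] subV(2)] by simp

text \<open>\<open>K[G] \<otimes> V\<close> as the space of functions from the group to
  \<open>V\<close>, so that membership becomes a pointwise condition.\<close>

definition TV :: "('a \<times> nat \<Rightarrow> 'k) set"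
  where "TV = {w. \<forall>g. (\<lambda>i. w (g, i)) \<in> V \<and> (g \<notin> carrier G \<longrightarrow> (\<lambda>i. w (g, i)) = 0)}"

lemma TV_expand:
  assumes "w \<in> TV"
  shows "w = (\<Sum>g\<in>carrier G. tens (delta g) (\<lambda>i. w (g, i)))"
proof
  fix p :: "'a \<times> nat"
  obtain a i where p: "p = (a, i)" by fastforce
  have "(\<Sum>g\<in>carrier G. tens (delta g) (\<lambda>i. w (g, i))) (a, i) = (\<Sum>g\<in>carrier G. if g = a then w (g, i) else 0)"
    unfolding sum_fun_apply by (intro sum.cong) (auto simp: tens_def delta_def)
  also have "\<dots> = w (a, i)"
    using assms finite_carrier by (auto simp: TV_def fun_eq_iff zero_fun_apply)
  finally show "w p = (\<Sum>g\<in>carrier G. tens (delta g) (\<lambda>i. w (g, i))) p" by (simp add: p)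
qed

lemma tens_TV: "x \<in> group_alg G \<Longrightarrow> v \<in> V \<Longrightarrow> tens x v \<in> TV"
proof -
  assume x: "x \<in> group_alg G" and v: "v \<in> V"
  have "(\<lambda>i. tens x v (g, i)) = smul (x g) v" for g by (simp add: tens_def smul_def)
  then show ?thesis
    using x fn.subspace_scale[OF subV(1) v] by (simp add: TV_def group_alg_def)
qed

lemma subspace_TV: "fn.subspace TV"
proof (rule fn.subspaceI)
  have *: "(\<lambda>i. (0 :: 'a \<times> nat \<Rightarrow> 'k) (g, i)) = 0" "(\<lambda>i. (v + w) (g, i)) = (\<lambda>i. v (g, i)) + (\<lambda>i. w (g, i))"
    "(\<lambda>i. smul c v (g, i)) = smul c (\<lambda>i. v (g, i))" for g c and v w :: "'a \<times> nat \<Rightarrow> 'k"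
    by (auto simp: fun_eq_iff fun_simps)
  show "0 \<in> TV" by (simp add: TV_def * fn.subspace_0[OF subV(1)])
  show "v + w \<in> TV" if "v \<in> TV" "w \<in> TV" for v w
    using that by (simp add: TV_def * fn.subspace_add[OF subV(1)])
  show "smul c v \<in> TV" if "v \<in> TV" for c v
    using that by (simp add: TV_def * fn.subspace_scale[OF subV(1)])
qed

lemma tens_space_eq: "tens_space (group_alg G) V = TV"
proof
  show "tens_space (group_alg G) V \<subseteq> TV"
    unfolding tens_space_def using tens_TV by (intro fn.span_minimal subspace_TV) auto
  show "TV \<subseteq> tens_space (group_alg G) V"
  proof
    fix w assume w: "w \<in> TV"
    show "w \<in> tens_space (group_alg G) V"
      by (subst TV_expand[OF w], intro fn.subspace_sum subspace_tens_space tens_in_tens_space delta_in_group_alg)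
        (use w in \<open>auto simp: TV_def\<close>)
  qed
qed

text \<open>The map \<open>x \<otimes> v \<mapsto> (a \<mapsto> \<Sum>h. x (a h) h v)\<close> from \<open>K[G] \<otimes> V\<close> to the \<open>V\<close>-valued functions on \<open>G\<close>;
  its kernel is spanned by the balancing relations.\<close>

definition avg :: "('a \<times> nat \<Rightarrow> 'k) \<Rightarrow> 'a \<times> nat \<Rightarrow> 'k"
  where "avg w = (\<lambda>(a, i). if a \<in> carrier G then (\<Sum>h\<in>H. act X h (\<lambda>j. w (a \<otimes> h, j))) i else 0)"

lemma avg_linear: "linear_on TV avg"
proof (rule linear_onI)
  fix v w assume vw: "v \<in> TV" "w \<in> TV"
  have "act X h (\<lambda>j. (v + w) (g, j)) = act X h (\<lambda>j. v (g, j)) + act X h (\<lambda>j. w (g, j))" if "h \<in> H" for h g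
  proof -
    have "(\<lambda>j. (v + w) (g, j)) = (\<lambda>j. v (g, j)) + (\<lambda>j. w (g, j))" by (auto simp: fun_eq_iff fun_simps)
    then show ?thesis using linear_on_add[OF act_lin[OF that]] vw by (simp add: TV_def)
  qed
  then show "avg (v + w) = avg v + avg w"
    by (auto simp: avg_def fun_eq_iff fun_simps sum_fun_apply sum.distrib)
next
  fix c v assume v: "v \<in> TV"
  have "act X h (\<lambda>j. smul c v (g, j)) = smul c (act X h (\<lambda>j. v (g, j)))" if "h \<in> H" for h g
  proof -
    have "(\<lambda>j. smul c v (g, j)) = smul c (\<lambda>j. v (g, j))" by (auto simp: fun_eq_iff fun_simps)
    then show ?thesis using linear_on_smul[OF act_lin[OF that]] v by (simp add: TV_def)
  qed
  then show "avg (smul c v) = smul c (avg v)"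
    by (auto simp: avg_def fun_eq_iff fun_simps sum_fun_apply sum_distrib_left)
qed

lemma avg_tens:
  assumes "v \<in> V"
  shows "avg (tens x v) = (\<lambda>(a, i). if a \<in> carrier G then (\<Sum>h\<in>H. x (a \<otimes> h) * act X h v i) else 0)"
proof -
  have "act X h (\<lambda>j. tens x v (g, j)) = smul (x g) (act X h v)" if "h \<in> H" for h g
  proof -
    have "(\<lambda>j. tens x v (g, j)) = smul (x g) v" by (simp add: tens_def smul_def)
    then show ?thesis using linear_on_smul[OF act_lin[OF that] assms] by simp
  qed
  then show ?thesis
    by (auto simp: avg_def fun_eq_iff sum_fun_apply smul_apply)
qed

lemma conv_delta_left: "g \<in> carrier G \<Longrightarrow> conv G (delta g) x = (\<lambda>a. if a \<in> carrier G then x (inv g \<otimes> a) else 0 :: 'k)"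
proof
  fix a assume g: "g \<in> carrier G"
  have "(\<Sum>b\<in>carrier G. delta g b * x (inv b \<otimes> a)) = (\<Sum>b\<in>carrier G. if b = g then x (inv b \<otimes> a) else 0)"
    by (intro sum.cong) (auto simp: delta_def)
  then show "conv G (delta g) x a = (if a \<in> carrier G then x (inv g \<otimes> a) else 0)"
    using g finite_carrier by (simp add: conv_def)
qed

lemma conv_delta_delta:
  "g \<in> carrier G \<Longrightarrow> h \<in> carrier G \<Longrightarrow> conv G (delta g) (delta h) = (delta (g \<otimes> h) :: 'a \<Rightarrow> 'k)"
  by (subst conv_delta_left) (auto simp: delta_def fun_eq_iff inv_solve_left' m_assoc[symmetric])

lemma conv_closed: "(conv G x y :: 'a \<Rightarrow> 'k) \<in> group_alg G"
  by (simp add: conv_def group_alg_def)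

text \<open>The right-hand side at \<open>a\<close> is a double sum over \<open>H\<close>.
  Substituting \<open>k\<close> for \<open>h \<otimes> k\<close> produces the convolution, in which
  \<open>y\<close>, being supported on \<open>H\<close>, confines the sum over the group to the
  coset \<open>a H\<close>.\<close>

lemma avg_balanced:
  fixes x y :: "'a \<Rightarrow> 'k"
  assumes x: "x \<in> group_alg G" and y: "y \<in> group_alg (sub G H)" and v: "v \<in> V"
  shows "avg (tens (conv G x y) v) = avg (tens x (alg_act (sub G H) X y v))"
proof -
  have yv: "alg_act (sub G H) X y v \<in> V"
    by (rule alg_act_in_subspace[OF subV(1)]) (use act_V v in auto)
  have vX: "v \<in> space X" using v subV by auto
  have "(\<Sum>h\<in>H. conv G x y (a \<otimes> h) * act X h v i)
      = (\<Sum>h\<in>H. x (a \<otimes> h) * act X h (alg_act (sub G H) X y v) i)" if a: "a \<in> carrier G" for a i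
  proof -
    have "act X h (alg_act (sub G H) X y v) = (\<Sum>k\<in>H. smul (y k) (act X (h \<otimes> k) v))" if h: "h \<in> H" for h
    proof -
      have "act X h (alg_act (sub G H) X y v) = (\<Sum>k\<in>H. act X h (smul (y k) (act X k v)))"
        unfolding alg_act_def
        using linear_on_sum[OF act_lin[OF h] subV(1), of H "\<lambda>k. smul (y k) (act X k v)"] act_V v
        by (simp add: fn.subspace_scale[OF subV(1)])
      also have "\<dots> = (\<Sum>k\<in>H. smul (y k) (act X (h \<otimes> k) v))"
      proof (rule sum.cong)
        fix k assume k: "k \<in> H"
        have "act X k v \<in> space X" using act_V[OF k v] subV by auto
        then show "act X h (smul (y k) (act X k v)) = smul (y k) (act X (h \<otimes> k) v)"
          using act_simps(3)[of "act X k v" h "y k"] act_simps(2)[OF vX h k] h by simp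
      qed simp
      finally show ?thesis .
    qed
    then have "(\<Sum>h\<in>H. x (a \<otimes> h) * act X h (alg_act (sub G H) X y v) i)
        = (\<Sum>h\<in>H. \<Sum>k\<in>H. x (a \<otimes> h) * (y k * act X (h \<otimes> k) v i))"
      by (simp add: sum_fun_apply smul_apply sum_distrib_left)
    also have "\<dots> = (\<Sum>h\<in>H. \<Sum>k\<in>H. x (a \<otimes> h) * (y (inv h \<otimes> k) * act X k v i))"
    proof (rule sum.cong)
      fix h assume h: "h \<in> H"
      have inv: "inv\<^bsub>sub G H\<^esub> h = inv h" using H h by (rule m_inv_consistent)
      show "(\<Sum>k\<in>H. x (a \<otimes> h) * (y k * act X (h \<otimes> k) v i))
          = (\<Sum>k\<in>H. x (a \<otimes> h) * (y (inv h \<otimes> k) * act X k v i))"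
        by (rule sum.reindex_bij_witness[where i = "\<lambda>k. inv h \<otimes> k" and j = "\<lambda>k. h \<otimes> k"])
          (use h in \<open>auto simp: m_assoc[symmetric]\<close>)
    qed simp
    also have "\<dots> = (\<Sum>k\<in>H. (\<Sum>h\<in>H. x (a \<otimes> h) * y (inv h \<otimes> k)) * act X k v i)"
      by (subst sum.swap) (simp add: sum_distrib_right mult.assoc)
    also have "\<dots> = (\<Sum>k\<in>H. conv G x y (a \<otimes> k) * act X k v i)"
    proof (rule sum.cong)
      fix k assume k: "k \<in> H"
      have "conv G x y (a \<otimes> k) = (\<Sum>b\<in>carrier G. x b * y (inv b \<otimes> (a \<otimes> k)))"
        using a k by (simp add: conv_def)
      also have "\<dots> = (\<Sum>b\<in>carrier G. x (a \<otimes> b) * y (inv (a \<otimes> b) \<otimes> (a \<otimes> k)))"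
        by (rule sum_left_mult[OF a, symmetric])
      also have "\<dots> = (\<Sum>b\<in>carrier G. x (a \<otimes> b) * y (inv b \<otimes> k))"
      proof (rule sum.cong)
        fix b assume b: "b \<in> carrier G"
        have "inv (a \<otimes> b) \<otimes> (a \<otimes> k) = inv b \<otimes> k"
          using a b k by (simp add: inv_mult_group m_assoc) (simp add: m_assoc[symmetric])
        then show "x (a \<otimes> b) * y (inv (a \<otimes> b) \<otimes> (a \<otimes> k)) = x (a \<otimes> b) * y (inv b \<otimes> k)" by simp
      qed simp
      also have "\<dots> = (\<Sum>h\<in>H. x (a \<otimes> h) * y (inv h \<otimes> k))"
      proof (rule sum.mono_neutral_right)
        show "\<forall>b\<in>carrier G - H. x (a \<otimes> b) * y (inv b \<otimes> k) = 0"
        proof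
          fix b assume b: "b \<in> carrier G - H"
          then have "inv b \<notin> H" using H.m_inv_closed[of "inv b"] by auto
          then have "inv b \<otimes> k \<notin> H" using subgroup_coset_mem_iff[OF H k, of "inv b"] b by simp
          then show "x (a \<otimes> b) * y (inv b \<otimes> k) = 0" using y by (simp add: group_alg_def)
        qed
      qed (use finite_carrier H.subset in auto)
      finally show "(\<Sum>h\<in>H. x (a \<otimes> h) * y (inv h \<otimes> k)) * act X k v i = conv G x y (a \<otimes> k) * act X k v i"
        by simp
    qed simp
    finally show ?thesis by simp
  qed
  then show ?thesis
    by (auto simp: avg_tens[OF v] avg_tens[OF yv] fun_eq_iff)
qed

text \<open>For \<open>w\<close> in the kernel, the balancing relations with
  \<open>x = delta (g \<otimes> inv h)\<close>, \<open>y = delta h\<close> and vector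
  \<open>w(g, _)\<close> are added over all \<open>g\<close> and \<open>h\<close>. Their first terms
  give \<open>card H\<close> times \<open>w\<close>; the second terms, reindexed by
  \<open>g \<mapsto> g \<otimes> h\<close>, collect the values of \<open>avg w\<close> and vanish.
  Dividing by \<open>card H\<close> finishes.\<close>

lemma kernel_avg: "{w \<in> TV. avg w = 0} = balance_relations G H X"
proof
  let ?S = "{tens (conv G x y) v - tens x (alg_act (sub G H) X y v) |x y v.
    x \<in> group_alg G \<and> y \<in> group_alg (sub G H) \<and> v \<in> V}"
  have sub: "fn.subspace {w \<in> TV. avg w \<in> {0}}"
    by (intro subspace_linear_on_vimage avg_linear subspace_TV fn.subspace_single_0)
  have "?S \<subseteq> {w \<in> TV. avg w \<in> {0}}"
  proof clarify
    fix x y :: "'a \<Rightarrow> 'k" and v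
    assume x: "x \<in> group_alg G" and y: "y \<in> group_alg (sub G H)" and v: "v \<in> V"
    have yv: "alg_act (sub G H) X y v \<in> V"
      by (rule alg_act_in_subspace[OF subV(1)]) (use act_V v in auto)
    have t: "tens (conv G x y) v \<in> TV" "tens x (alg_act (sub G H) X y v) \<in> TV"
      using tens_TV[OF conv_closed v] tens_TV[OF x yv] by auto
    show "tens (conv G x y) v - tens x (alg_act (sub G H) X y v) \<in> TV \<and>
        avg (tens (conv G x y) v - tens x (alg_act (sub G H) X y v)) \<in> {0}"
      using fn.subspace_diff[OF subspace_TV t] linear_on_diff[OF avg_linear subspace_TV t]
        avg_balanced[OF x y v] by simp
  qed
  then show "balance_relations G H X \<subseteq> {w \<in> TV. avg w = 0}"
    unfolding balance_relations_def using fn.span_minimal[OF _ sub] by simp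
  show "{w \<in> TV. avg w = 0} \<subseteq> balance_relations G H X"
  proof clarify
    fix w assume w: "w \<in> TV" and avg: "avg w = 0"
    let ?w = "\<lambda>g i. w (g, i)"
    have wV: "?w g \<in> V" for g using w by (simp add: TV_def)
    have B: "fn.subspace (balance_relations G H X)" by (simp add: balance_relations_def)
    have rel: "tens (delta g) (?w g) - tens (delta (g \<otimes> inv h)) (act X h (?w g)) \<in> balance_relations G H X"
      if g: "g \<in> carrier G" and h: "h \<in> H" for g h
    proof -
      have "conv G (delta (g \<otimes> inv h)) (delta h) = (delta g :: 'a \<Rightarrow> 'k)"
        using g h by (simp add: conv_delta_delta m_assoc)
      moreover have "alg_act (sub G H) X (delta h) (?w g) = act X h (?w g)"
        using h by (intro alg_act_delta K.finite_carrier) simp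
      ultimately have "tens (delta g) (?w g) - tens (delta (g \<otimes> inv h)) (act X h (?w g)) \<in> ?S"
        using delta_in_group_alg[of "g \<otimes> inv h" G] delta_in_group_alg[of h "sub G H"] g h wV[of g]
        by (intro CollectI exI[of _ "delta (g \<otimes> inv h)"] exI[of _ "delta h"] exI[of _ "?w g"]) auto
      then show ?thesis unfolding balance_relations_def by (rule fn.span_base)
    qed
    have "(\<Sum>h\<in>H. \<Sum>g\<in>carrier G. tens (delta (g \<otimes> inv h)) (act X h (?w g)))
        = (\<Sum>h\<in>H. \<Sum>g\<in>carrier G. tens (delta g) (act X h (?w (g \<otimes> h))))"
    proof (rule sum.cong)
      fix h assume h: "h \<in> H"
      show "(\<Sum>g\<in>carrier G. tens (delta (g \<otimes> inv h)) (act X h (?w g)))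
          = (\<Sum>g\<in>carrier G. tens (delta g) (act X h (?w (g \<otimes> h))))"
        using sum_right_mult[of h "\<lambda>g. tens (delta (g \<otimes> inv h)) (act X h (?w g))", symmetric] h
        by (simp add: m_assoc cong: sum.cong)
    qed simp
    also have "\<dots> = (\<Sum>g\<in>carrier G. tens (delta g) (\<Sum>h\<in>H. act X h (?w (g \<otimes> h))))"
    proof (subst sum.swap, rule sum.cong)
      fix g assume "g \<in> carrier G"
      have "linear_on UNIV (tens (delta g :: 'a \<Rightarrow> 'k) :: (nat \<Rightarrow> 'k) \<Rightarrow> _)"
        by (simp add: linear_on_def tens_add_right tens_smul_right)
      from linear_on_sum[OF this, of H "\<lambda>h. act X h (?w (g \<otimes> h))"]
      show "(\<Sum>h\<in>H. tens (delta g) (act X h (?w (g \<otimes> h)))) = tens (delta g) (\<Sum>h\<in>H. act X h (?w (g \<otimes> h)))"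
        by simp
    qed simp
    also have "\<dots> = 0"
    proof (rule sum.neutral, rule ballI)
      fix g assume g: "g \<in> carrier G"
      have "(\<Sum>h\<in>H. act X h (?w (g \<otimes> h))) i = 0 i" for i
        using fun_cong[OF avg, of "(g, i)"] g by (simp add: avg_def zero_fun_apply)
      then have "(\<Sum>h\<in>H. act X h (?w (g \<otimes> h))) = 0" by (rule ext)
      then show "tens (delta g) (\<Sum>h\<in>H. act X h (?w (g \<otimes> h))) = (0 :: 'a \<times> nat \<Rightarrow> 'k)" by simp
    qed
    finally have 0: "(\<Sum>h\<in>H. \<Sum>g\<in>carrier G. tens (delta (g \<otimes> inv h)) (act X h (?w g))) = 0" .
    have "(\<Sum>h\<in>H. \<Sum>g\<in>carrier G. tens (delta g) (?w g) - tens (delta (g \<otimes> inv h)) (act X h (?w g)))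
        \<in> balance_relations G H X"
      by (intro fn.subspace_sum[OF B] rel)
    then have "(\<Sum>h\<in>H. \<Sum>g\<in>carrier G. tens (delta g) (?w g)) \<in> balance_relations G H X"
      by (simp add: sum_subtractf 0)
    then have m: "(\<Sum>h\<in>H. w) \<in> balance_relations G H X"
      unfolding TV_expand[OF w, symmetric] .
    have e: "(\<Sum>h\<in>H. w) = smul (of_nat (card H)) w"
      by (rule ext) (simp add: sum_fun_apply smul_apply)
    have "smul (inverse (of_nat (card H))) (smul (of_nat (card H)) w) \<in> balance_relations G H X"
      by (rule fn.subspace_scale[OF B m[unfolded e]])
    moreover have "of_nat (card H) \<noteq> (0 :: 'k)"
      using finite_subgroup[OF H] H.one_closed by (metis card_0_eq empty_iff of_nat_eq_0_iff)
    ultimately show "w \<in> balance_relations G H X" by simp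
  qed
qed

text \<open>An arbitrary numbering of the group: spaces of modules consist of functions on the
  naturals, so functions on pairs of a group element and a natural have to be recoded.\<close>

definition index :: "'a \<Rightarrow> nat"
  where "index = (SOME f. inj_on f (carrier G))"

lemma inj_index: "inj_on index (carrier G)"
  unfolding index_def
  using finite_imp_inj_to_nat_seg[OF finite_carrier] by (metis (mono_tags, lifting) someI)

definition pack :: "('a \<times> nat \<Rightarrow> 'k) \<Rightarrow> nat \<Rightarrow> 'k"
  where "pack f = (\<lambda>n. case prod_decode n of (k, i) \<Rightarrow>
    if k \<in> index ` carrier G then f (inv_into (carrier G) index k, i) else 0)"

definition unpack :: "(nat \<Rightarrow> 'k) \<Rightarrow> 'a \<times> nat \<Rightarrow> 'k"
  where "unpack y = (\<lambda>(a, i). if a \<in> carrier G then y (prod_encode (index a, i)) else 0)"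

lemma linear_pack: "linear_on W pack" and linear_unpack: "linear_on W' unpack"
  by (auto simp: linear_on_def pack_def unpack_def fun_eq_iff fun_simps split: prod.split)

lemma unpack_pack:
  assumes "\<And>a i. a \<notin> carrier G \<Longrightarrow> f (a, i) = 0"
  shows "unpack (pack f) = f"
  using assms by (auto simp: unpack_def pack_def fun_eq_iff inv_into_f_f[OF inj_index])

text \<open>Left translation by \<open>g\<close>, which is the action on
  \<open>K[G] \<otimes> V\<close> through the first factor.\<close>

definition shift :: "'a \<Rightarrow> ('a \<times> nat \<Rightarrow> 'k) \<Rightarrow> 'a \<times> nat \<Rightarrow> 'k"
  where "shift g w = (\<lambda>(a, i). if a \<in> carrier G then w (inv g \<otimes> a, i) else 0)"

lemma linear_shift: "linear_on W (shift g)"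
  by (auto simp: linear_on_def shift_def fun_eq_iff fun_simps)

lemma unpack_pack_avg: "unpack (pack (avg w)) = avg w"
  by (rule unpack_pack) (simp add: avg_def)

lemma shift_TV: "w \<in> TV \<Longrightarrow> shift g w \<in> TV"
proof -
  assume w: "w \<in> TV"
  have "(\<lambda>i. shift g w (a, i)) = (if a \<in> carrier G then (\<lambda>i. w (inv g \<otimes> a, i)) else 0)" for a
    by (simp add: shift_def fun_eq_iff zero_fun_apply)
  then show ?thesis using w fn.subspace_0[OF subV(1)] by (simp add: TV_def)
qed

lemma shift_avg:
  assumes "g \<in> carrier G"
  shows "shift g (avg w) = avg (shift g w)"
  using assms by (auto simp: shift_def avg_def fun_eq_iff m_assoc intro!: sum.cong)

lemma shift_one: "w \<in> TV \<Longrightarrow> shift \<one> w = w"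
  by (auto simp: shift_def TV_def fun_eq_iff zero_fun_apply)

lemma shift_mult:
  "g \<in> carrier G \<Longrightarrow> h \<in> carrier G \<Longrightarrow> shift (g \<otimes> h) w = shift g (shift h w)"
  by (auto simp: shift_def fun_eq_iff inv_mult_group m_assoc)

lemma shift_tens:
  "g \<in> carrier G \<Longrightarrow> shift g (tens x v) = tens (conv G (delta g) x) v"
  by (auto simp: shift_def tens_def conv_delta_left fun_eq_iff)

abbreviation ind_map :: "('a \<times> nat \<Rightarrow> 'k) \<Rightarrow> nat \<Rightarrow> 'k"
  where "ind_map w \<equiv> pack (avg w)"

text \<open>The quotient by the balancing relations is realized as the image of \<open>avg\<close>,
  whose kernel they span.\<close>

definition ind_glider :: "('a, 'k) glider"
  where "ind_glider = \<lparr>space = ind_map ` TV, act = \<lambda>g y. pack (shift g (unpack y)),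
    lev0 = ind_map ` TV, lev1 = (\<lambda>v. ind_map (tens (delta \<one>) v)) ` lev1 X\<rparr>"

lemma ind_glider_simps [simp]:
  "space ind_glider = ind_map ` TV" "lev0 ind_glider = ind_map ` TV"
  "lev1 ind_glider = (\<lambda>v. ind_map (tens (delta \<one>) v)) ` lev1 X"
  "act ind_glider g y = pack (shift g (unpack y))"
  by (simp_all add: ind_glider_def)

lemma linear_ind_map: "linear_on TV ind_map"
  by (rule linear_on_compose[OF avg_linear linear_pack subset_UNIV])

lemma act_ind_map: "g \<in> carrier G \<Longrightarrow> act ind_glider g (ind_map w) = ind_map (shift g w)"
  by (simp add: unpack_pack_avg shift_avg)

lemma is_glider_ind: "is_glider G ind_glider"
proof -
  have one: "\<one> \<in> carrier G" by simp
  have mod: "is_module G ind_glider"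
    unfolding is_module_def
  proof (intro conjI ballI)
    show "fn.subspace (space ind_glider)"
      using subspace_linear_on_image[OF linear_ind_map subspace_TV] by simp
    fix g assume g: "g \<in> carrier G"
    show "act ind_glider g ` space ind_glider \<subseteq> space ind_glider"
    proof clarify
      fix y assume "y \<in> space ind_glider"
      then obtain w where "w \<in> TV" "y = ind_map w" by auto
      then show "act ind_glider g y \<in> space ind_glider"
        using act_ind_map[OF g, of w] shift_TV[of w g] by simp
    qed
    have "linear_on UNIV (\<lambda>y. pack (shift g (unpack y)))"
      by (rule linear_on_compose[OF linear_on_compose[OF linear_unpack linear_shift subset_UNIV]
            linear_pack subset_UNIV])
    then show "linear_on (space ind_glider) (act ind_glider g)"
      by (simp add: linear_on_def)
    fix h y assume h: "h \<in> carrier G" and "y \<in> space ind_glider"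
    then obtain w where w: "w \<in> TV" "y = ind_map w" by auto
    show "act ind_glider (g \<otimes> h) y = act ind_glider g (act ind_glider h y)"
      unfolding w(2) act_ind_map[OF h] act_ind_map[OF g] act_ind_map[OF m_closed[OF g h]]
        shift_mult[OF g h] ..
  next
    fix y assume "y \<in> space ind_glider"
    then obtain w where w: "w \<in> TV" "y = ind_map w" by auto
    show "act ind_glider \<one> y = y"
      unfolding w(2) act_ind_map[OF one] shift_one[OF w(1)] ..
  qed
  have lin: "linear_on V (\<lambda>v. ind_map (tens (delta \<one>) v))"
  proof (rule linear_on_compose[OF _ linear_ind_map])
    show "linear_on V (tens (delta \<one> :: 'a \<Rightarrow> 'k))"
      by (simp add: linear_on_def tens_add_right tens_smul_right)
    show "tens (delta \<one>) ` V \<subseteq> TV" using tens_TV[OF delta_in_group_alg[OF one]] by auto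
  qed
  have "lev1 ind_glider \<subseteq> lev0 ind_glider"
    using tens_TV[OF delta_in_group_alg[OF one]] is_gliderD(6)[OF gX] by auto
  moreover have "finite_dim TV"
    using finite_dim_tens_space[OF finite_dim_group_alg subV(3)] by (simp add: tens_space_eq)
  then have "finite_dim (lev0 ind_glider)"
    using finite_dim_image[OF linear_ind_map] by simp
  moreover have "fn.subspace (lev1 ind_glider)"
    using subspace_linear_on_image[OF linear_on_subset[OF lin is_gliderD(6)[OF gX]] is_gliderD(3)[OF gX]]
    by simp
  moreover have "act ind_glider g m \<in> lev0 ind_glider" if "g \<in> carrier G" "m \<in> lev1 ind_glider" for g m
  proof -
    have "m \<in> space ind_glider" using that(2) calculation(1) by auto
    then show ?thesis using is_moduleD(2)[OF mod that(1)] by (simp del: ind_glider_simps(4))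
  qed
  ultimately show ?thesis
    unfolding is_glider_iff[OF finite_carrier] using mod by simp
qed

lemma is_induced_ind_glider: "is_induced G H X ind_glider"
  unfolding is_induced_def tens_space_eq
proof (intro conjI exI[of _ ind_map] is_glider_ind linear_ind_map ballI)
  have "ind_map w = 0 \<longleftrightarrow> avg w = 0" for w
  proof
    assume "ind_map w = 0"
    then have "unpack (ind_map w) = unpack 0" by simp
    then show "avg w = 0"
      by (simp add: unpack_pack_avg linear_on_zero[OF linear_unpack[of UNIV]])
  next
    assume "avg w = 0"
    then show "ind_map w = 0" by (simp add: linear_on_zero[OF linear_pack[of UNIV]])
  qed
  then show "{w \<in> TV. ind_map w = 0} = balance_relations G H X"
    by (simp add: kernel_avg)
  fix g x v assume "g \<in> carrier G"
  then show "act ind_glider g (ind_map (tens x v)) = ind_map (tens (conv G (delta g) x) v)"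
    using act_ind_map[of g "tens x v"] by (simp only: shift_tens)
qed simp_all

text \<open>Whatever model \<open>Y\<close> is taken, its quotient map \<open>p\<close> has the same
  kernel as \<open>avg\<close>, and \<open>x\<close> sends the generator to
  \<open>p (tens x u)\<close>. The annihilator can hence be computed with \<open>avg\<close>, which
  pairs the left translates of \<open>x\<close>, restricted to \<open>H\<close>, with the
  coordinates of \<open>u\<close>; it is the same for all models.\<close>

lemma induced_generates:
  assumes "is_induced G H X Y"
  obtains y where "generates Y y"
    and "\<And>x. x \<in> ann G Y \<longleftrightarrow> x \<in> group_alg G \<and>
      (\<forall>a\<in>carrier G. (\<lambda>h. if h \<in> H then x (a \<otimes> h) else 0) \<in> ann (sub G H) X)"
proof -
  have one: "\<one> \<in> carrier G" by simp
  have gY: "is_glider G Y" using assms by (simp add: is_induced_def)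
  obtain p where P: "linear_on TV p \<and> p ` TV = space Y \<and> {w \<in> TV. p w = 0} = balance_relations G H X \<and>
      (\<forall>g\<in>carrier G. \<forall>x\<in>group_alg G. \<forall>v\<in>V. act Y g (p (tens x v)) = p (tens (conv G (delta g) x) v)) \<and>
      lev0 Y = space Y \<and> lev1 Y = (\<lambda>v. p (tens (delta \<one>) v)) ` lev1 X"
    using conjunct2[OF assms[unfolded is_induced_def tens_space_eq]] by (rule exE)
  then have p: "linear_on TV p" "{w \<in> TV. p w = 0} = balance_relations G H X"
    "\<And>g x v. g \<in> carrier G \<Longrightarrow> x \<in> group_alg G \<Longrightarrow> v \<in> V \<Longrightarrow>
      act Y g (p (tens x v)) = p (tens (conv G (delta g) x) v)"
    "lev1 Y = (\<lambda>v. p (tens (delta \<one>) v)) ` lev1 X"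
    by simp_all
  have p0: "p w = 0 \<longleftrightarrow> avg w = 0" if "w \<in> TV" for w
    using that p(2) kernel_avg by blast
  let ?y = "p (tens (delta \<one>) u)"
  have lev1: "lev1 Y = fn.span {?y}"
  proof -
    have "linear_on (fn.span {u}) (tens (delta \<one> :: 'a \<Rightarrow> 'k))"
      by (simp add: linear_on_def tens_add_right tens_smul_right)
    moreover have "tens (delta \<one>) ` fn.span {u} \<subseteq> TV"
      using tens_TV[OF delta_in_group_alg[OF one]] is_gliderD(6)[OF gX] u(2) by auto
    ultimately have "linear_on (fn.span {u}) (\<lambda>v. p (tens (delta \<one>) v))"
      by (rule linear_on_compose[OF _ p(1)])
    then show ?thesis
      unfolding p(4) u(2) by (subst linear_on_span_image) auto
  qed
  have act: "alg_act G Y x ?y = p (tens x u)" if x: "x \<in> group_alg G" for x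
  proof -
    have "act Y g ?y = p (tens (delta g) u)" if g: "g \<in> carrier G" for g
      using p(3)[OF g delta_in_group_alg[OF one] uV(1)] g by (simp add: conv_delta_delta)
    then have "alg_act G Y x ?y = (\<Sum>g\<in>carrier G. smul (x g) (p (tens (delta g) u)))"
      by (simp add: alg_act_def)
    also have "\<dots> = (\<Sum>g\<in>carrier G. p (tens (smul (x g) (delta g)) u))"
      unfolding tens_smul_left
      using linear_on_smul[OF p(1) tens_TV[OF delta_in_group_alg uV(1)]] by (intro sum.cong) auto
    also have "\<dots> = p (\<Sum>g\<in>carrier G. tens (smul (x g) (delta g)) u)"
      by (rule linear_on_sum[OF p(1) subspace_TV, symmetric])
        (intro tens_TV fn.subspace_scale[OF subspace_group_alg] delta_in_group_alg uV)
    also have "(\<Sum>g\<in>carrier G. tens (smul (x g) (delta g)) u) = tens x u"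
    proof -
      have "(\<Sum>g\<in>carrier G. tens (smul (x g) (delta g)) u) (a, i) = x a * u i" for a i
      proof -
        have "(\<Sum>g\<in>carrier G. tens (smul (x g) (delta g)) u) (a, i)
            = (\<Sum>g\<in>carrier G. if g = a then x g * u i else 0)"
          unfolding sum_fun_apply by (intro sum.cong) (auto simp: tens_def smul_apply delta_def)
        then show ?thesis using x finite_carrier by (auto simp: group_alg_def)
      qed
      then show ?thesis by (auto simp: fun_eq_iff tens_def)
    qed
    finally show ?thesis .
  qed
  have avg0: "avg (tens x u) = 0 \<longleftrightarrow> (\<forall>a\<in>carrier G. \<forall>i. (\<Sum>h\<in>H. x (a \<otimes> h) * act X h u i) = 0)" for x
    by (auto simp: avg_tens[OF uV(1)] fun_eq_iff zero_fun_apply)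
  have "?y \<noteq> 0"
  proof
    assume "?y = 0"
    then have "avg (tens (delta \<one>) u) = 0"
      using p0 tens_TV[OF delta_in_group_alg[OF one] uV(1)] by blast
    then have "(\<Sum>h\<in>H. delta \<one> (\<one> \<otimes> h) * act X h u i) = 0" for i using avg0 one by blast
    moreover have "(\<Sum>h\<in>H. delta \<one> (\<one> \<otimes> h) * act X h u i) = (\<Sum>h\<in>H. if h = \<one> then act X h u i else 0)" for i
      by (intro sum.cong) (auto simp: delta_def)
    ultimately have "act X \<one> u i = 0" for i
      using finite_subgroup[OF H] by simp
    then have "u i = 0" for i using act_simps(1)[of u] uV(1) subV(2) by auto
    then show False using u(1) by (auto simp: fun_eq_iff zero_fun_apply)
  qed
  then have gen: "generates Y ?y" using gY lev1 by (simp add: generates_def)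
  have genX: "K.generates X u" using gX u by (simp add: K.generates_def)
  have "x \<in> ann G Y \<longleftrightarrow> x \<in> group_alg G \<and>
      (\<forall>a\<in>carrier G. (\<lambda>h. if h \<in> H then x (a \<otimes> h) else 0) \<in> ann (sub G H) X)" for x
  proof -
    have "x \<in> ann G Y \<longleftrightarrow> x \<in> group_alg G \<and> avg (tens x u) = 0"
      unfolding ann_line[OF gY lev1] using act p0 tens_TV[OF _ uV(1)] by auto
    moreover have "(\<lambda>h. if h \<in> H then x (a \<otimes> h) else 0) \<in> ann (sub G H) X \<longleftrightarrow>
        (\<forall>i. (\<Sum>h\<in>H. x (a \<otimes> h) * act X h u i) = 0)" for a
      unfolding K.ann_iff[OF genX] by (simp add: group_alg_def cong: sum.cong)
    ultimately show ?thesis unfolding avg0 by simp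
  qed
  then show thesis using gen that by blast
qed

end

section \<open>The induction map on classes\<close>

context finite_group
begin

text \<open>\<open>J\<close> annihilates the induced generator iff the restrictions to
  \<open>H\<close> of all left translates of elements of \<open>J\<close> annihilate the original
  one; this is the adjunction required by \<open>class_hom_exists\<close>. The models of an induced
  glider all have the same annihilator, so the condition in the choice of \<open>Ind\<close> can be
  met, and \<open>F\<close> computes the chosen map.\<close>

lemma Ind_cls:
  assumes H: "subgroup H G"
  obtains F :: "('a, 'k::field_char_0) glider \<Rightarrow> ('a, 'k) glider"
  where "\<And>X. cyclic (sub G H) X \<Longrightarrow> cyclic G (F X)"
    and "\<And>X. cyclic (sub G H) X \<Longrightarrow> Ind G H (cls (sub G H) X) = cls G (F X)"
    and "\<And>X x. cyclic (sub G H) X \<Longrightarrow> x \<in> ann G (F X) \<longleftrightarrow> x \<in> group_alg G \<and>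
      (\<forall>a\<in>carrier G. (\<lambda>h. if h \<in> H then x (a \<otimes> h) else 0) \<in> ann (sub G H) X)"
    and "Ind G H \<in> hom (add_monoid (R1 (sub G H) :: ('a, 'k) glider_class ring)) (add_monoid (R1 G))"
proof -
  interpret K: finite_group "sub G H" by (rule finite_group_sub[OF H])
  let ?sh = "\<lambda>X :: ('a, 'k) glider. X\<lparr>lev0 := alg_span (sub G H) X (lev1 X)\<rparr>"
  have irr: "irreducible_glider (sub G H) (?sh X)" if "cyclic (sub G H) X" for X
    by (rule irreducible_shrink[OF K.finite_carrier K.is_group that])
  have data: "\<exists>u. induction_data G H X u" if X: "irreducible_glider (sub G H) X" for X :: "('a, 'k) glider"
  proof -
    obtain u where "K.generates X u" using K.cyclic_generates[OF irreducible_imp_cyclic[OF X]] by blast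
    then have "induction_data G H X u"
      using H X finite_group_axioms
      by (simp add: induction_data_def induction_data_axioms_def K.generates_def)
    then show ?thesis by blast
  qed
  have ind: "cyclic G Y \<and> (\<forall>x. x \<in> ann G Y \<longleftrightarrow> x \<in> group_alg G \<and>
      (\<forall>a\<in>carrier G. (\<lambda>h. if h \<in> H then x (a \<otimes> h) else 0) \<in> ann (sub G H) X))"
    if X: "irreducible_glider (sub G H) X" and Y: "is_induced G H X Y" for X Y :: "('a, 'k) glider"
  proof -
    obtain u where "induction_data G H X u" using data[OF X] by blast
    then interpret I: induction_data G H X u .
    obtain y where y: "generates Y y" "\<And>x. x \<in> ann G Y \<longleftrightarrow> x \<in> group_alg G \<and>
        (\<forall>a\<in>carrier G. (\<lambda>h. if h \<in> H then x (a \<otimes> h) else 0) \<in> ann (sub G H) X)"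
      by (rule I.induced_generates[OF Y]) (rule that)
    show ?thesis using generates_cyclic[OF y(1)] y(2) by simp
  qed
  have ex: "\<exists>Y. is_induced G H X Y" if X: "irreducible_glider (sub G H) X" for X :: "('a, 'k) glider"
  proof -
    obtain u where "induction_data G H X u" using data[OF X] by blast
    then interpret I: induction_data G H X u .
    show ?thesis by (rule exI) (rule I.is_induced_ind_glider)
  qed
  define F where "F X = (SOME Y. is_induced G H (?sh X) Y)" for X :: "('a, 'k) glider"
  have FI: "is_induced G H (?sh X) (F X)" if "cyclic (sub G H) X" for X
    unfolding F_def by (rule someI_ex[OF ex[OF irr[OF that]]])
  have Fc: "cyclic G (F X)" and Fa: "x \<in> ann G (F X) \<longleftrightarrow> x \<in> group_alg G \<and>
      (\<forall>a\<in>carrier G. (\<lambda>h. if h \<in> H then x (a \<otimes> h) else 0) \<in> ann (sub G H) X)"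
    if "cyclic (sub G H) X" for X x
    using ind[OF irr[OF that] FI[OF that]] by simp_all
  let ?adj = "\<lambda>J. {(\<lambda>h. if h \<in> H then x (a \<otimes> h) else 0) |x a. x \<in> J \<and> a \<in> carrier G} :: ('a \<Rightarrow> 'k) set"
  have adj: "?adj J \<subseteq> group_alg (sub G H)" for J by (auto simp: group_alg_def)
  have chi: "chi G J (F X) = chi (sub G H) (?adj J) X"
    if J: "J \<subseteq> group_alg G" and X: "cyclic (sub G H) X" for J X
  proof -
    have "J \<subseteq> ann G (F X) \<longleftrightarrow> ?adj J \<subseteq> ann (sub G H) X"
    proof
      assume L: "J \<subseteq> ann G (F X)"
      show "?adj J \<subseteq> ann (sub G H) X"
      proof clarify
        fix x a assume "x \<in> J" "a \<in> carrier G"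
        then show "(\<lambda>h. if h \<in> H then x (a \<otimes> h) else 0) \<in> ann (sub G H) X"
          using L Fa[OF X, of x] by blast
      qed
    next
      assume R: "?adj J \<subseteq> ann (sub G H) X"
      show "J \<subseteq> ann G (F X)"
      proof
        fix x assume x: "x \<in> J"
        have "(\<lambda>h. if h \<in> H then x (a \<otimes> h) else 0) \<in> ann (sub G H) X" if "a \<in> carrier G" for a
          by (rule subsetD[OF R]) (use x that in blast)
        then show "x \<in> ann G (F X)" using Fa[OF X, of x] x J by blast
      qed
    qed
    then show ?thesis by (simp add: chi_cyclic[OF Fc[OF X] J] chi_cyclic[OF X adj])
  qed
  obtain \<phi> where \<phi>: "\<phi> \<in> hom (add_monoid (R1 (sub G H))) (add_monoid (R1 G))"
    "\<And>X :: ('a, 'k) glider. cyclic (sub G H) X \<Longrightarrow> \<phi> (cls (sub G H) X) = cls G (F X)"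
    by (rule class_hom_exists[OF K.finite_group_axioms finite_group_axioms, of F ?adj])
       (use Fc adj chi in auto)
  define P where "P \<phi> \<longleftrightarrow> \<phi> \<in> hom (add_monoid (R1 (sub G H))) (add_monoid (R1 G)) \<and>
    (\<forall>(X :: ('a, 'k) glider) Y. irreducible_glider (sub G H) X \<and> is_induced G H X Y
       \<longrightarrow> \<phi> (cls (sub G H) X) = cls G Y)" for \<phi>
  have same: "cls G (F X) = cls G Y"
    if X: "irreducible_glider (sub G H) X" and Y: "is_induced G H X Y" for X Y :: "('a, 'k) glider"
  proof -
    note cX = irreducible_imp_cyclic[OF X]
    have "ann G (F X) = ann G Y" unfolding set_eq_iff Fa[OF cX] using ind[OF X Y] by simp
    then show ?thesis using cls_eq_iff[OF Fc[OF cX]] ind[OF X Y] by simp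
  qed
  have "P \<phi>"
    unfolding P_def
  proof (intro conjI allI impI \<phi>(1))
    fix X Y :: "('a, 'k) glider" assume XY: "irreducible_glider (sub G H) X \<and> is_induced G H X Y"
    then have c: "cyclic (sub G H) X" by (intro irreducible_imp_cyclic) simp
    show "\<phi> (cls (sub G H) X) = cls G Y" unfolding \<phi>(2)[OF c] using same XY by simp
  qed
  then have "P (SOME \<phi>. P \<phi>)" by (rule someI[of P])
  then have P: "P (Ind G H)" unfolding Ind_def P_def .
  have Fi: "Ind G H (cls (sub G H) X) = cls G (F X)" if X: "cyclic (sub G H) X" for X
  proof -
    have "Ind G H (cls (sub G H) (?sh X)) = cls G (F X)"
      using P irr[OF X] FI[OF X] by (simp add: P_def)
    then show ?thesis by (simp only: K.cls_shrink[OF X])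
  qed
  show thesis
  proof (rule that[of F])
    show "Ind G H \<in> hom (add_monoid (R1 (sub G H) :: ('a, 'k) glider_class ring)) (add_monoid (R1 G))"
      using P by (simp add: P_def)
  qed (use Fc Fi Fa in simp_all)
qed

text \<open>Both conditions say that \<open>x\<close> has sum 0 over every coset of
  \<open>S\<close>: for \<open>b\<close> in \<open>H\<close> the coset \<open>b S\<close> stays
  inside \<open>H\<close>, and restricting to \<open>H\<close> loses nothing.\<close>

lemma coset_ann_Ind:
  assumes H: "subgroup H G" and S: "subgroup S G" "S \<subseteq> H" and x: "x \<in> group_alg G"
  shows "(\<forall>a\<in>carrier G. (\<lambda>h. if h \<in> H then x (a \<otimes> h) else 0) \<in> coset_ann (sub G H) S) \<longleftrightarrow>
    x \<in> coset_ann G S"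
proof -
  interpret H: subgroup H G by (rule H)
  have e: "(\<Sum>s\<in>S. if b \<otimes> s \<in> H then x (a \<otimes> (b \<otimes> s)) else 0) = (\<Sum>s\<in>S. x (a \<otimes> b \<otimes> s))"
    if "a \<in> carrier G" "b \<in> H" for a b
    using that S(2) by (intro sum.cong) (auto simp: m_assoc subset_eq)
  show ?thesis
  proof
    assume L: "\<forall>a\<in>carrier G. (\<lambda>h. if h \<in> H then x (a \<otimes> h) else 0) \<in> coset_ann (sub G H) S"
    have "(\<Sum>s\<in>S. x (a \<otimes> s)) = 0" if "a \<in> carrier G" for a
      using e[OF that H.one_closed] L that by (auto simp: coset_ann_def)
    then show "x \<in> coset_ann G S" using x by (simp add: coset_ann_def)
  next
    assume "x \<in> coset_ann G S"
    then show "\<forall>a\<in>carrier G. (\<lambda>h. if h \<in> H then x (a \<otimes> h) else 0) \<in> coset_ann (sub G H) S"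
      using e by (auto simp: coset_ann_def group_alg_def)
  qed
qed

text \<open>Induction takes the permutation glider of \<open>S\<close> over \<open>H\<close> to that
  of \<open>S\<close> over the whole group. The mark at \<open>P\<close> is unchanged when
  \<open>P\<close> lies in \<open>H\<close>; otherwise \<open>P\<close> is not contained in
  \<open>S\<close> and the mark is 0.\<close>

lemma marks_Ind:
  fixes r :: "('a, 'k::field_char_0) glider_class"
  assumes H: "subgroup H G" and r: "finite_group.marks (sub G H) r f"
  shows "marks (Ind G H r) (\<lambda>P. if P \<subseteq> H then f P else 0)"
proof -
  interpret K: finite_group "sub G H" by (rule finite_group_sub[OF H])
  obtain F :: "('a, 'k) glider \<Rightarrow> ('a, 'k) glider"
    where Fc: "\<And>X. cyclic (sub G H) X \<Longrightarrow> cyclic G (F X)"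
    and Fi: "\<And>X. cyclic (sub G H) X \<Longrightarrow> Ind G H (cls (sub G H) X) = cls G (F X)"
    and Fa: "\<And>X x. cyclic (sub G H) X \<Longrightarrow> x \<in> ann G (F X) \<longleftrightarrow> x \<in> group_alg G \<and>
      (\<forall>a\<in>carrier G. (\<lambda>h. if h \<in> H then x (a \<otimes> h) else 0) \<in> ann (sub G H) X)"
    and hom: "Ind G H \<in> hom (add_monoid (R1 (sub G H) :: ('a, 'k) glider_class ring)) (add_monoid (R1 G))"
    by (rule Ind_cls[OF H]) (rule that)
  interpret RK: cring "R1 (sub G H) :: ('a, 'k) glider_class ring" by (rule K.cring_R1)
  interpret RG: cring "R1 G :: ('a, 'k) glider_class ring" by (rule cring_R1)
  interpret h: group_hom "add_monoid (R1 (sub G H) :: ('a, 'k) glider_class ring)" "add_monoid (R1 G)" "Ind G H"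
    using hom RK.a_group RG.a_group by (simp add: group_hom_def group_hom_axioms_def)
  have perm: "perm_glider (F X) S" if X: "K.perm_glider X S" for X S
  proof -
    have X': "cyclic (sub G H) X" "subgroup S (sub G H)" "ann (sub G H) X = coset_ann (sub G H) S"
      using X by (auto simp: K.perm_glider_def)
    have S: "subgroup S G" "S \<subseteq> H"
      using incl_subgroup[OF H X'(2)] subgroup.subset[OF X'(2)] by auto
    have "ann G (F X) = coset_ann G S"
      unfolding set_eq_iff Fa[OF X'(1)] X'(3)
      using coset_ann_Ind[OF H S] by (auto simp: coset_ann_def)
    then show ?thesis using Fc[OF X'(1)] S by (simp add: perm_glider_def)
  qed
  obtain p where p: "Poly_Mapping.keys p \<subseteq> {X :: ('a, 'k) glider. \<exists>S. K.perm_glider X S}" "K.red p = r"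
      "\<forall>P. subgroup P (sub G H) \<longrightarrow> ext (chi (sub G H) (coset_ann (sub G H) P)) p = f P"
    using r unfolding K.marks_def by blast
  let ?F = "frag_extend (\<lambda>X. frag_of (F X))"
  have kF: "Poly_Mapping.keys (?F q) \<subseteq> {X. \<exists>S. perm_glider X S}"
    if "Poly_Mapping.keys q \<subseteq> {X. \<exists>S. K.perm_glider X S}" for q
    using keys_frag_extend[of "\<lambda>X. frag_of (F X)" q] that perm by fastforce
  have "Ind G H (K.red p) = red (?F p)"
    using p(1)
  proof (induction p rule: frag_induct_supp)
    case zero
    have "\<zero>\<^bsub>R1 (sub G H)\<^esub> = K.red (0 :: ('a, 'k) glider \<Rightarrow>\<^sub>0 int)" by (simp add: K.R1_simps K.red_simps)
    moreover have "\<zero>\<^bsub>R1 G\<^esub> = red (0 :: ('a, 'k) glider \<Rightarrow>\<^sub>0 int)" by (simp add: R1_simps red_simps)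
    ultimately show ?case using h.hom_one by simp
  next
    case (one X)
    then show ?case using Fi[of X] by (auto simp: K.perm_glider_def cls_eq K.cls_eq)
  next
    case (diff a b)
    have ab: "a \<in> K.cyclic_frags" "b \<in> K.cyclic_frags"
      using diff.hyps K.perm_frags_cyclic by auto
    have F: "?F a \<in> cyclic_frags" "?F b \<in> cyclic_frags"
      using kF[OF diff.hyps(1)] kF[OF diff.hyps(2)] perm_frags_cyclic by auto
    have c: "K.red a \<in> carrier (R1 (sub G H))" "K.red b \<in> carrier (R1 (sub G H))"
      using ab K.red_in_R1 by auto
    have "Ind G H (\<ominus>\<^bsub>R1 (sub G H)\<^esub> K.red b) = \<ominus>\<^bsub>R1 G\<^esub> Ind G H (K.red b)"
      using h.hom_inv[of "K.red b"] c(2) by (simp add: a_inv_def)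
    then have "Ind G H (K.red (a - b)) = Ind G H (K.red a) \<ominus>\<^bsub>R1 G\<^esub> Ind G H (K.red b)"
      using h.hom_mult[of "K.red a" "\<ominus>\<^bsub>R1 (sub G H)\<^esub> K.red b"] c RK.a_inv_closed[OF c(2)]
      unfolding K.red_diff[OF ab] a_minus_def by simp
    then show ?case
      using diff.IH red_diff[OF F] by (simp add: frag_extend_diff)
  qed
  moreover have "ext (chi G (coset_ann G P)) (?F p) = (if P \<subseteq> H then f P else 0)" if P: "subgroup P G" for P
  proof -
    have "ext (chi G (coset_ann G P)) (?F p) = ext (\<lambda>X. chi G (coset_ann G P) (F X)) p"
      by (rule ext_frag_extend)
    also have "\<dots> = (if P \<subseteq> H then ext (chi (sub G H) (coset_ann (sub G H) P)) p else ext (\<lambda>X. 0) p)"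
    proof (cases "P \<subseteq> H")
      case True
      then have P': "subgroup P (sub G H)" using subgroup_incl[OF P H] by simp
      have "chi G (coset_ann G P) (F X) = chi (sub G H) (coset_ann (sub G H) P) X"
        if X: "X \<in> Poly_Mapping.keys p" for X
      proof -
        obtain S where S: "K.perm_glider X S" using X p(1) by auto
        show ?thesis unfolding chi_perm_glider[OF perm[OF S] P] K.chi_perm_glider[OF S P'] ..
      qed
      then show ?thesis using True by (simp cong: ext_cong)
    next
      case False
      have "chi G (coset_ann G P) (F X) = 0" if X: "X \<in> Poly_Mapping.keys p" for X
      proof -
        obtain S where S: "K.perm_glider X S" using X p(1) by auto
        then have "S \<subseteq> H" using subgroup.subset[of S "sub G H"] by (simp add: K.perm_glider_def)
        then show ?thesis using False unfolding chi_perm_glider[OF perm[OF S] P] by auto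
      qed
      then show ?thesis using False by (simp cong: ext_cong)
    qed
    also have "\<dots> = (if P \<subseteq> H then f P else 0)"
      using p(3) subgroup_incl[OF P H] by (simp add: ext_eq_sum[of "\<lambda>X. 0"])
    finally show ?thesis .
  qed
  ultimately show ?thesis
    unfolding marks_def using kF[OF p(1)] p(2) by (intro exI[of _ "?F p"]) simp
qed

end


section \<open>Semisimplicity\<close>

definition submodule :: "('g, 'x) monoid_scheme \<Rightarrow> ('g, 'k::field) rep \<Rightarrow> (nat \<Rightarrow> 'k) set \<Rightarrow> bool"
  where "submodule G V W \<longleftrightarrow> fn.subspace W \<and> W \<subseteq> space V \<and> (\<forall>g\<in>carrier G. act V g ` W \<subseteq> W)"

definition equivariant :: "('g, 'x) monoid_scheme \<Rightarrow> ('g, 'k::field) rep \<Rightarrow> ('g, 'k) rep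
    \<Rightarrow> ((nat \<Rightarrow> 'k) \<Rightarrow> nat \<Rightarrow> 'k) \<Rightarrow> bool"
  where "equivariant G V W f \<longleftrightarrow> linear_on (space V) f \<and> f ` space V \<subseteq> space W \<and>
    (\<forall>g\<in>carrier G. \<forall>v\<in>space V. f (act V g v) = act W g (f v))"

lemma submoduleD:
  assumes "submodule G V W"
  shows "fn.subspace W" "W \<subseteq> space V" "g \<in> carrier G \<Longrightarrow> v \<in> W \<Longrightarrow> act V g v \<in> W"
  using assms by (auto simp: submodule_def)

lemma simple_module_iff:
  "simple_module G V \<longleftrightarrow> is_module G V \<and> space V \<noteq> {0} \<and> (\<forall>W. submodule G V W \<longrightarrow> W = {0} \<or> W = space V)"
  by (simp add: simple_module_def submodule_def)

lemma equivariantD: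
  assumes "equivariant G V W f"
  shows "linear_on (space V) f" "v \<in> space V \<Longrightarrow> f v \<in> space W"
    "g \<in> carrier G \<Longrightarrow> v \<in> space V \<Longrightarrow> f (act V g v) = act W g (f v)"
  using assms by (auto simp: equivariant_def)

lemma equivariantI:
  assumes "linear_on (space V) f" "\<And>v. v \<in> space V \<Longrightarrow> f v \<in> space W"
    "\<And>g v. g \<in> carrier G \<Longrightarrow> v \<in> space V \<Longrightarrow> f (act V g v) = act W g (f v)"
  shows "equivariant G V W f"
  unfolding equivariant_def by (intro conjI ballI image_subsetI assms)

lemma is_module_submodule:
  assumes V: "is_module G V" and W: "submodule G V W"
  shows "is_module G (V\<lparr>space := W\<rparr>)"
proof -
  have "linear_on W (act V g)" if "g \<in> carrier G" for g
    by (rule linear_on_subset[OF is_moduleD(3)[OF V that] submoduleD(2)[OF W]])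
  moreover have eq: "space (V\<lparr>space := W\<rparr>) = W" "act (V\<lparr>space := W\<rparr>) = act V" by simp_all
  moreover have "v \<in> space V" if "v \<in> W" for v using submoduleD(2)[OF W] that by (rule subsetD)
  ultimately show ?thesis
    unfolding is_module_def eq
    by (intro conjI ballI image_subsetI submoduleD[OF W] is_moduleD(4,5)[OF V])
qed

lemma equivariant_compose:
  assumes f: "equivariant G U V f" and h: "equivariant G V W h"
  shows "equivariant G U W (\<lambda>v. h (f v))"
proof (rule equivariantI)
  show "linear_on (space U) (\<lambda>v. h (f v))"
    by (rule linear_on_compose[OF equivariantD(1)[OF f] equivariantD(1)[OF h]]) (rule image_subsetI, rule equivariantD(2)[OF f])
qed (simp_all add: equivariantD[OF f] equivariantD[OF h])

lemma equivariant_alg_act: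
  assumes V: "is_module G V" and f: "equivariant G V W f" and v: "v \<in> space V"
  shows "f (alg_act G V x v) = alg_act G W x (f v)"
  by (rule alg_act_hom[OF equivariantD(1)[OF f] is_moduleD(1)[OF V]])
     (simp_all add: v is_moduleD(2)[OF V] equivariantD(3)[OF f])

lemma submodule_kernel:
  assumes V: "is_module G V" and W: "is_module G W" and f: "equivariant G V W f"
  shows "submodule G V {v \<in> space V. f v = 0}"
proof -
  have "act W g 0 = 0" if "g \<in> carrier G" for g
    by (rule linear_on_zero[OF is_moduleD(3)[OF W that] is_moduleD(1)[OF W]])
  moreover have "fn.subspace {v \<in> space V. f v \<in> {0}}"
    by (intro subspace_linear_on_vimage equivariantD(1)[OF f] is_moduleD(1)[OF V]) simp
  ultimately show ?thesis
    using is_moduleD(2)[OF V] equivariantD(3)[OF f] by (auto simp: submodule_def)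
qed

lemma submodule_image:
  assumes V: "is_module G V" and f: "equivariant G V W f"
  shows "submodule G W (f ` space V)"
proof -
  have "act W g (f v) \<in> f ` space V" if "g \<in> carrier G" "v \<in> space V" for g v
    using equivariantD(3)[OF f that, symmetric] is_moduleD(2)[OF V that] by simp
  then show ?thesis
    using subspace_linear_on_image[OF equivariantD(1)[OF f] is_moduleD(1)[OF V]] equivariantD(2)[OF f]
    by (auto simp: submodule_def)
qed

lemma schur:
  assumes U: "simple_module G U" and W: "simple_module G W" and f: "equivariant G U W f"
    and u: "u \<in> space U" "f u \<noteq> 0"
  shows "rep_iso G U W"
proof -
  have mod: "is_module G U" "is_module G W" using U W by (auto simp: simple_module_def)
  have sub: "fn.subspace (space U)" by (rule is_moduleD(1)[OF mod(1)])
  have "{v \<in> space U. f v = 0} = {0}"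
    using submodule_kernel[OF mod f] U u by (auto simp: simple_module_iff)
  have "inj_on f (space U)"
  proof (rule inj_onI)
    fix v w assume vw: "v \<in> space U" "w \<in> space U" "f v = f w"
    then have "f (v - w) = 0" using linear_on_diff[OF equivariantD(1)[OF f] sub] by simp
    then have "v - w \<in> {0}"
      unfolding \<open>{v \<in> space U. f v = 0} = {0}\<close>[symmetric] using vw fn.subspace_diff[OF sub] by simp
    then show "v = w" by simp
  qed
  moreover have "f ` space U = space W"
    using submodule_image[OF mod(1) f] W u by (force simp: simple_module_iff)
  ultimately show ?thesis
    unfolding rep_iso_def bij_betw_def
    by (intro exI[of _ f]) (simp add: equivariantD(1,3)[OF f])
qed

lemma rep_iso_refl: "rep_iso G U U"
  unfolding rep_iso_def by (intro exI[of _ "\<lambda>v. v"]) (simp add: bij_betw_def)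

lemma rep_iso_equivariant:
  assumes "rep_iso G U W"
  obtains f where "equivariant G U W f" "bij_betw f (space U) (space W)"
proof -
  obtain f where "linear_on (space U) f \<and> bij_betw f (space U) (space W) \<and>
    (\<forall>g\<in>carrier G. \<forall>v\<in>space U. f (act U g v) = act W g (f v))"
    using assms unfolding rep_iso_def by (rule exE)
  then have "equivariant G U W f" "bij_betw f (space U) (space W)"
    by (simp_all add: equivariant_def bij_betw_def)
  then show thesis by (rule that)
qed

context finite_group
begin

lemma submodule_alg_span:
  assumes V: "is_module G V" and v: "v \<in> space V"
  shows "submodule G V (alg_span G V (fn.span {v}))"
proof -
  \<comment> \<open>The product of \<open>delta g\<close> and \<open>x\<close> in the group algebra,
    that is, a left translate of \<open>x\<close>.\<close>
  let ?x = "\<lambda>g x a. if a \<in> carrier G then x (inv g \<otimes> a) else 0"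
  have "act V g (alg_act G V x v) = alg_act G V (?x g x) v" if g: "g \<in> carrier G" for g x
  proof -
    have "act V g (alg_act G V x v) = (\<Sum>h\<in>carrier G. smul (x h) (act V (g \<otimes> h) v))"
      unfolding alg_act_def
      using is_moduleD(5)[OF V g _ v] is_moduleD(2)[OF V _ v] fn.subspace_scale[OF is_moduleD(1)[OF V]]
        linear_on_smul[OF is_moduleD(3)[OF V g]]
      by (subst linear_on_sum[OF is_moduleD(3)[OF V g] is_moduleD(1)[OF V]]) simp_all
    also have "\<dots> = (\<Sum>h\<in>carrier G. smul (?x g x (g \<otimes> h)) (act V (g \<otimes> h) v))"
      using g by (intro sum.cong) (simp_all add: m_assoc[symmetric])
    also have "\<dots> = alg_act G V (?x g x) v"
      unfolding alg_act_def by (rule sum_left_mult[OF g, of "\<lambda>h. smul (?x g x h) (act V h v)"])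
    finally show ?thesis .
  qed
  moreover have "?x g x \<in> group_alg G" for g x by (simp add: group_alg_def)
  ultimately show ?thesis
    using subspace_alg_span[of G V "fn.span {v}"] alg_act_closed[OF V v]
    unfolding alg_span_line[OF V v] submodule_def by (auto intro!: image_eqI)
qed

lemma card_ne: "card (carrier G) \<noteq> 0"
  using finite_carrier one_closed by (metis card_0_eq empty_iff)

text \<open>\<open>\<pi>\<close> is the average of the conjugates of a linear projection onto
  \<open>W\<close> by the group elements; \<open>n\<close> is the inverse of the group
  order.\<close>

lemma maschke:
  fixes V :: "('a, 'k::field_char_0) rep"
  assumes V: "is_module G V" and W: "submodule G V W"
  obtains \<pi> where "equivariant G V (V\<lparr>space := W\<rparr>) \<pi>" "\<And>w. w \<in> W \<Longrightarrow> \<pi> w = w"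
proof -
  note sV = is_moduleD(1)[OF V] and lin = is_moduleD(3)[OF V] and actV = is_moduleD(2)[OF V]
  note W' = submoduleD[OF W]
  obtain p where p: "Vector_Spaces.linear smul smul p" "range p \<subseteq> W" "\<And>w. w \<in> W \<Longrightarrow> p w = w"
    using projection_exists[OF W'(1)] by metis
  have pW: "p v \<in> W" and pV: "p v \<in> space V" for v using p(2) W'(2) by auto
  define n where "n = inverse (of_nat (card (carrier G)) :: 'k)"
  define \<pi> where "\<pi> v = (\<Sum>g\<in>carrier G. smul n (act V g (p (act V (inv g) v))))" for v
  have one: "linear_on (space V) (\<lambda>v. act V g (p (act V (inv g) v)))" if g: "g \<in> carrier G" for g
  proof -
    have "linear_on (space V) (\<lambda>v. p (act V (inv g) v))"
      using lin[of "inv g"] g by (intro linear_on_compose[of _ "act V (inv g)" UNIV p] linear_imp_linear_on[OF p(1)]) auto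
    then show ?thesis
      using pV by (intro linear_on_compose[of _ "\<lambda>v. p (act V (inv g) v)" "space V" "act V g"] lin g) auto
  qed
  have "equivariant G V (V\<lparr>space := W\<rparr>) \<pi>"
  proof (rule equivariantI)
    show "linear_on (space V) \<pi>"
      unfolding \<pi>_def[abs_def] by (rule linear_on_sum_fun[of "carrier G" "space V" _ "\<lambda>_. n"]) (rule one)
    show "\<pi> v \<in> space (V\<lparr>space := W\<rparr>)" if "v \<in> space V" for v
      unfolding \<pi>_def by (simp, intro fn.subspace_sum fn.subspace_scale W'(1,3) pW)
    show "\<pi> (act V h v) = act (V\<lparr>space := W\<rparr>) h (\<pi> v)" if h: "h \<in> carrier G" and v: "v \<in> space V" for h v
    proof -
      have "act V h (\<pi> v) = (\<Sum>g\<in>carrier G. smul n (act V (h \<otimes> g) (p (act V (inv g) v))))"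
        unfolding \<pi>_def
        using is_moduleD(5)[OF V h _ pV] actV[OF _ pV] fn.subspace_scale[OF sV] linear_on_smul[OF lin[OF h]]
        by (subst linear_on_sum[OF lin[OF h] sV]) simp_all
      also have "\<dots> = (\<Sum>g\<in>carrier G. smul n (act V (h \<otimes> g) (p (act V (inv (h \<otimes> g)) (act V h v)))))"
        using h is_moduleD(5)[OF V _ h v, symmetric]
        by (intro sum.cong refl) (simp add: inv_mult_group m_assoc)
      also have "\<dots> = \<pi> (act V h v)"
        unfolding \<pi>_def by (rule sum_left_mult[OF h, of "\<lambda>g. smul n (act V g (p (act V (inv g) (act V h v))))"])
      finally show ?thesis by simp
    qed
  qed
  moreover have "\<pi> w = w" if w: "w \<in> W" for w
  proof -
    have "act V g (p (act V (inv g) w)) = w" if g: "g \<in> carrier G" for g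
      using g w W'(2,3) p(3) is_moduleD(4)[OF V, of w] is_moduleD(5)[OF V g _ , of "inv g" w]
      by auto
    then have "\<pi> w = (\<Sum>g\<in>carrier G. smul n w)" by (simp add: \<pi>_def)
    also have "\<dots> = smul (of_nat (card (carrier G)) * n) w"
      by (simp add: fun_eq_iff sum_fun_apply smul_apply)
    also have "of_nat (card (carrier G)) * n = 1"
    proof -
      have "card (carrier G) \<noteq> 0" by (rule card_ne)
      then show ?thesis by (simp add: n_def)
    qed
    finally show ?thesis by simp
  qed
  ultimately show thesis by (rule that)
qed

text \<open>Induction on the dimension. A proper nonzero submodule has an equivariant projection
  \<open>\<pi>\<close>. If \<open>\<pi> w\<close> is nonzero, the argument continues in the
  submodule; otherwise in the kernel of \<open>\<pi>\<close>, reached by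
  \<open>v \<mapsto> v - \<pi> v\<close>, which fixes \<open>w\<close>.\<close>

lemma separation:
  fixes V :: "('a, 'k::field_char_0) rep"
  assumes "is_module G V" "finite_dim (space V)" "w \<in> space V" "w \<noteq> 0"
  obtains Q \<theta> where "simple_module G Q" "finite_dim (space Q)" "equivariant G V Q \<theta>" "\<theta> w \<noteq> 0"
  using assms
proof (induction "fn.dim (space V)" arbitrary: V w thesis rule: less_induct)
  case less
  note V = less.prems(2) and fd = less.prems(3) and w = less.prems(4,5)
  show ?case
  proof (cases "simple_module G V")
    case True
    show ?thesis
      by (rule less.prems(1)[OF True fd, of "\<lambda>v. v"]) (use w in \<open>simp_all add: equivariant_def\<close>)
  next
    case False
    then obtain W where W: "submodule G V W" "W \<noteq> {0}" "W \<noteq> space V"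
      using V w by (auto simp: simple_module_iff)
    obtain \<pi> where \<pi>: "equivariant G V (V\<lparr>space := W\<rparr>) \<pi>" "\<And>w. w \<in> W \<Longrightarrow> \<pi> w = w"
      using maschke[OF V W(1)] by blast
    have \<pi>W: "\<pi> v \<in> W" if "v \<in> space V" for v using equivariantD(2)[OF \<pi>(1) that] by simp
    have go: thesis if N: "submodule G V N" "N \<noteq> space V" and f: "equivariant G V (V\<lparr>space := N\<rparr>) f" "f w \<noteq> 0"
      for N f
    proof -
      have lt: "fn.dim (space (V\<lparr>space := N\<rparr>)) < fn.dim (space V)"
        using dim_psubset[OF fd submoduleD(1)[OF N(1)]] submoduleD(2)[OF N(1)] N(2) by auto
      have fdN: "finite_dim (space (V\<lparr>space := N\<rparr>))"
        using finite_dim_subspace[OF fd submoduleD(1,2)[OF N(1)]] by simp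
      obtain Q \<theta> where Q: "simple_module G Q" "finite_dim (space Q)" "equivariant G (V\<lparr>space := N\<rparr>) Q \<theta>" "\<theta> (f w) \<noteq> 0"
        by (rule less.hyps[OF lt _ is_module_submodule[OF V N(1)] fdN equivariantD(2)[OF f(1) w(1)] f(2)])
      show thesis
        by (rule less.prems(1)[OF Q(1,2) equivariant_compose[OF f(1) Q(3)] Q(4)])
    qed
    show ?thesis
    proof (cases "\<pi> w = 0")
      case False
      then show ?thesis by (rule go[OF W(1,3) \<pi>(1)])
    next
      case True
      let ?N = "{v \<in> space V. \<pi> v = 0}" and ?f = "\<lambda>v. v - \<pi> v"
      have N: "submodule G V ?N" by (rule submodule_kernel[OF V is_module_submodule[OF V W(1)] \<pi>(1)])
      have "?N \<noteq> space V"
      proof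
        assume N: "?N = space V"
        have "w' = 0" if "w' \<in> W" for w'
        proof -
          have "w' \<in> ?N" unfolding N using that submoduleD(2)[OF W(1)] by blast
          then show ?thesis using \<pi>(2)[OF that] by simp
        qed
        then show False using W(2) fn.subspace_0[OF submoduleD(1)[OF W(1)]] by blast
      qed
      moreover have "equivariant G V (V\<lparr>space := ?N\<rparr>) ?f"
      proof (rule equivariantI)
        have "linear_on (space V) \<pi>" by (rule equivariantD(1)[OF \<pi>(1)])
        then show "linear_on (space V) ?f"
          by (intro linear_onI) (simp_all add: linear_on_add linear_on_smul algebra_simps fn.scale_right_diff_distrib)
        note sV = is_moduleD(1)[OF V]
        have \<pi>V: "\<pi> v \<in> space V" if "v \<in> space V" for v using \<pi>W[OF that] submoduleD(2)[OF W(1)] by blast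
        have diff: "\<pi> (v - \<pi> v) = 0" if "v \<in> space V" for v
          using linear_on_diff[OF equivariantD(1)[OF \<pi>(1)] sV that \<pi>V[OF that]] \<pi>(2)[OF \<pi>W[OF that]] by simp
        show "?f v \<in> space (V\<lparr>space := ?N\<rparr>)" if "v \<in> space V" for v
          using diff[OF that] fn.subspace_diff[OF sV that \<pi>V[OF that]] by simp
        show "?f (act V g v) = act (V\<lparr>space := ?N\<rparr>) g (?f v)" if "g \<in> carrier G" "v \<in> space V" for g v
          using linear_on_diff[OF is_moduleD(3)[OF V that(1)] sV that(2) \<pi>V[OF that(2)]] equivariantD(3)[OF \<pi>(1) that] by simp
      qed
      moreover have "?f w \<noteq> 0" using True w by simp
      ultimately show ?thesis by (rule go[OF N])
    qed
  qed
qed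

end


section \<open>Sums of pairwise non-isomorphic simple modules\<close>

context finite_group
begin

lemma equivariant_coord:
  assumes Us: "\<And>U. U \<in> set Us \<Longrightarrow> is_module G U" and j: "j < length Us"
  shows "equivariant G (Us ! j) (dsum Us) (coord j)"
proof (rule equivariantI)
  note mod = Us[OF nth_mem]
  have z: "act (Us ! k) g 0 = 0" if "k < length Us" "g \<in> carrier G" for k g
    by (rule linear_on_zero[OF is_moduleD(3)[OF mod[OF that(1)] that(2)] is_moduleD(1)[OF mod[OF that(1)]]])
  show "coord j v \<in> space (dsum Us)" if "v \<in> space (Us ! j)" for v
    using that j fn.subspace_0[OF is_moduleD(1)[OF mod]] by (simp add: dsum_space_iff)
  show "coord j (act (Us ! j) g v) = act (dsum Us) g (coord j v)" if "g \<in> carrier G" for g v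
    by (rule comp_eqI) (use j that z in simp)
qed (rule coord_linear)

lemma equivariant_comp:
  assumes k: "k < length Us"
  shows "equivariant G (dsum Us) (Us ! k) (\<lambda>w. comp w k)"
  by (rule equivariantI) (use k in \<open>simp_all add: linear_on_def dsum_space_iff\<close>)

text \<open>An equivariant projection \<open>\<pi>\<close> onto the submodule generated by
  \<open>v\<close> has no off-diagonal entries, by Schur's lemma. Comparing components in
  \<open>\<pi> v = v\<close> shows that \<open>\<pi>\<close> fixes each
  \<open>coord l (comp v l)\<close>, which therefore lies in the submodule.\<close>

lemma sum_of_distinct_simples:
  fixes Us :: "('a, 'k::field_char_0) rep list"
  assumes Us: "\<And>U. U \<in> set Us \<Longrightarrow> simple_module G U"
    and dist: "\<And>j k. j < length Us \<Longrightarrow> k < length Us \<Longrightarrow> j \<noteq> k \<Longrightarrow> \<not> rep_iso G (Us ! j) (Us ! k)"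
    and v: "v \<in> space (dsum Us)" and l: "l < length Us"
  shows "coord l (comp v l) \<in> alg_span G (dsum Us) (fn.span {v})"
proof -
  have mod: "is_module G U" if "U \<in> set Us" for U using Us[OF that] by (simp add: simple_module_def)
  let ?D = "dsum Us" and ?W = "alg_span G (dsum Us) (fn.span {v})"
  have D: "is_module G ?D" by (rule is_module_dsum[OF mod])
  have W: "submodule G ?D ?W" by (rule submodule_alg_span[OF D v])
  obtain \<pi> where \<pi>: "equivariant G ?D (?D\<lparr>space := ?W\<rparr>) \<pi>" "\<And>w. w \<in> ?W \<Longrightarrow> \<pi> w = w"
    by (rule maschke[OF D W]) (rule that)
  have \<pi>W: "\<pi> w \<in> ?W" if "w \<in> space ?D" for w using equivariantD(2)[OF \<pi>(1) that] by simp
  have \<pi>D: "equivariant G ?D ?D \<pi>"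
  proof (rule equivariantI[OF equivariantD(1)[OF \<pi>(1)]])
    show "\<pi> w \<in> space ?D" if "w \<in> space ?D" for w
      by (rule subsetD[OF submoduleD(2)[OF W] \<pi>W[OF that]])
    show "\<pi> (act ?D g w) = act ?D g (\<pi> w)" if "g \<in> carrier G" "w \<in> space ?D" for g w
      using equivariantD(3)[OF \<pi>(1) that] by simp
  qed
  have cross: "comp (\<pi> (coord j x)) k = 0"
    if "j < length Us" "k < length Us" "j \<noteq> k" "x \<in> space (Us ! j)" for j k x
  proof (rule ccontr)
    assume "comp (\<pi> (coord j x)) k \<noteq> 0"
    moreover have "equivariant G (Us ! j) (Us ! k) (\<lambda>x. comp (\<pi> (coord j x)) k)"
      by (rule equivariant_compose[OF equivariant_compose[OF equivariant_coord[OF mod that(1)] \<pi>D] equivariant_comp[OF that(2)]])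
    ultimately have "rep_iso G (Us ! j) (Us ! k)"
      using schur[OF Us[OF nth_mem[OF that(1)]] Us[OF nth_mem[OF that(2)]] _ that(4)] by simp
    then show False using dist[OF that(1-3)] by simp
  qed
  have vk: "comp v k \<in> space (Us ! k)" if "k < length Us" for k
    using v that by (simp add: dsum_space_iff)
  have cD: "coord k (comp v k) \<in> space ?D" if "k < length Us" for k
    by (rule equivariantD(2)[OF equivariant_coord[OF mod that] vk[OF that]])
  have "v \<in> ?W"
    using alg_span_line[OF D v] delta_in_group_alg[OF one_closed] alg_act_delta[OF finite_carrier one_closed, of ?D v]
      is_moduleD(4)[OF D v] by (metis image_eqI)
  then have \<pi>v: "\<pi> v = v" by (rule \<pi>(2))
  have v_sum: "v = (\<Sum>j<length Us. coord j (comp v j))"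
    using dsum_space_eq_sum[of v "map space Us"] v by simp
  have "\<pi> v = \<pi> (\<Sum>j<length Us. coord j (comp v j))" using v_sum by simp
  also have "\<dots> = (\<Sum>j<length Us. \<pi> (coord j (comp v j)))"
    by (rule linear_on_sum[OF equivariantD(1)[OF \<pi>(1)] is_moduleD(1)[OF D]]) (use cD in simp)
  finally have "comp v l = (\<Sum>j<length Us. comp (\<pi> (coord j (comp v j))) l)"
    unfolding \<pi>v using comp_sum[of "\<lambda>j. \<pi> (coord j (comp v j))" "{..<length Us}" l] by simp
  also have "\<dots> = (\<Sum>j<length Us. if j = l then comp (\<pi> (coord l (comp v l))) l else 0)"
    using cross[OF _ l _ vk] by (intro sum.cong) auto
  finally have diag: "comp (\<pi> (coord l (comp v l))) l = comp v l" using l by simp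
  have "\<pi> (coord l (comp v l)) = coord l (comp v l)"
  proof (rule comp_eqI)
    fix k
    have "comp (\<pi> (coord l (comp v l))) k = 0" if "k \<ge> length Us"
      using equivariantD(2)[OF \<pi>D cD[OF l]] that by (simp add: dsum_space_iff)
    then show "comp (\<pi> (coord l (comp v l))) k = comp (coord l (comp v l)) k"
      using diag cross[OF l _ _ vk[OF l], of k] by (cases "k < length Us") auto
  qed
  then show ?thesis using \<pi>W[OF cD[OF l]] by simp
qed

text \<open>With a nonzero vector chosen in each simple module, the annihilator of the vectors of a
  finite family shrinks strictly whenever a module is added: by
  \<open>sum_of_distinct_simples\<close> some \<open>x\<close> fixes the new vector and kills the
  others. The size of a family is thus at most the dimension of the group algebra.\<close>

lemma finite_irr:
  fixes I :: "('a, 'k::field_char_0) rep set"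
  assumes I: "irr_param G I"
  shows "finite I"
proof -
  have simp: "simple_module G U" if "U \<in> I" for U using I that by (simp add: irr_param_def)
  have uniq: "U = V" if "U \<in> I" "V \<in> I" "rep_iso G U V" for U V
    using I that rep_iso_refl[of G U] simp[OF that(1)] unfolding irr_param_def by blast
  have "\<exists>u. u \<in> space U \<and> u \<noteq> 0" if "U \<in> I" for U
    using simp[OF that] fn.subspace_0[OF is_moduleD(1)[of G U]] unfolding simple_module_def by blast
  then obtain e where e: "\<And>U. U \<in> I \<Longrightarrow> e U \<in> space U \<and> e U \<noteq> 0" by metis
  define J where "J F = {x \<in> group_alg G. \<forall>U\<in>F. alg_act G U x (e U) = 0}" for F
  have subJ: "fn.subspace (J F)" for F
    unfolding J_def
    by (intro fn.subspaceI) (simp_all add: alg_act_linear_left fn.subspace_0[OF subspace_group_alg]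
      fn.subspace_add[OF subspace_group_alg] fn.subspace_scale[OF subspace_group_alg])
  have "card F + fn.dim (J F) \<le> fn.dim (group_alg G :: ('a \<Rightarrow> 'k) set)" if "finite F" "F \<subseteq> I" for F
    using that
  proof (induction F)
    case empty
    then show ?case by (simp add: J_def)
  next
    case (insert U F)
    obtain xs where xs: "set xs = F" "distinct xs" using finite_distinct_list[OF insert.hyps(1)] by blast
    let ?Us = "U # xs"
    have inI: "V \<in> I" if "V \<in> set ?Us" for V using that insert.prems xs by auto
    have dist: "distinct ?Us" using xs insert.hyps by simp
    let ?v = "tuple (map e ?Us)"
    have cv: "comp ?v k = e (?Us ! k)" if "k < length ?Us" for k using that by (simp only: comp_tuple length_map nth_map if_True)
    have v: "?v \<in> space (dsum ?Us)"
    proof -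
      have "comp ?v k \<in> map space ?Us ! k" if "k < length ?Us" for k
        unfolding cv[OF that] nth_map[OF that] using e inI nth_mem[OF that] by blast
      moreover have "comp ?v k = 0" if "k \<ge> length ?Us" for k using that by (simp only: comp_tuple length_map) simp
      ultimately show ?thesis by (simp only: dsum_simps dsum_space_iff length_map) blast
    qed
    have D: "is_module G (dsum ?Us)"
      using simp inI by (intro is_module_dsum) (simp add: simple_module_def)
    have nonisos: "\<not> rep_iso G (?Us ! j) (?Us ! k)" if "j < length ?Us" "k < length ?Us" "j \<noteq> k" for j k
      using uniq[OF inI[OF nth_mem[OF that(1)]] inI[OF nth_mem[OF that(2)]]] nth_eq_iff_index_eq[OF dist that(1,2)] that(3)
      by blast
    have "coord 0 (comp ?v 0) \<in> alg_span G (dsum ?Us) (fn.span {?v})"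
      by (rule sum_of_distinct_simples[OF simp[OF inI] nonisos v]) simp_all
    then obtain x where x: "coord 0 (comp ?v 0) = alg_act G (dsum ?Us) x ?v" "x \<in> group_alg G"
      unfolding alg_span_line[OF D v] by (rule imageE)
    have xk: "alg_act G (?Us ! k) x (e (?Us ! k)) = (if k = 0 then e U else 0)" if "k < length ?Us" for k
    proof -
      have "comp (alg_act G (dsum ?Us) x ?v) k = alg_act G (?Us ! k) x (comp ?v k)"
        using that by (simp only: comp_alg_act_dsum if_True)
      then show ?thesis unfolding x(1)[symmetric] cv[OF that] using cv[of 0] by (cases k) simp_all
    qed
    have "alg_act G V x (e V) = 0" if "V \<in> F" for V
    proof -
      obtain i where "i < length xs" "V = xs ! i" using \<open>V \<in> F\<close> xs(1) in_set_conv_nth[of V xs] by blast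
      then show ?thesis using xk[of "Suc i"] by simp
    qed
    then have "x \<in> J F" using x(2) by (simp add: J_def)
    moreover have "x \<notin> J (insert U F)" using xk[of 0] e[of U] insert.prems by (simp add: J_def)
    moreover have "J (insert U F) \<subseteq> J F" by (auto simp: J_def)
    ultimately have psub: "J (insert U F) \<subset> J F" by blast
    have "J F \<subseteq> group_alg G" by (auto simp: J_def)
    then have "fn.dim (J (insert U F)) < fn.dim (J F)"
      by (intro dim_psubset psub subJ finite_dim_subspace[OF finite_dim_group_alg])
    then show ?case using insert by simp
  qed
  then have "card F \<le> fn.dim (group_alg G :: ('a \<Rightarrow> 'k) set)" if "F \<subseteq> I" "finite F" for F
    using that by fastforce
  then show ?thesis using finite_if_finite_subsets_card_bdd[of I] by blast
qed

text \<open>\<open>E p\<close> is the polynomial \<open>p\<close> evaluated at \<open>g\<close> and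
  applied to \<open>v\<close>. For nonzero \<open>p\<close> of least degree with
  \<open>E p = 0\<close> and a root \<open>\<zeta>\<close> of \<open>p\<close>, the cofactor
  \<open>q\<close> of the linear factor has smaller degree, so \<open>E q\<close> is nonzero, and it
  is an eigenvector for \<open>\<zeta>\<close>.\<close>

lemma eigenvector_exists:
  fixes V :: "('a, 'k::alg_closed_field) rep"
  assumes V: "is_module G V" and g: "g \<in> carrier G" and v: "v \<in> space V" "v \<noteq> 0"
  obtains \<zeta> w where "w \<in> space V" "w \<noteq> 0" "act V g w = smul \<zeta> w"
proof -
  define a where "a i = act V (g [^] i) v" for i :: nat
  define E where "E p = (\<Sum>i\<le>degree p. smul (coeff p i) (a i))" for p
  have aV: "a i \<in> space V" for i using is_moduleD(2)[OF V _ v(1)] g by (simp add: a_def)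
  have a_Suc: "act V g (a i) = a (Suc i)" for i
    using is_moduleD(5)[OF V g _ v(1), of "g [^] i"] g nat_pow_Suc2[OF g] by (simp add: a_def)
  have E_ge: "E p = (\<Sum>i\<le>n. smul (coeff p i) (a i))" if "degree p \<le> n" for p n
    unfolding E_def using that by (intro sum.mono_neutral_left) (auto simp: coeff_eq_0)
  define n where "n = card (carrier G)"
  have n: "n \<noteq> 0" by (simp add: n_def card_ne)
  \<comment> \<open>The polynomial \<open>X^n - 1\<close> for the group order \<open>n\<close>: it
    kills \<open>v\<close>, so that a polynomial of least degree exists below, whatever the
    dimension of the module.\<close>
  define p0 where "p0 = monom (1 :: 'k) n - 1"
  have p0: "degree p0 \<le> n" unfolding p0_def by (intro degree_diff_le degree_monom_le) simp
  have "coeff p0 n = 1" using n by (simp add: p0_def)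
  then have p0': "p0 \<noteq> 0" by auto
  have "E p0 = (\<Sum>i\<le>n. smul (coeff p0 i) (a i))" by (rule E_ge[OF p0])
  also have "\<dots> = (\<Sum>i\<in>{0, n}. smul (coeff p0 i) (a i))"
    using n by (intro sum.mono_neutral_right) (auto simp: p0_def one_pCons coeff_pCons split: nat.splits)
  also have "\<dots> = a n - a 0" using n by (simp add: p0_def fun_eq_iff fun_simps)
  also have "a n = a 0" using pow_order_eq_1[OF g] by (simp add: a_def n_def Coset.order_def)
  finally have E0: "E p0 = 0" by simp
  define d where "d = (LEAST d. \<exists>p. p \<noteq> 0 \<and> degree p = d \<and> E p = 0)"
  have "\<exists>p. p \<noteq> 0 \<and> degree p = d \<and> E p = 0"
    unfolding d_def by (rule LeastI[of _ "degree p0"]) (use p0' E0 in blast)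
  then obtain p where p: "p \<noteq> 0" "degree p = d" "E p = 0" by blast
  have min: "E q \<noteq> 0" if "q \<noteq> 0" "degree q < d" for q
    using not_less_Least[of "degree q" "\<lambda>d. \<exists>p. p \<noteq> 0 \<and> degree p = d \<and> E p = 0"] that unfolding d_def by blast
  have "degree p \<noteq> 0"
  proof
    assume "degree p = 0"
    then obtain c where c: "p = [:c:]" by (rule degree_eq_zeroE)
    then have "smul c v = 0" using p(3) is_moduleD(4)[OF V v(1)] by (simp add: E_def a_def)
    then show False using c p(1) v(2) by simp
  qed
  then obtain \<zeta> where "poly p \<zeta> = 0" using alg_closed_imp_poly_has_root[of p] by auto
  then obtain q where q: "p = [:-\<zeta>, 1:] * q" by (auto simp: poly_eq_0_iff_dvd)
  then have q0: "q \<noteq> 0" using p(1) by auto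
  have deg: "degree p = Suc (degree q)" unfolding q by (subst degree_mult_eq) (use q0 in simp_all)
  define m where "m = degree q"
  have coeff_p: "coeff p i = (case i of 0 \<Rightarrow> 0 | Suc j \<Rightarrow> coeff q j) - \<zeta> * coeff q i" for i
    by (simp add: q coeff_pCons)
  have "E p = (\<Sum>i\<le>Suc m. smul (coeff p i) (a i))" by (rule E_ge) (simp add: deg m_def)
  also have "\<dots> = (\<Sum>i\<le>Suc m. smul (case i of 0 \<Rightarrow> 0 | Suc j \<Rightarrow> coeff q j) (a i)) - (\<Sum>i\<le>Suc m. smul (\<zeta> * coeff q i) (a i))"
    unfolding coeff_p by (simp add: fn.scale_left_diff_distrib sum_subtractf del: sum.atMost_Suc)
  also have "(\<Sum>i\<le>Suc m. smul (case i of 0 \<Rightarrow> 0 | Suc j \<Rightarrow> coeff q j) (a i)) = (\<Sum>i\<le>m. smul (coeff q i) (a (Suc i)))"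
    by (subst sum.atMost_Suc_shift) simp
  also have "\<dots> = (\<Sum>i\<le>m. act V g (smul (coeff q i) (a i)))"
    using linear_on_smul[OF is_moduleD(3)[OF V g] aV] a_Suc by simp
  also have "\<dots> = act V g (E q)"
    unfolding E_def m_def using fn.subspace_scale[OF is_moduleD(1)[OF V] aV]
    by (intro linear_on_sum[OF is_moduleD(3)[OF V g] is_moduleD(1)[OF V], symmetric]) simp
  also have "(\<Sum>i\<le>Suc m. smul (\<zeta> * coeff q i) (a i)) = smul \<zeta> (E q)"
    by (subst E_ge[of q "Suc m"]) (simp_all add: m_def fn.scale_sum_right fn.scale_right_distrib)
  finally have "act V g (E q) = smul \<zeta> (E q)" using p(3) by simp
  moreover have "E q \<in> space V" unfolding E_def by (intro fn.subspace_sum fn.subspace_scale is_moduleD(1)[OF V] aV)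
  moreover have "E q \<noteq> 0" using min[OF q0] deg p(2) by simp
  ultimately show thesis using that by blast
qed

text \<open>By commutativity an eigenspace of \<open>g\<close> is a submodule, hence everything.
  Once all group elements act on \<open>v\<close> by scalars, the line through \<open>v\<close> is a
  submodule.\<close>

lemma simple_commuting_dim:
  fixes V :: "('a, 'k::alg_closed_field) rep"
  assumes V: "simple_module G V"
    and comm: "\<And>g h v. g \<in> carrier G \<Longrightarrow> h \<in> carrier G \<Longrightarrow> v \<in> space V \<Longrightarrow> act V g (act V h v) = act V h (act V g v)"
  shows "fn.dim (space V) = 1"
proof -
  have mod: "is_module G V" using V by (simp add: simple_module_def)
  note sV = is_moduleD(1)[OF mod]
  obtain v where v: "v \<in> space V" "v \<noteq> 0"
    using V fn.subspace_0[OF sV] unfolding simple_module_def by blast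
  have scalar: "\<exists>\<zeta>. act V g v = smul \<zeta> v" if g: "g \<in> carrier G" for g
  proof -
    obtain \<zeta> w where w: "w \<in> space V" "w \<noteq> 0" "act V g w = smul \<zeta> w"
      by (rule eigenvector_exists[OF mod g v]) (rule that)
    let ?E = "{u \<in> space V. act V g u = smul \<zeta> u}"
    note lin = is_moduleD(3)[OF mod]
    have "fn.subspace ?E"
      using linear_on_add[OF lin[OF g]] linear_on_smul[OF lin[OF g]] linear_on_zero[OF lin[OF g] sV]
      by (intro fn.subspaceI)
         (simp_all add: fn.subspace_0[OF sV] fn.subspace_add[OF sV] fn.subspace_scale[OF sV]
            fn.scale_right_distrib mult.commute)
    moreover have "act V h u \<in> ?E" if "h \<in> carrier G" "u \<in> ?E" for h u
      using that comm[OF g that(1), of u] linear_on_smul[OF lin[OF that(1)], of u \<zeta>] is_moduleD(2)[OF mod that(1), of u] by simp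
    ultimately have "submodule G V ?E" unfolding submodule_def by blast
    then have "?E = {0} \<or> ?E = space V" using V unfolding simple_module_iff by blast
    moreover have "w \<in> ?E" using w by simp
    ultimately have "v \<in> ?E" using v w(2) by blast
    then show ?thesis by blast
  qed
  have "fn.span {v} \<subseteq> space V" using v(1) sV by (intro fn.span_minimal) auto
  moreover have "act V g (smul c v) \<in> fn.span {v}" if "g \<in> carrier G" for g c
    using scalar[OF that] linear_on_smul[OF is_moduleD(3)[OF mod that] v(1), of c]
    unfolding fn.span_singleton by auto
  ultimately have "submodule G V (fn.span {v})"
    unfolding submodule_def using fn.subspace_span[of "{v}"] by (auto simp: fn.span_singleton)
  moreover have "v \<in> fn.span {v}" by (simp add: fn.span_base)
  ultimately have "space V = fn.span {v}" using V v(2) unfolding simple_module_iff by blast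
  then show ?thesis using dim_line[OF v(2)] by simp
qed

section \<open>One-dimensional modules\<close>

lemma one_dim_module:
  assumes V: "is_module G V" and dim: "fn.dim (space V) = 1"
  obtains v \<chi> where "v \<noteq> 0" "space V = fn.span {v}" "\<And>g w. g \<in> carrier G \<Longrightarrow> w \<in> space V \<Longrightarrow> act V g w = smul (\<chi> g) w"
proof -
  obtain v where v: "v \<noteq> 0" "space V = fn.span {v}" using dim_one_line[OF is_moduleD(1)[OF V] dim] by blast
  have vV: "v \<in> space V" using v(2) by (simp add: fn.span_base)
  have "\<exists>c. act V g v = smul c v" if "g \<in> carrier G" for g
    using is_moduleD(2)[OF V that vV] unfolding v(2) fn.span_singleton by blast
  then obtain \<chi> where \<chi>: "\<And>g. g \<in> carrier G \<Longrightarrow> act V g v = smul (\<chi> g) v" by metis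
  have "act V g w = smul (\<chi> g) w" if g: "g \<in> carrier G" and w: "w \<in> space V" for g w
  proof -
    obtain c where "w = smul c v" using w unfolding v(2) fn.span_singleton by blast
    then show ?thesis using linear_on_smul[OF is_moduleD(3)[OF V g] vV, of c] \<chi>[OF g] by (simp add: mult.commute)
  qed
  then show thesis by (rule that[OF v])
qed

lemma one_dim_simple:
  fixes V :: "('a, 'k::field) rep"
  assumes V: "is_module G V" and dim: "fn.dim (space V) = 1"
  shows "simple_module G V"
proof -
  obtain v where v: "v \<noteq> 0" "space V = fn.span {v}" using dim_one_line[OF is_moduleD(1)[OF V] dim] by blast
  have "W = {0} \<or> W = space V" if W: "submodule G V W" for W
  proof (cases "W \<subseteq> {0}")
    case True
    then show ?thesis using fn.subspace_0[OF submoduleD(1)[OF W]] by auto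
  next
    case False
    then obtain w where w: "w \<in> W" "w \<noteq> 0" by blast
    then obtain c where c: "w = smul c v" using submoduleD(2)[OF W] unfolding v(2) fn.span_singleton by blast
    then have "v = smul (1 / c) w" using w(2) by auto
    then have "v \<in> W" using fn.subspace_scale[OF submoduleD(1)[OF W] w(1)] by simp
    then have "space V \<subseteq> W" unfolding v(2) by (intro fn.span_minimal submoduleD(1)[OF W]) simp
    then show ?thesis using submoduleD(2)[OF W] by blast
  qed
  moreover have "v \<in> space V" using v(2) by (simp add: fn.span_base)
  ultimately show ?thesis using V v(1) unfolding simple_module_iff by blast
qed

lemma one_dim_iso:
  assumes V: "v \<noteq> 0" "space V = fn.span {v}" "\<And>g w. g \<in> carrier G \<Longrightarrow> w \<in> space V \<Longrightarrow> act V g w = smul (\<chi> g) w"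
    and W: "w \<noteq> 0" "space W = fn.span {w}" "\<And>g v. g \<in> carrier G \<Longrightarrow> v \<in> space W \<Longrightarrow> act W g v = smul (\<chi> g) v"
  shows "rep_iso G V W"
proof -
  obtain i where i: "v i \<noteq> 0" using V(1) by (auto simp: fun_eq_iff zero_fun_apply)
  \<comment> \<open>On the line through \<open>v\<close>, the quotient \<open>u i / v i\<close> is
    the coefficient of \<open>u\<close> with respect to \<open>v\<close>.\<close>
  let ?f = "\<lambda>u. smul (u i / v i) w"
  have fv: "?f (smul c v) = smul c w" for c using i by (simp add: smul_apply)
  have lin: "linear_on (space V) ?f"
    by (rule linear_onI) (simp_all add: fun_simps add_divide_distrib fn.scale_left_distrib)
  have "bij_betw ?f (space V) (space W)"
    unfolding bij_betw_def
  proof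
    show "inj_on ?f (space V)"
    proof (rule inj_onI)
      fix a b assume "a \<in> space V" "b \<in> space V" and eq: "?f a = ?f b"
      then obtain c d where cd: "a = smul c v" "b = smul d v" unfolding V(2) fn.span_singleton by blast
      then have "smul c w = smul d w" using eq fv by simp
      then show "a = b" using W(1) cd by simp
    qed
    have "?f ` range (\<lambda>c. smul c v) = range (\<lambda>c. smul c w)" by (simp only: image_image fv)
    then show "?f ` space V = space W" unfolding V(2) W(2) fn.span_singleton .
  qed
  moreover have "?f (act V g u) = act W g (?f u)" if g: "g \<in> carrier G" and u: "u \<in> space V" for g u
  proof -
    have "?f u \<in> space W" unfolding W(2) by (intro fn.span_scale fn.span_base) simp
    then show ?thesis using linear_on_smul[OF lin u] by (simp only: V(3)[OF g u] W(3)[OF g])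
  qed
  ultimately show ?thesis unfolding rep_iso_def using lin by blast
qed

end


section \<open>Standard gliders\<close>

context finite_group
begin

text \<open>Frobenius reciprocity for \<open>K[G/S]\<close>: a homomorphism sending the coset
  \<open>S\<close> to \<open>v\<close> exists iff \<open>S\<close> fixes \<open>v\<close>.\<close>

lemma killed_coset_ann_iff:
  fixes V :: "('a, 'k::field_char_0) rep"
  assumes V: "is_module G V" and S: "subgroup S G" and v: "v \<in> space V"
  shows "(\<forall>x\<in>coset_ann G S. alg_act G V x v = 0) \<longleftrightarrow> (\<forall>s\<in>S. act V s v = v)"
proof (intro iffI ballI)
  fix s assume k: "\<forall>x\<in>coset_ann G S. alg_act G V x v = 0" and s: "s \<in> S"
  have sG: "s \<in> carrier G" by (rule subgroup.mem_carrier[OF S s])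
  have "alg_act G V (delta s - delta \<one>) v = 0"
    using k delta_diff_in_coset_ann[OF S one_closed s, where ?'k = 'k] sG by simp
  moreover have "alg_act G V (delta s - delta \<one>) v + alg_act G V (delta \<one>) v = alg_act G V (delta s) v"
    by (simp flip: alg_act_linear_left(1))
  ultimately show "act V s v = v"
    using is_moduleD(4)[OF V v] by (simp add: alg_act_delta[OF finite_carrier] sG)
next
  fix x :: "'a \<Rightarrow> 'k" assume inv: "\<forall>s\<in>S. act V s v = v" and x: "x \<in> coset_ann G S"
  have "(\<Sum>g\<in>carrier G. x g * act V g v i) = 0" for i
    using is_moduleD(5)[OF V _ subgroup.mem_carrier[OF S] v] inv
    by (intro coset_ann_sum[OF S x]) simp
  then show "alg_act G V x v = 0"
    by (simp add: alg_act_def fun_eq_iff sum_fun_apply smul_apply zero_fun_apply)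
qed

lemma subspace_alg_act_kernel:
  assumes V: "is_module G V"
  shows "fn.subspace {v \<in> space V. \<forall>x\<in>J. alg_act G V x v = 0}"
proof -
  note sV = is_moduleD(1)[OF V] and lin = alg_act_linear[OF V]
  show ?thesis
    by (intro fn.subspaceI)
       (simp_all add: fn.subspace_0[OF sV] fn.subspace_add[OF sV] fn.subspace_scale[OF sV]
        linear_on_zero[OF lin sV] linear_on_add[OF lin] linear_on_smul[OF lin])
qed

text \<open>The action is componentwise, so the annihilator of the tuple is the intersection of
  those of its components and depends only on the set of pairs in the list.\<close>

lemma cyclic_glider_props:
  fixes cs :: "(('a, 'k::field) rep \<times> (nat \<Rightarrow> 'k)) list"
  assumes cs: "\<And>U c. (U, c) \<in> set cs \<Longrightarrow> is_module G U \<and> finite_dim (space U) \<and> c \<in> space U \<and> c \<noteq> 0"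
    and ne: "cs \<noteq> []"
  shows "cyclic G (cyclic_glider cs)"
    and "ann G (cyclic_glider cs) = {x \<in> group_alg G. \<forall>(U, c)\<in>set cs. alg_act G U x c = 0}"
proof -
  let ?X = "cyclic_glider cs" and ?D = "dsum (map fst cs)" and ?v = "tuple (map snd cs)"
  have simps: "space ?X = space ?D" "act ?X = act ?D" "lev0 ?X = space ?D" "lev1 ?X = fn.span {?v}"
    by (simp_all add: cyclic_glider_def rep.defs)
  have nth: "is_module G (fst (cs ! k))" "finite_dim (space (fst (cs ! k)))" "snd (cs ! k) \<in> space (fst (cs ! k))" "snd (cs ! k) \<noteq> 0"
    if "k < length cs" for k
    using cs[of "fst (cs ! k)" "snd (cs ! k)"] nth_mem[OF that] by simp_all
  have D: "is_module G ?D"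
  proof (rule is_module_dsum)
    fix U assume "U \<in> set (map fst cs)"
    then obtain k where "k < length cs" "U = fst (cs ! k)" by (auto simp: in_set_conv_nth)
    then show "is_module G U" using nth(1) by simp
  qed
  have vD: "?v \<in> space ?D"
    using nth(3) by (simp add: dsum_space_iff comp_tuple)
  have "comp ?v 0 \<noteq> 0" using ne nth(4)[of 0] by (simp add: comp_tuple)
  then have v0: "?v \<noteq> 0" by auto
  have mod: "is_module G ?X" using D is_module_cong[of ?X ?D G] simps by simp
  have fd: "finite_dim (space ?D)"
    unfolding dsum_simps(1)
  proof (rule finite_dim_dsum_space)
    fix V assume "V \<in> set (map space (map fst cs))"
    then obtain k where "k < length cs" "V = space (fst (cs ! k))" by (auto simp: in_set_conv_nth)
    then show "finite_dim V" using nth(2) by simp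
  qed
  have "fn.span {?v} \<subseteq> space ?D" by (intro fn.span_minimal is_moduleD(1)[OF D]) (use vD in simp)
  then have gl: "is_glider G ?X"
    unfolding is_glider_iff[OF finite_carrier] simps using mod fd is_moduleD(2)[OF D] by auto
  then have "generates ?X ?v" using v0 simps by (simp add: generates_def)
  then show "cyclic G ?X" by (rule generates_cyclic)
  have "alg_act G ?X x ?v = 0 \<longleftrightarrow> (\<forall>k<length cs. alg_act G (fst (cs ! k)) x (snd (cs ! k)) = 0)" for x
  proof -
    have "comp (alg_act G ?X x ?v) k = (if k < length cs then alg_act G (fst (cs ! k)) x (snd (cs ! k)) else 0)" for k
      unfolding alg_act_cong[of ?X ?D, OF simps(2)] by (simp add: comp_alg_act_dsum comp_tuple)
    moreover have "alg_act G ?X x ?v = 0 \<longleftrightarrow> (\<forall>k. comp (alg_act G ?X x ?v) k = 0)"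
      using comp_eqI[of "alg_act G ?X x ?v" 0] by auto
    ultimately show ?thesis by simp
  qed
  then show "ann G ?X = {x \<in> group_alg G. \<forall>(U, c)\<in>set cs. alg_act G U x c = 0}"
    unfolding ann_line[OF gl simps(4)] by (fastforce simp: in_set_conv_nth case_prod_beta)
qed

end

locale glider_params = finite_group G for G (structure) +
  fixes T :: "'a set \<Rightarrow> 'a set \<Rightarrow> ('a, 'k::{alg_closed_field, field_char_0}) rep"
    and Irr :: "'a set \<Rightarrow> ('a, 'k) rep set"
  assumes T: "one_dim_param G (T (carrier G))" and Irr: "irr_param G (Irr (carrier G))"
begin

abbreviation "G' \<equiv> derived G (carrier G)"
abbreviation "chr \<equiv> T (carrier G)"
abbreviation "irrs \<equiv> Irr (carrier G)"

lemma group_ab: "group (ab G)"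
  unfolding ab_def by (rule normal.factorgroup_is_group[OF derived_self_is_normal])

lemma finite_ab: "finite (carrier (ab G))"
  using finite_carrier by (simp add: ab_def FactGroup_def RCOSETS_def)

lemma one_ab: "\<one>\<^bsub>ab G\<^esub> \<in> carrier (ab G)"
  by (rule group.is_monoid[OF group_ab, THEN monoid.one_closed])

lemma chr_ex1: "is_module G (V :: ('a, 'k) rep) \<Longrightarrow> fn.dim (space V) = 1 \<Longrightarrow> \<exists>!z. z \<in> carrier (ab G) \<and> rep_iso G V (chr z)"
  by (rule T[unfolded one_dim_param_def, THEN conjunct2, THEN conjunct2, rule_format, OF conjI])

lemma irr_ex1: "simple_module G (V :: ('a, 'k) rep) \<Longrightarrow> \<exists>!U. U \<in> irrs \<and> rep_iso G V U"
  by (rule Irr[unfolded irr_param_def, THEN conjunct2, rule_format])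

lemma chr:
  assumes "z \<in> carrier (ab G)"
  shows "is_module G (chr z)" "fn.dim (space (chr z)) = 1" "simple_module G (chr z)" "finite_dim (space (chr z))"
proof -
  show 1: "is_module G (chr z)" "fn.dim (space (chr z)) = 1" using T assms by (auto simp: one_dim_param_def)
  show "simple_module G (chr z)" by (rule one_dim_simple[OF 1])
  show "finite_dim (space (chr z))" using 1 by (intro finite_dim_of_dim_pos is_moduleD(1)[OF 1(1)]) simp
qed

lemma chr_span:
  assumes "z \<in> carrier (ab G)" "v \<in> space (chr z)" "v \<noteq> 0"
  shows "space (chr z) = fn.span {v}"
proof -
  obtain t where t: "t \<noteq> 0" "space (chr z) = fn.span {t}" 
    using dim_one_line[OF is_moduleD(1)] chr[OF assms(1)] by metis
  obtain c where c: "v = smul c t" using assms(2) unfolding t(2) fn.span_singleton by blast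
  have "t = smul (1 / c) v" using c assms(3) by auto
  then have "t \<in> fn.span {v}" by (simp add: fn.span_scale fn.span_base)
  moreover have "v \<in> fn.span {t}" using c by (simp add: fn.span_scale fn.span_base)
  ultimately show ?thesis unfolding t(2) by (intro equalityI fn.span_minimal) auto
qed

lemma irrs:
  assumes "U \<in> irrs"
  shows "simple_module G U" "is_module G U" "fn.dim (space U) > 1 \<Longrightarrow> finite_dim (space U)"
proof -
  show "simple_module G U" using Irr assms by (simp add: irr_param_def)
  then show m: "is_module G U" by (simp add: simple_module_def)
  show "fn.dim (space U) > 1 \<Longrightarrow> finite_dim (space U)"
    by (intro finite_dim_of_dim_pos is_moduleD(1)[OF m]) simp
qed

text \<open>The annihilator of the standard glider, written without the orderings, vectors and bases
  on which \<open>standard_glider\<close> depends.\<close>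

definition std_ann :: "'a set set \<Rightarrow> (('a, 'k) rep \<times> (nat \<Rightarrow> 'k) set) set \<Rightarrow> ('a \<Rightarrow> 'k) set"
  where "std_ann A B = {x \<in> group_alg G. (\<forall>z\<in>A. \<forall>v\<in>space (chr z). alg_act G (chr z) x v = 0) \<and>
    (\<forall>(U, W)\<in>B. \<forall>w\<in>W. alg_act G U x w = 0)}"

text \<open>\<open>B\<close> is finite, and can hence be listed, because there are finitely many
  simple modules in \<open>irrs\<close> and at most one point over each.\<close>

lemma admissibleD:
  assumes "admissible G Irr A B"
  shows "A \<subseteq> carrier (ab G)" "finite A" "finite B" "A \<noteq> {} \<or> B \<noteq> {}"
    and "(U, W) \<in> B \<Longrightarrow> U \<in> irrs \<and> is_module G U \<and> finite_dim (space U) \<and> finite_dim W \<and> W \<subseteq> space U \<and> fn.dim W \<noteq> 0 \<and> 1 < fn.dim (space U)"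
proof -
  show A: "A \<subseteq> carrier (ab G)" and "A \<noteq> {} \<or> B \<noteq> {}" using assms by (auto simp: admissible_def)
  show "finite A" by (rule finite_subset[OF A finite_ab])
  have B: "B \<subseteq> (SIGMA U : {U \<in> irrs. fn.dim (space U) > 1}. grass U)"
    and uniq: "\<And>U W W'. (U, W) \<in> B \<Longrightarrow> (U, W') \<in> B \<Longrightarrow> W = W'"
    using assms by (auto simp: admissible_def SS_def)
  have "inj_on fst B" by (rule inj_onI) (metis prod.collapse uniq)
  moreover have "finite (fst ` B)" using B by (intro finite_subset[OF _ finite_irr[OF Irr]]) auto
  ultimately show "finite B" using finite_image_iff by blast
  assume "(U, W) \<in> B"
  then have UW: "U \<in> irrs" "1 < fn.dim (space U)" "fn.subspace W" "W \<subseteq> space U" "1 \<le> fn.dim W"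
    using B by (auto simp: grass_def)
  have "finite_dim (space U)" by (rule irrs(3)[OF UW(1,2)])
  then show "U \<in> irrs \<and> is_module G U \<and> finite_dim (space U) \<and> finite_dim W \<and> W \<subseteq> space U \<and> fn.dim W \<noteq> 0 \<and> 1 < fn.dim (space U)"
    using UW finite_dim_subspace[of "space U" W] irrs(2)[OF UW(1)] by simp
qed

lemma standard_exists:
  assumes "admissible G Irr A B"
  shows "\<exists>X. standard_glider chr A B X"
proof -
  note adm = admissibleD[OF assms]
  obtain zs where zs: "set zs = A" "distinct zs" using finite_distinct_list[OF adm(2)] by blast
  obtain ps where ps: "set ps = B" "distinct ps" using finite_distinct_list[OF adm(3)] by blast
  have "\<exists>v. v \<in> space (chr z) \<and> v \<noteq> 0" if "z \<in> A" for z
  proof -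
    have z: "z \<in> carrier (ab G)" using adm(1) that by blast
    obtain v where "v \<noteq> 0" "space (chr z) = fn.span {v}"
      using dim_one_line[OF is_moduleD(1)[OF chr(1)[OF z]] chr(2)[OF z]] by blast
    then show ?thesis using fn.span_base[of v "{v}"] by auto
  qed
  then obtain c where c: "\<And>z. z \<in> A \<Longrightarrow> c z \<in> space (chr z) \<and> c z \<noteq> 0" by metis
  have "\<exists>b. distinct b \<and> fn.independent (set b) \<and> fn.span (set b) = snd p" if "p \<in> B" for p
  proof -
    have "finite_dim (snd p)" using adm(5)[of "fst p" "snd p"] that by simp
    then obtain S where S: "finite S" "fn.independent S" "snd p = fn.span S" using finite_dim_basis by blast
    obtain b where "set b = S" "distinct b" using finite_distinct_list[OF S(1)] by blast
    then show ?thesis using S by (intro exI[of _ b]) simp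
  qed
  then obtain b where b: "\<And>p. p \<in> B \<Longrightarrow> distinct (b p) \<and> fn.independent (set (b p)) \<and> fn.span (set (b p)) = snd p" by metis
  show ?thesis
    unfolding standard_glider_def using zs ps b c by blast
qed

text \<open>An algebra element kills a basis of \<open>W\<close> iff it kills \<open>W\<close>, and
  kills a nonzero vector of a line iff it kills the line; so the choices made in building the glider
  leave the annihilator unchanged.\<close>

lemma standard_ann:
  assumes adm: "admissible G Irr A B" and X: "standard_glider chr A B X"
  shows "cyclic G X" "ann G X = std_ann A B"
proof -
  note adm = admissibleD[OF adm]
  obtain zs c ps b where zs: "set zs = A" and ps: "set ps = B"
    and c: "\<forall>z\<in>A. c z \<in> space (chr z) \<and> c z \<noteq> 0"
    and b: "\<forall>p\<in>B. distinct (b p) \<and> fn.independent (set (b p)) \<and> fn.span (set (b p)) = snd p"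
    and X: "X = cyclic_glider (map (\<lambda>z. (chr z, c z)) zs @ concat (map (\<lambda>p. map (Pair (fst p)) (b p)) ps))"
    using X unfolding standard_glider_def by blast
  define cs where "cs = map (\<lambda>z. (chr z, c z)) zs @ concat (map (\<lambda>p. map (Pair (fst p)) (b p)) ps)"
  have set_cs: "set cs = (\<lambda>z. (chr z, c z)) ` A \<union> (\<Union>p\<in>B. Pair (fst p) ` set (b p))"
    unfolding cs_def by (simp add: zs ps)
  have indep0: "0 \<notin> set (b p)" if "p \<in> B" for p using b that fn.dependent_zero by blast
  have bW: "set (b (U, W)) \<subseteq> W" if "(U, W) \<in> B" for U W
    using b that fn.span_superset[of "set (b (U, W))"] by force
  have cs: "is_module G U \<and> finite_dim (space U) \<and> v \<in> space U \<and> v \<noteq> 0" if "(U, v) \<in> set cs" for U v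
  proof -
    from that consider (1) z where "z \<in> A" "U = chr z" "v = c z" | (2) W where "(U, W) \<in> B" "v \<in> set (b (U, W))"
      unfolding set_cs by auto
    then show ?thesis
    proof cases
      case 1
      then have z: "z \<in> carrier (ab G)" using adm(1) by blast
      show ?thesis unfolding 1(2,3) using chr(1,4)[OF z] c 1(1) by blast
    next
      case 2
      have "v \<noteq> 0" using indep0[OF 2(1)] 2(2) by auto
      then show ?thesis using adm(5)[OF 2(1)] bW[OF 2(1)] 2(2) by blast
    qed
  qed
  have ne: "cs \<noteq> []"
  proof (cases "A = {}")
    case True
    then obtain U W where UW: "(U, W) \<in> B" using adm(4) by auto
    have "b (U, W) \<noteq> []"
    proof
      assume e: "b (U, W) = []"
      have "W = fn.span (set (b (U, W)))" using b UW by force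
      then have "W = {0}" unfolding e by simp
      then show False using adm(5)[OF UW] by simp
    qed
    then have "set cs \<noteq> {}" unfolding set_cs using UW by force
    then show ?thesis by auto
  next
    case False
    then have "set cs \<noteq> {}" unfolding set_cs by blast
    then show ?thesis by auto
  qed
  show "cyclic G X" unfolding X cs_def[symmetric] by (rule cyclic_glider_props(1)[OF cs ne])
  have 1: "(\<forall>v\<in>space (chr z). alg_act G (chr z) x v = 0) \<longleftrightarrow> alg_act G (chr z) x (c z) = 0" if "z \<in> A" for x z
  proof
    have z: "z \<in> carrier (ab G)" using adm(1) that by blast
    have cz: "c z \<in> space (chr z)" "c z \<noteq> 0" using c that by auto
    assume 0: "alg_act G (chr z) x (c z) = 0"
    show "\<forall>v\<in>space (chr z). alg_act G (chr z) x v = 0"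
      using linear_on_smul[OF alg_act_linear[OF chr(1)[OF z]] cz(1)] 0
      unfolding chr_span[OF z cz] fn.span_singleton by auto
  qed (use c that in blast)
  have 2: "(\<forall>w\<in>W. alg_act G U x w = 0) \<longleftrightarrow> (\<forall>w\<in>set (b (U, W)). alg_act G U x w = 0)" if "(U, W) \<in> B" for U W x
  proof
    assume 0: "\<forall>w\<in>set (b (U, W)). alg_act G U x w = 0"
    note UW = adm(5)[OF that]
    have "fn.span (set (b (U, W))) \<subseteq> {v \<in> space U. \<forall>x\<in>{x}. alg_act G U x v = 0}"
      using 0 bW[OF that] UW by (intro fn.span_minimal subspace_alg_act_kernel) auto
    then show "\<forall>w\<in>W. alg_act G U x w = 0" using b that by force
  qed (use bW[OF that] in blast)
  have eq: "(\<forall>(U, c)\<in>set cs. alg_act G U x c = 0) \<longleftrightarrow>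
      (\<forall>z\<in>A. \<forall>v\<in>space (chr z). alg_act G (chr z) x v = 0) \<and> (\<forall>(U, W)\<in>B. \<forall>w\<in>W. alg_act G U x w = 0)" for x
  proof -
    have "(\<forall>(U, c)\<in>set cs. alg_act G U x c = 0) \<longleftrightarrow> (\<forall>z\<in>A. alg_act G (chr z) x (c z) = 0) \<and>
      (\<forall>(U, W)\<in>B. \<forall>w\<in>set (b (U, W)). alg_act G U x w = 0)"
      unfolding set_cs ball_Un by (auto simp: split_beta)
    then show ?thesis using 1 2 by (simp add: split_beta cong: ball_cong)
  qed
  have "ann G X = {x \<in> group_alg G. \<forall>(U, c)\<in>set cs. alg_act G U x c = 0}"
    unfolding X cs_def[symmetric] by (rule cyclic_glider_props(2)[OF cs ne])
  then show "ann G X = std_ann A B" unfolding std_ann_def eq .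
qed

lemma Mcls_eq:
  assumes "admissible G Irr A B"
  obtains X where "cyclic G X" "Mcls G T A B = cls G X" "ann G X = std_ann A B"
proof -
  have "standard_glider chr A B (SOME X. standard_glider chr A B X)"
    by (rule someI_ex[OF standard_exists[OF assms]])
  then show thesis by (intro that[OF standard_ann(1)[OF assms] _ standard_ann(2)[OF assms]]) (simp_all add: Mcls_def)
qed

lemma Mcls_eq_iff:
  assumes "admissible G Irr A B" "cyclic G X"
  shows "Mcls G T A B = cls G X \<longleftrightarrow> std_ann A B = ann G X"
proof -
  obtain Y where "cyclic G Y" "Mcls G T A B = cls G Y" "ann G Y = std_ann A B" by (rule Mcls_eq[OF assms(1)])
  then show ?thesis using cls_eq_iff[of Y X] assms(2) by simp
qed

section \<open>Parameters recovered from an annihilator\<close>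

lemma simple_cases:
  fixes Q :: "('a, 'k) rep"
  assumes Q: "simple_module G Q" "finite_dim (space Q)"
  obtains z where "z \<in> carrier (ab G)" "rep_iso G Q (chr z)"
    | U where "U \<in> irrs" "1 < fn.dim (space U)" "rep_iso G Q U"
proof (cases "fn.dim (space Q) = 1")
  case True
  have "is_module G Q" using Q(1) by (simp add: simple_module_def)
  from chr_ex1[OF this True] obtain z where "z \<in> carrier (ab G) \<and> rep_iso G Q (chr z)" by (rule ex1E)
  then show thesis by (intro that(1)[of z]) simp_all
next
  case False
  from irr_ex1[OF Q(1)] obtain U where "U \<in> irrs \<and> rep_iso G Q U" by (rule ex1E)
  then have U: "U \<in> irrs" "rep_iso G Q U" by simp_all
  obtain f where f: "equivariant G Q U f" "bij_betw f (space Q) (space U)" by (rule rep_iso_equivariant[OF U(2)])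
  have "fn.dim (space U) = fn.dim (space Q)"
    using dim_linear_on_image[OF equivariantD(1)[OF f(1)] Q(2)] f(2) by (simp add: bij_betw_def)
  moreover have "space Q \<noteq> {0}" using Q(1) by (simp add: simple_module_def)
  then have "fn.dim (space Q) \<noteq> 0" using finite_dim_eq_0[OF Q(2)] by blast
  ultimately show thesis using False U that(2) by auto
qed

text \<open>Together with \<open>W_of\<close> and \<open>B_of\<close>, this collects the vectors of
  simple modules killed by \<open>J\<close>. For \<open>J\<close> the annihilator of a generator
  \<open>u\<close>, such vectors of \<open>U\<close> are the possible images of \<open>u\<close>
  under homomorphisms from \<open>K[G] u\<close> to \<open>U\<close>.\<close>

definition A_of :: "('a \<Rightarrow> 'k) set \<Rightarrow> 'a set set"
  where "A_of J = {z \<in> carrier (ab G). \<forall>x\<in>J. \<forall>v\<in>space (chr z). alg_act G (chr z) x v = 0}"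

definition W_of :: "('a \<Rightarrow> 'k) set \<Rightarrow> ('a, 'k) rep \<Rightarrow> (nat \<Rightarrow> 'k) set"
  where "W_of J U = {w \<in> space U. \<forall>x\<in>J. alg_act G U x w = 0}"

definition B_of :: "('a \<Rightarrow> 'k) set \<Rightarrow> (('a, 'k) rep \<times> (nat \<Rightarrow> 'k) set) set"
  where "B_of J = {(U, W_of J U) |U. U \<in> irrs \<and> 1 < fn.dim (space U) \<and> W_of J U \<noteq> {0}}"

text \<open>If \<open>x u\<close> is nonzero, \<open>separation\<close> gives a homomorphism
  \<theta> from \<open>K[G] u\<close> to a simple module with \<theta>(x u) nonzero. The image of
  \<open>u\<close> is then killed by the annihilator but not by \<open>x\<close>, and it occurs
  among the recovered parameters; so no \<open>x\<close> outside the annihilator kills all of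
  these.\<close>

lemma param_exists:
  assumes X: "cyclic G X"
  shows "admissible G Irr (A_of (ann G X)) (B_of (ann G X))"
    and "std_ann (A_of (ann G X)) (B_of (ann G X)) = ann G X"
proof -
  let ?J = "ann G X" and ?A = "A_of (ann G X)" and ?B = "B_of (ann G X)"
  obtain u where u: "generates X u" by (rule cyclic_generates[OF X])
  have gX: "is_glider G X" using u by (simp add: generates_def)
  have uX: "u \<in> space X" by (rule generates_in(2)[OF u])
  have J: "?J = {x \<in> group_alg G. alg_act G X x u = 0}" using ann_line[OF gX] u by (simp add: generates_def)
  have "x \<in> ?J" if x: "x \<in> std_ann ?A ?B" for x
  proof (rule ccontr)
    assume "x \<notin> ?J"
    then have xu: "alg_act G X x u \<noteq> 0" using x J by (simp add: std_ann_def)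
    have xG: "x \<in> group_alg G" using x by (simp add: std_ann_def)
    let ?V0 = "rep.truncate X" and ?L = "alg_span G X (fn.span {u})"
    have V0: "is_module G ?V0" using is_gliderD(1)[OF gX] by simp
    have acteq: "alg_act G (?V0\<lparr>space := ?L\<rparr>) = alg_act G X" "alg_act G ?V0 = alg_act G X"
      by (rule alg_act_cong, simp)+
    have Leq: "alg_span G ?V0 (fn.span {u}) = ?L" unfolding alg_span_def acteq ..
    have sub: "submodule G ?V0 ?L"
      using submodule_alg_span[OF V0, of u] uX unfolding Leq by simp
    let ?V = "?V0\<lparr>space := ?L\<rparr>"
    have V: "is_module G ?V" by (rule is_module_submodule[OF V0 sub])
    have lev: "lev1 X = fn.span {u}" using u by (simp add: generates_def)
    have "?L \<subseteq> lev0 X" using alg_span_lev1(2)[OF finite_carrier is_group gX] unfolding lev .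
    then have "finite_dim ?L" by (rule finite_dim_subspace[OF is_gliderD(4)[OF gX] submoduleD(1)[OF sub]])
    then have fd: "finite_dim (space ?V)" by simp
    have L: "alg_act G X y u \<in> space ?V" if "y \<in> group_alg G" for y
      unfolding rep.simps using alg_span_line[OF is_gliderD(1)[OF gX] uX] that by simp
    have "u \<in> lev1 X" by (rule generates_in(1)[OF u])
    then have "u \<in> ?L" using alg_span_lev1(1)[OF finite_carrier is_group gX] unfolding lev by blast
    then have uV: "u \<in> space ?V" by simp
    obtain Q \<theta> where Q: "simple_module G Q" "finite_dim (space Q)" "equivariant G ?V Q \<theta>" "\<theta> (alg_act G X x u) \<noteq> 0"
      by (rule separation[OF V fd L[OF xG] xu]) (rule that)
    have \<theta>: "\<theta> (alg_act G X y u) = alg_act G Q y (\<theta> u)" for y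
      using equivariant_alg_act[OF V Q(3) uV, of y] unfolding acteq .
    have go: "\<exists>q\<in>space U. (\<forall>y\<in>?J. alg_act G U y q = 0) \<and> alg_act G U x q \<noteq> 0"
      if iso: "rep_iso G Q U" for U :: "('a, 'k) rep"
    proof -
      obtain f where f: "equivariant G Q U f" "bij_betw f (space Q) (space U)" by (rule rep_iso_equivariant[OF iso])
      have Qm: "is_module G Q" using Q(1) by (simp add: simple_module_def)
      have \<theta>uQ: "\<theta> u \<in> space Q" by (rule equivariantD(2)[OF Q(3) uV])
      have f\<theta>: "f (\<theta> (alg_act G X y u)) = alg_act G U y (f (\<theta> u))" for y
        unfolding \<theta> by (rule equivariant_alg_act[OF Qm f(1) \<theta>uQ])
      have f0: "f 0 = 0" by (rule linear_on_zero[OF equivariantD(1)[OF f(1)] is_moduleD(1)[OF Qm]])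
      have \<theta>0: "\<theta> 0 = 0" by (rule linear_on_zero[OF equivariantD(1)[OF Q(3)] is_moduleD(1)[OF V]])
      have "f (\<theta> (alg_act G X x u)) \<noteq> f 0"
        using inj_onD[OF bij_betw_imp_inj_on[OF f(2)], of "\<theta> (alg_act G X x u)" 0] Q(4)
          equivariantD(2)[OF Q(3) L[OF xG]] fn.subspace_0[OF is_moduleD(1)[OF Qm]] by blast
      then have "alg_act G U x (f (\<theta> u)) \<noteq> 0" using f\<theta>[of x] f0 by simp
      moreover have "alg_act G U y (f (\<theta> u)) = 0" if "y \<in> ?J" for y
        using f\<theta>[of y] that f0 \<theta>0 by (simp add: J)
      ultimately show ?thesis by (intro bexI[OF _ equivariantD(2)[OF f(1) \<theta>uQ]]) simp
    qed
    from Q(1,2) show False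
    proof (cases rule: simple_cases)
      case (1 z)
      obtain q where q: "q \<in> space (chr z)" "\<forall>y\<in>?J. alg_act G (chr z) y q = 0" "alg_act G (chr z) x q \<noteq> 0"
        using go[OF 1(2)] by blast
      have q0: "q \<noteq> 0" using q(3) linear_on_zero[OF alg_act_linear[OF chr(1)[OF 1(1)]] is_moduleD(1)[OF chr(1)[OF 1(1)]]] by auto
      then have "\<forall>y\<in>?J. \<forall>v\<in>space (chr z). alg_act G (chr z) y v = 0"
        using linear_on_smul[OF alg_act_linear[OF chr(1)[OF 1(1)]] q(1)] q(2)
        unfolding chr_span[OF 1(1) q(1) q0] fn.span_singleton by auto
      then have "z \<in> ?A" using 1(1) by (simp add: A_of_def)
      then show False using x q(1,3) by (auto simp: std_ann_def)
    next
      case (2 U)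
      obtain q where q: "q \<in> space U" "\<forall>y\<in>?J. alg_act G U y q = 0" "alg_act G U x q \<noteq> 0"
        using go[OF 2(3)] by blast
      have "q \<noteq> 0" using q(3) linear_on_zero[OF alg_act_linear[OF irrs(2)[OF 2(1)]] is_moduleD(1)[OF irrs(2)[OF 2(1)]]] by auto
      moreover have qW: "q \<in> W_of ?J U" using q by (simp add: W_of_def)
      ultimately have "(U, W_of ?J U) \<in> ?B" using 2 by (auto simp: B_of_def)
      then show False using x q(3) qW by (auto simp: std_ann_def)
    qed
  qed
  moreover have "?J \<subseteq> std_ann ?A ?B"
    by (auto simp: std_ann_def A_of_def B_of_def W_of_def ann_def)
  ultimately show eq: "std_ann ?A ?B = ?J" by blast
  \<comment> \<open>\<open>delta \<one>\<close> does not kill \<open>u\<close>, whereas empty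
    parameters would impose no condition on it; the recovered parameters are thus not both
    empty.\<close>
  have "alg_act G X (delta \<one>) u = u"
    unfolding alg_act_delta[OF finite_carrier one_closed] by (rule is_moduleD(4)[OF is_gliderD(1)[OF gX] uX])
  then have "delta \<one> \<notin> ?J" using u by (simp add: J generates_def)
  moreover have "delta \<one> \<in> std_ann {} {}" by (simp add: std_ann_def delta_in_group_alg)
  ultimately have "\<not> (?A = {} \<and> ?B = {})" using eq by auto
  moreover have "?B \<in> SS irrs"
  proof -
    have "W_of ?J U \<in> grass U" if U: "U \<in> irrs" "1 < fn.dim (space U)" "W_of ?J U \<noteq> {0}" for U
    proof -
      have s: "fn.subspace (W_of ?J U)" unfolding W_of_def by (rule subspace_alg_act_kernel[OF irrs(2)[OF U(1)]])
      have ss: "W_of ?J U \<subseteq> space U" by (auto simp: W_of_def)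
      have fd: "finite_dim (space U)" by (rule irrs(3)[OF U(1,2)])
      have "fn.dim (W_of ?J U) \<noteq> 0" using finite_dim_eq_0[OF finite_dim_subspace[OF fd s ss]] U(3) by blast
      then show ?thesis using s ss dim_subset[OF fd s ss] by (simp add: grass_def)
    qed
    then show ?thesis by (auto simp: SS_def B_of_def)
  qed
  ultimately show "admissible G Irr ?A ?B" by (auto simp: admissible_def A_of_def)
qed

end


section \<open>One-dimensional modules and subgroups containing the derived subgroup\<close>

context finite_group
begin

text \<open>The glider is obtained by inducing the trivial glider of \<open>S\<close>.\<close>

lemma perm_glider_exists:
  assumes S: "subgroup S G"
  obtains X :: "('a, 'k::field_char_0) glider" where "perm_glider X S"
proof -
  interpret K: finite_group "sub G S" by (rule finite_group_sub[OF S])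
  interpret S: subgroup S G by (rule S)
  obtain F :: "('a, 'k) glider \<Rightarrow> ('a, 'k) glider"
    where Fc: "\<And>X. cyclic (sub G S) X \<Longrightarrow> cyclic G (F X)"
    and "\<And>X. cyclic (sub G S) X \<Longrightarrow> Ind G S (cls (sub G S) X) = cls G (F X)"
    and Fa: "\<And>X x. cyclic (sub G S) X \<Longrightarrow> x \<in> ann G (F X) \<longleftrightarrow> x \<in> group_alg G \<and>
      (\<forall>a\<in>carrier G. (\<lambda>h. if h \<in> S then x (a \<otimes> h) else 0) \<in> ann (sub G S) X)"
    and "Ind G S \<in> hom (add_monoid (R1 (sub G S) :: ('a, 'k) glider_class ring)) (add_monoid (R1 G))"
    by (rule Ind_cls[OF S]) (rule that)
  have u: "cyclic (sub G S) (unit_glider :: ('a, 'k) glider)" by (rule K.generates_cyclic[OF K.generates_unit])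
  have "x \<in> ann G (F unit_glider) \<longleftrightarrow> x \<in> coset_ann G S" for x
  proof -
    have "(\<lambda>h. if h \<in> S then x (a \<otimes> h) else 0) \<in> ann (sub G S) (unit_glider :: ('a, 'k) glider) \<longleftrightarrow> (\<Sum>s\<in>S. x (a \<otimes> s)) = 0" for a
      unfolding K.ann_unit_iff by (simp add: group_alg_def)
    then show ?thesis unfolding Fa[OF u] coset_ann_def by simp
  qed
  then have "perm_glider (F unit_glider) S" using Fc[OF u] S by (auto simp: perm_glider_def)
  then show thesis by (rule that)
qed

lemma mult_inv_cancel: "a \<in> carrier G \<Longrightarrow> b \<in> carrier G \<Longrightarrow> a \<otimes> (inv a \<otimes> b) = b"
  by (simp add: m_assoc[symmetric])

lemma commutator_in_derived:
  assumes g: "g \<in> carrier G" and h: "h \<in> carrier G"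
  shows "inv g \<otimes> inv h \<otimes> g \<otimes> h \<in> derived G (carrier G)"
proof -
  have "inv g \<otimes> inv h \<otimes> inv (inv g) \<otimes> inv (inv h) \<in> derived_set G (carrier G)"
    by (intro UN_I[of "inv g"] UN_I[of "inv h"]) (use g h in auto)
  then show ?thesis unfolding derived_def using g h by (intro generate.incl) simp
qed

lemma maximal_subgroup_exists:
  assumes "subgroup N (sub G H)" "N \<noteq> H" "derived G (carrier G) \<subseteq> N" and H: "subgroup H G"
  obtains L where "L \<in> maximal_subgroups G H" "N \<subseteq> L"
proof -
  let ?A = "{L. subgroup L (sub G H) \<and> L \<noteq> H \<and> derived G (carrier G) \<subseteq> L \<and> N \<subseteq> L}"
  have "?A \<subseteq> Pow H" using subgroup.subset[of _ "sub G H"] by auto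
  then have "finite ?A" using finite_subgroup[OF H] by (simp add: finite_subset)
  moreover have "N \<in> ?A" using assms by simp
  ultimately obtain L where L: "L \<in> ?A" "N \<subseteq> L \<and> (\<forall>L'\<in>?A. L \<subseteq> L' \<longrightarrow> L = L')"
    by (rule bexE[OF finite_has_maximal2])
  have "L' = L" if "subgroup L' (sub G H)" "L \<subseteq> L'" "L' \<noteq> H" for L'
  proof -
    have "L' \<in> ?A" using that L(1) by auto
    then show ?thesis using L(2) that(2) by blast
  qed
  then have "L \<in> maximal_subgroups G H" using L(1) unfolding maximal_subgroups_def by auto
  then show thesis by (rule that) (use L(2) in simp)
qed

lemma maximal_subgroupsD:
  assumes "L \<in> maximal_subgroups G H" "subgroup H G"
  shows "subgroup L G" "L \<subseteq> H" "L \<noteq> H" "derived G (carrier G) \<subseteq> L" "subgroup L (sub G H)"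
  using assms incl_subgroup[OF assms(2)] subgroup.subset[of L "sub G H"] by (auto simp: maximal_subgroups_def)

end

context glider_params
begin

lemma chr_character:
  assumes z: "z \<in> carrier (ab G)"
  obtains v \<chi> where "v \<noteq> 0" "space (chr z) = fn.span {v}"
    "\<And>g w. g \<in> carrier G \<Longrightarrow> w \<in> space (chr z) \<Longrightarrow> act (chr z) g w = smul (\<chi> g) w"
    "\<chi> \<one> = 1" "\<And>g h. g \<in> carrier G \<Longrightarrow> h \<in> carrier G \<Longrightarrow> \<chi> (g \<otimes> h) = \<chi> g * \<chi> h"
    "\<And>g. g \<in> carrier G \<Longrightarrow> \<chi> (inv g) * \<chi> g = 1"
proof -
  note mod = chr(1)[OF z]
  obtain v \<chi> where v: "v \<noteq> 0" "space (chr z) = fn.span {v}"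
    "\<And>g w. g \<in> carrier G \<Longrightarrow> w \<in> space (chr z) \<Longrightarrow> act (chr z) g w = smul (\<chi> g) w"
    by (rule one_dim_module[OF mod chr(2)[OF z]]) (rule that)
  have vV: "v \<in> space (chr z)" using v(2) by (simp add: fn.span_base)
  have "smul (\<chi> \<one>) v = smul 1 v" using is_moduleD(4)[OF mod vV] v(3)[OF one_closed vV] by simp
  then have one: "\<chi> \<one> = 1" using v(1) by (simp only: fn.scale_right_imp_eq[OF v(1)])
  have mult: "\<chi> (g \<otimes> h) = \<chi> g * \<chi> h" if gh: "g \<in> carrier G" "h \<in> carrier G" for g h
  proof -
    have "smul (\<chi> (g \<otimes> h)) v = act (chr z) g (act (chr z) h v)"
      using is_moduleD(5)[OF mod gh vV] v(3)[OF m_closed[OF gh] vV] by simp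
    also have "\<dots> = smul (\<chi> g) (smul (\<chi> h) v)"
      using v(3)[OF gh(1) is_moduleD(2)[OF mod gh(2) vV]] v(3)[OF gh(2) vV] by simp
    finally have "smul (\<chi> (g \<otimes> h)) v = smul (\<chi> g * \<chi> h) v" by simp
    then show ?thesis by (simp only: fn.scale_right_imp_eq[OF v(1)])
  qed
  have "\<chi> (inv g) * \<chi> g = 1" if "g \<in> carrier G" for g
    using mult[of "inv g" g] that one by simp
  from that[OF v one mult this] show thesis .
qed

lemma LL_subset: "LL G T C \<subseteq> carrier G"
  by (auto simp: LL_def)

lemma derived_chr:
  assumes z: "z \<in> carrier (ab G)" and g: "g \<in> G'" and w: "w \<in> space (chr z)"
  shows "act (chr z) g w = w"
proof -
  obtain v \<chi> where v: "v \<noteq> 0" "space (chr z) = fn.span {v}"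
    and act: "\<And>g w. g \<in> carrier G \<Longrightarrow> w \<in> space (chr z) \<Longrightarrow> act (chr z) g w = smul (\<chi> g) w"
    and \<chi>: "\<chi> \<one> = 1" "\<And>g h. g \<in> carrier G \<Longrightarrow> h \<in> carrier G \<Longrightarrow> \<chi> (g \<otimes> h) = \<chi> g * \<chi> h"
      "\<And>g. g \<in> carrier G \<Longrightarrow> \<chi> (inv g) * \<chi> g = 1"
    by (rule chr_character[OF z]) (rule that)
  let ?K = "{g \<in> carrier G. \<chi> g = 1}"
  have K: "subgroup ?K G" using \<chi>(1,2) \<chi>(3) by (intro subgroupI) (auto, fastforce)
  have "\<chi> (h1 \<otimes> h2 \<otimes> inv h1 \<otimes> inv h2) = 1" if h: "h1 \<in> carrier G" "h2 \<in> carrier G" for h1 h2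
  proof -
    have "\<chi> (h1 \<otimes> h2 \<otimes> inv h1 \<otimes> inv h2) = (\<chi> (inv h1) * \<chi> h1) * (\<chi> (inv h2) * \<chi> h2)"
      using h by (simp add: \<chi>(2))
    then show ?thesis unfolding \<chi>(3)[OF h(1)] \<chi>(3)[OF h(2)] by simp
  qed
  then have "derived_set G (carrier G) \<subseteq> ?K" by auto
  then have "G' \<subseteq> ?K" unfolding derived_def by (rule generate_subgroup_incl[OF _ K])
  then show ?thesis using g act[of g w] w by auto
qed

lemma subgroup_LL:
  assumes C: "C \<subseteq> carrier (ab G)"
  shows "subgroup (LL G T C) G" "G' \<subseteq> LL G T C"
proof -
  show "subgroup (LL G T C) G"
  proof (rule subgroupI)
    show "LL G T C \<noteq> {}" using is_moduleD(4)[OF chr(1)] C by (auto simp: LL_def intro!: exI[of _ \<one>])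
    show "inv a \<in> LL G T C" if a: "a \<in> LL G T C" for a
    proof -
      have "act (chr z) (inv a) v = v" if z: "z \<in> C" and v: "v \<in> space (chr z)" for z v
      proof -
        have mod: "is_module G (chr z)" using chr(1) C z by blast
        have a': "a \<in> carrier G" "act (chr z) a v = v" using a z v unfolding LL_def by blast+
        show ?thesis
          using is_moduleD(5)[OF mod inv_closed[OF a'(1)] a'(1) v] is_moduleD(4)[OF mod v] a' by simp
      qed
      then show ?thesis using a by (simp add: LL_def)
    qed
    show "a \<otimes> b \<in> LL G T C" if "a \<in> LL G T C" "b \<in> LL G T C" for a b
    proof -
      have "act (chr z) (a \<otimes> b) v = v" if z: "z \<in> C" and v: "v \<in> space (chr z)" for z v
      proof -
        have mod: "is_module G (chr z)" using chr(1) C z by blast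
        have ab: "a \<in> carrier G" "b \<in> carrier G" "act (chr z) a v = v" "act (chr z) b v = v"
          using \<open>a \<in> LL G T C\<close> \<open>b \<in> LL G T C\<close> z v unfolding LL_def by blast+
        show ?thesis unfolding is_moduleD(5)[OF mod ab(1,2) v] ab(4) by (rule ab(3))
      qed
      then show ?thesis using that by (simp add: LL_def)
    qed
  qed (rule LL_subset)
  show "G' \<subseteq> LL G T C"
    using derived_chr C derived_in_carrier[of "carrier G"] by (auto simp: LL_def)
qed

text \<open>Since \<open>T\<close> sends products to tensor products, the character of the unit is idempotent.\<close>

lemma chr_one_trivial:
  assumes g: "g \<in> carrier G" and w: "w \<in> space (chr \<one>\<^bsub>ab G\<^esub>)"
  shows "act (chr \<one>\<^bsub>ab G\<^esub>) g w = w"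
proof -
  let ?e = "\<one>\<^bsub>ab G\<^esub>"
  note e = one_ab
  obtain v \<chi> where v: "v \<noteq> 0" "space (chr ?e) = fn.span {v}"
    and act: "\<And>g w. g \<in> carrier G \<Longrightarrow> w \<in> space (chr ?e) \<Longrightarrow> act (chr ?e) g w = smul (\<chi> g) w"
    and \<chi>: "\<chi> \<one> = 1" "\<And>g h. g \<in> carrier G \<Longrightarrow> h \<in> carrier G \<Longrightarrow> \<chi> (g \<otimes> h) = \<chi> g * \<chi> h"
      "\<And>g. g \<in> carrier G \<Longrightarrow> \<chi> (inv g) * \<chi> g = 1"
    by (rule chr_character[OF e]) (rule that)
  have vV: "v \<in> space (chr ?e)" using v(2) by (simp add: fn.span_base)
  have "rep_iso G (chr (?e \<otimes>\<^bsub>ab G\<^esub> ?e)) (rep_tensor (chr ?e) (chr ?e))"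
    using T e by (simp add: one_dim_param_def)
  then have "rep_iso G (chr ?e) (rep_tensor (chr ?e) (chr ?e))"
    using monoid.l_one[OF group.is_monoid[OF group_ab] e] by simp
  then obtain f where f: "equivariant G (chr ?e) (rep_tensor (chr ?e) (chr ?e)) f"
    "bij_betw f (space (chr ?e)) (space (rep_tensor (chr ?e) (chr ?e)))" by (rule rep_iso_equivariant)
  let ?y = "enc (tens v v)"
  have "?y \<in> space (rep_tensor (chr ?e) (chr ?e))"
    using tens_in_tens_space[OF vV vV] by (simp add: rep_tensor_def)
  then obtain s where s: "s \<in> space (chr ?e)" "f s = ?y" using f(2) by (metis bij_betw_imp_surj_on imageE)
  have "smul (\<chi> g) ?y = f (act (chr ?e) g s)"
    using act[OF g s(1)] linear_on_smul[OF equivariantD(1)[OF f(1)] s(1)] s(2) by simp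
  also have "\<dots> = act (rep_tensor (chr ?e) (chr ?e)) g ?y" using equivariantD(3)[OF f(1) g s(1)] s(2) by simp
  also have "\<dots> = enc (tens (smul (\<chi> g) v) (smul (\<chi> g) v))"
    using act_rep_tensor[OF chr(1)[OF e] chr(1)[OF e] g vV vV] act[OF g vV] by simp
  finally have eq: "smul (\<chi> g) ?y = smul (\<chi> g * \<chi> g) ?y" by (simp add: tens_smul_left tens_smul_right)
  obtain i where i: "v i \<noteq> 0" using v(1) by (auto simp: fun_eq_iff zero_fun_apply)
  have "?y (prod_encode (i, i)) \<noteq> 0" using i by (simp add: enc_def tens_def)
  then have "\<chi> g = \<chi> g * \<chi> g" using fun_cong[OF eq, of "prod_encode (i, i)"] by (simp add: smul_apply)
  moreover have "\<chi> g \<noteq> 0" using \<chi>(3)[OF g] by auto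
  ultimately show ?thesis using act[OF g w] by simp
qed

text \<open>A trivial one-dimensional module is isomorphic to that of the unit, and \<open>T\<close>
  has no repetitions. The class with parameters consisting of the unit alone is thereby the case
  \<open>N = carrier G\<close> of \<open>Mcls_Aiota\<close>.\<close>

lemma Aiota_carrier: "Aiota G T (carrier G) = {\<one>\<^bsub>ab G\<^esub>}"
proof
  show "{\<one>\<^bsub>ab G\<^esub>} \<subseteq> Aiota G T (carrier G)" using chr_one_trivial one_ab by (simp add: Aiota_def)
  show "Aiota G T (carrier G) \<subseteq> {\<one>\<^bsub>ab G\<^esub>}"
  proof
    fix z assume "z \<in> Aiota G T (carrier G)"
    then have z: "z \<in> carrier (ab G)" "\<And>g v. g \<in> carrier G \<Longrightarrow> v \<in> space (chr z) \<Longrightarrow> act (chr z) g v = v"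
      by (auto simp: Aiota_def)
    obtain v where v: "v \<noteq> 0" "space (chr z) = fn.span {v}"
      using dim_one_line[OF is_moduleD(1)[OF chr(1)[OF z(1)]] chr(2)[OF z(1)]] by blast
    obtain w where w: "w \<noteq> 0" "space (chr \<one>\<^bsub>ab G\<^esub>) = fn.span {w}"
      using dim_one_line[OF is_moduleD(1)[OF chr(1)[OF one_ab]] chr(2)[OF one_ab]] by blast
    have "rep_iso G (chr z) (chr \<one>\<^bsub>ab G\<^esub>)"
      by (rule one_dim_iso[OF v _ w, where \<chi> = "\<lambda>_. 1"]) (simp_all add: z(2) chr_one_trivial)
    then show "z \<in> {\<one>\<^bsub>ab G\<^esub>}"
      using chr_ex1[OF chr(1,2)[OF z(1)]] z(1) one_ab rep_iso_refl[of G "chr z"] by auto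
  qed
qed

text \<open>The element \<open>x\<close> is, up to a scalar, the idempotent of the group algebra that projects onto the
  \<open>T z\<close>-isotypic part.\<close>

lemma isotypic_element:
  assumes z: "z \<in> carrier (ab G)"
  obtains x where "x \<in> group_alg G" "\<And>w. w \<in> space (chr z) \<Longrightarrow> w \<noteq> 0 \<Longrightarrow> alg_act G (chr z) x w \<noteq> 0"
    "\<And>(V :: ('a, 'k) rep) w. simple_module G V \<Longrightarrow> w \<in> space V \<Longrightarrow> alg_act G V x w \<noteq> 0 \<Longrightarrow> rep_iso G V (chr z)"
proof -
  obtain v \<chi> where v: "v \<noteq> 0" "space (chr z) = fn.span {v}"
    and act: "\<And>g w. g \<in> carrier G \<Longrightarrow> w \<in> space (chr z) \<Longrightarrow> act (chr z) g w = smul (\<chi> g) w"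
    and \<chi>: "\<chi> \<one> = 1" "\<And>g h. g \<in> carrier G \<Longrightarrow> h \<in> carrier G \<Longrightarrow> \<chi> (g \<otimes> h) = \<chi> g * \<chi> h"
      "\<And>g. g \<in> carrier G \<Longrightarrow> \<chi> (inv g) * \<chi> g = 1"
    by (rule chr_character[OF z]) (rule that)
  define x where "x g = (if g \<in> carrier G then \<chi> (inv g) else 0)" for g
  have xG: "x \<in> group_alg G" by (simp add: x_def group_alg_def)
  have nz: "alg_act G (chr z) x w \<noteq> 0" if w: "w \<in> space (chr z)" "w \<noteq> 0" for w
  proof -
    have "alg_act G (chr z) x w = (\<Sum>g\<in>carrier G. smul (\<chi> (inv g) * \<chi> g) w)"
      unfolding alg_act_def by (intro sum.cong) (simp_all add: act[OF _ w(1)] x_def)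
    also have "\<dots> = (\<Sum>g\<in>carrier G. w)" by (intro sum.cong) (simp_all add: \<chi>(3))
    also have "\<dots> = smul (of_nat (card (carrier G))) w" by (simp add: fun_eq_iff sum_fun_apply smul_apply)
    finally show ?thesis using w(2) card_ne by simp
  qed
  have iso: "rep_iso G V (chr z)"
    if V: "simple_module G V" and w: "w \<in> space V" and q0: "alg_act G V x w \<noteq> 0" for V :: "('a, 'k) rep" and w
  proof -
    have mod: "is_module G V" using V by (simp add: simple_module_def)
    let ?q = "alg_act G V x w"
    have qV: "?q \<in> space V" by (rule alg_act_closed[OF mod w])
    have h: "act V h ?q = smul (\<chi> h) ?q" if h: "h \<in> carrier G" for h
    proof -
      have "act V h ?q = (\<Sum>g\<in>carrier G. smul (x g) (act V (h \<otimes> g) w))"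
        unfolding alg_act_def
        using is_moduleD(5)[OF mod h _ w] is_moduleD(2)[OF mod _ w] fn.subspace_scale[OF is_moduleD(1)[OF mod]]
          linear_on_smul[OF is_moduleD(3)[OF mod h]]
        by (subst linear_on_sum[OF is_moduleD(3)[OF mod h] is_moduleD(1)[OF mod]]) simp_all
      also have "\<dots> = (\<Sum>g\<in>carrier G. smul (\<chi> h * x (h \<otimes> g)) (act V (h \<otimes> g) w))"
      proof (intro sum.cong refl)
        fix g assume g: "g \<in> carrier G"
        have "\<chi> h * x (h \<otimes> g) = \<chi> (inv h) * \<chi> h * \<chi> (inv g)"
          using g h by (simp add: x_def inv_mult_group \<chi>(2))
        then show "smul (x g) (act V (h \<otimes> g) w) = smul (\<chi> h * x (h \<otimes> g)) (act V (h \<otimes> g) w)"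
          using g \<chi>(3)[OF h] by (simp add: x_def)
      qed
      also have "\<dots> = (\<Sum>g\<in>carrier G. smul (\<chi> h * x g) (act V g w))"
        by (rule sum_left_mult[OF h, of "\<lambda>g. smul (\<chi> h * x g) (act V g w)"])
      also have "\<dots> = smul (\<chi> h) ?q" by (simp add: alg_act_def fn.scale_sum_right)
      finally show ?thesis .
    qed
    have hs: "act V h (smul c ?q) = smul (\<chi> h) (smul c ?q)" if "h \<in> carrier G" for h c
      using linear_on_smul[OF is_moduleD(3)[OF mod that] qV, of c] h[OF that] by (simp add: mult.commute)
    have "submodule G V (fn.span {?q})"
      unfolding submodule_def
    proof (intro conjI ballI)
      show "fn.span {?q} \<subseteq> space V" by (intro fn.span_minimal is_moduleD(1)[OF mod]) (simp add: qV)
      show "act V h ` fn.span {?q} \<subseteq> fn.span {?q}" if "h \<in> carrier G" for h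
        unfolding fn.span_singleton using hs[OF that] by auto
    qed simp
    moreover have "?q \<in> fn.span {?q}" by (simp add: fn.span_base)
    ultimately have sp: "space V = fn.span {?q}" using V q0 unfolding simple_module_iff by blast
    show ?thesis
    proof (rule one_dim_iso[OF q0 sp _ v])
      show "act V g w = smul (\<chi> g) w" if "g \<in> carrier G" "w \<in> space V" for g w
        using that hs[OF that(1)] unfolding sp fn.span_singleton by auto
    qed (rule act)
  qed
  show thesis by (rule that[OF xG nz iso])
qed

lemma A_of_coset_ann:
  assumes S: "subgroup S G"
  shows "A_of (coset_ann G S) = Aiota G T S"
  unfolding A_of_def Aiota_def using killed_coset_ann_iff[OF chr(1) S] by blast

text \<open>The vectors fixed by \<open>N\<close> form a submodule, because \<open>N\<close>
  contains all commutators. If this submodule is nonzero it is everything; then the commutators act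
  trivially, the actions commute, and the simple module is one-dimensional.\<close>

lemma B_of_coset_ann:
  assumes N: "subgroup N G" and der: "G' \<subseteq> N"
  shows "B_of (coset_ann G N) = {}"
proof -
  interpret N: subgroup N G by (rule N)
  have False if U: "U \<in> irrs" and dim: "1 < fn.dim (space U)" and W: "W_of (coset_ann G N) U \<noteq> {0}" for U
  proof -
    note mod = irrs(2)[OF U]
    have W_eq: "W_of (coset_ann G N) U = {w \<in> space U. \<forall>n\<in>N. act U n w = w}"
      unfolding W_of_def using killed_coset_ann_iff[OF mod N] by blast
    have "act U g w \<in> W_of (coset_ann G N) U" if g: "g \<in> carrier G" and w: "w \<in> W_of (coset_ann G N) U" for g w
    proof -
      have wU: "w \<in> space U" and fix_w: "\<And>n. n \<in> N \<Longrightarrow> act U n w = w" using w unfolding W_eq by auto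
      have "act U n (act U g w) = act U g w" if n: "n \<in> N" for n
      proof -
        have nG: "n \<in> carrier G" using n by simp
        \<comment> \<open>Moving \<open>n\<close> past \<open>g\<close> changes it by a commutator,
          which stays in \<open>N\<close>.\<close>
        have "n \<otimes> (inv n \<otimes> inv g \<otimes> n \<otimes> g) \<in> N"
          using n commutator_in_derived[OF nG g] der by blast
        moreover have "n \<otimes> g = g \<otimes> (n \<otimes> (inv n \<otimes> inv g \<otimes> n \<otimes> g))"
          using nG g by (simp add: m_assoc mult_inv_cancel)
        ultimately show ?thesis
          using is_moduleD(5)[OF mod nG g wU] is_moduleD(5)[OF mod g _ wU, of "n \<otimes> (inv n \<otimes> inv g \<otimes> n \<otimes> g)"] fix_w
          by simp
      qed
      then show ?thesis unfolding W_eq using is_moduleD(2)[OF mod g wU] by simp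
    qed
    then have "submodule G U (W_of (coset_ann G N) U)"
      unfolding submodule_def W_of_def using subspace_alg_act_kernel[OF mod, of "coset_ann G N"] by blast
    then have all: "W_of (coset_ann G N) U = space U" using irrs(1)[OF U] W unfolding simple_module_iff by blast
    have "act U g (act U h w) = act U h (act U g w)" if gh: "g \<in> carrier G" "h \<in> carrier G" and w: "w \<in> space U" for g h w
    proof -
      let ?c = "inv g \<otimes> inv h \<otimes> g \<otimes> h"
      have c: "?c \<in> N" using commutator_in_derived[OF gh] der by blast
      have "w \<in> W_of (coset_ann G N) U" unfolding all by (rule w)
      then have "act U ?c w = w" using c unfolding W_eq by blast
      moreover have "g \<otimes> h = h \<otimes> g \<otimes> ?c" using gh by (simp add: m_assoc mult_inv_cancel)
      ultimately show ?thesis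
        using is_moduleD(5)[OF mod gh w] is_moduleD(5)[OF mod gh(2,1) w]
          is_moduleD(5)[OF mod _ N.mem_carrier[OF c] w, of "h \<otimes> g"] gh by simp
    qed
    then have "fn.dim (space U) = 1" by (rule simple_commuting_dim[OF irrs(1)[OF U]])
    then show False using dim by simp
  qed
  then show ?thesis by (auto simp: B_of_def)
qed

text \<open>The parameters recovered from \<open>coset_ann G N\<close> are the characters trivial on
  \<open>N\<close> and, by \<open>B_of_coset_ann\<close>, nothing else.\<close>

lemma Mcls_Aiota:
  assumes N: "subgroup N G" and der: "G' \<subseteq> N"
  obtains X where "perm_glider X N" "Mcls G T (Aiota G T N) {} = cls G X" "std_ann (Aiota G T N) {} = coset_ann G N"
proof -
  obtain X :: "('a, 'k) glider" where X: "perm_glider X N" by (rule perm_glider_exists[OF N])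
  then have c: "cyclic G X" and ann: "ann G X = coset_ann G N" by (simp_all add: perm_glider_def)
  note p = param_exists[OF c, unfolded ann A_of_coset_ann[OF N] B_of_coset_ann[OF N der]]
  have "Mcls G T (Aiota G T N) {} = cls G X" using Mcls_eq_iff[OF p(1) c] p(2) ann by simp
  then show thesis by (rule that[OF X _ p(2)])
qed

text \<open>One half of the duality between subgroups above the derived subgroup and sets of
  characters. It comes from annihilators: \<open>coset_ann\<close> of the common kernel kills all
  characters trivial on \<open>N\<close>, hence is contained in
  \<open>std_ann (Aiota G T N) {} = coset_ann G N\<close>.\<close>

lemma LL_Aiota:
  assumes N: "subgroup N G" and der: "G' \<subseteq> N"
  shows "LL G T (Aiota G T N) \<subseteq> N"
proof -
  have C: "Aiota G T N \<subseteq> carrier (ab G)" by (auto simp: Aiota_def)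
  note L = subgroup_LL(1)[OF C]
  have eq: "std_ann (Aiota G T N) {} = coset_ann G N" by (rule Mcls_Aiota[OF N der])
  have "alg_act G (chr z) x v = 0"
    if z: "z \<in> Aiota G T N" and x: "x \<in> coset_ann G (LL G T (Aiota G T N))" and v: "v \<in> space (chr z)" for z x v
  proof -
    have "\<forall>s\<in>LL G T (Aiota G T N). act (chr z) s v = v" using z v by (auto simp: LL_def)
    then show ?thesis using killed_coset_ann_iff[OF chr(1) L v] z x C by blast
  qed
  moreover have "x \<in> group_alg G" if "x \<in> coset_ann G (LL G T (Aiota G T N))" for x :: "'a \<Rightarrow> 'k"
    by (rule subsetD[OF coset_ann_subset that])
  ultimately have "coset_ann G (LL G T (Aiota G T N)) \<subseteq> (std_ann (Aiota G T N) {} :: ('a \<Rightarrow> 'k) set)"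
    by (auto simp: std_ann_def)
  then show ?thesis unfolding eq coset_ann_subset_iff[OF L N] .
qed

text \<open>The form in which an idempotent enters the chain: its class is that of the permutation
  glider of \<open>S\<close>, and the same \<open>S\<close> serves for all links.\<close>

definition perm_param :: "'a set set \<Rightarrow> (('a, 'k) rep \<times> (nat \<Rightarrow> 'k) set) set \<Rightarrow> 'a set \<Rightarrow> bool"
  where "perm_param C D S \<longleftrightarrow> admissible G Irr C D \<and> (\<exists>X. perm_glider X S \<and> Mcls G T C D = cls G X)"

text \<open>A character of the class kills \<open>coset_ann G S\<close>, hence is trivial on
  \<open>S\<close>. Conversely, if \<open>z\<close> is trivial on \<open>S\<close> but absent from
  \<open>C\<close>, its isotypic element kills every module in the standard glider, hence lies in
  \<open>coset_ann G S\<close>; but it does not kill \<open>T z\<close>, a contradiction.\<close>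

lemma perm_paramD:
  assumes "perm_param C D S"
  shows "subgroup S G" "C = Aiota G T S"
proof -
  obtain X where adm: "admissible G Irr C D" and X: "perm_glider X S" "Mcls G T C D = cls G X"
    using assms by (auto simp: perm_param_def)
  show S: "subgroup S G" using X(1) by (simp add: perm_glider_def)
  have eq: "std_ann C D = coset_ann G S" using Mcls_eq_iff[OF adm, of X] X by (simp add: perm_glider_def)
  have sub: "C \<subseteq> A_of (coset_ann G S)"
    unfolding eq[symmetric] A_of_def using admissibleD(1)[OF adm] by (auto simp: std_ann_def)
  have "z \<in> C" if z: "z \<in> A_of (coset_ann G S)" for z
  proof (rule ccontr)
    assume zC: "z \<notin> C"
    have zab: "z \<in> carrier (ab G)" using z by (simp add: A_of_def)
    obtain x where x: "x \<in> group_alg G" "\<And>w. w \<in> space (chr z) \<Longrightarrow> w \<noteq> 0 \<Longrightarrow> alg_act G (chr z) x w \<noteq> 0"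
      "\<And>(V :: ('a, 'k) rep) w. simple_module G V \<Longrightarrow> w \<in> space V \<Longrightarrow> alg_act G V x w \<noteq> 0 \<Longrightarrow> rep_iso G V (chr z)"
      by (rule isotypic_element[OF zab]) (rule that)
    have "alg_act G (chr y) x w = 0" if y: "y \<in> C" and w: "w \<in> space (chr y)" for y w
    proof (rule ccontr)
      assume "alg_act G (chr y) x w \<noteq> 0"
      have yab: "y \<in> carrier (ab G)" using y admissibleD(1)[OF adm] by blast
      have "rep_iso G (chr y) (chr z)" by (rule x(3)[OF chr(3)[OF yab] w]) fact
      then have "y = z" using chr_ex1[OF chr(1,2)[OF yab]] yab zab rep_iso_refl[of G "chr y"] by blast
      then show False using y zC by blast
    qed
    moreover have "alg_act G U x w = 0" if UW: "(U, W) \<in> D" and w: "w \<in> W" for U W w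
    proof (rule ccontr)
      assume nz: "alg_act G U x w \<noteq> 0"
      have U: "U \<in> irrs" "finite_dim (space U)" "w \<in> space U" "1 < fn.dim (space U)"
        using admissibleD(5)[OF adm UW] w by blast+
      have "rep_iso G U (chr z)" by (rule x(3)[OF irrs(1)[OF U(1)] U(3) nz])
      then obtain f where f: "equivariant G U (chr z) f" "bij_betw f (space U) (space (chr z))" by (rule rep_iso_equivariant)
      have "fn.dim (space (chr z)) = fn.dim (space U)"
        using dim_linear_on_image[OF equivariantD(1)[OF f(1)] U(2)] f(2) by (simp add: bij_betw_def)
      then show False using chr(2)[OF zab] U(4) by simp
    qed
    ultimately have "x \<in> std_ann C D" using x(1) by (auto simp: std_ann_def)
    then have "x \<in> coset_ann G S" unfolding eq .
    moreover obtain v where v: "v \<noteq> 0" "space (chr z) = fn.span {v}"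
      using dim_one_line[OF is_moduleD(1)[OF chr(1)[OF zab]] chr(2)[OF zab]] by blast
    moreover have "v \<in> space (chr z)" using v(2) by (simp add: fn.span_base)
    ultimately show False using x(2)[of v] z by (simp add: A_of_def)
  qed
  then show "C = Aiota G T S" using sub unfolding A_of_coset_ann[OF S] by blast
qed

text \<open>\<open>C\<close> consists of all characters trivial on \<open>S\<close>. Those trivial
  on a subgroup \<open>L\<close> that contains \<open>S\<close> and the derived subgroup are among
  them, and by \<open>LL_Aiota\<close> they cut out a subgroup of \<open>L\<close>. The last claim
  translates the stopping rule for \<open>C\<close> into one for the subgroups.\<close>

lemma perm_param_LL:
  assumes p: "perm_param C D S"
  shows "subgroup (LL G T C) G" "S \<subseteq> LL G T C" "G' \<subseteq> LL G T C"
    and "\<And>L. subgroup L G \<Longrightarrow> S \<subseteq> L \<Longrightarrow> G' \<subseteq> L \<Longrightarrow> LL G T C \<subseteq> L"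
    and "C = {\<one>\<^bsub>ab G\<^esub>} \<longleftrightarrow> LL G T C = carrier G"
proof -
  note S = perm_paramD(1)[OF p] and C = perm_paramD(2)[OF p]
  have Cab: "C \<subseteq> carrier (ab G)" unfolding C by (auto simp: Aiota_def)
  show "subgroup (LL G T C) G" "G' \<subseteq> LL G T C" by (rule subgroup_LL[OF Cab])+
  show SL: "S \<subseteq> LL G T C" using subgroup.subset[OF S] by (auto simp: C LL_def Aiota_def)
  show "LL G T C \<subseteq> L" if L: "subgroup L G" "S \<subseteq> L" "G' \<subseteq> L" for L
  proof -
    have "Aiota G T L \<subseteq> C" using L(2) by (auto simp: C Aiota_def)
    then have "LL G T C \<subseteq> LL G T (Aiota G T L)" by (auto simp: LL_def)
    then show ?thesis using LL_Aiota[OF L(1,3)] by blast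
  qed
  have oneC: "\<one>\<^bsub>ab G\<^esub> \<in> C"
    using chr_one_trivial one_ab subgroup.subset[OF S] by (auto simp: C Aiota_def)
  have "C \<subseteq> Aiota G T (carrier G)" if "LL G T C = carrier G"
  proof
    fix z assume z: "z \<in> C"
    have "act (chr z) g v = v" if "g \<in> carrier G" "v \<in> space (chr z)" for g v
      using that z \<open>LL G T C = carrier G\<close> unfolding LL_def by blast
    then show "z \<in> Aiota G T (carrier G)" using z Cab by (auto simp: Aiota_def)
  qed
  moreover have "LL G T {\<one>\<^bsub>ab G\<^esub>} = carrier G" using chr_one_trivial by (auto simp: LL_def)
  ultimately show "C = {\<one>\<^bsub>ab G\<^esub>} \<longleftrightarrow> LL G T C = carrier G"
    using oneC unfolding Aiota_carrier by blast
qed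

lemma idem_perm_param:
  assumes "idem_param G T Irr C D"
  obtains S where "perm_param C D S"
proof -
  have adm: "admissible G Irr C D" and idem: "Mcls G T C D \<otimes>\<^bsub>R1 G\<^esub> Mcls G T C D = Mcls G T C D"
    using assms by (auto simp: idem_param_def)
  obtain X where X: "cyclic G X" "Mcls G T C D = cls G X" "ann G X = std_ann C D" by (rule Mcls_eq[OF adm])
  have "cls G (glider_tensor X X) = cls G X" using idem cls_mult[OF X(1) X(1)] by (simp add: X(2))
  then have "ann G (glider_tensor X X) = ann G X" using cls_eq_iff[OF cyclic_tensor[OF X(1) X(1)] X(1)] by simp
  then obtain S where "perm_glider X S" by (rule idempotent_perm_glider[OF X(1)])
  then show thesis using adm X(2) that by (auto simp: perm_param_def)
qed

section \<open>Marks of the elements \<open>\<epsilon>\<close>\<close>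

lemma marks_one: "marks (\<one>\<^bsub>R1 G\<^esub> :: ('a, 'k) glider_class) (\<lambda>P. 1)"
proof -
  have s: "(\<Sum>s\<in>carrier G. x (a \<otimes> s)) = sum x (carrier G)" if "a \<in> carrier G" for a and x :: "'a \<Rightarrow> 'k"
    by (rule sum_left_mult[OF that])
  have "ann G unit_glider = (coset_ann G (carrier G) :: ('a \<Rightarrow> 'k) set)"
    unfolding set_eq_iff ann_unit_iff coset_ann_def
    using s one_closed by auto
  then have "perm_glider (unit_glider :: ('a, 'k) glider) (carrier G)"
    using generates_cyclic[OF generates_unit] subgroup_self by (simp add: perm_glider_def)
  moreover have "\<one>\<^bsub>R1 G\<^esub> = cls G (unit_glider :: ('a, 'k) glider)" by (simp add: cls_eq R1_simps red_simps)
  ultimately have "marks (\<one>\<^bsub>R1 G\<^esub> :: ('a, 'k) glider_class) (\<lambda>P. if P \<subseteq> carrier G then 1 else 0)"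
    using marks_perm_glider by simp
  then show ?thesis by (rule marks_cong) (simp add: subgroup.subset)
qed

lemma marks_finprod:
  fixes r :: "'i \<Rightarrow> ('a, 'k) glider_class"
  assumes "finite A" "\<And>a. a \<in> A \<Longrightarrow> marks (r a) (f a)"
  shows "marks (\<Otimes>\<^bsub>R1 G\<^esub>a\<in>A. r a) (\<lambda>P. \<Prod>a\<in>A. f a P)"
  using assms
proof (induction A)
  case empty
  interpret R: cring "R1 G :: ('a, 'k) glider_class ring" by (rule cring_R1)
  show ?case using marks_one by simp
next
  case (insert a A)
  interpret R: cring "R1 G :: ('a, 'k) glider_class ring" by (rule cring_R1)
  have "r \<in> A \<rightarrow> carrier (R1 G)" "r a \<in> carrier (R1 G)" using marks_in_R1 insert.prems by auto
  then have "(\<Otimes>\<^bsub>R1 G\<^esub>b\<in>insert a A. r b) = r a \<otimes>\<^bsub>R1 G\<^esub> (\<Otimes>\<^bsub>R1 G\<^esub>b\<in>A. r b)"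
    by (rule R.finprod_insert[OF insert.hyps])
  moreover have "marks (r a \<otimes>\<^bsub>R1 G\<^esub> (\<Otimes>\<^bsub>R1 G\<^esub>b\<in>A. r b)) (\<lambda>P. f a P * (\<Prod>b\<in>A. f b P))"
    by (rule marks_mult) (use insert in auto)
  ultimately show ?case using insert.hyps by simp
qed

lemma marks_Mcls_Aiota:
  assumes "subgroup N G" "G' \<subseteq> N"
  shows "marks (Mcls G T (Aiota G T N) {}) (\<lambda>P. if P \<subseteq> N then 1 else 0)"
proof -
  obtain X where X: "perm_glider X N" "Mcls G T (Aiota G T N) {} = cls G X"
    using Mcls_Aiota[OF assms] by blast
  show ?thesis unfolding X(2) by (rule marks_perm_glider[OF X(1)])
qed

text \<open>The factor for \<open>L\<close> has mark 0 if \<open>P\<close> lies in \<open>L\<close>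
  and 1 otherwise. The whole product is the indicator of those \<open>P\<close> that together with
  the derived subgroup generate \<open>K\<close>.\<close>

lemma marks_eps_rel:
  assumes K: "subgroup K G" and der: "G' \<subseteq> K"
  shows "marks (eps_rel G T K) (\<lambda>P. if P \<subseteq> K \<and> (\<forall>L\<in>maximal_subgroups G K. \<not> P \<subseteq> L) then 1 else 0)"
proof -
  have fin: "finite (maximal_subgroups G K)"
  proof (rule finite_subset)
    show "maximal_subgroups G K \<subseteq> Pow K" 
    proof
      fix L assume "L \<in> maximal_subgroups G K"
      from maximal_subgroupsD(2)[OF this K] show "L \<in> Pow K" by simp
    qed
  qed (simp add: finite_subgroup[OF K])
  have one: "marks (Mcls G T {\<one>\<^bsub>ab G\<^esub>} {}) (\<lambda>P. if P \<subseteq> carrier G then 1 else 0)"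
    using marks_Mcls_Aiota[OF subgroup_self derived_in_carrier[OF subset_refl]] unfolding Aiota_carrier .
  have "marks (eps_rel G T K) (\<lambda>P. (if P \<subseteq> K then 1 else 0) *
      (\<Prod>L\<in>maximal_subgroups G K. (if P \<subseteq> carrier G then 1 else 0) - (if P \<subseteq> L then 1 else 0)))"
    unfolding eps_rel_def
  proof (rule marks_mult[OF marks_Mcls_Aiota[OF K der] marks_finprod[OF fin]])
    fix L assume L: "L \<in> maximal_subgroups G K"
    show "marks (Mcls G T {\<one>\<^bsub>ab G\<^esub>} {} \<ominus>\<^bsub>R1 G\<^esub> Mcls G T (Aiota G T L) {})
        (\<lambda>P. (if P \<subseteq> carrier G then 1 else 0) - (if P \<subseteq> L then 1 else 0))"
      by (rule marks_minus[OF one marks_Mcls_Aiota[OF maximal_subgroupsD(1,4)[OF L K]]])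
  qed
  then show ?thesis
  proof (rule marks_cong)
    fix P assume P: "subgroup P G"
    have "(\<Prod>L\<in>maximal_subgroups G K. (if P \<subseteq> carrier G then 1 else 0) - (if P \<subseteq> L then 1 else 0))
        = (\<Prod>L\<in>maximal_subgroups G K. if P \<subseteq> L then 0 else 1 :: int)"
      using subgroup.subset[OF P] by (intro prod.cong) auto
    also have "\<dots> = (if \<forall>L\<in>maximal_subgroups G K. \<not> P \<subseteq> L then 1 else 0)"
      using fin by (auto intro!: prod.neutral)
    finally show "(if P \<subseteq> K then 1 else 0) *
      (\<Prod>L\<in>maximal_subgroups G K. (if P \<subseteq> carrier G then 1 else 0) - (if P \<subseteq> L then 1 else 0))
      = (if P \<subseteq> K \<and> (\<forall>L\<in>maximal_subgroups G K. \<not> P \<subseteq> L) then 1 else 0 :: int)" by simp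
  qed
qed

end


section \<open>Chains of subgroups\<close>

context finite_group
begin

text \<open>\<open>K \<inter> K'\<close> contains \<open>P\<close> and the derived subgroup; if it
  were proper in \<open>K\<close>, a maximal subgroup above it would contain
  \<open>P\<close>.\<close>

lemma no_maximal_imp_subset:
  assumes K: "subgroup K G" "derived G (carrier G) \<subseteq> K" and K': "subgroup K' G" "derived G (carrier G) \<subseteq> K'"
    and P: "P \<subseteq> K" "P \<subseteq> K'" "\<And>L. L \<in> maximal_subgroups G K \<Longrightarrow> \<not> P \<subseteq> L"
  shows "K \<subseteq> K'"
proof (rule ccontr)
  assume "\<not> K \<subseteq> K'"
  then have ne: "K \<inter> K' \<noteq> K" by blast
  have "subgroup (K \<inter> K') (sub G K)"
    by (rule subgroup_incl[OF subgroups_Inter_pair[OF K(1) K'(1)] K(1)]) simp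
  then obtain L where "L \<in> maximal_subgroups G K" "K \<inter> K' \<subseteq> L"
    by (rule maximal_subgroup_exists[OF _ ne _ K(1)]) (use K(2) K'(2) in simp_all)
  then show False using P by blast
qed

text \<open>The links are iterated without stopping, so the conditions are imposed at every index;
  only strict descent is confined to the indices below \<open>m\<close>. Each step is described as
  the least subgroup containing \<open>S\<close> and the derived subgroup of the current
  one.\<close>

definition chain :: "'a set \<Rightarrow> (nat \<Rightarrow> 'a set) \<Rightarrow> nat \<Rightarrow> bool"
  where "chain S Hs m \<longleftrightarrow> Hs 0 = carrier G \<and>
    (\<forall>i. subgroup (Hs i) G \<and> S \<subseteq> Hs i \<and> subgroup (Hs (Suc i)) (sub G (Hs i)) \<and>
      derived (sub G (Hs i)) (Hs i) \<subseteq> Hs (Suc i) \<and>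
      (\<forall>L. subgroup L (sub G (Hs i)) \<and> S \<subseteq> L \<and> derived (sub G (Hs i)) (Hs i) \<subseteq> L \<longrightarrow> Hs (Suc i) \<subseteq> L)) \<and>
    (\<forall>i<m. Hs (Suc i) \<noteq> Hs i)"

text \<open>The condition on \<open>P\<close> under which every factor of \<epsilon> has mark 1 at
  \<open>P\<close>.\<close>

definition marked :: "(nat \<Rightarrow> 'a set) \<Rightarrow> nat \<Rightarrow> 'a set \<Rightarrow> bool"
  where "marked Hs m P \<longleftrightarrow>
    (\<forall>i<m. P \<subseteq> Hs (Suc i) \<and> (\<forall>L\<in>maximal_subgroups (sub G (Hs i)) (Hs (Suc i)). \<not> P \<subseteq> L)) \<and>
    P \<subseteq> Hs m \<and> (\<forall>L\<in>maximal_subgroups (sub G (Hs m)) (Hs m). \<not> P \<subseteq> L)"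

lemma chainD:
  assumes "chain S Hs m"
  shows "Hs 0 = carrier G" "subgroup (Hs i) G" "S \<subseteq> Hs i" "subgroup (Hs (Suc i)) (sub G (Hs i))"
    "derived (sub G (Hs i)) (Hs i) \<subseteq> Hs (Suc i)" "Hs (Suc i) \<subseteq> Hs i"
    "\<And>L. subgroup L (sub G (Hs i)) \<Longrightarrow> S \<subseteq> L \<Longrightarrow> derived (sub G (Hs i)) (Hs i) \<subseteq> L \<Longrightarrow> Hs (Suc i) \<subseteq> L"
    "i < m \<Longrightarrow> Hs (Suc i) \<noteq> Hs i"
  using assms subgroup.subset[of "Hs (Suc i)" "sub G (Hs i)"] by (auto simp: chain_def)

lemma chain_antimono:
  assumes "chain S Hs m" "i \<le> j"
  shows "Hs j \<subseteq> Hs i"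
  using lift_Suc_antimono_le[of Hs i j, OF chainD(6)[OF assms(1)] assms(2)] .

text \<open>\<open>Hs m\<close> contains \<open>S\<close>. A maximal subgroup \<open>L\<close>
  containing \<open>Hs m\<close> would contain \<open>S\<close> and the derived subgroup of
  \<open>Hs i\<close>, hence all of \<open>Hs (Suc i)\<close> by leastness.\<close>

lemma marked_last:
  assumes c: "chain S Hs m"
  shows "marked Hs m (Hs m)"
proof -
  have "\<not> Hs m \<subseteq> L" if i: "i < m" and L: "L \<in> maximal_subgroups (sub G (Hs i)) (Hs (Suc i))" for i L
  proof
    assume mL: "Hs m \<subseteq> L"
    interpret K: finite_group "sub G (Hs i)" by (rule finite_group_sub[OF chainD(2)[OF c]])
    note L = K.maximal_subgroupsD[OF L chainD(4)[OF c]]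
    have "Hs (Suc i) \<subseteq> L" using L(1,4) chainD(3)[OF c, of m] mL by (intro chainD(7)[OF c]) auto
    then show False using L(2,3) by blast
  qed
  moreover have "\<not> Hs m \<subseteq> L" if L: "L \<in> maximal_subgroups (sub G (Hs m)) (Hs m)" for L
  proof -
    interpret K: finite_group "sub G (Hs m)" by (rule finite_group_sub[OF chainD(2)[OF c]])
    have "subgroup (Hs m) (sub G (Hs m))" using K.subgroup_self by simp
    from K.maximal_subgroupsD(2,3)[OF L this] show ?thesis by blast
  qed
  moreover have "Hs m \<subseteq> Hs (Suc i)" if "i < m" for i
    using chain_antimono[OF c, of "Suc i" m] that by simp
  ultimately show ?thesis unfolding marked_def by blast
qed

text \<open>Below a common link both next links contain \<open>P\<close> and no maximal subgroup of
  either does; \<open>no_maximal_imp_subset\<close> applied in both directions makes them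
  equal.\<close>

lemma marked_agree:
  assumes c: "chain S Hs m" "chain S' Hs' m'" and P: "marked Hs m P" "marked Hs' m' P"
  shows "i \<le> m \<Longrightarrow> i \<le> m' \<Longrightarrow> Hs i = Hs' i"
proof (induction i)
  case 0
  then show ?case using chainD(1)[OF c(1)] chainD(1)[OF c(2)] by simp
next
  case (Suc i)
  then have H: "Hs' i = Hs i" and i: "i < m" "i < m'" by auto
  interpret K: finite_group "sub G (Hs i)" by (rule finite_group_sub[OF chainD(2)[OF c(1)]])
  note d = chainD(4,5)[OF c(1), of i] chainD(4,5)[OF c(2), of i, unfolded H]
  have PP: "P \<subseteq> Hs (Suc i)" "P \<subseteq> Hs' (Suc i)"
    and max: "\<And>L. L \<in> maximal_subgroups (sub G (Hs i)) (Hs (Suc i)) \<Longrightarrow> \<not> P \<subseteq> L"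
      "\<And>L. L \<in> maximal_subgroups (sub G (Hs i)) (Hs' (Suc i)) \<Longrightarrow> \<not> P \<subseteq> L"
    using P i H by (auto simp: marked_def)
  have "Hs (Suc i) \<subseteq> Hs' (Suc i)"
    by (rule K.no_maximal_imp_subset[of "Hs (Suc i)" "Hs' (Suc i)" P]) (use d PP max in auto)
  moreover have "Hs' (Suc i) \<subseteq> Hs (Suc i)"
    by (rule K.no_maximal_imp_subset[of "Hs' (Suc i)" "Hs (Suc i)" P]) (use d PP max in auto)
  ultimately show ?case by blast
qed

text \<open>If the second chain went on at \<open>m\<close>, the last factor of the first element
  would say that no maximal subgroup of \<open>Hs m\<close> above its derived subgroup contains
  \<open>P\<close>. This forces \<open>Hs m\<close> into the next link of the second chain, against
  strict descent.\<close>

lemma marked_length: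
  assumes c: "chain S Hs m" "chain S' Hs' m'" and P: "marked Hs m P" "marked Hs' m' P"
  shows "m' \<le> m"
proof (rule ccontr)
  assume "\<not> m' \<le> m"
  then have m: "m < m'" by simp
  then have H: "Hs' m = Hs m" using marked_agree[OF assms, of m] by simp
  interpret K: finite_group "sub G (Hs m)" by (rule finite_group_sub[OF chainD(2)[OF c(1)]])
  note d = chainD(4,5)[OF c(2), of m, unfolded H]
  have "subgroup (Hs m) (sub G (Hs m))" using K.subgroup_self by simp
  moreover have "derived (sub G (Hs m)) (Hs m) \<subseteq> Hs m" using K.derived_in_carrier[of "Hs m"] by simp
  moreover have "P \<subseteq> Hs m" "P \<subseteq> Hs' (Suc m)" and "\<And>L. L \<in> maximal_subgroups (sub G (Hs m)) (Hs m) \<Longrightarrow> \<not> P \<subseteq> L"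
    using P m by (auto simp: marked_def)
  ultimately have "Hs m \<subseteq> Hs' (Suc m)"
    using K.no_maximal_imp_subset[of "Hs m" "Hs' (Suc m)" P] d by simp
  then show False using chainD(6,8)[OF c(2), of m] m H by blast
qed

lemma marked_common_iff:
  assumes c: "chain S Hs m" "chain S' Hs' m'"
  shows "(\<exists>P. subgroup P G \<and> marked Hs m P \<and> marked Hs' m' P) \<longleftrightarrow> Hs m = Hs' m'"
proof
  assume "\<exists>P. subgroup P G \<and> marked Hs m P \<and> marked Hs' m' P"
  then obtain P where P: "marked Hs m P" "marked Hs' m' P" by blast
  have "m = m'"
    using marked_length[OF c P] marked_length[OF c(2,1) P(2,1)] by simp
  then show "Hs m = Hs' m'" using marked_agree[OF c P, of m] by simp
next
  assume eq: "Hs m = Hs' m'"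
  show "\<exists>P. subgroup P G \<and> marked Hs m P \<and> marked Hs' m' P"
    using marked_last[OF c(1)] marked_last[OF c(2)] chainD(2)[OF c(1), of m] unfolding eq by blast
qed

end

section \<open>The chain and the element attached to an idempotent\<close>

locale params_group = finite_group G for G (structure) +
  fixes T :: "'a set \<Rightarrow> 'a set \<Rightarrow> ('a, 'k::{alg_closed_field, field_char_0}) rep"
    and Irr :: "'a set \<Rightarrow> ('a, 'k) rep set"
  assumes params: "params G T Irr"
begin

lemma glider_params_sub:
  assumes "subgroup H G"
  shows "glider_params (sub G H) T Irr"
  using finite_group_sub[OF assms] params assms
  by (simp add: glider_params_def glider_params_axioms_def params_def)

text \<open>Since \<open>S\<close> lies in \<open>K\<close>, restricting the permutation glider of
  \<open>S\<close> to \<open>K\<close> gives the permutation glider of \<open>S\<close> over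
  \<open>K\<close>. By \<open>param_exists\<close> this class has parameters, so the choice in
  \<open>next_link\<close> returns parameters of it.\<close>

lemma perm_param_next:
  assumes H: "subgroup H G" and p: "glider_params.perm_param (sub G H) T Irr C D S"
    and link: "next_link G T Irr (H, C, D) = (K, A, B)"
  shows "subgroup K G" "glider_params.perm_param (sub G K) T Irr A B S"
proof -
  interpret P: glider_params "sub G H" T Irr by (rule glider_params_sub[OF H])
  let ?K = "LL (sub G H) T C"
  have l: "?K = K \<and> (SOME (A, B). admissible (sub G ?K) Irr A B \<and>
      Mcls (sub G ?K) T A B = Res (sub G H) ?K (Mcls (sub G H) T C D)) = (A, B)"
    using link unfolding next_link_def prod.case Let_def prod.inject[of ?K _ K] .
  have K: "K = ?K" using l by simp
  have AB: "(A, B) = (SOME (A, B). admissible (sub G K) Irr A B \<and>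
      Mcls (sub G K) T A B = Res (sub G H) K (Mcls (sub G H) T C D))"
    unfolding K by (rule sym[OF conjunct2[OF l]])
  have Ksub: "subgroup K (sub G H)" and SK: "S \<subseteq> K" using P.perm_param_LL(1,2)[OF p] by (simp_all add: K)
  show KG: "subgroup K G" by (rule incl_subgroup[OF H Ksub])
  interpret Q: glider_params "sub G K" T Irr by (rule glider_params_sub[OF KG])
  obtain X where X: "P.perm_glider X S" "Mcls (sub G H) T C D = cls (sub G H) X"
    using p unfolding P.perm_param_def by blast
  have subsub: "sub (sub G H) K = sub G K" by simp
  have XK: "Q.perm_glider X S" using P.perm_glider_sub[OF Ksub X(1) SK] unfolding subsub .
  have cX: "cyclic (sub G K) X" using XK by (simp add: Q.perm_glider_def)
  have "cyclic (sub G H) X" using X(1) by (simp add: P.perm_glider_def)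
  then have Res: "Res (sub G H) K (Mcls (sub G H) T C D) = cls (sub G K) X"
    unfolding X(2) using P.Res_cls[OF Ksub] by simp
  let ?R = "\<lambda>(A, B). admissible (sub G K) Irr A B \<and> Mcls (sub G K) T A B = cls (sub G K) X"
  have "?R (Q.A_of (ann (sub G K) X), Q.B_of (ann (sub G K) X))"
    using Q.param_exists[OF cX] Q.Mcls_eq_iff[OF _ cX] by simp
  then have "?R (SOME p. ?R p)" by (rule someI[of ?R])
  then have "?R (A, B)" unfolding AB Res .
  then show "Q.perm_param A B S" unfolding Q.perm_param_def using XK by auto
qed

lemma sub_carrier: "sub G (carrier G) = G"
  by simp

sublocale glider_params G T Irr
  using glider_params_sub[OF subgroup_self] unfolding sub_carrier .

context
  fixes C D S
  assumes p: "perm_param C D S"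
begin

abbreviation "Hs \<equiv> chain_grp G T Irr C D"
abbreviation "Cs i \<equiv> fst (snd (link G T Irr C D i))"
abbreviation "Ds i \<equiv> snd (snd (link G T Irr C D i))"

lemma link_Suc: "next_link G T Irr (Hs i, Cs i, Ds i) = (Hs (Suc i), Cs (Suc i), Ds (Suc i))"
  by (simp add: chain_grp_def link_def)

lemma chain_grp_0: "Hs 0 = carrier G" and Cs_0: "Cs 0 = C" and Ds_0: "Ds 0 = D"
  by (simp_all add: chain_grp_def link_def)

lemma link_perm_param: "subgroup (Hs i) G \<and> glider_params.perm_param (sub G (Hs i)) T Irr (Cs i) (Ds i) S"
proof (induction i)
  case 0
  show ?case unfolding chain_grp_0 Cs_0 Ds_0 sub_carrier using p subgroup_self by simp
next
  case (Suc i)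
  then show ?case using perm_param_next[OF _ _ link_Suc[of i]] by blast
qed

lemma chain_grp_props:
  shows "subgroup (Hs i) G" "glider_params (sub G (Hs i)) T Irr" "S \<subseteq> Hs i"
    "subgroup (Hs (Suc i)) (sub G (Hs i))" "derived (sub G (Hs i)) (Hs i) \<subseteq> Hs (Suc i)"
    "\<And>L. subgroup L (sub G (Hs i)) \<Longrightarrow> S \<subseteq> L \<Longrightarrow> derived (sub G (Hs i)) (Hs i) \<subseteq> L \<Longrightarrow> Hs (Suc i) \<subseteq> L"
    "Cs i = {\<one>\<^bsub>ab (sub G (Hs i))\<^esub>} \<longleftrightarrow> Hs (Suc i) = Hs i"
proof -
  show H: "subgroup (Hs i) G" using link_perm_param by blast
  show "glider_params (sub G (Hs i)) T Irr" by (rule glider_params_sub[OF H])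
  then interpret P: glider_params "sub G (Hs i)" T Irr .
  have q: "P.perm_param (Cs i) (Ds i) S" using link_perm_param by blast
  have Suc: "Hs (Suc i) = LL (sub G (Hs i)) T (Cs i)"
    using arg_cong[OF link_Suc[of i], of fst] by (simp only: next_link_def prod.case Let_def fst_conv)
  show "S \<subseteq> Hs i" using subgroup.subset[OF P.perm_paramD(1)[OF q]] by simp
  show "subgroup (Hs (Suc i)) (sub G (Hs i))" "derived (sub G (Hs i)) (Hs i) \<subseteq> Hs (Suc i)"
    "\<And>L. subgroup L (sub G (Hs i)) \<Longrightarrow> S \<subseteq> L \<Longrightarrow> derived (sub G (Hs i)) (Hs i) \<subseteq> L \<Longrightarrow> Hs (Suc i) \<subseteq> L"
    "Cs i = {\<one>\<^bsub>ab (sub G (Hs i))\<^esub>} \<longleftrightarrow> Hs (Suc i) = Hs i"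
    unfolding Suc using P.perm_param_LL[OF q] by simp_all
qed

text \<open>Before the least index where \<open>C\<close> is the unit group, \<open>C\<close> is
  nontrivial, and by the last claim of \<open>chain_grp_props\<close> the next link is a different
  subgroup.\<close>

lemma chain_link: "chain S Hs (chain_len G T Irr C D)"
proof -
  have "Hs (Suc i) \<noteq> Hs i" if "i < chain_len G T Irr C D" for i
    using not_less_Least[of i "\<lambda>m. Cs m = {\<one>\<^bsub>ab (sub G (Hs m))\<^esub>}"] that chain_grp_props(7)[of i]
    unfolding chain_len_def by blast
  then show ?thesis unfolding chain_def using chain_grp_0 chain_grp_props by simp
qed

lemma marks_eps: "marks (eps G T Irr C D) (\<lambda>P. if marked Hs (chain_len G T Irr C D) P then 1 else 0)"
proof -
  let ?m = "chain_len G T Irr C D"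
  let ?f = "\<lambda>i K P. if P \<subseteq> Hs i then if P \<subseteq> K \<and> (\<forall>L\<in>maximal_subgroups (sub G (Hs i)) K. \<not> P \<subseteq> L) then 1 else 0 else 0 :: int"
  have Ind: "marks (Ind G (Hs i) (eps_rel (sub G (Hs i)) T K)) (?f i K)"
    if K: "subgroup K (sub G (Hs i))" "derived (sub G (Hs i)) (Hs i) \<subseteq> K" for i K
  proof -
    interpret P: glider_params "sub G (Hs i)" T Irr by (rule chain_grp_props(2))
    have "P.marks (eps_rel (sub G (Hs i)) T K) (\<lambda>P. if P \<subseteq> K \<and> (\<forall>L\<in>maximal_subgroups (sub G (Hs i)) K. \<not> P \<subseteq> L) then 1 else 0)"
      using K by (intro P.marks_eps_rel) simp_all
    then show ?thesis by (rule marks_Ind[OF chain_grp_props(1)])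
  qed
  have self: "subgroup (Hs ?m) (sub G (Hs ?m))" "derived (sub G (Hs ?m)) (Hs ?m) \<subseteq> Hs ?m"
  proof -
    interpret P: glider_params "sub G (Hs ?m)" T Irr by (rule chain_grp_props(2))
    show "subgroup (Hs ?m) (sub G (Hs ?m))" "derived (sub G (Hs ?m)) (Hs ?m) \<subseteq> Hs ?m"
      using P.subgroup_self P.derived_in_carrier[of "Hs ?m"] by simp_all
  qed
  have "marks (eps G T Irr C D) (\<lambda>P. (\<Prod>i\<in>{..<?m}. ?f i (Hs (Suc i)) P) * ?f ?m (Hs ?m) P)"
    unfolding eps_def Let_def
    by (rule marks_mult[OF marks_finprod[OF finite_lessThan] Ind[OF self]])
       (rule Ind[OF chain_grp_props(4,5)])
  then show ?thesis
  proof (rule marks_cong)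
    fix P
    \<comment> \<open>Induction from \<open>Hs i\<close> contributes the condition that
      \<open>P\<close> lies in \<open>Hs i\<close>, which follows from containment in the smaller
      \<open>Hs (Suc i)\<close>.\<close>
    have "?f i (Hs (Suc i)) P = (if P \<subseteq> Hs (Suc i) \<and> (\<forall>L\<in>maximal_subgroups (sub G (Hs i)) (Hs (Suc i)). \<not> P \<subseteq> L) then 1 else 0)" for i
      using chainD(6)[OF chain_link, of i] by auto
    moreover have "(\<Prod>i\<in>{..<m}. if Q i then 1 else 0 :: int) = (if \<forall>i<m. Q i then 1 else 0)" for Q and m :: nat
      by (auto intro!: prod.neutral)
    ultimately show "(\<Prod>i\<in>{..<?m}. ?f i (Hs (Suc i)) P) * ?f ?m (Hs ?m) P = (if marked Hs ?m P then 1 else 0)"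
      unfolding marked_def by simp
  qed
qed

end

end

theorem proposition6p2:
  fixes G :: "('g, 'x) monoid_scheme"
    and T :: "'g set \<Rightarrow> 'g set \<Rightarrow> ('g, 'k :: {alg_closed_field, field_char_0}) rep"
    and Irr :: "'g set \<Rightarrow> ('g, 'k) rep set"
    and C C' :: "'g set set"
    and D D' :: "(('g, 'k) rep \<times> (nat \<Rightarrow> 'k) set) set"
  assumes "group G" and "finite (carrier G)"
    and "params G T Irr"
    and "idem_param G T Irr C D"
    and "idem_param G T Irr C' D'"
  shows "HCD G T Irr C D \<noteq> HCD G T Irr C' D' \<longleftrightarrow>
    eps G T Irr C D \<otimes>\<^bsub>R1 G\<^esub> eps G T Irr C' D' = \<zero>\<^bsub>R1 G\<^esub>"
proof -
  interpret params_group G T Irr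
    using assms(1-3) by (simp add: params_group_def params_group_axioms_def finite_group_def finite_group_axioms_def)
  obtain S where S: "perm_param C D S" by (rule idem_perm_param[OF assms(4)])
  obtain S' where S': "perm_param C' D' S'" by (rule idem_perm_param[OF assms(5)])
  let ?M = "marked (chain_grp G T Irr C D) (chain_len G T Irr C D)"
  let ?M' = "marked (chain_grp G T Irr C' D') (chain_len G T Irr C' D')"
  \<comment> \<open>Marks multiply and are 0 or 1 here, so the product is 0 iff no subgroup is
    marked for both chains.\<close>
  have "eps G T Irr C D \<otimes>\<^bsub>R1 G\<^esub> eps G T Irr C' D' = \<zero>\<^bsub>R1 G\<^esub> \<longleftrightarrow>
      \<not> (\<exists>P. subgroup P G \<and> ?M P \<and> ?M' P)"
    unfolding marks_zero_iff[OF marks_mult[OF marks_eps[OF S] marks_eps[OF S']]] by auto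
  also have "\<dots> \<longleftrightarrow> HCD G T Irr C D \<noteq> HCD G T Irr C' D'"
    unfolding marked_common_iff[OF chain_link[OF S] chain_link[OF S']] HCD_def ..
  finally show ?thesis by blast
qed


end
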